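(* If $H$ is a graph of treewidth at most $2$, then for every graph $G$ the number $\#\mathrm{Hom}(H,G)$ can be computed in time $\mathrm{poly}(|V(H)|)\cdot|V(G)|^{\omega}$.
   Context: All graphs are finite, simple and undirected. A homomorphism from $H$ to $G$ is a map $f:V(H)\to V(G)$ such that $\{f(u),f(v)\}\in E(G)$ for all $\{u,v\}\in E(H)$; $\#\mathrm{Hom}(H,G)$ is the number of such maps. $\omega$ is the matrix multiplication exponent ($\omega<2.373$). *)

theory Defs
  imports
    Complex_Main
    "HOL-Library.FuncSet"
    "HOL-Library.Log_Nat"
    "HOL-Library.Landau_Symbols"
    "HOL-Computational_Algebra.Polynomial"
    "Jordan_Normal_Form.Matrix"
begin

section \<open>Graphs, homomorphisms, treewidth\<close>

record 'a sgraph =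
  verts :: "'a set"
  edges :: "'a set set"

definition simple_graph :: "'a sgraph \<Rightarrow> bool" where
  "simple_graph G \<longleftrightarrow>
     finite (verts G) \<and> (\<forall>e\<in>edges G. e \<subseteq> verts G \<and> card e = 2)"

definition Hom :: "'a sgraph \<Rightarrow> 'b sgraph \<Rightarrow> ('a \<Rightarrow> 'b) set" where
  "Hom H G = {f \<in> verts H \<rightarrow>\<^sub>E verts G. \<forall>u v. {u, v} \<in> edges H \<longrightarrow> {f u, f v} \<in> edges G}"

definition connected_in :: "'a sgraph \<Rightarrow> 'a set \<Rightarrow> bool" where
  "connected_in G S \<longleftrightarrow>
     (\<forall>s\<in>S. \<forall>t\<in>S. (s, t) \<in> {(a, b). a \<in> S \<and> b \<in> S \<and> {a, b} \<in> edges G}\<^sup>*)"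

definition is_cycle :: "'a sgraph \<Rightarrow> 'a list \<Rightarrow> bool" where
  "is_cycle G xs \<longleftrightarrow> 3 \<le> length xs \<and> distinct xs \<and>
     (\<forall>i<length xs. {xs ! i, xs ! (Suc i mod length xs)} \<in> edges G)"

definition is_tree :: "'a sgraph \<Rightarrow> bool" where
  "is_tree T \<longleftrightarrow> simple_graph T \<and> verts T \<noteq> {} \<and>
     connected_in T (verts T) \<and> (\<nexists>xs. is_cycle T xs)"

definition tree_decomposition :: "'a sgraph \<Rightarrow> 't sgraph \<Rightarrow> ('t \<Rightarrow> 'a set) \<Rightarrow> bool" where
  "tree_decomposition G T B \<longleftrightarrow> is_tree T \<and>
     (\<Union>t\<in>verts T. B t) = verts G \<and>
     (\<forall>e\<in>edges G. \<exists>t\<in>verts T. e \<subseteq> B t) \<and>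
     (\<forall>v\<in>verts G. connected_in T {t \<in> verts T. v \<in> B t})"

text \<open>The subtraction is truncated, so the graph without vertices gets width 0 rather than -1.\<close>

definition decomposition_width :: "'t sgraph \<Rightarrow> ('t \<Rightarrow> 'a set) \<Rightarrow> nat" where
  "decomposition_width T B = Max ((\<lambda>t. card (B t)) ` verts T) - 1"

definition treewidth :: "'a sgraph \<Rightarrow> nat" where
  "treewidth G = (LEAST w. \<exists>(T :: nat sgraph) B.
     tree_decomposition G T B \<and> decomposition_width T B = w)"


section \<open>The matrix multiplication exponent\<close>

text \<open>Straight-line programs over the rationals. Each instruction is one arithmetic operation and
  appends its result to the list of values computed so far, which initially holds the inputs;
  scalars are free.\<close>

datatype slp_arg = Scalar rat | Slot nat

datatype slp_instr = SAdd slp_arg slp_arg | SSub slp_arg slp_arg | SMul slp_arg slp_arg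

fun slp_arg_val :: "rat list \<Rightarrow> slp_arg \<Rightarrow> rat" where
  "slp_arg_val vs (Scalar c) = c"
| "slp_arg_val vs (Slot i) = (if i < length vs then vs ! i else 0)"

fun slp_instr_val :: "rat list \<Rightarrow> slp_instr \<Rightarrow> rat" where
  "slp_instr_val vs (SAdd a b) = slp_arg_val vs a + slp_arg_val vs b"
| "slp_instr_val vs (SSub a b) = slp_arg_val vs a - slp_arg_val vs b"
| "slp_instr_val vs (SMul a b) = slp_arg_val vs a * slp_arg_val vs b"

fun slp_run :: "slp_instr list \<Rightarrow> rat list \<Rightarrow> rat list" where
  "slp_run [] vs = vs"
| "slp_run (c # cs) vs = slp_run cs (vs @ [slp_instr_val vs c])"

definition mat_entries :: "nat \<Rightarrow> rat mat \<Rightarrow> rat list" where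
  "mat_entries n A = [A $$ (i, j). i \<leftarrow> [0..<n], j \<leftarrow> [0..<n]]"

definition slp_multiplies :: "nat \<Rightarrow> slp_instr list \<Rightarrow> bool" where
  "slp_multiplies n p \<longleftrightarrow>
     (\<exists>out. \<forall>A \<in> carrier_mat n n. \<forall>B \<in> carrier_mat n n. \<forall>i<n. \<forall>j<n.
        slp_arg_val (slp_run p (mat_entries n A @ mat_entries n B)) (out i j) = (A * B) $$ (i, j))"

definition mm_ops :: "nat \<Rightarrow> nat" where
  "mm_ops n = (LEAST s. \<exists>p. slp_multiplies n p \<and> length p = s)"

definition mm_exponent :: real where
  "mm_exponent = Inf {\<tau>. (\<lambda>n. real (mm_ops n)) \<in> O(\<lambda>n. real n powr \<tau>)}"


section \<open>Random access machines with logarithmic cost\<close>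

text \<open>Registers are indexed by integers and hold integers of unbounded size. Each operation costs
  the total bit length of all numbers and register addresses that it touches (the logarithmic cost
  criterion of Aho, Hopcroft and Ullman). Programs use while loops in place of jumps.\<close>

type_synonym mem = "int \<Rightarrow> int"

datatype loc = Reg int | Ind int

datatype operand = Const int | Val loc

datatype binop = Plus | Minus | Times | Div

datatype cond = Eq operand operand | Less operand operand

datatype com =
    Skip
  | Assign loc binop operand operand
  | Seq com com
  | If cond com com
  | While cond com

definition len :: "int \<Rightarrow> nat" where
  "len i = max 1 (floorlog 2 (nat \<bar>i\<bar>))"

fun loc_addr :: "mem \<Rightarrow> loc \<Rightarrow> int" where
  "loc_addr M (Reg i) = i"
| "loc_addr M (Ind i) = M i"

fun loc_cost :: "mem \<Rightarrow> loc \<Rightarrow> nat" where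
  "loc_cost M (Reg i) = len i"
| "loc_cost M (Ind i) = len i + len (M i)"

fun operand_val :: "mem \<Rightarrow> operand \<Rightarrow> int" where
  "operand_val M (Const c) = c"
| "operand_val M (Val l) = M (loc_addr M l)"

fun operand_cost :: "mem \<Rightarrow> operand \<Rightarrow> nat" where
  "operand_cost M (Const c) = len c"
| "operand_cost M (Val l) = loc_cost M l + len (M (loc_addr M l))"

fun binop_val :: "binop \<Rightarrow> int \<Rightarrow> int \<Rightarrow> int" where
  "binop_val Plus x y = x + y"
| "binop_val Minus x y = x - y"
| "binop_val Times x y = x * y"
| "binop_val Div x y = x div y"

fun cond_val :: "mem \<Rightarrow> cond \<Rightarrow> bool" where
  "cond_val M (Eq a b) \<longleftrightarrow> operand_val M a = operand_val M b"
| "cond_val M (Less a b) \<longleftrightarrow> operand_val M a < operand_val M b"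

fun cond_cost :: "mem \<Rightarrow> cond \<Rightarrow> nat" where
  "cond_cost M (Eq a b) = operand_cost M a + operand_cost M b"
| "cond_cost M (Less a b) = operand_cost M a + operand_cost M b"

text \<open>\<open>exec c M t M'\<close>: started in memory \<open>M\<close>, the program \<open>c\<close> halts after time \<open>t\<close> in memory \<open>M'\<close>.\<close>

inductive exec :: "com \<Rightarrow> mem \<Rightarrow> nat \<Rightarrow> mem \<Rightarrow> bool" where
  Skip: "exec Skip M 1 M"
| Assign: "r = binop_val f (operand_val M a) (operand_val M b) \<Longrightarrow>
    exec (Assign l f a b) M (loc_cost M l + operand_cost M a + operand_cost M b + len r)
      (M(loc_addr M l := r))"
| Seq: "exec c1 M t1 M' \<Longrightarrow> exec c2 M' t2 M'' \<Longrightarrow> exec (Seq c1 c2) M (t1 + t2) M''"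
| IfTrue: "cond_val M b \<Longrightarrow> exec c1 M t M' \<Longrightarrow> exec (If b c1 c2) M (cond_cost M b + t) M'"
| IfFalse: "\<not> cond_val M b \<Longrightarrow> exec c2 M t M' \<Longrightarrow> exec (If b c1 c2) M (cond_cost M b + t) M'"
| WhileFalse: "\<not> cond_val M b \<Longrightarrow> exec (While b c) M (cond_cost M b) M"
| WhileTrue: "cond_val M b \<Longrightarrow> exec c M t1 M' \<Longrightarrow> exec (While b c) M' t2 M'' \<Longrightarrow>
    exec (While b c) M (cond_cost M b + t1 + t2) M''"

text \<open>A graph on the vertices \<open>0, \<dots>, n - 1\<close> is presented by its adjacency matrix, row by row.
  The input consists of both numbers of vertices followed by both matrices, in the registers
  \<open>0, 1, 2, \<dots>\<close>; all other registers initially hold 0.\<close>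

definition adj_matrix :: "nat sgraph \<Rightarrow> int list" where
  "adj_matrix G = (let n = card (verts G) in
     [of_bool ({u, v} \<in> edges G). u \<leftarrow> [0..<n], v \<leftarrow> [0..<n]])"

definition input_mem :: "nat sgraph \<Rightarrow> nat sgraph \<Rightarrow> mem" where
  "input_mem H G = (let xs = [int (card (verts H)), int (card (verts G))] @ adj_matrix H @ adj_matrix G
     in (\<lambda>i. if 0 \<le> i \<and> nat i < length xs then xs ! nat i else 0))"

end

theory Submission
  imports Defs
begin

text \<open>
  A vertex \<open>v\<close> of \<open>H\<close> with at most two neighbours \<open>a\<close>, \<open>c\<close> is eliminated by multiplying the weight
  matrix of the pair \<open>(a, c)\<close> entrywise by the product of the matrices of \<open>(a, v)\<close> and \<open>(v, c)\<close>;
  treewidth at most 2 guarantees that such eliminations can be continued until two vertices remain.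
  Each elimination is a product of two \<open>n \<times> n\<close> matrices. A straight-line program of length \<open>L\<close> that
  multiplies \<open>b \<times> b\<close> matrices yields, from the quadratic parts of its values, a bilinear algorithm
  with \<open>2 L\<close> products; its \<open>d\<close>-th Kronecker power multiplies \<open>b ^ d \<times> b ^ d\<close> matrices and is evaluated
  one tensor factor after the other. For a fixed large \<open>b\<close> this takes time \<open>n\<close> to the power
  \<open>mm_exponent + \<epsilon>\<close>, and all numbers that occur have \<open>O(|V(H)| log n)\<close> bits.
\<close>

section \<open>From straight-line programs to bilinear algorithms\<close>

text \<open>The exponent is defined by straight-line programs, one for each size and with arbitrary
  rational constants, whereas a single machine program has to serve all \<open>G\<close>. Hence only
  one size \<open>b\<close> is taken from the definition. Its finitely many coefficients, multiplied
  by a common denominator, are written into the program as tables, and all larger sizes are reached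
  by powers. The scaling survives as a factor \<open>D ^ d\<close>, removed by an exact division
  after each product. The infimum \<open>mm_exponent\<close> need not be attained, and logarithmic
  cost brings in factors polynomial in the depth \<open>d\<close>, which is about log n. Both losses
  go into \<epsilon>, one half each: the first half makes \<open>2 L\<close> at most
  \<open>b powr (mm_exponent + \<epsilon> / 2)\<close>, the second absorbs a factor (d + 1)^2. The
  degree in |V(H)| comes only from the search for eliminable vertices, the number of rounds and the
  bit length, so the polynomial can be fixed before \<epsilon>.\<close>

fun parg :: "rat poly list \<Rightarrow> slp_arg \<Rightarrow> rat poly" where
  "parg vs (Scalar c) = [:c:]"
| "parg vs (Slot i) = (if i < length vs then vs ! i else 0)"

fun pinstr :: "rat poly list \<Rightarrow> slp_instr \<Rightarrow> rat poly" where
  "pinstr vs (SAdd a b) = parg vs a + parg vs b"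
| "pinstr vs (SSub a b) = parg vs a - parg vs b"
| "pinstr vs (SMul a b) = parg vs a * parg vs b"

text \<open>Programs are run over polynomials in one variable t. If the j-th input is
  \<open>[:0, z j:]\<close>, that is z_j t, then the coefficient of t^i in any value is its
  homogeneous part of degree i in z.\<close>

fun prun :: "slp_instr list \<Rightarrow> rat poly list \<Rightarrow> rat poly list" where
  "prun [] vs = vs"
| "prun (c # cs) vs = prun cs (vs @ [pinstr vs c])"

lemma poly_parg: "poly (parg vs a) t = slp_arg_val (map (\<lambda>p. poly p t) vs) a"
  by (cases a) auto

lemma poly_prun: "map (\<lambda>p. poly p t) (prun cs vs) = slp_run cs (map (\<lambda>p. poly p t) vs)"
proof (induction cs arbitrary: vs)
  case (Cons c cs)
  have "poly (pinstr vs c) t = slp_instr_val (map (\<lambda>p. poly p t) vs) c"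
    by (cases c) (simp_all add: poly_parg)
  then show ?case using Cons by simp
qed simp

lemma slp_run_append: "slp_run (p @ q) vs = slp_run q (slp_run p vs)"
  by (induction p arbitrary: vs) auto

lemma prun_append: "prun (p @ q) vs = prun q (prun p vs)"
  by (induction p arbitrary: vs) auto

lemma length_slp_run: "length (slp_run p vs) = length vs + length p"
  by (induction p arbitrary: vs) auto

lemma length_prun: "length (prun p vs) = length vs + length p"
  by (induction p arbitrary: vs) auto

lemma nth_slp_run: "i < length vs \<Longrightarrow> slp_run p vs ! i = vs ! i"
  by (induction p arbitrary: vs) (auto simp: nth_append)

definition lin :: "nat \<Rightarrow> (nat \<Rightarrow> rat) \<Rightarrow> (nat \<Rightarrow> rat) \<Rightarrow> rat" where
  "lin m a z = (\<Sum>j<m. a j * z j)"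

lemma lin_combine: "c * lin m a z + d * lin m b z = lin m (\<lambda>j. c * a j + d * b j) z"
  unfolding lin_def by (simp add: sum_distrib_left sum.distrib distrib_right mult.assoc)

text \<open>The polynomial has a constant coefficient, a linear form as coefficient of degree 1, and a
  combination of the first \<open>s\<close> products of linear forms as coefficient of degree 2.\<close>

definition quad :: "nat \<Rightarrow> nat \<Rightarrow> (nat \<Rightarrow> nat \<Rightarrow> rat) \<Rightarrow> (nat \<Rightarrow> nat \<Rightarrow> rat) \<Rightarrow> ((nat \<Rightarrow> rat) \<Rightarrow> rat poly) \<Rightarrow> bool" where
  "quad m s \<alpha> \<beta> f \<longleftrightarrow> (\<exists>c l w. \<forall>z. coeff (f z) 0 = c \<and> coeff (f z) 1 = lin m l z \<and>
     coeff (f z) 2 = (\<Sum>r<s. w r * (lin m (\<alpha> r) z * lin m (\<beta> r) z)))"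

lemma coeff_mult_2: "coeff (p * q) 2 = coeff p 0 * coeff q 2 + coeff p 1 * coeff q 1 + coeff p 2 * (coeff q 0 :: rat)"
  by (simp add: coeff_mult numeral_2_eq_2)

lemma coeff_mult_1: "coeff (p * q) 1 = coeff p 0 * coeff q 1 + coeff p 1 * (coeff q 0 :: rat)"
  by (simp add: coeff_mult)

lemma quad_const: "quad m s \<alpha> \<beta> (\<lambda>z. [:c:])"
  unfolding quad_def by (intro exI[of _ c] exI[of _ "\<lambda>_. 0"]) (simp add: lin_def numeral_2_eq_2)

lemma quad_combine:
  assumes "quad m s \<alpha> \<beta> f" "quad m s \<alpha> \<beta> g"
  shows "quad m s \<alpha> \<beta> (\<lambda>z. Polynomial.smult a (f z) + Polynomial.smult b (g z))"
proof -
  obtain c l w where 1: "\<And>z. coeff (f z) 0 = c \<and> coeff (f z) 1 = lin m l z \<and>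
     coeff (f z) 2 = (\<Sum>r<s. w r * (lin m (\<alpha> r) z * lin m (\<beta> r) z))"
    using assms(1) unfolding quad_def by blast
  obtain c' l' w' where 2: "\<And>z. coeff (g z) 0 = c' \<and> coeff (g z) 1 = lin m l' z \<and>
     coeff (g z) 2 = (\<Sum>r<s. w' r * (lin m (\<alpha> r) z * lin m (\<beta> r) z))"
    using assms(2) unfolding quad_def by blast
  show ?thesis
    unfolding quad_def
    by (rule exI[of _ "a * c + b * c'"], rule exI[of _ "\<lambda>j. a * l j + b * l' j"], rule exI[of _ "\<lambda>r. a * w r + b * w' r"])
      (simp add: 1 2 lin_combine sum_distrib_left distrib_right sum.distrib mult.assoc del: One_nat_def)
qed

text \<open>With constant terms c, c', linear parts l, l' and quadratic parts q, q', the product has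
  quadratic part c q' + l l' + c' q. Only l l' is not a combination of old products, so a
  multiplication adds one product to the pool shared by all values.\<close>

lemma quad_mult:
  assumes "quad m s \<alpha> \<beta> f" "quad m s \<alpha> \<beta> g"
  shows "\<exists>a b. quad m (Suc s) (\<alpha>(s := a)) (\<beta>(s := b)) (\<lambda>z. f z * g z)"
proof -
  obtain c l w where 1: "\<And>z. coeff (f z) 0 = c" "\<And>z. coeff (f z) 1 = lin m l z"
     "\<And>z. coeff (f z) 2 = (\<Sum>r<s. w r * (lin m (\<alpha> r) z * lin m (\<beta> r) z))"
    using assms(1) unfolding quad_def by blast
  obtain c' l' w' where 2: "\<And>z. coeff (g z) 0 = c'" "\<And>z. coeff (g z) 1 = lin m l' z"
     "\<And>z. coeff (g z) 2 = (\<Sum>r<s. w' r * (lin m (\<alpha> r) z * lin m (\<beta> r) z))"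
    using assms(2) unfolding quad_def by blast
  have "quad m (Suc s) (\<alpha>(s := l)) (\<beta>(s := l')) (\<lambda>z. f z * g z)"
    unfolding quad_def
  proof (rule exI[of _ "c * c'"], rule exI[of _ "\<lambda>j. c' * l j + c * l' j"],
      rule exI[of _ "\<lambda>r. if r = s then 1 else c' * w r + c * w' r"], intro allI conjI)
    fix z
    show "coeff (f z * g z) 0 = c * c'" by (simp add: coeff_mult 1 2)
    show "coeff (f z * g z) 1 = lin m (\<lambda>j. c' * l j + c * l' j) z"
      unfolding coeff_mult_1 1 2 lin_combine[symmetric] by simp
    show "coeff (f z * g z) 2 = (\<Sum>r<Suc s. (if r = s then 1 else c' * w r + c * w' r) *
        (lin m ((\<alpha>(s := l)) r) z * lin m ((\<beta>(s := l')) r) z))"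
      unfolding coeff_mult_2 1 2
      by (simp add: sum_distrib_left distrib_right sum.distrib mult.assoc) (simp add: sum_distrib_left sum_distrib_right mult_ac)
  qed
  then show ?thesis by blast
qed

text \<open>The new product gets weight 0. Thus older values ignore products created later, and
  additive instructions can be given a dummy product.\<close>

lemma quad_extend:
  assumes "quad m s \<alpha> \<beta> f"
  shows "quad m (Suc s) (\<alpha>(s := a)) (\<beta>(s := b)) f"
proof -
  obtain c l w where 1: "\<And>z. coeff (f z) 0 = c \<and> coeff (f z) 1 = lin m l z \<and>
     coeff (f z) 2 = (\<Sum>r<s. w r * (lin m (\<alpha> r) z * lin m (\<beta> r) z))"
    using assms(1) unfolding quad_def by blast
  show ?thesis
    unfolding quad_def
    by (rule exI[of _ c], rule exI[of _ l], rule exI[of _ "\<lambda>r. if r = s then 0 else w r"])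
      (simp add: 1 del: One_nat_def)
qed

section \<open>Quadratic parts of the values of a program\<close>

definition indeterminates :: "nat \<Rightarrow> (nat \<Rightarrow> rat) \<Rightarrow> rat poly list" where
  "indeterminates m z = map (\<lambda>j. [:0, z j:]) [0..<m]"

lemma length_indeterminates[simp]: "length (indeterminates m z) = m"
  unfolding indeterminates_def by simp

lemma quad_prun:
  "\<exists>\<alpha> \<beta>. \<forall>i < m + length p. quad m (length p) \<alpha> \<beta> (\<lambda>z. prun p (indeterminates m z) ! i)"
proof (induction p rule: rev_induct)
  case Nil
  have "quad m 0 \<alpha> \<beta> (\<lambda>z. indeterminates m z ! i)" if "i < m" for i \<alpha> \<beta>
  proof -
    have "lin m (\<lambda>j. of_bool (j = i)) z = z i" for z
      unfolding lin_def using that by (simp add: of_bool_def if_distrib[of "\<lambda>x. x * _"] cong: if_cong)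
    note l = this
    show ?thesis
      unfolding quad_def
      by (rule exI[of _ 0], rule exI[of _ "\<lambda>j. of_bool (j = i)"], rule exI[of _ "\<lambda>_. 0"])
        (simp add: indeterminates_def numeral_2_eq_2 that l)
  qed
  then show ?case by auto
next
  case (snoc c p)
  obtain \<alpha> \<beta> where IH: "\<And>i. i < m + length p \<Longrightarrow> quad m (length p) \<alpha> \<beta> (\<lambda>z. prun p (indeterminates m z) ! i)"
    using snoc by blast
  have arg: "quad m (length p) \<alpha> \<beta> (\<lambda>z. parg (prun p (indeterminates m z)) a)" for a
  proof (cases a)
    case (Scalar c)
    then show ?thesis using quad_const by simp
  next
    case (Slot i)
    then show ?thesis
      using IH[of i] quad_const[of m _ _ _ 0] by (cases "i < m + length p") (simp_all add: length_prun)
  qed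
  \<comment> \<open>Additions and subtractions use up an index too, so the size of the pool is
    simply the length of the program.\<close>
  have "\<exists>a b. quad m (Suc (length p)) (\<alpha>(length p := a)) (\<beta>(length p := b))
      (\<lambda>z. pinstr (prun p (indeterminates m z)) c)"
  proof (cases c)
    case (SAdd a b)
    then show ?thesis using quad_extend[OF quad_combine[OF arg[of a] arg[of b], of 1 1]] by auto
  next
    case (SSub a b)
    then show ?thesis using quad_extend[OF quad_combine[OF arg[of a] arg[of b], of 1 "- 1"]] by auto
  next
    case (SMul a b)
    then show ?thesis using quad_mult[OF arg[of a] arg[of b]] by auto
  qed
  then obtain a b where ab: "quad m (Suc (length p)) (\<alpha>(length p := a)) (\<beta>(length p := b))
      (\<lambda>z. pinstr (prun p (indeterminates m z)) c)" by blast
  have "quad m (Suc (length p)) (\<alpha>(length p := a)) (\<beta>(length p := b))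
      (\<lambda>z. prun (p @ [c]) (indeterminates m z) ! i)" if "i < m + Suc (length p)" for i
  proof (cases "i < m + length p")
    case True
    then show ?thesis using quad_extend[OF IH[OF True]] by (simp add: prun_append nth_append length_prun)
  next
    case False
    then have "i = m + length p" using that by simp
    then show ?thesis using ab by (simp add: prun_append nth_append length_prun)
  qed
  then show ?case by auto
qed

section \<open>Matrices as row-major lists\<close>

lemma length_concat_map:
  assumes "\<And>i. i < a \<Longrightarrow> length (f i) = b"
  shows "length (concat (map f [0..<a])) = a * b"
  using assms by (induction a) (simp_all add: algebra_simps)

lemma nth_concat_map:
  assumes "\<And>i. i < a \<Longrightarrow> length (f i) = b" "i < a" "j < b"
  shows "concat (map f [0..<a]) ! (i * b + j) = f i ! j"
  using assms
proof (induction a)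
  case (Suc a)
  have len: "length (concat (map f [0..<a])) = a * b"
    using Suc.prems(1) by (induction a) (simp_all add: algebra_simps)
  show ?case
  proof (cases "i = a")
    case True
    then show ?thesis using len by (simp add: nth_append)
  next
    case False
    then have ia: "i < a" using Suc.prems by simp
    then have "i * b + j < Suc i * b" "Suc i * b \<le> a * b" using Suc.prems by (simp, intro mult_le_mono1) auto
    then show ?thesis using len ia Suc by (simp add: nth_append)
  qed
qed simp

lemma length_mat_entries[simp]: "length (mat_entries n A) = n * n"
proof -
  have "length (concat (map (\<lambda>i. map (\<lambda>j. A $$ (i, j)) [0..<b]) [0..<a])) = a * b" for a b
    by (induction a) (simp_all add: algebra_simps)
  then show ?thesis unfolding mat_entries_def by simp
qed

lemma nth_mat_entries: "i < n \<Longrightarrow> j < n \<Longrightarrow> mat_entries n A ! (i * n + j) = A $$ (i, j)"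
  unfolding mat_entries_def by (subst nth_concat_map[where b = n]) auto

lemma mat_entries_eq: "mat_entries n A = map (\<lambda>g. A $$ (g div n, g mod n)) [0..<n * n]"
proof (rule nth_equalityI)
  fix g assume "g < length (mat_entries n A)"
  then have g: "g < n * n" by simp
  then have "g div n < n" "g mod n < n" by (simp_all add: less_mult_imp_div_less) (metis mod_less_divisor mult_0 not_less_zero not_gr_zero)
  then have "mat_entries n A ! (g div n * n + g mod n) = A $$ (g div n, g mod n)" by (rule nth_mat_entries)
  then show "mat_entries n A ! g = map (\<lambda>g. A $$ (g div n, g mod n)) [0..<n * n] ! g" using g by simp
qed simp

lemma mat_entries_smult:
  assumes "A \<in> carrier_mat n n"
  shows "mat_entries n (t \<cdot>\<^sub>m A) = map ((*) t) (mat_entries n A)"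
proof -
  have "(t \<cdot>\<^sub>m A) $$ (g div n, g mod n) = t * A $$ (g div n, g mod n)" if "g < n * n" for g
  proof -
    have "0 < n" using that by (cases n) auto
    then show ?thesis using that assms by (simp add: less_mult_imp_div_less)
  qed
  then show ?thesis unfolding mat_entries_eq by simp
qed

definition unit_mat :: "nat \<Rightarrow> nat \<Rightarrow> rat mat" where
  "unit_mat n g = mat n n (\<lambda>(i, j). of_bool (i * n + j = g))"

text \<open>The structure tensor of matrix multiplication in row-major coordinates: it holds if g =
  (i, l), h = (l, j) and q = (i, j) for some i, l, j.\<close>

definition mm_tensor :: "nat \<Rightarrow> nat \<Rightarrow> nat \<Rightarrow> nat \<Rightarrow> bool" where
  "mm_tensor n q g h \<longleftrightarrow> q div n = g div n \<and> g mod n = h div n \<and> h mod n = q mod n"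

lemma unit_mat_carrier[simp]: "unit_mat n g \<in> carrier_mat n n"
  unfolding unit_mat_def by simp

lemma div_mod_unique:
  fixes n i j g :: nat
  assumes "j < n"
  shows "i * n + j = g \<longleftrightarrow> i = g div n \<and> j = g mod n"
  using assms by (auto simp: div_mult_mod_eq)

lemma unit_mat_mult:
  assumes "g < n * n" "h < n * n" "q < n * n"
  shows "(unit_mat n g * unit_mat n h) $$ (q div n, q mod n) = of_bool (mm_tensor n q g h)"
proof -
  have n: "0 < n" using assms by (cases n) auto
  have q: "q div n < n" "q mod n < n" using assms n by (simp_all add: less_mult_imp_div_less)
  have "(unit_mat n g * unit_mat n h) $$ (q div n, q mod n) =
      (\<Sum>k<n. of_bool (q div n * n + k = g) * of_bool (k * n + q mod n = h))"
    using q unfolding unit_mat_def by (simp add: scalar_prod_def lessThan_atLeast0)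
  also have "\<dots> = (\<Sum>k<n. of_bool (k = g mod n \<and> mm_tensor n q g h))"
    using q by (intro sum.cong refl) (auto simp: div_mod_unique mm_tensor_def)
  also have "\<dots> = of_bool (mm_tensor n q g h)"
    using n by (cases "mm_tensor n q g h") (simp_all add: of_bool_def)
  finally show ?thesis .
qed

text \<open>Run on \<open>t A\<close> and \<open>t B\<close>, the program computes \<open>t\<^sup>2 A B\<close>, so \<open>A B\<close> is the coefficient of \<open>t\<^sup>2\<close>.
  Polarization on unit matrices isolates the terms that are bilinear in \<open>A\<close> and \<open>B\<close>.\<close>

lemma slp_multiplies_tensor:
  assumes "slp_multiplies n p"
  shows "\<exists>U V W :: nat \<Rightarrow> nat \<Rightarrow> rat. \<forall>q < n * n. \<forall>g < n * n. \<forall>h < n * n.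
    (\<Sum>s < 2 * length p. W q s * U s g * V s h) = of_bool (mm_tensor n q g h)"
proof -
  obtain out where out: "\<And>A B i j. A \<in> carrier_mat n n \<Longrightarrow> B \<in> carrier_mat n n \<Longrightarrow> i < n \<Longrightarrow> j < n \<Longrightarrow>
        slp_arg_val (slp_run p (mat_entries n A @ mat_entries n B)) (out i j) = (A * B) $$ (i, j)"
    using assms unfolding slp_multiplies_def by blast
  define N where "N = n * n"
  define m where "m = N + N"
  define L where "L = length p"
  obtain \<alpha> \<beta> where \<alpha>: "\<And>i. i < m + L \<Longrightarrow> quad m L \<alpha> \<beta> (\<lambda>z. prun p (indeterminates m z) ! i)"
    using quad_prun[of m p] unfolding L_def by blast
  have arg: "quad m L \<alpha> \<beta> (\<lambda>z. parg (prun p (indeterminates m z)) a)" for a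
  proof (cases a)
    case (Scalar c)
    then show ?thesis using quad_const by simp
  next
    case (Slot i)
    then show ?thesis
      using \<alpha>[of i] quad_const[of m _ _ _ 0] by (cases "i < m + L") (simp_all add: length_prun L_def)
  qed
  have "\<exists>w. \<forall>z. coeff (parg (prun p (indeterminates m z)) a) 2 = (\<Sum>r<L. w r * (lin m (\<alpha> r) z * lin m (\<beta> r) z))" for a
    using arg[of a] unfolding quad_def by blast
  then obtain w where w: "\<And>a z. coeff (parg (prun p (indeterminates m z)) a) 2 =
      (\<Sum>r<L. w a r * (lin m (\<alpha> r) z * lin m (\<beta> r) z))" by metis
  have *: "(\<Sum>r<L. w (out i j) r * (lin m (\<alpha> r) z * lin m (\<beta> r) z)) = (A * B) $$ (i, j)"
    if A: "A \<in> carrier_mat n n" and B: "B \<in> carrier_mat n n" and ij: "i < n" "j < n"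
      and z: "mat_entries n A @ mat_entries n B = map z [0..<m]" for A B i j z
  proof -
    let ?P = "parg (prun p (indeterminates m z)) (out i j)"
    \<comment> \<open>Agreement at every rational t suffices to identify the two
      polynomials.\<close>
    have "poly ?P t = poly (monom ((A * B) $$ (i, j)) 2) t" for t
    proof -
      have "map (\<lambda>p. poly p t) (indeterminates m z) = map ((*) t) (map z [0..<m])"
        unfolding indeterminates_def by (simp add: mult.commute)
      also have "\<dots> = mat_entries n (t \<cdot>\<^sub>m A) @ mat_entries n (t \<cdot>\<^sub>m B)"
        unfolding z[symmetric] using A B by (simp add: mat_entries_smult)
      finally have "poly ?P t = slp_arg_val (slp_run p (mat_entries n (t \<cdot>\<^sub>m A) @ mat_entries n (t \<cdot>\<^sub>m B))) (out i j)"
        by (simp add: poly_parg poly_prun)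
      also have "\<dots> = ((t \<cdot>\<^sub>m A) * (t \<cdot>\<^sub>m B)) $$ (i, j)" using A B ij by (intro out) auto
      also have "\<dots> = t ^ 2 * (A * B) $$ (i, j)"
        using A B ij by (simp add: scalar_prod_def sum_distrib_left power2_eq_square mult_ac)
      finally show ?thesis by (simp add: poly_monom mult.commute)
    qed
    then have "?P = monom ((A * B) $$ (i, j)) 2" by (simp add: poly_eq_poly_eq_iff[symmetric] fun_eq_iff)
    then show ?thesis using w[of z "out i j"] by simp
  qed
  define o' where "o' q = out (q div n) (q mod n)" for q
  \<comment> \<open>Each linear form in the 2 n^2 inputs is cut into the part reading the first
    matrix (suffix 1) and the part reading the second (suffix 2).\<close>
  define A1 where "A1 r g = \<alpha> r g" for r g
  define A2 where "A2 r h = \<alpha> r (N + h)" for r h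
  define B1 where "B1 r g = \<beta> r g" for r g
  define B2 where "B2 r h = \<beta> r (N + h)" for r h
  have key: "(\<Sum>r<L. w (o' q) r * (A1 r g * B2 r h)) + (\<Sum>r<L. w (o' q) r * (A2 r h * B1 r g)) = of_bool (mm_tensor n q g h)"
    if g: "g < N" and h: "h < N" and q: "q < N" for q g h
  proof -
    have n: "0 < n" using q unfolding N_def by (cases n) auto
    have qq: "q div n < n" "q mod n < n" using q n unfolding N_def by (simp_all add: less_mult_imp_div_less)
    have me: "mat_entries n (unit_mat n g) = map (\<lambda>j. of_bool (j = g)) [0..<N]" for g
    proof -
      have "unit_mat n g $$ (j div n, j mod n) = of_bool (j = g)" if "j < N" for j
        using that n unfolding unit_mat_def N_def by (simp add: less_mult_imp_div_less)
      then show ?thesis unfolding mat_entries_eq N_def[symmetric] by simp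
    qed
    have zero: "mat_entries n (0\<^sub>m n n) = map (\<lambda>j. 0) [0..<N]"
      unfolding mat_entries_eq N_def using n by (auto simp: less_mult_imp_div_less)
    define cc :: "(nat \<Rightarrow> rat) \<Rightarrow> (nat \<Rightarrow> rat) \<Rightarrow> nat \<Rightarrow> rat"
      where "cc a b = (\<lambda>j. if j < N then a j else b (j - N))" for a b
    have split: "map a [0..<N] @ map b [0..<N] = map (cc a b) [0..<m]" for a b
      unfolding m_def cc_def by (rule nth_equalityI) (auto simp: nth_append)
    have lin1: "lin m a (cc x y) = (\<Sum>j<N. a j * x j) + (\<Sum>j<N. a (N + j) * y j)" for a x y
    proof -
      have "{..<m} = {..<N} \<union> {N..<m}" "{..<N} \<inter> {N..<m} = {}" unfolding m_def by auto
      then have "lin m a (cc x y) = (\<Sum>j<N. a j * x j) + (\<Sum>j\<in>{N..<m}. a j * y (j - N))"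
        unfolding lin_def cc_def by (simp add: sum.union_disjoint)
      also have "(\<Sum>j\<in>{N..<m}. a j * y (j - N)) = (\<Sum>j<N. a (N + j) * y j)"
        unfolding m_def by (rule sum.reindex_bij_witness[of _ "\<lambda>j. N + j" "\<lambda>j. j - N"]) auto
      finally show ?thesis .
    qed
    have delta: "(\<Sum>j<N. a j * of_bool (j = g)) = a g" if "g < N" for a :: "nat \<Rightarrow> rat" and g
      using that by (simp add: of_bool_def if_distrib[of "\<lambda>x. _ * x"] cong: if_cong)
    have gh: "(\<Sum>r<L. w (o' q) r * ((A1 r g + A2 r h) * (B1 r g + B2 r h))) = of_bool (mm_tensor n q g h)"
      using *[of "unit_mat n g" "unit_mat n h", OF _ _ qq, unfolded me split, OF _ _ refl] g h q
      unfolding lin1 delta[OF g] delta[OF h] o'_def A1_def A2_def B1_def B2_def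
      by (simp add: unit_mat_mult N_def)
    \<comment> \<open>If one matrix is 0, so is the product; hence the terms that are quadratic in a
      single matrix cancel out, and only the mixed terms of \<open>gh\<close> are left.\<close>
    have g0: "(\<Sum>r<L. w (o' q) r * (A1 r g * B1 r g)) = 0"
      using *[of "unit_mat n g" "0\<^sub>m n n", OF _ _ qq, unfolded me zero split, OF _ _ refl] qq
      unfolding lin1 delta[OF g] o'_def A1_def B1_def right_mult_zero_mat[OF unit_mat_carrier]
      by simp
    have h0: "(\<Sum>r<L. w (o' q) r * (A2 r h * B2 r h)) = 0"
      using *[of "0\<^sub>m n n" "unit_mat n h", OF _ _ qq, unfolded me zero split, OF _ _ refl] qq
      unfolding lin1 delta[OF h] o'_def A2_def B2_def left_mult_zero_mat[OF unit_mat_carrier]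
      by simp
    show ?thesis using gh g0 h0 by (simp add: algebra_simps sum.distrib)
  qed
  \<comment> \<open>Both mixed terms of every product are kept, which is where the factor 2 comes
    from. In the second half the roles of \<alpha> and \<beta> are exchanged, so that
    \<open>U\<close> always reads the first matrix and \<open>V\<close> the second.\<close>
  define U where "U s g = (if s < L then A1 s g else B1 (s - L) g)" for s g
  define V where "V s h = (if s < L then B2 s h else A2 (s - L) h)" for s h
  define W where "W q s = (if s < L then w (o' q) s else w (o' q) (s - L))" for q s
  have "(\<Sum>s < 2 * L. W q s * U s g * V s h) = of_bool (mm_tensor n q g h)" if "q < N" "g < N" "h < N" for q g h
  proof -
    have "{..<2 * L} = {..<L} \<union> {L..<2 * L}" "{..<L} \<inter> {L..<2 * L} = {}" by auto
    then have "(\<Sum>s < 2 * L. W q s * U s g * V s h) =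
        (\<Sum>s<L. W q s * U s g * V s h) + (\<Sum>s\<in>{L..<2 * L}. W q s * U s g * V s h)"
      by (simp add: sum.union_disjoint)
    also have "(\<Sum>s<L. W q s * U s g * V s h) = (\<Sum>r<L. w (o' q) r * (A1 r g * B2 r h))"
      unfolding U_def V_def W_def by (simp add: mult.assoc)
    also have "(\<Sum>s\<in>{L..<2 * L}. W q s * U s g * V s h) = (\<Sum>r<L. w (o' q) r * (A2 r h * B1 r g))"
      unfolding U_def V_def W_def
      by (rule sum.reindex_bij_witness[of _ "\<lambda>j. L + j" "\<lambda>j. j - L"]) (auto simp: mult_ac)
    finally show ?thesis using key that by simp
  qed
  then show ?thesis unfolding N_def L_def by blast
qed

section \<open>Clearing denominators\<close>

lemma common_denominator:
  assumes "finite (F :: rat set)"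
  shows "\<exists>D::int. 0 < D \<and> (\<forall>x\<in>F. \<exists>k::int. of_int D * x = of_int k)"
  using assms
proof (induction F)
  case (insert x F)
  then obtain D :: int where D: "0 < D" "\<And>y. y \<in> F \<Longrightarrow> \<exists>k::int. of_int D * y = of_int k" by blast
  obtain a b where ab: "quotient_of x = (a, b)" by (cases "quotient_of x")
  then have b: "0 < b" "x = of_int a / of_int b" using quotient_of_denom_pos quotient_of_div by auto
  have "\<exists>k::int. of_int (D * b) * y = of_int k" if y: "y \<in> insert x F" for y
  proof (cases "y = x")
    case True
    then have "of_int (D * b) * y = of_int (D * a)" using b by simp
    then show ?thesis by blast
  next
    case False
    then obtain k :: int where "of_int D * y = of_int k" using D(2)[of y] y False by blast
    then have "of_int (D * b) * y = of_int (k * b)" by (simp add: mult_ac)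
    then show ?thesis by blast
  qed
  then show ?case using D(1) b(1) by (intro exI[of _ "D * b"]) auto
qed (auto intro: exI[of _ 1])

lemma integer_multiple:
  fixes f :: "nat \<Rightarrow> nat \<Rightarrow> rat"
  shows "\<exists>(D::int) (F :: nat \<Rightarrow> nat \<Rightarrow> int). 0 < D \<and> (\<forall>i<a. \<forall>j<b. of_int (F i j) = of_int D * f i j)"
proof -
  have "finite ((\<lambda>(i, j). f i j) ` ({..<a} \<times> {..<b}))" by simp
  then obtain D :: int where "0 < D" "\<forall>x\<in>(\<lambda>(i, j). f i j) ` ({..<a} \<times> {..<b}). \<exists>k::int. of_int D * x = of_int k"
    using common_denominator by blast
  then have "\<exists>k::int. i < a \<and> j < b \<longrightarrow> of_int k = of_int D * f i j" for i j
    by (cases "i < a \<and> j < b") (fastforce simp: eq_commute)+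
  then have "\<exists>F. \<forall>i j. i < a \<and> j < b \<longrightarrow> of_int (F i j :: int) = of_int D * f i j" by metis
  then show ?thesis using \<open>0 < D\<close> by blast
qed

text \<open>The machine has integers only. The three coefficient families are scaled separately;
  every summand is a product of one coefficient from each, so the whole identity is scaled by
  \<open>D1 * D2 * D3\<close>.\<close>

lemma slp_multiplies_int_tensor:
  assumes "slp_multiplies n p"
  shows "\<exists>(D::int) U V W. 0 < D \<and> (\<forall>q < n * n. \<forall>g < n * n. \<forall>h < n * n.
    (\<Sum>s < 2 * length p. W q s * U s g * V s h) = D * of_bool (mm_tensor n q g h))"
proof -
  obtain u v w :: "nat \<Rightarrow> nat \<Rightarrow> rat" where uvw: "\<And>q g h. q < n * n \<Longrightarrow> g < n * n \<Longrightarrow> h < n * n \<Longrightarrow>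
    (\<Sum>s < 2 * length p. w q s * u s g * v s h) = of_bool (mm_tensor n q g h)"
    using slp_multiplies_tensor[OF assms] by blast
  obtain D1 U where U: "0 < D1" "\<And>s g. s < 2 * length p \<Longrightarrow> g < n * n \<Longrightarrow> of_int (U s g) = of_int D1 * u s g"
    using integer_multiple[of "2 * length p" "n * n" u] by blast
  obtain D2 V where V: "0 < D2" "\<And>s g. s < 2 * length p \<Longrightarrow> g < n * n \<Longrightarrow> of_int (V s g) = of_int D2 * v s g"
    using integer_multiple[of "2 * length p" "n * n" v] by blast
  obtain D3 W where W: "0 < D3" "\<And>g s. g < n * n \<Longrightarrow> s < 2 * length p \<Longrightarrow> of_int (W g s) = of_int D3 * w g s"
    using integer_multiple[of "n * n" "2 * length p" w] by blast
  have "(\<Sum>s < 2 * length p. W q s * U s g * V s h) = (D1 * D2 * D3) * of_bool (mm_tensor n q g h)"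
    if "q < n * n" "g < n * n" "h < n * n" for q g h
  proof -
    have "(of_int (\<Sum>s < 2 * length p. W q s * U s g * V s h) :: rat) =
        (\<Sum>s < 2 * length p. of_int (D1 * D2 * D3) * (w q s * u s g * v s h))"
      using that by (simp add: U V W mult_ac)
    also have "\<dots> = of_int (D1 * D2 * D3) * of_bool (mm_tensor n q g h)"
      using uvw that by (simp add: sum_distrib_left[symmetric])
    also have "\<dots> = of_int ((D1 * D2 * D3) * of_bool (mm_tensor n q g h))" by simp
    finally show ?thesis by (simp only: of_int_eq_iff)
  qed
  then show ?thesis using U(1) V(1) W(1)
    by (intro exI[of _ "D1 * D2 * D3"] exI[of _ U] exI[of _ V] exI[of _ W]) simp
qed

section \<open>The schoolbook program and the length of optimal programs\<close>

text \<open>The sum of the products of the slots \<open>f k\<close> and \<open>g k\<close>, accumulated from slot \<open>b\<close> on.\<close>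

fun dot_slp :: "(nat \<Rightarrow> nat) \<Rightarrow> (nat \<Rightarrow> nat) \<Rightarrow> nat \<Rightarrow> nat \<Rightarrow> slp_instr list" where
  "dot_slp f g b 0 = [SAdd (Scalar 0) (Scalar 0)]"
| "dot_slp f g b (Suc k) = dot_slp f g b k @
     [SMul (Slot (f k)) (Slot (g k)), SAdd (Slot (b + 2 * k)) (Slot (b + 2 * k + 1))]"

lemma length_dot_slp[simp]: "length (dot_slp f g b k) = 2 * k + 1"
  by (induction k) auto

text \<open>Slot layout: after k summands the accumulator is slot \<open>b + 2 * k\<close>; the next
  product goes to slot \<open>b + 2 * k + 1\<close> and the next accumulator right behind
  it.\<close>

lemma dot_slp:
  assumes "length vs = b" "\<And>j. j < k \<Longrightarrow> f j < b" "\<And>j. j < k \<Longrightarrow> g j < b"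
  shows "slp_run (dot_slp f g b k) vs ! (b + 2 * k) = (\<Sum>j<k. vs ! f j * vs ! g j)"
  using assms
proof (induction k)
  case (Suc k)
  let ?v = "slp_run (dot_slp f g b k) vs"
  have l: "length ?v = b + 2 * k + 1" using Suc by (simp add: length_slp_run)
  have fg: "f k < b" "g k < b" using Suc by auto
  then have v: "?v ! f k = vs ! f k" "?v ! g k = vs ! g k" using Suc nth_slp_run by auto
  have "slp_run (dot_slp f g b (Suc k)) vs = ?v @ [vs ! f k * vs ! g k, ?v ! (b + 2 * k) + vs ! f k * vs ! g k]"
    using l fg v by (simp add: slp_run_append nth_append)
  then show ?case using Suc l by (simp add: nth_append)
qed (simp add: nth_append)

text \<open>One block of \<open>2 * n + 1\<close> instructions per entry q of the product, placed
  behind the \<open>2 * (n * n)\<close> inputs; the last slot of a block is its result. The number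
  \<open>m\<close> of entries is kept free for the induction.\<close>

definition naive_slp :: "nat \<Rightarrow> nat \<Rightarrow> slp_instr list" where
  "naive_slp n m = concat (map (\<lambda>q. dot_slp (\<lambda>k. (q div n) * n + k) (\<lambda>k. n * n + (k * n + q mod n))
     (2 * (n * n) + q * (2 * n + 1)) n) [0..<m])"

lemma length_naive_slp: "length (naive_slp n m) = m * (2 * n + 1)"
  unfolding naive_slp_def by (induction m) simp_all

lemma naive_slp:
  assumes "length vs = 2 * (n * n)" "m \<le> n * n" "q < m"
  shows "slp_run (naive_slp n m) vs ! (2 * (n * n) + q * (2 * n + 1) + 2 * n) =
    (\<Sum>k<n. vs ! ((q div n) * n + k) * vs ! (n * n + (k * n + q mod n)))"
  using assms(2,3)
proof (induction m)
  case (Suc m)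
  let ?d = "\<lambda>q. dot_slp (\<lambda>k. (q div n) * n + k) (\<lambda>k. n * n + (k * n + q mod n)) (2 * (n * n) + q * (2 * n + 1)) n"
  let ?v = "slp_run (naive_slp n m) vs"
  have run: "slp_run (naive_slp n (Suc m)) vs = slp_run (?d m) ?v"
    unfolding naive_slp_def by (simp add: slp_run_append)
  have l: "length ?v = 2 * (n * n) + m * (2 * n + 1)" using assms by (simp add: length_slp_run length_naive_slp)
  show ?case
  proof (cases "q = m")
    case True
    have n: "0 < n" using Suc.prems by (cases n) auto
    have idx: "(q div n) * n + k < n * n" "k * n + q mod n < n * n" if "k < n" for k
    proof -
      have "q div n < n" using Suc.prems by (simp add: less_mult_imp_div_less)
      then have "Suc (q div n) * n \<le> n * n" by (intro mult_le_mono1) simp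
      then show "(q div n) * n + k < n * n" using that by simp
      have "Suc k * n \<le> n * n" using that by (intro mult_le_mono1) simp
      moreover have "q mod n < n" using n by simp
      ultimately show "k * n + q mod n < n * n" by simp
    qed
    have "slp_run (?d m) ?v ! (2 * (n * n) + m * (2 * n + 1) + 2 * n) =
       (\<Sum>k<n. ?v ! ((m div n) * n + k) * ?v ! (n * n + (k * n + m mod n)))"
    proof (intro dot_slp)
      show "length ?v = 2 * (n * n) + m * (2 * n + 1)" by (rule l)
      fix k assume k: "k < n"
      have "m div n * n + k < 2 * (n * n)" using idx[OF k] True by auto
      then show "m div n * n + k < 2 * (n * n) + m * (2 * n + 1)" by (rule trans_less_add1)
      have "n * n + (k * n + m mod n) < 2 * (n * n)" using idx[OF k] True by auto
      then show "n * n + (k * n + m mod n) < 2 * (n * n) + m * (2 * n + 1)" by (rule trans_less_add1)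
    qed
    also have "\<dots> = (\<Sum>k<n. vs ! ((m div n) * n + k) * vs ! (n * n + (k * n + m mod n)))"
    proof (intro sum.cong refl arg_cong2[where f = "(*)"] nth_slp_run)
      fix k assume "k \<in> {..<n}"
      then have k: "k < n" by simp
      show "m div n * n + k < length vs" "n * n + (k * n + m mod n) < length vs"
        using idx[OF k] True assms by auto
    qed
    finally show ?thesis using True run by simp
  next
    case False
    then have "q < m" using Suc.prems by simp
    then have "Suc q * (2 * n + 1) \<le> m * (2 * n + 1)" by (intro mult_le_mono1) simp
    then have "2 * (n * n) + q * (2 * n + 1) + 2 * n < length ?v" unfolding l by simp
    then show ?thesis using Suc \<open>q < m\<close> run nth_slp_run by simp
  qed
qed simp

lemma slp_multiplies_naive: "slp_multiplies n (naive_slp n (n * n))"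
  unfolding slp_multiplies_def
proof (intro exI[of _ "\<lambda>i j. Slot (2 * (n * n) + (i * n + j) * (2 * n + 1) + 2 * n)"] ballI allI impI)
  fix A B :: "rat mat" and i j
  assume A: "A \<in> carrier_mat n n" and B: "B \<in> carrier_mat n n" and ij: "i < n" "j < n"
  let ?vs = "mat_entries n A @ mat_entries n B"
  have "Suc i * n \<le> n * n" using ij by (intro mult_le_mono1) simp
  then have q: "i * n + j < n * n" using ij by simp
  then have "Suc (i * n + j) * (2 * n + 1) \<le> n * n * (2 * n + 1)" by (intro mult_le_mono1) simp
  then have "slp_arg_val (slp_run (naive_slp n (n * n)) ?vs) (Slot (2 * (n * n) + (i * n + j) * (2 * n + 1) + 2 * n))
     = slp_run (naive_slp n (n * n)) ?vs ! (2 * (n * n) + (i * n + j) * (2 * n + 1) + 2 * n)"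
    by (simp add: length_slp_run length_naive_slp)
  also have "\<dots> = (\<Sum>k<n. ?vs ! (i * n + k) * ?vs ! (n * n + (k * n + j)))"
    using naive_slp[of ?vs n "n * n" "i * n + j"] q ij by simp
  also have "\<dots> = (\<Sum>k<n. A $$ (i, k) * B $$ (k, j))"
  proof (intro sum.cong refl)
    fix k assume "k \<in> {..<n}"
    then have k: "k < n" by simp
    have "Suc i * n \<le> n * n" using ij by (intro mult_le_mono1) simp
    then have "i * n + k < n * n" using k by simp
    then show "?vs ! (i * n + k) * ?vs ! (n * n + (k * n + j)) = A $$ (i, k) * B $$ (k, j)"
      using k ij by (simp add: nth_append nth_mat_entries)
  qed
  also have "\<dots> = (A * B) $$ (i, j)"
    using A B ij by (simp add: scalar_prod_def lessThan_atLeast0)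
  finally show "slp_arg_val (slp_run (naive_slp n (n * n)) ?vs)
     (Slot (2 * (n * n) + (i * n + j) * (2 * n + 1) + 2 * n)) = (A * B) $$ (i, j)" .
qed

text \<open>The schoolbook program shows that some length occurs, so the \<open>LEAST\<close> is
  attained.\<close>

lemma mm_ops: "\<exists>p. slp_multiplies n p \<and> length p = mm_ops n"
proof -
  have "\<exists>s p. slp_multiplies n p \<and> length p = s" using slp_multiplies_naive by blast
  then show ?thesis unfolding mm_ops_def by (rule LeastI_ex)
qed

lemma mm_ops_le: "mm_ops n \<le> n * n * (2 * n + 1)"
  unfolding mm_ops_def
  by (rule Least_le) (use slp_multiplies_naive[of n] length_naive_slp[of n "n * n"] in blast)

text \<open>The outputs are distinct and none of them is an input or a constant.\<close>

lemma slp_multiplies_length: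
  assumes "slp_multiplies n p"
  shows "n * n \<le> length p"
proof (cases "n = 0")
  case False
  obtain out where out: "\<And>A B i j. A \<in> carrier_mat n n \<Longrightarrow> B \<in> carrier_mat n n \<Longrightarrow> i < n \<Longrightarrow> j < n \<Longrightarrow>
        slp_arg_val (slp_run p (mat_entries n A @ mat_entries n B)) (out i j) = (A * B) $$ (i, j)"
    using assms unfolding slp_multiplies_def by blast
  let ?one = "1\<^sub>m n :: rat mat" and ?zero = "0\<^sub>m n n :: rat mat"
  have slot: "\<exists>l. out i j = Slot l \<and> 2 * (n * n) \<le> l \<and> l < 2 * (n * n) + length p" if ij: "i < n" "j < n" for i j
  proof -
    let ?E = "mat n n (\<lambda>x. of_bool (x = (i, j))) :: rat mat"
    have "?E * ?one = ?E" by (rule right_mult_one_mat[of _ n n]) simp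
    moreover have "?zero * ?one = ?zero" by (rule right_mult_one_mat[of _ n n]) simp
    ultimately have E: "(?E * ?one) $$ (i, j) = 1" and E0: "(?zero * ?one) $$ (i, j) = 0"
      using ij by (simp_all del: right_mult_one_mat)
    show ?thesis
    proof (cases "out i j")
      \<comment> \<open>A constant cannot be 1 for \<open>?E * ?one\<close> and 0 for
        \<open>?zero * ?one\<close>.\<close>
      case (Scalar c)
      then show ?thesis using out[of ?E ?one i j] out[of ?zero ?one i j] E E0 ij by simp
    next
      case (Slot l)
      \<comment> \<open>A slot out of range reads as 0, while the entry is 1 for
        \<open>?E * ?one\<close>.\<close>
      have "l < 2 * (n * n) + length p"
      proof (rule ccontr)
        assume "\<not> ?thesis"
        then show False using out[of ?E ?one i j] E ij Slot by (simp add: length_slp_run)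
      qed
      \<comment> \<open>An input slot holds 1 for one of the products \<open>?J * ?zero\<close> and
        \<open>?zero * ?J\<close>, although both are zero matrices.\<close>
      moreover have "2 * (n * n) \<le> l"
      proof (rule ccontr)
        assume l: "\<not> 2 * (n * n) \<le> l"
        let ?J = "mat n n (\<lambda>x. 1) :: rat mat"
        have val: "slp_arg_val (slp_run p (mat_entries n A @ mat_entries n B)) (out i j) =
            (mat_entries n A @ mat_entries n B) ! l" for A B
          using l Slot by (simp add: length_slp_run nth_slp_run)
        have J: "mat_entries n ?J ! g = 1" if "g < n * n" for g
          using that False unfolding mat_entries_eq by (simp add: less_mult_imp_div_less)
        have "?J * ?zero = ?zero" by (rule right_mult_zero_mat[of _ n n]) simp
        moreover have "?zero * ?J = ?zero" by (rule left_mult_zero_mat[of _ n n]) simp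
        ultimately have "(?J * ?zero) $$ (i, j) = 0" "(?zero * ?J) $$ (i, j) = 0"
          using ij by (simp_all del: right_mult_zero_mat left_mult_zero_mat)
        then have "(mat_entries n ?J @ mat_entries n ?zero) ! l = 0" "(mat_entries n ?zero @ mat_entries n ?J) ! l = 0"
          using out[of ?J ?zero i j] out[of ?zero ?J i j] val ij by simp_all
        then show False using J l by (cases "l < n * n") (simp_all add: nth_append)
      qed
      ultimately show ?thesis using Slot by blast
    qed
  qed
  have inj: "(i, j) = (i', j')" if ij: "i < n" "j < n" "i' < n" "j' < n" and eq: "out i j = out i' j'" for i j i' j'
  proof -
    let ?E = "mat n n (\<lambda>x. of_bool (x = (i, j))) :: rat mat"
    have c: "?E \<in> carrier_mat n n" "?one \<in> carrier_mat n n" by simp_all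
    have "(?E * ?one) $$ (i, j) = (?E * ?one) $$ (i', j')"
      using out[OF c ij(1,2)] out[OF c ij(3,4)] eq by metis
    then have "?E $$ (i, j) = ?E $$ (i', j')" using c by (metis right_mult_one_mat)
    then have "of_bool ((i', j') = (i, j)) = (1 :: rat)" using ij by simp
    then show ?thesis by (auto simp: of_bool_def split: if_splits)
  qed
  have "\<exists>l. \<forall>i j. i < n \<and> j < n \<longrightarrow> out i j = Slot (l i j) \<and> 2 * (n * n) \<le> l i j \<and> l i j < 2 * (n * n) + length p"
    using slot by metis
  then obtain l where l: "\<And>i j. i < n \<Longrightarrow> j < n \<Longrightarrow> out i j = Slot (l i j) \<and> 2 * (n * n) \<le> l i j \<and> l i j < 2 * (n * n) + length p"
    by blast
  have "inj_on (\<lambda>(i, j). l i j) ({..<n} \<times> {..<n})"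
  proof (intro inj_onI)
    fix x y assume x: "x \<in> {..<n} \<times> {..<n}" and y: "y \<in> {..<n} \<times> {..<n}"
      and eq: "(case x of (i, j) \<Rightarrow> l i j) = (case y of (i, j) \<Rightarrow> l i j)"
    obtain i j i' j' where xy: "x = (i, j)" "y = (i', j')" by (metis surj_pair)
    then have "out i j = out i' j'" using l[of i j] l[of i' j'] x y eq by simp
    then show "x = y" using inj[of i j i' j'] x y xy by simp
  qed
  moreover have "(\<lambda>(i, j). l i j) ` ({..<n} \<times> {..<n}) \<subseteq> {2 * (n * n)..<2 * (n * n) + length p}"
    using l by auto
  ultimately have "card ({..<n} \<times> {..<n}) \<le> card {2 * (n * n)..<2 * (n * n) + length p}"
    by (intro card_inj_on_le) auto
  then show ?thesis by simp
qed simp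

text \<open>Becomes \<open>b * b \<le> r\<close>: a matrix has no more entries than the bilinear
  algorithm has products, so work linear in the matrices is never dominant.\<close>

lemma mm_ops_ge: "n * n \<le> mm_ops n"
  using mm_ops slp_multiplies_length by metis

text \<open>Some admissible \<tau> lies strictly below \<sigma>, even if the infimum is not
  admissible. The gap makes n^\<tau> negligible against n^\<sigma>, which swallows the O-constant
  and the factor 2 from polarization. The size must be at least 2 for its powers to grow.\<close>

lemma mm_exponent_approx:
  assumes "mm_exponent < \<sigma>"
  shows "\<exists>n \<ge> 2. real (2 * mm_ops n) \<le> real n powr \<sigma>"
proof -
  let ?S = "{\<tau>. (\<lambda>n. real (mm_ops n)) \<in> O(\<lambda>n. real n powr \<tau>)}"
  \<comment> \<open>The schoolbook program puts 3 into the set, so its infimum is taken over a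
    nonempty set.\<close>
  have "(\<lambda>n. real (mm_ops n)) \<in> O(\<lambda>n. real n powr 3)"
  proof (rule bigoI[of _ 3], rule eventually_sequentiallyI[of 1])
    fix n :: nat assume "1 \<le> n"
    have "mm_ops n \<le> n * n * (2 * n + 1)" by (rule mm_ops_le)
    also have "\<dots> \<le> n * n * (3 * n)" using \<open>1 \<le> n\<close> by (intro mult_le_mono2) simp
    finally have "real (mm_ops n) \<le> real (n * n * (3 * n))" by (simp only: of_nat_le_iff)
    also have "\<dots> = 3 * real n powr 3" using \<open>1 \<le> n\<close> by (simp add: powr_numeral power3_eq_cube)
    finally show "norm (real (mm_ops n)) \<le> 3 * norm (real n powr 3)" by simp
  qed
  then have "?S \<noteq> {}" by blast
  then obtain \<tau> where \<tau>: "(\<lambda>n. real (mm_ops n)) \<in> O(\<lambda>n. real n powr \<tau>)" "\<tau> < \<sigma>"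
    using cInf_lessD[of ?S \<sigma>] assms unfolding mm_exponent_def by blast
  have "(\<lambda>n. real n powr \<tau>) \<in> o(\<lambda>n. real n powr \<sigma>)"
    using \<tau>(2) by (intro powr_smallo_iff[THEN iffD2]) (auto simp: filterlim_real_sequentially)
  then have "(\<lambda>n. real (mm_ops n)) \<in> o(\<lambda>n. real n powr \<sigma>)"
    by (rule landau_o.big_small_trans[OF \<tau>(1)])
  then have "eventually (\<lambda>n. norm (real (mm_ops n)) \<le> 1/2 * norm (real n powr \<sigma>)) sequentially"
    by (rule landau_o.smallD) simp
  then have "eventually (\<lambda>n. n \<ge> 2 \<and> real (2 * mm_ops n) \<le> real n powr \<sigma>) sequentially"
    using eventually_ge_at_top[of 2] by eventually_elim simp
  then show ?thesis using eventually_happens'[OF sequentially_bot] by blast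
qed

section \<open>Kronecker powers of a bilinear algorithm\<close>

lemma sum_product_index:
  fixes f :: "nat \<Rightarrow> 'a :: comm_monoid_add"
  shows "(\<Sum>x<a * b. f x) = (\<Sum>i<a. \<Sum>j<b. f (i * b + j))"
proof (induction a)
  case (Suc a)
  have "{..<Suc a * b} = {..<a * b} \<union> {a * b..<a * b + b}" "{..<a * b} \<inter> {a * b..<a * b + b} = {}" by auto
  then have "(\<Sum>x<Suc a * b. f x) = (\<Sum>x<a * b. f x) + (\<Sum>x\<in>{a * b..<a * b + b}. f x)"
    by (simp add: sum.union_disjoint)
  also have "(\<Sum>x\<in>{a * b..<a * b + b}. f x) = (\<Sum>j<b. f (a * b + j))"
    by (rule sum.reindex_bij_witness[of _ "\<lambda>j. a * b + j" "\<lambda>x. x - a * b"]) auto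
  finally show ?case using Suc by simp
qed simp

text \<open>Kronecker powers of an \<open>r \<times> p\<close> matrix; row and column indices are digit sequences in base
  \<open>r\<close> and \<open>p\<close>.\<close>

fun kpow :: "nat \<Rightarrow> nat \<Rightarrow> (nat \<Rightarrow> nat \<Rightarrow> int) \<Rightarrow> nat \<Rightarrow> nat \<Rightarrow> nat \<Rightarrow> int" where
  "kpow r p U 0 h g = 1"
| "kpow r p U (Suc l) h g = kpow r p U l (h div r) (g div p) * U (h mod r) (g mod p)"

lemma kpow_bound:
  assumes "\<And>i j. i < r \<Longrightarrow> j < p \<Longrightarrow> \<bar>U i j\<bar> \<le> \<mu>" "0 < r" "0 < p" "0 \<le> \<mu>"
  shows "\<bar>kpow r p U l h g\<bar> \<le> \<mu> ^ l"
proof (induction l arbitrary: h g)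
  case (Suc l)
  have "\<bar>kpow r p U l (h div r) (g div p) * U (h mod r) (g mod p)\<bar> \<le> \<mu> ^ l * \<mu>"
    unfolding abs_mult using Suc assms by (intro mult_mono) auto
  then show ?case by (simp add: mult.commute)
qed simp

text \<open>The step that lets a power be applied one factor at a time. The l leading digits, coded
  by h, are transformed already; the next digit j is contracted with row i of \<open>U\<close>; the
  trailing digits t, with stride m, are left alone.\<close>

lemma kpow_step:
  assumes i: "i < r"
  shows "(\<Sum>j<p. U i j * (\<Sum>g<p ^ l. kpow r p U l h g * x ((g * p + j) * m + t))) =
    (\<Sum>g<p ^ Suc l. kpow r p U (Suc l) (h * r + i) g * x (g * m + t))"
proof -
  have "(\<Sum>g<p ^ l * p. kpow r p U (Suc l) (h * r + i) g * x (g * m + t)) =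
      (\<Sum>g<p ^ l. \<Sum>j<p. kpow r p U (Suc l) (h * r + i) (g * p + j) * x ((g * p + j) * m + t))"
    by (rule sum_product_index)
  also have "\<dots> = (\<Sum>g<p ^ l. \<Sum>j<p. U i j * (kpow r p U l h g * x ((g * p + j) * m + t)))"
    using i by (intro sum.cong refl) (simp add: mult_ac)
  also have "\<dots> = (\<Sum>j<p. \<Sum>g<p ^ l. U i j * (kpow r p U l h g * x ((g * p + j) * m + t)))"
    by (rule sum.swap)
  finally show ?thesis by (simp add: sum_distrib_left mult.commute)
qed

text \<open>A position q in an \<open>n ^ d\<close> by \<open>n ^ d\<close> matrix is numbered by
  digits in base \<open>n * n\<close>, each digit holding one row digit and one column digit. In
  this interleaved order, unlike the row-major one, the multiplication tensor of size
  \<open>n ^ d\<close> is literally a Kronecker power of the one of size n.\<close>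

fun row_index :: "nat \<Rightarrow> nat \<Rightarrow> nat \<Rightarrow> nat" where
  "row_index n 0 q = 0"
| "row_index n (Suc d) q = row_index n d (q div (n * n)) * n + (q mod (n * n)) div n"

fun col_index :: "nat \<Rightarrow> nat \<Rightarrow> nat \<Rightarrow> nat" where
  "col_index n 0 q = 0"
| "col_index n (Suc d) q = col_index n d (q div (n * n)) * n + (q mod (n * n)) mod n"

fun pair_index :: "nat \<Rightarrow> nat \<Rightarrow> nat \<Rightarrow> nat \<Rightarrow> nat" where
  "pair_index n 0 x y = 0"
| "pair_index n (Suc d) x y = pair_index n d (x div n) (y div n) * (n * n) + ((x mod n) * n + y mod n)"

lemma mult_add_less:
  fixes a b n m :: nat
  assumes "a < m" "b < n"
  shows "a * n + b < m * n"
proof -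
  have "Suc a * n \<le> m * n" using assms by (intro mult_le_mono1) simp
  then show ?thesis using assms by simp
qed

lemma row_index_less: "0 < n \<Longrightarrow> row_index n d q < n ^ d"
proof (induction d arbitrary: q)
  case (Suc d)
  have "(q mod (n * n)) div n < n" using Suc.prems by (simp add: less_mult_imp_div_less)
  then have "row_index n (Suc d) q < n ^ d * n" using Suc by (auto intro!: mult_add_less)
  then show ?case by (simp add: mult.commute)
qed simp

lemma col_index_less: "0 < n \<Longrightarrow> col_index n d q < n ^ d"
proof (induction d arbitrary: q)
  case (Suc d)
  have "(q mod (n * n)) mod n < n" using Suc.prems by simp
  then have "col_index n (Suc d) q < n ^ d * n" using Suc by (auto intro!: mult_add_less)
  then show ?case by (simp add: mult.commute)
qed simp

lemma pair_index_less: "0 < n \<Longrightarrow> pair_index n d x y < (n * n) ^ d"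
proof (induction d arbitrary: x y)
  case (Suc d)
  have "(x mod n) * n + y mod n < n * n" using Suc.prems by (intro mult_add_less) auto
  then have "pair_index n (Suc d) x y < (n * n) ^ d * (n * n)"
    unfolding pair_index.simps using Suc by (intro mult_add_less) auto
  then show ?case by (simp add: mult.commute)
qed simp

lemma row_pair_index: "0 < n \<Longrightarrow> x < n ^ d \<Longrightarrow> row_index n d (pair_index n d x y) = x"
proof (induction d arbitrary: x y)
  case (Suc d)
  have l: "(x mod n) * n + y mod n < n * n" using Suc.prems by (intro mult_add_less) auto
  have "x div n < n ^ d" using Suc.prems by (simp add: less_mult_imp_div_less mult.commute)
  then have "row_index n d (pair_index n d (x div n) (y div n)) = x div n" using Suc by blast
  then show ?case using l Suc.prems(1) by (simp del: mult_Suc_right)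
qed simp

lemma col_pair_index: "0 < n \<Longrightarrow> y < n ^ d \<Longrightarrow> col_index n d (pair_index n d x y) = y"
proof (induction d arbitrary: x y)
  case (Suc d)
  have l: "(x mod n) * n + y mod n < n * n" using Suc.prems by (intro mult_add_less) auto
  have "y div n < n ^ d" using Suc.prems by (simp add: less_mult_imp_div_less mult.commute)
  then have "col_index n d (pair_index n d (x div n) (y div n)) = y div n" using Suc by blast
  then show ?case using l Suc.prems(1) by simp
qed simp

lemma pair_index_row_col: "0 < n \<Longrightarrow> q < (n * n) ^ d \<Longrightarrow> pair_index n d (row_index n d q) (col_index n d q) = q"
proof (induction d arbitrary: q)
  case (Suc d)
  have a: "(q mod (n * n)) div n < n" using Suc.prems by (simp add: less_mult_imp_div_less)
  have b: "(q mod (n * n)) mod n < n" using Suc.prems by simp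
  have "q div (n * n) < (n * n) ^ d" using Suc.prems by (simp add: less_mult_imp_div_less mult.commute)
  then have "pair_index n d (row_index n d (q div (n * n))) (col_index n d (q div (n * n))) = q div (n * n)"
    using Suc by blast
  then have "pair_index n (Suc d) (row_index n (Suc d) q) (col_index n (Suc d) q) =
      q div (n * n) * (n * n) + ((q mod (n * n)) div n * n + (q mod (n * n)) mod n)"
    unfolding pair_index.simps row_index.simps col_index.simps using a b Suc.prems(1) by simp
  also have "\<dots> = q" by (simp only: div_mult_mod_eq)
  finally show ?case .
qed simp

definition power_tensor :: "nat \<Rightarrow> nat \<Rightarrow> nat \<Rightarrow> nat \<Rightarrow> nat \<Rightarrow> bool" where
  "power_tensor n d q g h \<longleftrightarrow> row_index n d q = row_index n d g \<and>
     col_index n d g = row_index n d h \<and> col_index n d h = col_index n d q"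

lemma digits_eq_iff:
  fixes n :: nat
  assumes "a < n" "b < n"
  shows "x * n + a = y * n + b \<longleftrightarrow> x = y \<and> a = b"
  using assms by (metis Euclidean_Rings.div_eq_0_iff add.commute add.left_neutral div_mult_self1 less_nat_zero_code
      mod_less mod_mult_self1 mult_eq_0_iff)

text \<open>Two row or column indices agree if and only if all their digits do; hence the
  multiplication tensor splits into one tensor of size n per digit.\<close>

lemma power_tensor_Suc:
  assumes "0 < n"
  shows "power_tensor n (Suc d) q g h \<longleftrightarrow>
    power_tensor n d (q div (n * n)) (g div (n * n)) (h div (n * n)) \<and>
    mm_tensor n (q mod (n * n)) (g mod (n * n)) (h mod (n * n))"
proof -
  have a: "(x mod (n * n)) div n < n" "(x mod (n * n)) mod n < n" for x
    using assms by (simp_all add: less_mult_imp_div_less)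
  show ?thesis
    unfolding power_tensor_def mm_tensor_def row_index.simps col_index.simps
      digits_eq_iff[OF a(1) a(1)] digits_eq_iff[OF a(2) a(1)] digits_eq_iff[OF a(2) a(2)]
    by blast
qed

text \<open>The sum over s factors into d independent sums over the digits of s. Each of them is the
  identity for size n and contributes one factor \<open>D\<close>.\<close>

lemma kpow_tensor:
  assumes UVW: "\<And>q g h. q < n * n \<Longrightarrow> g < n * n \<Longrightarrow> h < n * n \<Longrightarrow>
    (\<Sum>s<r. W q s * U s g * V s h) = D * of_bool (mm_tensor n q g h)" and n: "0 < n"
  shows "(\<Sum>s<r ^ d. kpow (n * n) r W d q s * kpow r (n * n) U d s g * kpow r (n * n) V d s h) =
    D ^ d * of_bool (power_tensor n d q g h)"
proof (induction d arbitrary: q g h)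
  case 0
  then show ?case by (simp add: power_tensor_def)
next
  case (Suc d)
  let ?P = "n * n"
  let ?f = "\<lambda>d q g h s. kpow ?P r W d q s * kpow r ?P U d s g * kpow r ?P V d s h"
  let ?e = "\<lambda>s. W (q mod ?P) s * U s (g mod ?P) * V s (h mod ?P)"
  have "(\<Sum>s<r ^ d * r. ?f (Suc d) q g h s) = (\<Sum>s<r ^ d. \<Sum>i<r. ?f (Suc d) q g h (s * r + i))"
    by (rule sum_product_index)
  also have "\<dots> = (\<Sum>s<r ^ d. \<Sum>i<r. ?f d (q div ?P) (g div ?P) (h div ?P) s * ?e i)"
    by (intro sum.cong refl) (simp add: mult_ac)
  also have "\<dots> = (\<Sum>s<r ^ d. ?f d (q div ?P) (g div ?P) (h div ?P) s) * (\<Sum>i<r. ?e i)"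
    by (simp add: sum_product)
  also have "\<dots> = (D ^ d * of_bool (power_tensor n d (q div ?P) (g div ?P) (h div ?P))) *
      (D * of_bool (mm_tensor n (q mod ?P) (g mod ?P) (h mod ?P)))"
    using Suc[of "q div ?P" "g div ?P" "h div ?P"] UVW n by simp
  also have "\<dots> = D ^ Suc d * of_bool (power_tensor n (Suc d) q g h)"
    unfolding power_tensor_Suc[OF n] by simp
  finally show ?case by (simp add: mult.commute)
qed

definition kapply :: "nat \<Rightarrow> nat \<Rightarrow> (nat \<Rightarrow> nat \<Rightarrow> int) \<Rightarrow> nat \<Rightarrow> (nat \<Rightarrow> int) \<Rightarrow> nat \<Rightarrow> int" where
  "kapply r p U d x h = (\<Sum>g<p ^ d. kpow r p U d h g * x g)"

text \<open>Exchanging the sums gathers the coefficients into the tensor of the power. For fixed q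
  the pairs (g, h) in its support are parametrized by the inner index z, which is the column of g
  and the row of h.\<close>

lemma kapply_product:
  assumes UVW: "\<And>q g h. q < n * n \<Longrightarrow> g < n * n \<Longrightarrow> h < n * n \<Longrightarrow>
    (\<Sum>s<r. W q s * U s g * V s h) = D * of_bool (mm_tensor n q g h)" and n: "0 < n"
    and q: "q < (n * n) ^ d"
  shows "kapply (n * n) r W d (\<lambda>s. kapply r (n * n) U d a s * kapply r (n * n) V d b s) q =
    D ^ d * (\<Sum>z<n ^ d. a (pair_index n d (row_index n d q) z) * b (pair_index n d z (col_index n d q)))"
proof -
  let ?P = "n * n"
  let ?r = "row_index n d" and ?c = "col_index n d"
  let ?f = "\<lambda>s g h. kpow ?P r W d q s * kpow r ?P U d s g * kpow r ?P V d s h"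
  have "kapply ?P r W d (\<lambda>s. kapply r ?P U d a s * kapply r ?P V d b s) q =
      (\<Sum>s<r ^ d. \<Sum>g<?P ^ d. \<Sum>h<?P ^ d. ?f s g h * (a g * b h))"
  proof -
    have "w * ((\<Sum>g\<in>G. u g * a g) * (\<Sum>h\<in>G. v h * b h)) =
        (\<Sum>g\<in>G. \<Sum>h\<in>G. w * u g * v h * (a g * b h))" for w G and u v :: "nat \<Rightarrow> int"
      by (subst sum_product) (simp add: sum_distrib_left mult_ac)
    then show ?thesis unfolding kapply_def by simp
  qed
  also have "\<dots> = (\<Sum>g<?P ^ d. \<Sum>s<r ^ d. \<Sum>h<?P ^ d. ?f s g h * (a g * b h))"
    by (rule sum.swap)
  also have "\<dots> = (\<Sum>g<?P ^ d. \<Sum>h<?P ^ d. \<Sum>s<r ^ d. ?f s g h * (a g * b h))"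
    by (intro sum.cong refl sum.swap)
  also have "\<dots> = (\<Sum>g<?P ^ d. \<Sum>h<?P ^ d. D ^ d * of_bool (power_tensor n d q g h) * (a g * b h))"
  proof -
    have "(\<Sum>s<r ^ d. ?f s g h) = D ^ d * of_bool (power_tensor n d q g h)" for g h
      by (rule kpow_tensor[OF _ n]) (rule UVW)
    then show ?thesis by (simp only: sum_distrib_right[symmetric])
  qed
  also have "\<dots> = D ^ d * (\<Sum>g<?P ^ d. \<Sum>h<?P ^ d. of_bool (power_tensor n d q g h) * (a g * b h))"
    by (simp only: sum_distrib_left mult.assoc)
  also have "(\<Sum>g<?P ^ d. \<Sum>h<?P ^ d. of_bool (power_tensor n d q g h) * (a g * b h)) =
      (\<Sum>(g, h)\<in>{..<?P ^ d} \<times> {..<?P ^ d}. of_bool (power_tensor n d q g h) * (a g * b h))"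
    by (rule sum.cartesian_product)
  also have "(\<Sum>(g, h)\<in>{..<?P ^ d} \<times> {..<?P ^ d}. of_bool (power_tensor n d q g h) * (a g * b h)) =
      (\<Sum>(g, h)\<in>{(g, h) \<in> {..<?P ^ d} \<times> {..<?P ^ d}. power_tensor n d q g h}. a g * b h)"
    by (rule sum.mono_neutral_cong_right) (auto simp: of_bool_def split: if_splits)
  also have "\<dots> = (\<Sum>z<n ^ d. a (pair_index n d (?r q) z) * b (pair_index n d z (?c q)))"
  proof (rule sum.reindex_bij_witness[of _ "\<lambda>z. (pair_index n d (?r q) z, pair_index n d z (?c q))" "\<lambda>(g, h). ?c g"])
    fix gh assume "gh \<in> {(g, h) \<in> {..<?P ^ d} \<times> {..<?P ^ d}. power_tensor n d q g h}"
    then obtain g h where gh: "gh = (g, h)" "g < ?P ^ d" "h < ?P ^ d" "power_tensor n d q g h" by auto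
    then have eq: "?r q = ?r g" "?r h = ?c g" "?c q = ?c h" unfolding power_tensor_def by simp_all
    have "pair_index n d (?r q) (?c g) = g" "pair_index n d (?c g) (?c q) = h"
      using pair_index_row_col[OF n gh(2)] pair_index_row_col[OF n gh(3)] eq by simp_all
    then show "(pair_index n d (?r q) ((\<lambda>(g, h). ?c g) gh), pair_index n d ((\<lambda>(g, h). ?c g) gh) (?c q)) = gh"
      "(\<lambda>(g, h). ?c g) gh \<in> {..<n ^ d}"
      "a (pair_index n d (?r q) ((\<lambda>(g, h). ?c g) gh)) * b (pair_index n d ((\<lambda>(g, h). ?c g) gh) (?c q)) =
        (case gh of (g, h) \<Rightarrow> a g * b h)"
      using gh col_index_less[OF n] by auto
  next
    fix z assume "z \<in> {..<n ^ d}"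
    then have z: "z < n ^ d" by simp
    show "(\<lambda>(g, h). ?c g) (pair_index n d (?r q) z, pair_index n d z (?c q)) = z"
      using col_pair_index[OF n z] by simp
    show "(pair_index n d (?r q) z, pair_index n d z (?c q)) \<in>
        {(g, h) \<in> {..<?P ^ d} \<times> {..<?P ^ d}. power_tensor n d q g h}"
      using z n pair_index_less[OF n] row_index_less[OF n] col_index_less[OF n]
      by (simp add: power_tensor_def row_pair_index col_pair_index)
  qed
  finally show ?thesis .
qed

text \<open>Entries grow by a constant factor per level, so d levels add only O(d) bits.\<close>

lemma kapply_bound:
  assumes "\<And>i j. i < r \<Longrightarrow> j < p \<Longrightarrow> \<bar>U i j\<bar> \<le> \<mu>" "0 < r" "0 < p" "0 \<le> \<mu>" "\<And>g. g < p ^ d \<Longrightarrow> \<bar>x g\<bar> \<le> X"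
  shows "\<bar>kapply r p U d x h\<bar> \<le> (int p * \<mu>) ^ d * X"
proof -
  have "\<bar>kapply r p U d x h\<bar> \<le> (\<Sum>g<p ^ d. \<bar>kpow r p U d h g * x g\<bar>)"
    unfolding kapply_def by (rule sum_abs)
  also have "\<dots> \<le> (\<Sum>g<p ^ d. \<mu> ^ d * X)"
    unfolding abs_mult using kpow_bound[OF assms(1-4)] assms by (intro sum_mono mult_mono) auto
  also have "\<dots> = (int p * \<mu>) ^ d * X" by (simp add: power_mult_distrib)
  finally show ?thesis .
qed

section \<open>Vertex elimination in graphs of treewidth at most 2\<close>

text \<open>Bags in the order in which leaves can be removed from the tree: what a bag shares with the
  later ones lies in a single later bag.\<close>

fun rip :: "'a set list \<Rightarrow> bool" where
  "rip [] \<longleftrightarrow> True"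
| "rip (b # bs) \<longleftrightarrow> rip bs \<and> (bs = [] \<or> (\<exists>c\<in>set bs. b \<inter> \<Union>(set bs) \<subseteq> c))"

text \<open>Take the first vertex of a longest path inside \<open>W\<close>. By maximality its
  neighbours in \<open>W\<close> lie on the path, and one other than the second vertex would close a
  cycle. The subset \<open>W\<close> is what is left of the tree while leaves are peeled off;
  \<open>T\<close> itself never changes.\<close>

lemma acyclic_leaf:
  assumes W: "finite W" "W \<noteq> {}" and irr: "\<And>e. e \<in> edges T \<Longrightarrow> card e = 2" and acyc: "\<nexists>xs. is_cycle T xs"
  shows "\<exists>t\<in>W. \<exists>p. \<forall>s\<in>W. {t, s} \<in> edges T \<longrightarrow> s = p"
proof -
  define path where "path xs \<longleftrightarrow> xs \<noteq> [] \<and> distinct xs \<and> set xs \<subseteq> W \<and>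
    (\<forall>i. Suc i < length xs \<longrightarrow> {xs ! i, xs ! Suc i} \<in> edges T)" for xs
  obtain w where "w \<in> W" using W by blast
  then have "path [w]" unfolding path_def by simp
  moreover have "\<forall>xs. path xs \<longrightarrow> length xs < Suc (card W)"
    unfolding path_def using W by (metis card_mono distinct_card less_Suc_eq_le)
  ultimately obtain xs where xs: "path xs" and max: "\<And>ys. path ys \<Longrightarrow> length ys \<le> length xs"
    using ex_has_greatest_nat[of path "[w]" length "Suc (card W)"] by blast
  define t where "t = xs ! 0"
  have t: "t \<in> W" using xs unfolding path_def t_def by (metis length_greater_0_conv nth_mem subset_iff)
  \<comment> \<open>For a path with a single vertex \<open>xs ! 1\<close> is arbitrary, but then
    there is no such s.\<close>
  have "s = xs ! 1" if s: "s \<in> W" "{t, s} \<in> edges T" for s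
  proof -
    have "s \<in> set xs"
    proof (rule ccontr)
      assume n: "s \<notin> set xs"
      have "path (s # xs)" unfolding path_def
      proof (intro conjI allI impI)
        fix i assume i: "Suc i < length (s # xs)"
        show "{(s # xs) ! i, (s # xs) ! Suc i} \<in> edges T"
        proof (cases i)
          case 0
          then show ?thesis using s(2) unfolding t_def by (simp add: insert_commute)
        next
          case (Suc k)
          then show ?thesis using xs i unfolding path_def by simp
        qed
      qed (use n s xs in \<open>auto simp: path_def\<close>)
      then show False using max[of "s # xs"] by simp
    qed
    then obtain j where j: "j < length xs" "s = xs ! j" by (auto simp: in_set_conv_nth)
    have "t \<noteq> s" using irr[OF s(2)] by auto
    then have j0: "j \<noteq> 0" using j unfolding t_def by metis
    show ?thesis
    proof (rule ccontr)
      assume "s \<noteq> xs ! 1"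
      then have j2: "2 \<le> j" using j j0 by (cases j; cases "j - 1"; auto)
      let ?c = "take (Suc j) xs"
      have len: "length ?c = Suc j" using j by simp
      have "is_cycle T ?c" unfolding is_cycle_def
      proof (intro conjI allI impI)
        show "3 \<le> length ?c" using len j2 by simp
        show "distinct ?c" using xs unfolding path_def by simp
        fix i assume i: "i < length ?c"
        show "{?c ! i, ?c ! (Suc i mod length ?c)} \<in> edges T"
        proof (cases "i = j")
          case True
          then show ?thesis using s(2) j unfolding len t_def by (simp add: insert_commute)
        next
          case False
          then have "i < j" using i len by simp
          then show ?thesis using xs j unfolding len path_def by simp
        qed
      qed
      then show False using acyc by blast
    qed
  qed
  then show ?thesis using t by blast
qed

definition steps_in :: "'a sgraph \<Rightarrow> 'a set \<Rightarrow> ('a \<times> 'a) set" where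
  "steps_in G S = {(a, b). a \<in> S \<and> b \<in> S \<and> {a, b} \<in> edges G}"

text \<open>A walk that visits the leaf \<open>t\<close> enters and leaves it through
  \<open>p\<close>, so the detour can be cut out.\<close>

lemma connected_in_remove_leaf:
  assumes conn: "connected_in T S" and leaf: "\<forall>s\<in>S. {t, s} \<in> edges T \<longrightarrow> s = p"
  shows "connected_in T (S - {t})"
proof -
  \<comment> \<open>While the walk stands on \<open>t\<close>, the invariant keeps the path to
    \<open>p\<close>, from which the walk has come and to which it must return.\<close>
  have path: "(if y = t then t \<in> S \<longrightarrow> (x, p) \<in> (steps_in T (S - {t}))\<^sup>* else (x, y) \<in> (steps_in T (S - {t}))\<^sup>*)"
    if "(x, y) \<in> (steps_in T S)\<^sup>*" "x \<in> S" "x \<noteq> t" for x y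
    using that
  proof (induction rule: rtrancl_induct)
    case (step y z)
    have yz: "y \<in> S" "z \<in> S" "{y, z} \<in> edges T" using step(2) unfolding steps_in_def by auto
    show ?case
    proof (cases "y = t")
      case True
      then have "z = p" using leaf yz by auto
      then show ?thesis using step True yz by auto
    next
      case False
      have xy: "(x, y) \<in> (steps_in T (S - {t}))\<^sup>*" using step False by simp
      show ?thesis
      proof (cases "z = t")
        case True
        then have "y = p" using leaf yz by (auto simp: insert_commute)
        then show ?thesis using True xy by simp
      next
        case z: False
        then have "(y, z) \<in> steps_in T (S - {t})" using yz False unfolding steps_in_def by simp
        then show ?thesis using z xy by (simp add: rtrancl.rtrancl_into_rtrancl)
      qed
    qed
  qed simp
  show ?thesis
    unfolding connected_in_def
  proof (intro ballI)
    fix a b assume a: "a \<in> S - {t}" and b: "b \<in> S - {t}"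
    then have "(a, b) \<in> (steps_in T S)\<^sup>*" using conn unfolding connected_in_def steps_in_def by blast
    then show "(a, b) \<in> {(x, y). x \<in> S - {t} \<and> y \<in> S - {t} \<and> {x, y} \<in> edges T}\<^sup>*"
      using path[of a b] a b unfolding steps_in_def by auto
  qed
qed

text \<open>The bag of a leaf of the remaining tree is put in front of the list for the others.
  Everything that it shares with them passes through its only neighbour.\<close>

lemma rip_of_tree:
  assumes "finite W" and irr: "\<And>e. e \<in> edges T \<Longrightarrow> card e = 2" and acyc: "\<nexists>xs. is_cycle T xs"
    and "\<And>v. connected_in T {t \<in> W. v \<in> B t}"
  shows "\<exists>ts. set ts = W \<and> rip (map B ts)"
  using assms(1,4)
proof (induction "card W" arbitrary: W)
  case 0
  then show ?case by (intro exI[of _ "[]"]) simp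
next
  case (Suc n)
  then have "W \<noteq> {}" by auto
  then obtain t p where t: "t \<in> W" and p: "\<And>s. s \<in> W \<Longrightarrow> {t, s} \<in> edges T \<Longrightarrow> s = p"
    using acyclic_leaf[OF Suc.prems(1) _ irr acyc] by blast
  have conn: "connected_in T {s \<in> W - {t}. v \<in> B s}" for v
  proof -
    have "connected_in T ({s \<in> W. v \<in> B s} - {t})"
      using Suc.prems(2)[of v] p by (intro connected_in_remove_leaf[of _ _ _ p]) auto
    moreover have "{s \<in> W. v \<in> B s} - {t} = {s \<in> W - {t}. v \<in> B s}" by auto
    ultimately show ?thesis by simp
  qed
  have "n = card (W - {t})" using Suc.hyps(2) t Suc.prems(1) by simp
  then obtain ts where ts: "set ts = W - {t}" "rip (map B ts)"
    using Suc.hyps(1)[of "W - {t}"] conn Suc.prems(1) by auto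
  \<comment> \<open>The nodes whose bags contain v form a connected set, so a walk from t to s
    inside it starts with a step to the only neighbour p.\<close>
  have shared: "p \<in> W - {t} \<and> v \<in> B p" if v: "v \<in> B t" "v \<in> B s" "s \<in> W - {t}" for v s
  proof -
    let ?S = "{t \<in> W. v \<in> B t}"
    have "(t, s) \<in> (steps_in T ?S)\<^sup>*"
      using Suc.prems(2)[of v] v t unfolding connected_in_def steps_in_def by blast
    moreover have "t \<noteq> s" using v by auto
    ultimately obtain u where "(t, u) \<in> steps_in T ?S" by (meson converse_rtranclE)
    then have u: "u \<in> W" "v \<in> B u" "{t, u} \<in> edges T" unfolding steps_in_def by auto
    then have "u = p" using p by blast
    moreover have "u \<noteq> t" using irr[OF u(3)] by auto
    ultimately show ?thesis using u by blast
  qed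
  have "rip (map B (t # ts))"
  proof (cases "ts = []")
    case False
    show ?thesis
    \<comment> \<open>Without a shared vertex p need not be a node of the remaining tree; then any
      later bag serves.\<close>
    proof (cases "B t \<inter> \<Union>(B ` (W - {t})) = {}")
      case True
      then show ?thesis using ts False by (cases ts) auto
    next
      case nonempty: False
      then have "p \<in> W - {t}" using shared by blast
      moreover have "B t \<inter> \<Union>(B ` (W - {t})) \<subseteq> B p" using shared by blast
      ultimately show ?thesis using ts by auto
    qed
  qed simp
  then show ?case using ts t by (intro exI[of _ "t # ts"]) auto
qed

text \<open>Treewidth at most 2 of the graph \<open>E\<close> on \<open>R\<close>, witnessed by a
  list of bags with the running intersection property. Such a list is easier to carry through
  eliminations than a tree.\<close>

definition tw2 :: "'a set \<Rightarrow> ('a \<Rightarrow> 'a \<Rightarrow> bool) \<Rightarrow> bool" where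
  "tw2 R E \<longleftrightarrow> (\<exists>bs. rip bs \<and> \<Union>(set bs) = R \<and> (\<forall>b\<in>set bs. finite b \<and> card b \<le> 3) \<and>
     (\<forall>u\<in>R. \<forall>v\<in>R. u \<noteq> v \<longrightarrow> E u v \<longrightarrow> (\<exists>b\<in>set bs. u \<in> b \<and> v \<in> b)))"

text \<open>A single bag with all vertices; this is what makes the \<open>LEAST\<close> in
  \<open>treewidth\<close> attained.\<close>

lemma tree_decomposition_exists:
  assumes "simple_graph (G :: 'a sgraph)"
  shows "\<exists>(T :: nat sgraph) B. tree_decomposition G T B"
proof -
  let ?T = "\<lparr>verts = {0}, edges = {}\<rparr> :: nat sgraph"
  have "tree_decomposition G ?T (\<lambda>_. verts G)"
    unfolding tree_decomposition_def is_tree_def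
  proof (intro conjI)
    show "\<nexists>xs. is_cycle ?T xs" unfolding is_cycle_def by (auto, rule exI[of _ 0], linarith)
  qed (use assms in \<open>auto simp: simple_graph_def connected_in_def\<close>)
  then show ?thesis by blast
qed

lemma tw2_of_treewidth:
  assumes G: "simple_graph G" and tw: "treewidth G \<le> 2"
  shows "tw2 (verts G) (\<lambda>u v. {u, v} \<in> edges G)"
proof -
  have "\<exists>w (T :: nat sgraph) B. tree_decomposition G T B \<and> decomposition_width T B = w"
    using tree_decomposition_exists[OF G] by blast
  then have "\<exists>(T :: nat sgraph) B. tree_decomposition G T B \<and> decomposition_width T B = treewidth G"
    unfolding treewidth_def by (rule LeastI_ex)
  then obtain T :: "nat sgraph" and B where dec: "tree_decomposition G T B" and w: "decomposition_width T B \<le> 2"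
    using tw by auto
  have T: "finite (verts T)" "\<And>e. e \<in> edges T \<Longrightarrow> card e = 2" "\<nexists>xs. is_cycle T xs" "verts T \<noteq> {}"
    using dec unfolding tree_decomposition_def is_tree_def simple_graph_def by auto
  have un: "(\<Union>t\<in>verts T. B t) = verts G" using dec unfolding tree_decomposition_def by blast
  have "connected_in T {t \<in> verts T. v \<in> B t}" for v
  proof (cases "v \<in> verts G")
    case True
    then show ?thesis using dec unfolding tree_decomposition_def by blast
  next
    case False
    then have "{t \<in> verts T. v \<in> B t} = {}" using un by blast
    then show ?thesis by (simp only: connected_in_def ball_empty)
  qed
  then obtain ts where ts: "set ts = verts T" "rip (map B ts)"
    using rip_of_tree[OF T(1-3), of B] by blast
  have "card (B t) \<le> 3" if "t \<in> verts T" for t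
  proof -
    have "card (B t) \<le> Max ((\<lambda>t. card (B t)) ` verts T)" using T(1) that by (intro Max_ge) auto
    \<comment> \<open>The truncated subtraction is harmless: maximum minus 1 at most 2 still gives
      maximum at most 3.\<close>
    then show ?thesis using w unfolding decomposition_width_def by linarith
  qed
  moreover have "finite (B t)" if "t \<in> verts T" for t
    using un that G unfolding simple_graph_def by (metis UN_upper finite_subset)
  moreover have "\<exists>b\<in>set (map B ts). u \<in> b \<and> v \<in> b" if "{u, v} \<in> edges G" for u v
    using dec that ts(1) unfolding tree_decomposition_def by fastforce
  ultimately show ?thesis unfolding tw2_def
    using ts un by (intro exI[of _ "map B ts"]) auto
qed

section \<open>Ordered bags under renaming, deletion and contraction\<close>

lemma rip_image: "rip bs \<Longrightarrow> inj_on f (\<Union>(set bs)) \<Longrightarrow> rip (map ((`) f) bs)"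
proof (induction bs)
  case (Cons b bs)
  have inj: "inj_on f (\<Union>(set bs))" using Cons.prems(2) by (rule inj_on_subset) auto
  show ?case
  proof (cases "bs = []")
    case False
    then obtain c where c: "c \<in> set bs" "b \<inter> \<Union>(set bs) \<subseteq> c" using Cons.prems(1) by auto
    have "f ` b \<inter> f ` \<Union>(set bs) = f ` (b \<inter> \<Union>(set bs))"
      using Cons.prems(2) by (intro inj_on_image_Int[symmetric]) auto
    then have "f ` b \<inter> \<Union>(set (map ((`) f) bs)) \<subseteq> f ` c" using c by (auto simp: image_Union)
    then show ?thesis using Cons.IH[OF _ inj] Cons.prems(1) c(1) by auto
  qed simp
qed simp

lemma rip_remove: "rip bs \<Longrightarrow> rip (map (\<lambda>b. b - D) bs)"
proof (induction bs)
  case (Cons b bs)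
  show ?case
  proof (cases "bs = []")
    case False
    then obtain c where c: "c \<in> set bs" "b \<inter> \<Union>(set bs) \<subseteq> c" using Cons.prems(1) by auto
    then have "(b - D) \<inter> \<Union>(set (map (\<lambda>b. b - D) bs)) \<subseteq> c - D" by auto
    then show ?thesis using Cons c(1) by auto
  qed simp
qed simp

text \<open>Identifying v with a could create new intersections between bags. Those are harmless as
  long as a later bag holds both vertices. At the last bag that does, at most one of the two occurs
  later, and the map is injective on the rest.\<close>

lemma rip_contract:
  assumes f: "\<And>x. f x = (if x = v then a else x)" and "rip bs" "\<exists>b\<in>set bs. v \<in> b \<and> a \<in> b"
  shows "rip (map ((`) f) bs)"
  using assms(2,3)
proof (induction bs)
  case (Cons b bs)
  show ?case
  proof (cases "bs = []")
    case False
    then obtain c where c: "c \<in> set bs" "b \<inter> \<Union>(set bs) \<subseteq> c" using Cons.prems(1) by auto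
    show ?thesis
    proof (cases "\<exists>b\<in>set bs. v \<in> b \<and> a \<in> b")
      case True
      \<comment> \<open>Both vertices occur later, so whichever of them lies in \<open>b\<close>
        lies in \<open>c\<close> as well, and the image of \<open>c\<close> catches the merged
        vertex.\<close>
      then have "a \<in> \<Union>(set bs)" "v \<in> \<Union>(set bs)" by auto
      then have "f ` b \<inter> \<Union>(set (map ((`) f) bs)) \<subseteq> f ` c"
        using c by (auto simp: image_iff f split: if_splits)
      then show ?thesis using Cons.IH True Cons.prems(1) c(1) by (auto)
    next
      case none: False
      then have ab: "v \<in> b" "a \<in> b" using Cons.prems(2) by auto
      \<comment> \<open>If both v and a occurred in later bags, both would lie in \<open>b\<close>
        and hence in \<open>c\<close>, against \<open>none\<close>.\<close>
      have inj: "inj_on f (\<Union>(set bs))"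
        using none c ab unfolding inj_on_def f by auto
      have "f ` b \<inter> \<Union>(set (map ((`) f) bs)) \<subseteq> f ` c"
        using c ab none by (auto simp: image_iff f split: if_splits)
      then show ?thesis using rip_image[OF _ inj] Cons.prems(1) c(1) by (auto)
    qed
  qed simp
qed simp

definition elim_edge :: "'a \<Rightarrow> 'a \<Rightarrow> ('a \<Rightarrow> 'a \<Rightarrow> bool) \<Rightarrow> 'a \<Rightarrow> 'a \<Rightarrow> bool" where
  "elim_edge a b E u w \<longleftrightarrow> E u w \<or> (u = a \<and> w = b) \<or> (u = b \<and> w = a)"

text \<open>The three alternatives in which the elimination of \<open>v\<close> keeps the treewidth: a subgraph, an
  edge contraction, and a new leaf bag.\<close>

definition eliminable :: "'a set \<Rightarrow> ('a \<Rightarrow> 'a \<Rightarrow> bool) \<Rightarrow> 'a \<Rightarrow> 'a \<Rightarrow> 'a \<Rightarrow> bool" where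
  "eliminable R E v a b \<longleftrightarrow> v \<in> R \<and> a \<in> R \<and> b \<in> R \<and> v \<noteq> a \<and> v \<noteq> b \<and> a \<noteq> b \<and>
     (\<forall>u\<in>R. u \<noteq> v \<and> u \<noteq> a \<and> u \<noteq> b \<longrightarrow> \<not> E v u) \<and>
     (E a b \<or> (E v a \<and> E v b) \<or> (\<forall>u\<in>R. u \<noteq> a \<and> u \<noteq> v \<longrightarrow> \<not> E a u))"

lemma tw2_eliminate:
  assumes "tw2 R E" "eliminable R E v a b" and sym: "\<And>u w. E u w \<Longrightarrow> E w u"
  shows "tw2 (R - {v}) (elim_edge a b E)"
proof -
  obtain bs where bs: "rip bs" "\<Union>(set bs) = R" "\<And>b. b \<in> set bs \<Longrightarrow> finite b" "\<And>b. b \<in> set bs \<Longrightarrow> card b \<le> 3"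
     and cover: "\<And>u v. u \<in> R \<Longrightarrow> v \<in> R \<Longrightarrow> u \<noteq> v \<Longrightarrow> E u v \<Longrightarrow> \<exists>b\<in>set bs. u \<in> b \<and> v \<in> b"
    using assms(1) unfolding tw2_def by blast
  have e: "v \<in> R" "a \<in> R" "b \<in> R" "v \<noteq> a" "v \<noteq> b" "a \<noteq> b" and
    cases: "E a b \<or> (E v a \<and> E v b) \<or> (\<forall>u\<in>R. u \<noteq> a \<and> u \<noteq> v \<longrightarrow> \<not> E a u)"
    using assms(2) unfolding eliminable_def by auto
  from cases show ?thesis
  proof (elim disjE)
    assume "E a b"
    then have eq: "elim_edge a b E = E" using sym unfolding elim_edge_def by blast
    let ?bs = "map (\<lambda>b. b - {v}) bs"
    have "rip ?bs" by (rule rip_remove[OF bs(1)])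
    moreover have "\<Union>(set ?bs) = R - {v}" using bs(2) by auto
    moreover have "finite c \<and> card c \<le> 3" if "c \<in> set ?bs" for c
      using that bs(3,4) by (auto intro: order_trans[OF card_Diff1_le])
    moreover have "\<exists>b\<in>set ?bs. u \<in> b \<and> w \<in> b" if "u \<in> R - {v}" "w \<in> R - {v}" "u \<noteq> w" "E u w" for u w
      using cover[of u w] that by auto
    ultimately show ?thesis unfolding tw2_def eq by blast
  next
    assume vab: "E v a \<and> E v b"
    \<comment> \<open>Contraction of v into a: the bag \<open>d\<close> that covered the edge from v
      to b turns into a bag that covers the new edge from a to b.\<close>
    define f where "f x = (if x = v then a else x)" for x
    let ?bs = "map ((`) f) bs"
    obtain c where c: "c \<in> set bs" "v \<in> c" "a \<in> c" using cover[of v a] e vab by blast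
    obtain d where d: "d \<in> set bs" "v \<in> d" "b \<in> d" using cover[of v b] e vab by blast
    have "rip ?bs" using c by (intro rip_contract[OF f_def bs(1)]) blast
    moreover have "\<Union>(set ?bs) = R - {v}"
    proof -
      have "\<Union>(set ?bs) = f ` R" using bs(2) by auto
      also have "\<dots> = R - {v}" using e by (auto simp: f_def image_iff)
      finally show ?thesis .
    qed
    moreover have "finite c \<and> card c \<le> 3" if cc: "c \<in> set ?bs" for c
    proof -
      obtain x where x: "x \<in> set bs" "c = f ` x" using cc by auto
      have "card c \<le> card x" unfolding x(2) by (rule card_image_le[OF bs(3)[OF x(1)]])
      then show ?thesis using bs(3,4)[OF x(1)] x(2) by simp
    qed
    moreover have "\<exists>b\<in>set ?bs. u \<in> b \<and> w \<in> b"
      if uw: "u \<in> R - {v}" "w \<in> R - {v}" "u \<noteq> w" "elim_edge a b E u w" for u w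
    proof (cases "E u w")
      case True
      then obtain x where x: "x \<in> set bs" "u \<in> x" "w \<in> x" using cover[of u w] uw by auto
      then have "f u \<in> f ` x" "f w \<in> f ` x" by auto
      moreover have "f u = u" "f w = w" using uw by (auto simp: f_def)
      ultimately have "u \<in> f ` x \<and> w \<in> f ` x" by simp
      moreover have "f ` x \<in> set ?bs" using x(1) by simp
      ultimately show ?thesis by blast
    next
      case False
      then have "(u = a \<and> w = b) \<or> (u = b \<and> w = a)" using uw(4) unfolding elim_edge_def by blast
      moreover have "f v \<in> f ` d" "f b \<in> f ` d" using d by auto
      then have "a \<in> f ` d \<and> b \<in> f ` d" using e by (simp add: f_def)
      moreover have "f ` d \<in> set ?bs" using d(1) by simp
      ultimately show ?thesis by blast
    qed
    ultimately show ?thesis unfolding tw2_def by blast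
  next
    assume leaf: "\<forall>u\<in>R. u \<noteq> a \<and> u \<noteq> v \<longrightarrow> \<not> E a u"
    \<comment> \<open>Without v the vertex a is isolated, so it can be taken out of all bags and put
      into a new leaf bag, attached to any bag that contains b.\<close>
    let ?cs = "map (\<lambda>b. b - {v, a}) bs"
    let ?bs = "{a, b} # ?cs"
    obtain d where d: "d \<in> set bs" "b \<in> d" using e bs(2) by blast
    have un: "\<Union>(set ?cs) = R - {v, a}" using bs(2) by auto
    have "{a, b} \<inter> \<Union>(set ?cs) \<subseteq> d - {v, a}" using e d unfolding un by auto
    then have "rip ?bs" using rip_remove[OF bs(1), of "{v, a}"] d by auto
    moreover have "\<Union>(set ?bs) = R - {v}" using un e by auto
    moreover have "finite c \<and> card c \<le> 3" if cc: "c \<in> set ?bs" for c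
    proof (cases "c = {a, b}")
      case True
      then show ?thesis using card_insert_le_m1[of 3 "{b}" a] by simp
    next
      case False
      then obtain b' where "b' \<in> set bs" "c = b' - {v, a}" using cc by auto
      then show ?thesis using bs(3)[of b'] bs(4)[of b'] card_mono[of b' c] by force
    qed
    moreover have "\<exists>b\<in>set ?bs. u \<in> b \<and> w \<in> b"
      if uw: "u \<in> R - {v}" "w \<in> R - {v}" "u \<noteq> w" "elim_edge a b E u w" for u w
    proof (cases "(u = a \<and> w = b) \<or> (u = b \<and> w = a)")
      case False
      then have E: "E u w" using uw(4) unfolding elim_edge_def by blast
      have ua: "u \<noteq> a" using leaf uw E by (metis Diff_iff singletonI)
      have wa: "w \<noteq> a" using leaf uw sym[OF E] by (metis Diff_iff singletonI)
      have uR: "u \<in> R" "u \<noteq> v" and wR: "w \<in> R" "w \<noteq> v" using uw(1,2) by auto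
      obtain x where x: "x \<in> set bs" "u \<in> x" "w \<in> x" using cover[OF uR(1) wR(1) uw(3) E] by (elim bexE conjE)
      have "x - {v, a} \<in> set ?bs" using x(1) by simp
      moreover have "u \<in> x - {v, a} \<and> w \<in> x - {v, a}" using x(2,3) ua wa uR(2) wR(2) by simp
      ultimately show ?thesis by (rule bexI[rotated])
    next
      case True
      then show ?thesis by (intro bexI[of _ "{a, b}"]) auto
    qed
    ultimately show ?thesis unfolding tw2_def by blast
  qed
qed

text \<open>Either the first bag has a vertex that occurs nowhere else, or it is contained in a
  later bag and may be ignored. The vertex found has all its bags inside a single one.\<close>

lemma rip_private:
  assumes "rip bs" "\<Union>(set bs) \<noteq> {}"
  shows "\<exists>v b. b \<in> set bs \<and> v \<in> b \<and> (\<forall>c\<in>set bs. v \<in> c \<longrightarrow> c \<subseteq> b)"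
  using assms
proof (induction bs)
  case (Cons b bs)
  show ?case
  proof (cases "b \<subseteq> \<Union>(set bs)")
    case True
    then have ne: "\<Union>(set bs) \<noteq> {}" using Cons.prems(2) by auto
    then obtain v d where d: "d \<in> set bs" "v \<in> d" "\<forall>c\<in>set bs. v \<in> c \<longrightarrow> c \<subseteq> d" using Cons by auto
    have "bs \<noteq> []" using ne by auto
    then obtain c where "c \<in> set bs" "b \<subseteq> c" using Cons.prems(1) True by auto
    then have "v \<in> b \<longrightarrow> b \<subseteq> d" using d(3) by blast
    then show ?thesis using d by auto
  next
    case False
    then obtain v where "v \<in> b" "v \<notin> \<Union>(set bs)" by blast
    then show ?thesis by (intro exI[of _ v] exI[of _ b]) auto
  qed
qed simp

lemma card_2_cover:
  assumes "finite N" "card N \<le> 2" "finite X" "2 \<le> card X" "N \<subseteq> X"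
  shows "\<exists>a b. a \<in> X \<and> b \<in> X \<and> a \<noteq> b \<and> N \<subseteq> {a, b}"
proof -
  obtain Y where Y: "N \<subseteq> Y" "Y \<subseteq> X" "card Y = 2"
    using exists_subset_between[OF assms(2,4,5,3)] by blast
  then obtain a b where "Y = {a, b}" "a \<noteq> b" by (meson card_2_iff)
  then show ?thesis using Y by blast
qed

text \<open>For the vertex v from \<open>rip_private\<close> all neighbours lie in one bag of size
  at most 3, so there are at most two. If there are two, they form the triple with v. If there is at
  most one, call it x: when x has a further neighbour y, the edge from x to y exists already; when
  it has none, any y will do.\<close>

lemma eliminable_exists:
  assumes tw: "tw2 R E" and R: "finite R" "3 \<le> card R" and sym: "\<And>u w. E u w \<Longrightarrow> E w u"
  shows "\<exists>v a b. eliminable R E v a b"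
proof -
  obtain bs where bs: "rip bs" "\<Union>(set bs) = R" "\<And>b. b \<in> set bs \<Longrightarrow> finite b" "\<And>b. b \<in> set bs \<Longrightarrow> card b \<le> 3"
     and cover: "\<And>u v. u \<in> R \<Longrightarrow> v \<in> R \<Longrightarrow> u \<noteq> v \<Longrightarrow> E u v \<Longrightarrow> \<exists>b\<in>set bs. u \<in> b \<and> v \<in> b"
    using tw unfolding tw2_def by blast
  have "\<Union>(set bs) \<noteq> {}" unfolding bs(2) using R by auto
  from rip_private[OF bs(1) this]
  obtain v c where "c \<in> set bs" "v \<in> c" "\<forall>d\<in>set bs. v \<in> d \<longrightarrow> d \<subseteq> c" by blast
  then have v: "c \<in> set bs" "v \<in> c" "\<And>d. d \<in> set bs \<Longrightarrow> v \<in> d \<Longrightarrow> d \<subseteq> c" by blast+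
  have vR: "v \<in> R" using v bs(2) by auto
  have "card (c - {v}) \<le> 2" using bs(3,4)[OF v(1)] v(2) by simp
  moreover have "2 \<le> card (R - {v})" using R vR by simp
  moreover have "c - {v} \<subseteq> R - {v}" using bs(2) v(1) by auto
  ultimately obtain a b where ab: "a \<in> R - {v}" "b \<in> R - {v}" "a \<noteq> b" "c - {v} \<subseteq> {a, b}"
    using card_2_cover[of "c - {v}" "R - {v}"] bs(3)[OF v(1)] R by auto
  have N: "u = a \<or> u = b" if "u \<in> R" "u \<noteq> v" "E v u" for u
    using cover[of v u] vR that v(3) ab(4) by blast
  show ?thesis
  proof (cases "E v a \<and> E v b")
    case True
    then have "eliminable R E v a b" unfolding eliminable_def using ab N vR by blast
    then show ?thesis by blast
  next
    case False
    then obtain x where x: "x \<in> R - {v}" "\<And>u. u \<in> R \<Longrightarrow> u \<noteq> v \<Longrightarrow> E v u \<Longrightarrow> u = x"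
      using N ab by blast
    show ?thesis
    proof (cases "\<exists>y\<in>R. y \<noteq> x \<and> y \<noteq> v \<and> E x y")
      case True
      then obtain y where "y \<in> R" "y \<noteq> x" "y \<noteq> v" "E x y" by blast
      then have "eliminable R E v x y" unfolding eliminable_def using x vR by blast
      then show ?thesis by blast
    next
      case no: False
      obtain y where "y \<in> R - {v}" "y \<noteq> x" using ab by blast
      then have "eliminable R E v x y" unfolding eliminable_def using x vR no by blast
      then show ?thesis by blast
    qed
  qed
qed

section \<open>Partition functions of edge weights\<close>

text \<open>Every pair of vertices of \<open>H\<close> carries a matrix, nonadjacent pairs the all-ones matrix.\<close>

definition weight_sum :: "nat set \<Rightarrow> nat \<Rightarrow> (nat \<Rightarrow> nat \<Rightarrow> nat \<Rightarrow> nat \<Rightarrow> int) \<Rightarrow> int" where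
  "weight_sum R n M = (\<Sum>f \<in> R \<rightarrow>\<^sub>E {..<n}. \<Prod>(u, w) \<in> {(u, w). u \<in> R \<and> w \<in> R \<and> u < w}. M u w (f u) (f w))"

definition symmetric_weights :: "nat \<Rightarrow> (nat \<Rightarrow> nat \<Rightarrow> nat \<Rightarrow> nat \<Rightarrow> int) \<Rightarrow> bool" where
  "symmetric_weights n M \<longleftrightarrow> (\<forall>u w x y. M u w x y = M w u y x)"

text \<open>Both orders of the pair are updated, so that the matrix of (b, a) stays the transpose of
  that of (a, b).\<close>

definition elim_weight :: "nat \<Rightarrow> nat \<Rightarrow> nat \<Rightarrow> nat \<Rightarrow> (nat \<Rightarrow> nat \<Rightarrow> nat \<Rightarrow> nat \<Rightarrow> int) \<Rightarrow> nat \<Rightarrow> nat \<Rightarrow> nat \<Rightarrow> nat \<Rightarrow> int" where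
  "elim_weight n v a b M u w x y =
     (if u = a \<and> w = b \<or> u = b \<and> w = a then M u w x y * (\<Sum>z<n. M u v x z * M v w z y) else M u w x y)"

abbreviation "pairs R \<equiv> {(u, w). u \<in> R \<and> w \<in> R \<and> u < (w :: nat)}"

lemma finite_pairs: "finite R \<Longrightarrow> finite (pairs R)"
  by (rule finite_subset[of _ "R \<times> R"]) auto

lemma prod_pairs_insert:
  fixes h :: "nat \<Rightarrow> nat \<Rightarrow> int"
  assumes R: "finite R" "v \<notin> R" and sym: "\<And>u w. h u w = h w u"
  shows "(\<Prod>(u, w) \<in> pairs (insert v R). h u w) = (\<Prod>(u, w) \<in> pairs R. h u w) * (\<Prod>u\<in>R. h u v)"
proof -
  have eq: "pairs (insert v R) = pairs R \<union> (\<lambda>u. if u < v then (u, v) else (v, u)) ` R"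
    using R(2) by (auto simp: image_iff) (metis linorder_neqE_nat)+
  have disj: "pairs R \<inter> (\<lambda>u. if u < v then (u, v) else (v, u)) ` R = {}"
    using R(2) by (auto split: if_splits)
  have inj: "inj_on (\<lambda>u. if u < v then (u, v) else (v, u)) R"
    by (auto simp: inj_on_def split: if_splits)
  have "(\<Prod>(u, w) \<in> (\<lambda>u. if u < v then (u, v) else (v, u)) ` R. h u w) = (\<Prod>u\<in>R. h u v)"
    unfolding prod.reindex[OF inj] by (intro prod.cong refl) (simp add: sym)
  then show ?thesis
    unfolding eq using R finite_pairs[of R] disj by (subst prod.union_disjoint) auto
qed

text \<open>The image z of v occurs only in the factors of (a, v) and (v, b), all other factors of v
  being 1. Summing over z first therefore produces one entry of a matrix product, which is moved
  into the weight of (a, b).\<close>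

lemma weight_sum_eliminate:
  assumes R: "finite R" and vab: "v \<in> R" "a \<in> R" "b \<in> R" "v \<noteq> a" "v \<noteq> b" "a \<noteq> b"
    and sym: "symmetric_weights n M"
    and one: "\<And>u x y. u \<in> R \<Longrightarrow> u \<noteq> v \<Longrightarrow> u \<noteq> a \<Longrightarrow> u \<noteq> b \<Longrightarrow> x < n \<Longrightarrow> y < n \<Longrightarrow> M u v x y = 1"
  shows "weight_sum R n M = weight_sum (R - {v}) n (elim_weight n v a b M)"
proof -
  define S where "S = R - {v}"
  have S: "R = insert v S" "v \<notin> S" "finite S" "a \<in> S" "b \<in> S" using R vab unfolding S_def by auto
  have sM: "M u w x y = M w u y x" for u w x y using sym unfolding symmetric_weights_def by blast
  define \<pi> where "\<pi> f = (\<Prod>(u, w) \<in> pairs S. M u w (f u) (f w))" for f :: "nat \<Rightarrow> nat"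
  define \<sigma> where "\<sigma> f = (\<Sum>z<n. M a v (f a) z * M v b z (f b))" for f :: "nat \<Rightarrow> nat"
  have "weight_sum R n M = (\<Sum>(z, f) \<in> {..<n} \<times> (S \<rightarrow>\<^sub>E {..<n}). \<Prod>(u, w) \<in> pairs R. M u w ((f(v := z)) u) ((f(v := z)) w))"
  proof -
    have inj: "inj_on (\<lambda>(z, f). f(v := z)) ({..<n} \<times> (S \<rightarrow>\<^sub>E {..<n}))"
      using S(2) by (rule inj_combinator)
    show ?thesis
      unfolding weight_sum_def S(1) PiE_insert_eq sum.reindex[OF inj] by (simp add: case_prod_unfold)
  qed
  also have "\<dots> = (\<Sum>(z, f) \<in> {..<n} \<times> (S \<rightarrow>\<^sub>E {..<n}). \<pi> f * (M a v (f a) z * M v b z (f b)))"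
  proof (intro sum.cong refl, clarify)
    fix z f assume z: "z < n" and f: "f \<in> S \<rightarrow>\<^sub>E {..<n}"
    let ?f = "f(v := z)"
    have "(\<Prod>(u, w) \<in> pairs R. M u w (?f u) (?f w)) =
        (\<Prod>(u, w) \<in> pairs S. M u w (?f u) (?f w)) * (\<Prod>u\<in>S. M u v (?f u) (?f v))"
      unfolding S(1) using S sM by (intro prod_pairs_insert) auto
    also have "(\<Prod>(u, w) \<in> pairs S. M u w (?f u) (?f w)) = \<pi> f"
      unfolding \<pi>_def using S(2) by (intro prod.cong refl) auto
    also have "(\<Prod>u\<in>S. M u v (?f u) (?f v)) = (\<Prod>u\<in>{a, b}. M u v (f u) z)"
    proof (rule prod.mono_neutral_cong_right)
      show "\<forall>u\<in>S - {a, b}. M u v (?f u) (?f v) = 1"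
        using one z f S_def by (auto simp: PiE_iff)
    qed (use S in auto)
    also have "\<dots> = M a v (f a) z * M v b z (f b)" using vab(6) sM[of b v] by simp
    finally show "(\<Prod>(u, w) \<in> pairs R. M u w (?f u) (?f w)) = \<pi> f * (M a v (f a) z * M v b z (f b))" .
  qed
  also have "\<dots> = (\<Sum>f \<in> S \<rightarrow>\<^sub>E {..<n}. \<pi> f * \<sigma> f)"
    unfolding sum.cartesian_product[symmetric] \<sigma>_def sum_distrib_left by (rule sum.swap)
  also have "\<dots> = weight_sum S n (elim_weight n v a b M)"
    unfolding weight_sum_def
  proof (intro sum.cong refl)
    fix f assume f: "f \<in> S \<rightarrow>\<^sub>E {..<n}"
    \<comment> \<open>The product runs over increasing pairs, so the changed one is (a, b) or (b,
      a).\<close>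
    define p where "p = (if a < b then (a, b) else (b, a))"
    have p: "p \<in> pairs S" using S vab unfolding p_def by auto
    have fin: "finite (pairs S)" using S finite_pairs by blast
    have \<sigma>: "(\<Sum>z<n. M b v (f b) z * M v a z (f a)) = \<sigma> f"
      unfolding \<sigma>_def by (intro sum.cong refl) (subst (1 2) sM, simp add: mult.commute)
    have "(\<Prod>(u, w) \<in> pairs S. elim_weight n v a b M u w (f u) (f w)) =
        (case p of (u, w) \<Rightarrow> elim_weight n v a b M u w (f u) (f w)) *
        (\<Prod>(u, w) \<in> pairs S - {p}. elim_weight n v a b M u w (f u) (f w))"
      by (rule prod.remove[OF fin p])
    also have "(\<Prod>(u, w) \<in> pairs S - {p}. elim_weight n v a b M u w (f u) (f w)) =
        (\<Prod>(u, w) \<in> pairs S - {p}. M u w (f u) (f w))"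
      by (intro prod.cong refl) (auto simp: elim_weight_def p_def)
    also have "(case p of (u, w) \<Rightarrow> elim_weight n v a b M u w (f u) (f w)) =
        \<sigma> f * (case p of (u, w) \<Rightarrow> M u w (f u) (f w))"
      using vab(6) \<sigma> unfolding p_def elim_weight_def by (simp add: \<sigma>_def mult.commute)
    finally show "\<pi> f * \<sigma> f = (\<Prod>(u, w) \<in> pairs S. elim_weight n v a b M u w (f u) (f w))"
      unfolding \<pi>_def prod.remove[OF fin p] by (simp add: mult_ac)
  qed
  finally show ?thesis unfolding S_def .
qed

lemma symmetric_elim_weight:
  assumes "symmetric_weights n M"
  shows "symmetric_weights n (elim_weight n v a b M)"
proof -
  have sM: "M u w x y = M w u y x" for u w x y using assms unfolding symmetric_weights_def by blast
  have "(\<Sum>z<n. M u v x z * M v w z y) = (\<Sum>z<n. M w v y z * M v u z x)" for u w x y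
    by (intro sum.cong refl) (subst (1 2) sM, simp add: mult.commute)
  then show ?thesis unfolding symmetric_weights_def elim_weight_def using sM by auto
qed

lemma weight_sum_pair:
  assumes "a < b"
  shows "weight_sum {a, b} n M = (\<Sum>x<n. \<Sum>y<n. M a b x y)"
proof -
  have pr: "pairs {a, b} = {(a, b)}" using assms by auto
  have ab: "a \<notin> {b}" using assms by simp
  have "(\<Sum>f \<in> {a, b} \<rightarrow>\<^sub>E {..<n}. M a b (f a) (f b)) = (\<Sum>(x, f) \<in> {..<n} \<times> ({b} \<rightarrow>\<^sub>E {..<n}). M a b x (f b))"
  proof -
    have inj: "inj_on (\<lambda>(z, f). f(a := z)) ({..<n} \<times> ({b} \<rightarrow>\<^sub>E {..<n}))"
      using ab by (rule inj_combinator)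
    show ?thesis
      unfolding PiE_insert_eq[of a "{b}"] sum.reindex[OF inj] using assms by (simp add: case_prod_unfold)
  qed
  also have "\<dots> = (\<Sum>x<n. \<Sum>f \<in> {b} \<rightarrow>\<^sub>E {..<n}. M a b x (f b))" by (rule sum.cartesian_product[symmetric])
  also have "\<dots> = (\<Sum>x<n. \<Sum>y<n. M a b x y)"
  proof (intro sum.cong refl)
    fix x
    show "(\<Sum>f \<in> {b} \<rightarrow>\<^sub>E {..<n}. M a b x (f b)) = (\<Sum>y<n. M a b x y)"
      by (rule sum.reindex_bij_witness[of _ "\<lambda>y. (\<lambda>_. undefined)(b := y)" "\<lambda>f. f b"])
        (auto simp: PiE_iff extensional_def fun_eq_iff)
  qed
  finally show ?thesis unfolding weight_sum_def pr by simp
qed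

section \<open>Growth of the weights\<close>

text \<open>Exponents of the bound on the weights; their sum over all remaining pairs is at most the
  number of vertices eliminated so far.\<close>

definition weights_bounded :: "nat set \<Rightarrow> nat \<Rightarrow> nat \<Rightarrow> (nat \<Rightarrow> nat \<Rightarrow> nat \<Rightarrow> nat \<Rightarrow> int) \<Rightarrow> bool" where
  "weights_bounded R n k M \<longleftrightarrow> (\<exists>c. (\<forall>u w. c u w = c w u) \<and> (\<Sum>(u, w)\<in>pairs R. c u w) + card R \<le> k \<and>
     (\<forall>u\<in>R. \<forall>w\<in>R. \<forall>x<n. \<forall>y<n. 0 \<le> M u w x y \<and> (u \<noteq> w \<longrightarrow> M u w x y \<le> int n ^ c u w)))"

lemma sum_pairs_insert:
  fixes h :: "nat \<Rightarrow> nat \<Rightarrow> nat"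
  assumes R: "finite R" "v \<notin> R" and sym: "\<And>u w. h u w = h w u"
  shows "(\<Sum>(u, w) \<in> pairs (insert v R). h u w) = (\<Sum>(u, w) \<in> pairs R. h u w) + (\<Sum>u\<in>R. h u v)"
proof -
  have eq: "pairs (insert v R) = pairs R \<union> (\<lambda>u. if u < v then (u, v) else (v, u)) ` R"
    using R(2) by (auto simp: image_iff) (metis linorder_neqE_nat)+
  have disj: "pairs R \<inter> (\<lambda>u. if u < v then (u, v) else (v, u)) ` R = {}"
    using R(2) by (auto split: if_splits)
  have inj: "inj_on (\<lambda>u. if u < v then (u, v) else (v, u)) R"
    by (auto simp: inj_on_def split: if_splits)
  have "(\<Sum>(u, w) \<in> (\<lambda>u. if u < v then (u, v) else (v, u)) ` R. h u w) = (\<Sum>u\<in>R. h u v)"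
    unfolding sum.reindex[OF inj] by (intro sum.cong refl) (simp add: sym)
  then show ?thesis
    unfolding eq using R finite_pairs[of R] disj by (subst sum.union_disjoint) auto
qed

text \<open>The potential is the sum of the exponents plus the number of vertices. A matrix product
  bounded by n * n^(c a v) * n^(c v b) raises the exponent of (a, b) by
  \<open>c a v + c v b + 1\<close>. The first two terms disappear from the sum together with v, and
  the 1 is paid by the loss of one vertex.\<close>

lemma weights_bounded_eliminate:
  assumes R: "finite R" and vab: "v \<in> R" "a \<in> R" "b \<in> R" "v \<noteq> a" "v \<noteq> b" "a \<noteq> b"
    and bnd: "weights_bounded R n k M"
  shows "weights_bounded (R - {v}) n k (elim_weight n v a b M)"
proof -
  define S where "S = R - {v}"
  have S: "R = insert v S" "v \<notin> S" "finite S" "a \<in> S" "b \<in> S" using R vab unfolding S_def by auto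
  from bnd obtain c where c0: "\<forall>u w. c u w = c w u" and c: "(\<Sum>(u, w)\<in>pairs R. c u w) + card R \<le> k"
    and M0: "\<forall>u\<in>R. \<forall>w\<in>R. \<forall>x<n. \<forall>y<n. 0 \<le> M u w x y \<and> (u \<noteq> w \<longrightarrow> M u w x y \<le> int n ^ c u w)"
    unfolding weights_bounded_def by (elim exE conjE)
  have csym: "c u w = c w u" for u w using c0 by blast
  have M: "u \<in> R \<Longrightarrow> w \<in> R \<Longrightarrow> x < n \<Longrightarrow> y < n \<Longrightarrow> 0 \<le> M u w x y"
    "u \<in> R \<Longrightarrow> w \<in> R \<Longrightarrow> x < n \<Longrightarrow> y < n \<Longrightarrow> u \<noteq> w \<Longrightarrow> M u w x y \<le> int n ^ c u w" for u w x y
    using M0 by simp_all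
  define isab where "isab u w \<longleftrightarrow> u = a \<and> w = b \<or> u = b \<and> w = a" for u w
  define c' where "c' u w = c u w + (if isab u w then c a v + c v b + 1 else 0)" for u w
  have sum1: "(\<Sum>(u, w)\<in>pairs S. c' u w) = (\<Sum>(u, w)\<in>pairs S. c u w) + (c a v + c v b + 1)"
  proof -
    define p where "p = (if a < b then (a, b) else (b, a))"
    have p: "p \<in> pairs S" using S vab unfolding p_def by auto
    have fin: "finite (pairs S)" using S finite_pairs by blast
    have "(\<Sum>(u, w)\<in>pairs S. if isab u w then c a v + c v b + 1 else 0) =
        (\<Sum>(u, w)\<in>{p}. c a v + c v b + 1)"
      using fin p vab(6) by (intro sum.mono_neutral_cong_right) (auto simp: p_def isab_def split: if_splits)
    then show ?thesis unfolding c'_def by (simp add: sum.distrib case_prod_unfold)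
  qed
  have "c a v + c v b = (\<Sum>u\<in>{a, b}. c u v)" using vab(6) csym[of v b] by simp
  also have "\<dots> \<le> (\<Sum>u\<in>S. c u v)" using S by (intro sum_mono2) auto
  finally have "(\<Sum>(u, w)\<in>pairs S. c' u w) + card S \<le> (\<Sum>(u, w)\<in>pairs R. c u w) + card R"
    unfolding sum1 S(1) using sum_pairs_insert[OF S(3,2), of c] csym S by simp
  then have 1: "(\<Sum>(u, w)\<in>pairs S. c' u w) + card S \<le> k" using c by simp
  have 2: "0 \<le> elim_weight n v a b M u w x y \<and> (u \<noteq> w \<longrightarrow> elim_weight n v a b M u w x y \<le> int n ^ c' u w)"
    if u: "u \<in> S" and w: "w \<in> S" and xy: "x < n" "y < n" for u w x y
  proof (cases "isab u w")
    case False
    then have "elim_weight n v a b M u w x y = M u w x y" "c' u w = c u w"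
      by (auto simp: elim_weight_def isab_def c'_def)
    moreover have "u \<in> R" "w \<in> R" using u w unfolding S_def by auto
    ultimately show ?thesis using M[of u w x y] xy by simp
  next
    case True
    have R: "u \<in> R" "w \<in> R" "v \<in> R" "u \<noteq> v" "v \<noteq> w" "u \<noteq> w" using True vab u w unfolding isab_def S_def by auto
    let ?s = "\<Sum>z<n. M u v x z * M v w z y"
    have s0: "0 \<le> ?s" using M(1) R xy by (intro sum_nonneg) auto
    have "?s \<le> (\<Sum>z<n. int n ^ c u v * int n ^ c v w)"
      using M R xy by (intro sum_mono mult_mono) auto
    also have "\<dots> = int n ^ (c u v + c v w + 1)" by (simp add: power_add)
    also have "c u v + c v w = c a v + c v b" using True csym[of b v] csym[of v a] unfolding isab_def by auto
    finally have "M u w x y * ?s \<le> int n ^ c u w * int n ^ (c a v + c v b + 1)"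
      using M R xy s0 by (intro mult_mono) auto
    also have "\<dots> = int n ^ c' u w" using True unfolding c'_def by (simp add: power_add)
    finally have "M u w x y * ?s \<le> int n ^ c' u w" .
    moreover have "elim_weight n v a b M u w x y = M u w x y * ?s"
      using True unfolding elim_weight_def isab_def by simp
    moreover have "0 \<le> M u w x y * ?s" using s0 M R xy by simp
    ultimately show ?thesis by simp
  qed
  have 3: "c' u w = c' w u" for u w unfolding c'_def isab_def using csym[of u w] by auto
  show ?thesis unfolding weights_bounded_def S_def[symmetric]
    using 1 2 3 by (intro exI[of _ c'] conjI) simp_all
qed

text \<open>A single exponent is at most the potential. This keeps all weights at O(k log n) bits
  although products are nested up to k times.\<close>

lemma weights_bounded_le:
  assumes "weights_bounded R n k M" "finite R" "u \<in> R" "w \<in> R" "u \<noteq> w" "x < n" "y < n"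
  shows "0 \<le> M u w x y" "M u w x y \<le> int n ^ k"
proof -
  from assms(1) obtain c where c0: "\<forall>u w. c u w = c w u" and c: "(\<Sum>(u, w)\<in>pairs R. c u w) + card R \<le> k"
    and M0: "\<forall>u\<in>R. \<forall>w\<in>R. \<forall>x<n. \<forall>y<n. 0 \<le> M u w x y \<and> (u \<noteq> w \<longrightarrow> M u w x y \<le> int n ^ c u w)"
    unfolding weights_bounded_def by (elim exE conjE)
  have M: "0 \<le> M u w x y" "M u w x y \<le> int n ^ c u w" using M0 assms by simp_all
  show "0 \<le> M u w x y" by (rule M)
  have "c u w \<le> (\<Sum>(u, w)\<in>pairs R. c u w)"
  proof -
    let ?p = "if u < w then (u, w) else (w, u)"
    have "?p \<in> pairs R" using assms by auto
    then have "(case ?p of (u, w) \<Rightarrow> c u w) \<le> (\<Sum>(u, w)\<in>pairs R. c u w)"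
      using finite_pairs[OF assms(2)] by (intro member_le_sum) auto
    then show ?thesis using c0 by (auto split: if_splits)
  qed
  then have "c u w \<le> k" using c by simp
  then have "int n ^ c u w \<le> int n ^ k" using assms(6) by (intro power_increasing) auto
  then show "M u w x y \<le> int n ^ k" using M by simp
qed

section \<open>Weights that count homomorphisms\<close>

definition hom_weight :: "nat sgraph \<Rightarrow> nat sgraph \<Rightarrow> nat \<Rightarrow> nat \<Rightarrow> nat \<Rightarrow> nat \<Rightarrow> int" where
  "hom_weight H G u w x y = of_bool ({u, w} \<in> edges H \<longrightarrow> {x, y} \<in> edges G)"

lemma symmetric_hom_weight: "symmetric_weights n (hom_weight H G)"
  unfolding symmetric_weights_def hom_weight_def by (simp add: insert_commute)

lemma weights_bounded_hom_weight: "card R \<le> k \<Longrightarrow> weights_bounded R n k (hom_weight H G)"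
  unfolding weights_bounded_def by (intro exI[of _ "\<lambda>_ _. 0"]) (simp add: hom_weight_def)

text \<open>The product of indicators is the indicator of \<open>Hom H G\<close>. Increasing pairs
  see every edge because \<open>H\<close> has no loops.\<close>

lemma weight_sum_hom_weight:
  assumes H: "simple_graph H" and n: "verts G = {..<n}"
  shows "weight_sum (verts H) n (hom_weight H G) = int (card (Hom H G))"
proof -
  have fin: "finite (verts H)" using H unfolding simple_graph_def by blast
  have edge: "u \<in> verts H \<and> w \<in> verts H \<and> u \<noteq> w" if "{u, w} \<in> edges H" for u w
    using H that unfolding simple_graph_def by (force simp: card_2_iff)
  have "(\<Prod>(u, w) \<in> pairs (verts H). hom_weight H G u w (f u) (f w)) = of_bool (f \<in> Hom H G)"
    if f: "f \<in> verts H \<rightarrow>\<^sub>E {..<n}" for f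
  proof (cases "f \<in> Hom H G")
    case True
    then show ?thesis unfolding hom_weight_def Hom_def by (auto intro!: prod.neutral)
  next
    case False
    then obtain u w where uw: "{u, w} \<in> edges H" "{f u, f w} \<notin> edges G"
      using f n unfolding Hom_def by auto
    let ?p = "if u < w then (u, w) else (w, u)"
    have p: "?p \<in> pairs (verts H)" using edge[OF uw(1)] by auto
    have "(case ?p of (u, w) \<Rightarrow> hom_weight H G u w (f u) (f w)) = 0"
      using uw by (auto simp: hom_weight_def insert_commute)
    then have "\<exists>p\<in>pairs (verts H). (case p of (u, w) \<Rightarrow> hom_weight H G u w (f u) (f w)) = 0"
      using p by (rule bexI)
    then have "(\<Prod>(u, w) \<in> pairs (verts H). hom_weight H G u w (f u) (f w)) = 0"
      by (rule prod_zero[OF finite_pairs[OF fin]])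
    then show ?thesis using False by simp
  qed
  then have "weight_sum (verts H) n (hom_weight H G) = (\<Sum>f \<in> verts H \<rightarrow>\<^sub>E {..<n}. of_bool (f \<in> Hom H G))"
    unfolding weight_sum_def by (intro sum.cong refl) simp
  also have "\<dots> = int (card {f \<in> verts H \<rightarrow>\<^sub>E {..<n}. f \<in> Hom H G})"
    using fin by (simp add: finite_PiE Int_def)
  also have "{f \<in> verts H \<rightarrow>\<^sub>E {..<n}. f \<in> Hom H G} = Hom H G" unfolding Hom_def using n by auto
  finally show ?thesis .
qed

section \<open>A structured language compiled to the random access machine\<close>

datatype cell = S nat | Arr nat int | Inp int

type_synonym state = "cell \<Rightarrow> int"

datatype aexp = Num int | Var nat | Elt nat aexp | In aexp | Bop binop aexp aexp

datatype bexp = BLess aexp aexp | BEq aexp aexp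

datatype cmd =
    Set nat aexp
  | Put nat aexp aexp
  | Then cmd cmd (infixr ";;" 60)
  | Cond bexp cmd cmd
  | For nat aexp cmd

abbreviation "Nop \<equiv> Set 0 (Var 0)"

fun aval :: "aexp \<Rightarrow> state \<Rightarrow> int" where
  "aval (Num c) s = c"
| "aval (Var x) s = s (S x)"
| "aval (Elt j e) s = s (Arr j (aval e s))"
| "aval (In e) s = s (Inp (aval e s))"
| "aval (Bop f a b) s = binop_val f (aval a s) (aval b s)"

fun aok :: "aexp \<Rightarrow> state \<Rightarrow> bool" where
  "aok (Num c) s \<longleftrightarrow> True"
| "aok (Var x) s \<longleftrightarrow> True"
| "aok (Elt j e) s \<longleftrightarrow> j < 14 \<and> aok e s \<and> 0 \<le> aval e s"
| "aok (In e) s \<longleftrightarrow> aok e s \<and> 0 \<le> aval e s"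
| "aok (Bop f a b) s \<longleftrightarrow> aok a s \<and> aok b s"

fun bval :: "bexp \<Rightarrow> state \<Rightarrow> bool" where
  "bval (BLess a b) s \<longleftrightarrow> aval a s < aval b s"
| "bval (BEq a b) s \<longleftrightarrow> aval a s = aval b s"

fun bok :: "bexp \<Rightarrow> state \<Rightarrow> bool" where
  "bok (BLess a b) s \<longleftrightarrow> aok a s \<and> aok b s"
| "bok (BEq a b) s \<longleftrightarrow> aok a s \<and> aok b s"

primrec iter :: "nat \<Rightarrow> (int \<Rightarrow> state \<Rightarrow> state) \<Rightarrow> state \<Rightarrow> state" where
  "iter 0 f s = s"
| "iter (Suc m) f s = f (int m) (iter m f s)"

text \<open>The limit of a loop is evaluated once at its start, so every command terminates and the
  semantics is a total function.\<close>

fun run :: "cmd \<Rightarrow> state \<Rightarrow> state" where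
  "run (Set x e) s = s(S x := aval e s)"
| "run (Put j i e) s = s(Arr j (aval i s) := aval e s)"
| "run (c1 ;; c2) s = run c2 (run c1 s)"
| "run (Cond b c1 c2) s = (if bval b s then run c1 s else run c2 s)"
| "run (For x e c) s = iter (nat (aval e s)) (\<lambda>i s. run c (s(S x := i))) s"

text \<open>\<open>Z\<close> bounds the absolute values of all cells. A loop variable stays below its limit, so only
  the limit needs to be checked.\<close>

fun ok :: "int \<Rightarrow> cmd \<Rightarrow> state \<Rightarrow> bool" where
  "ok Z (Set x e) s \<longleftrightarrow> aok e s \<and> \<bar>aval e s\<bar> \<le> Z"
| "ok Z (Put j i e) s \<longleftrightarrow> j < 14 \<and> aok i s \<and> 0 \<le> aval i s \<and> aok e s \<and> \<bar>aval e s\<bar> \<le> Z"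
| "ok Z (c1 ;; c2) s \<longleftrightarrow> ok Z c1 s \<and> ok Z c2 (run c1 s)"
| "ok Z (Cond b c1 c2) s \<longleftrightarrow> bok b s \<and> (if bval b s then ok Z c1 s else ok Z c2 s)"
| "ok Z (For x e c) s \<longleftrightarrow> aok e s \<and> \<bar>aval e s\<bar> \<le> Z \<and>
     (\<forall>i < nat (aval e s). ok Z c ((iter i (\<lambda>i s. run c (s(S x := i))) s)(S x := int i)))"

text \<open>Expressions are free here: their size is bounded by the program text. They are charged
  afterwards, by a factor \<open>4 * W + 8\<close> and by the bit length.\<close>

fun cost :: "cmd \<Rightarrow> state \<Rightarrow> nat" where
  "cost (Set x e) s = 1"
| "cost (Put j i e) s = 1"
| "cost (c1 ;; c2) s = cost c1 s + cost c2 (run c1 s)"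
| "cost (Cond b c1 c2) s = 1 + (if bval b s then cost c1 s else cost c2 s)"
| "cost (For x e c) s = 1 +
     (\<Sum>i < nat (aval e s). 1 + cost c ((iter i (\<lambda>i s. run c (s(S x := i))) s)(S x := int i)))"

text \<open>Exceeds the size, the nesting depth, the constants and the variable numbers of the program.\<close>

fun asize :: "aexp \<Rightarrow> nat" where
  "asize (Num c) = 1 + nat \<bar>c\<bar>"
| "asize (Var x) = 1 + x"
| "asize (Elt j e) = 1 + asize e"
| "asize (In e) = 1 + asize e"
| "asize (Bop f a b) = 1 + asize a + asize b"

fun bsize :: "bexp \<Rightarrow> nat" where
  "bsize (BLess a b) = 1 + asize a + asize b"
| "bsize (BEq a b) = 1 + asize a + asize b"

fun csize :: "cmd \<Rightarrow> nat" where
  "csize (Set x e) = 1 + x + asize e"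
| "csize (Put j i e) = 1 + asize i + asize e"
| "csize (c1 ;; c2) = csize c1 + csize c2"
| "csize (Cond b c1 c2) = bsize b + csize c1 + csize c2"
| "csize (For x e c) = 2 + x + asize e + csize c"

text \<open>Scalars, temporaries and the 14 arrays occupy the residue classes modulo 16 of the negative
  addresses, since the nonnegative ones hold the input.\<close>

fun addr :: "cell \<Rightarrow> int" where
  "addr (S x) = - 1 - 16 * int x"
| "addr (Arr j i) = - 3 - int j - 16 * i"
| "addr (Inp i) = i"

definition tmp :: "nat \<Rightarrow> int" where
  "tmp d = - 2 - 16 * int d"

fun valid :: "cell \<Rightarrow> bool" where
  "valid (S x) \<longleftrightarrow> True"
| "valid (Arr j i) \<longleftrightarrow> j < 14 \<and> 0 \<le> i"
| "valid (Inp i) \<longleftrightarrow> 0 \<le> i"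

text \<open>Cells that are not valid are left out because their addresses may coincide with those of
  valid ones.\<close>

definition rep :: "state \<Rightarrow> mem \<Rightarrow> bool" where
  "rep s M \<longleftrightarrow> (\<forall>c. valid c \<longrightarrow> M (addr c) = s c)"

definition bnd :: "int \<Rightarrow> ('a \<Rightarrow> int) \<Rightarrow> bool" where
  "bnd Z M \<longleftrightarrow> (\<forall>i. \<bar>M i\<bar> \<le> Z)"

section \<open>The compiler\<close>

abbreviation "Mov l a \<equiv> Assign l Plus a (Const 0)"

text \<open>Temporaries form a stack: the value arrives in \<open>tmp d\<close>, and no temporary
  below d is touched. For an array access the address of the cell is computed in place and then
  dereferenced.\<close>

fun acomp :: "aexp \<Rightarrow> nat \<Rightarrow> com" where
  "acomp (Num c) d = Mov (Reg (tmp d)) (Const c)"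
| "acomp (Var x) d = Mov (Reg (tmp d)) (Val (Reg (addr (S x))))"
| "acomp (Elt j e) d = Seq (acomp e d)
     (Seq (Assign (Reg (tmp d)) Times (Val (Reg (tmp d))) (Const (- 16)))
     (Seq (Assign (Reg (tmp d)) Plus (Val (Reg (tmp d))) (Const (- 3 - int j)))
          (Mov (Reg (tmp d)) (Val (Ind (tmp d))))))"
| "acomp (In e) d = Seq (acomp e d) (Mov (Reg (tmp d)) (Val (Ind (tmp d))))"
| "acomp (Bop f a b) d = Seq (acomp a d) (Seq (acomp b (Suc d))
     (Assign (Reg (tmp d)) f (Val (Reg (tmp d))) (Val (Reg (tmp (Suc d))))))"

fun bcomp :: "bexp \<Rightarrow> nat \<Rightarrow> com" where
  "bcomp (BLess a b) d = Seq (acomp a d) (acomp b (Suc d))"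
| "bcomp (BEq a b) d = Seq (acomp a d) (acomp b (Suc d))"

fun btest :: "bexp \<Rightarrow> nat \<Rightarrow> cond" where
  "btest (BLess a b) d = Less (Val (Reg (tmp d))) (Val (Reg (tmp (Suc d))))"
| "btest (BEq a b) d = Eq (Val (Reg (tmp d))) (Val (Reg (tmp (Suc d))))"

text \<open>A loop keeps its limit in \<open>tmp d\<close> and a private counter in
  \<open>tmp (Suc d)\<close>, above which the body works. The loop variable is only a copy of the
  counter, so the body may overwrite it.\<close>

fun ccomp :: "cmd \<Rightarrow> nat \<Rightarrow> com" where
  "ccomp (Set x e) d = Seq (acomp e d) (Mov (Reg (addr (S x))) (Val (Reg (tmp d))))"
| "ccomp (Put j i e) d = Seq (acomp i d)
     (Seq (Assign (Reg (tmp d)) Times (Val (Reg (tmp d))) (Const (- 16)))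
     (Seq (Assign (Reg (tmp d)) Plus (Val (Reg (tmp d))) (Const (- 3 - int j)))
     (Seq (acomp e (Suc d)) (Mov (Ind (tmp d)) (Val (Reg (tmp (Suc d))))))))"
| "ccomp (c1 ;; c2) d = Seq (ccomp c1 d) (ccomp c2 d)"
| "ccomp (Cond b c1 c2) d = Seq (bcomp b d) (If (btest b d) (ccomp c1 d) (ccomp c2 d))"
| "ccomp (For x e c) d = Seq (acomp e d) (Seq (Mov (Reg (tmp (Suc d))) (Const 0))
     (While (Less (Val (Reg (tmp (Suc d)))) (Val (Reg (tmp d))))
       (Seq (Mov (Reg (addr (S x))) (Val (Reg (tmp (Suc d)))))
       (Seq (ccomp c (Suc (Suc d)))
            (Assign (Reg (tmp (Suc d))) Plus (Val (Reg (tmp (Suc d)))) (Const 1))))))"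

section \<open>Disjointness of the address classes\<close>

fun residue :: "cell \<Rightarrow> int" where
  "residue (S x) = 15"
| "residue (Arr j i) = 13 - int j"
| "residue (Inp i) = i mod 16"

lemma addr_mod: "valid c \<Longrightarrow> addr c mod 16 = residue c"
proof (cases c)
  case (S x)
  have "addr c = 15 + 16 * (- 1 - int x)" using S by simp
  then show ?thesis using S by (simp only: mod_mult_self2) simp
next
  case (Arr j i)
  assume "valid c"
  then have j: "j < 14" using Arr by simp
  have "addr c = (13 - int j) + 16 * (- 1 - i)" using Arr by simp
  then have "addr c mod 16 = (13 - int j) mod 16" by (simp only: mod_mult_self2)
  then show ?thesis using j Arr by simp
qed simp

lemma addr_neg: "valid c \<Longrightarrow> 0 \<le> addr c \<longleftrightarrow> (\<exists>i. c = Inp i)"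
  by (cases c) auto

text \<open>The sign separates the inputs from the rest, and among negative addresses the residue
  modulo 16 tells scalars and arrays apart.\<close>

lemma addr_inj:
  assumes "valid c" "valid c'" "addr c = addr c'"
  shows "c = c'"
proof (cases "\<exists>i. c = Inp i")
  case True
  then show ?thesis using assms addr_neg[of c'] by auto
next
  case False
  have "\<nexists>i. c' = Inp i" using False addr_neg assms by metis
  moreover have "residue c = residue c'" using addr_mod assms by metis
  ultimately show ?thesis using False assms by (cases c; cases c') auto
qed

lemma addr_neq_tmp: "valid c \<Longrightarrow> addr c \<noteq> tmp d"
proof
  assume c: "valid c" "addr c = tmp d"
  have "tmp d = 14 + 16 * (- 1 - int d)" unfolding tmp_def by simp
  then have "tmp d mod 16 = 14" by (simp only: mod_mult_self2) simp
  then have "residue c = 14" using c addr_mod by metis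
  moreover have "tmp d < 0" unfolding tmp_def by simp
  ultimately show False using c by (cases c) auto
qed

lemma tmp_eq[simp]: "tmp d = tmp d' \<longleftrightarrow> d = d'"
  unfolding tmp_def by auto

lemma rep_tmp[simp]: "rep s (M(tmp d := v)) \<longleftrightarrow> rep s M"
  unfolding rep_def by (auto simp: addr_neq_tmp)

lemma rep_upd: "rep s M \<Longrightarrow> valid c \<Longrightarrow> rep (s(c := v)) (M(addr c := v))"
  unfolding rep_def using addr_inj by auto

section \<open>Sizes of the numbers in a computation\<close>

lemma len_mono: "\<bar>x\<bar> \<le> y \<Longrightarrow> len x \<le> len y"
  unfolding len_def by (intro max.mono floorlog_mono nat_mono) auto

text \<open>Rounding towards minus infinity does not spoil this bound, and division by 0 gives 0; so
  \<open>Div\<close> needs no extra room in \<open>aval_bound\<close>.\<close>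

lemma int_div_abs_le: "\<bar>x div y\<bar> \<le> \<bar>x :: int\<bar>"
proof (cases "y = 0")
  case False
  have pos: "\<bar>x div y\<bar> \<le> \<bar>x\<bar>" if "y > 0" for x y :: int
  proof (cases "x \<ge> 0")
    case True
    then show ?thesis using that zdiv_mono2[of x 1 y] by (simp add: pos_imp_zdiv_nonneg_iff)
  next
    case False
    then show ?thesis using that zdiv_mono2_neg[of x 1 y] pos_imp_zdiv_neg_iff[of y x] by simp
  qed
  show ?thesis
    using pos[of y x] pos[of "- y" "- x"] False by (cases "y > 0") auto
qed simp
text \<open>The bounds of subexpressions multiply at worst. A sum fits as well: for X, Y at least 1
  one has X + Y \<le> 2 X Y \<le> Z X Y, and the node itself provides the extra factor
  \<open>Z\<close>. Constants are covered by \<open>asize e \<le> Z\<close>.\<close>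

lemma aval_bound:
  assumes "bnd Z s" "2 \<le> Z" "int (asize e) \<le> Z"
  shows "\<bar>aval e s\<bar> \<le> Z ^ asize e"
  using assms(3)
proof (induction e)
  case (Num c)
  have "Z \<le> Z ^ asize (Num c)" using assms(2) by simp
  then show ?case using Num by simp
next
  case (Var x)
  have "Z \<le> Z ^ asize (Var x)" using assms(2) by simp
  then show ?case using assms(1) unfolding bnd_def by (metis aval.simps(2) order_trans)
next
  case (Elt j e)
  have "Z \<le> Z ^ asize (Elt j e)" using assms(2) by simp
  then show ?case using assms(1) unfolding bnd_def by (metis aval.simps(3) order_trans)
next
  case (In e)
  have "Z \<le> Z ^ asize (In e)" using assms(2) by simp
  then show ?case using assms(1) unfolding bnd_def by (metis aval.simps(4) order_trans)
next
  case (Bop f a b)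
  let ?x = "aval a s" and ?y = "aval b s"
  let ?X = "Z ^ asize a" and ?Y = "Z ^ asize b"
  have x: "\<bar>?x\<bar> \<le> ?X" and y: "\<bar>?y\<bar> \<le> ?Y" using Bop by auto
  have X1: "1 \<le> ?X" "1 \<le> ?Y" using assms(2) by auto
  have big: "?X + ?Y \<le> Z ^ asize (Bop f a b)"
  proof -
    have "?X * 1 \<le> ?X * ?Y" "1 * ?Y \<le> ?X * ?Y"
      using X1 by (intro mult_left_mono mult_right_mono; simp)+
    then have "?X + ?Y \<le> 2 * (?X * ?Y)" by simp
    also have "\<dots> \<le> Z * (?X * ?Y)" using assms(2) X1 by (intro mult_right_mono) auto
    finally show ?thesis by (simp add: power_add)
  qed
  have times: "\<bar>?x * ?y\<bar> \<le> Z ^ asize (Bop f a b)"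
  proof -
    have "\<bar>?x * ?y\<bar> \<le> 1 * (?X * ?Y)" unfolding abs_mult mult_1 using x y by (intro mult_mono) auto
    also have "1 * (?X * ?Y) \<le> Z * (?X * ?Y)" using assms(2) X1 by (intro mult_right_mono) auto
    finally show ?thesis by (simp add: power_add)
  qed
  have div: "\<bar>?x div ?y\<bar> \<le> \<bar>?x\<bar>" by (rule int_div_abs_le)
  show ?case
    using x y X1 big times div by (cases f) auto
qed

text \<open>The 9 is the worst cost of an assignment in units of \<open>len L\<close>: 2 for the
  target, 3 for each operand and 1 for the result.\<close>

definition runs :: "int \<Rightarrow> com \<Rightarrow> mem \<Rightarrow> nat \<Rightarrow> mem \<Rightarrow> bool" where
  "runs L c M T M' \<longleftrightarrow> bnd L M' \<and> (\<exists>t. exec c M t M' \<and> t \<le> T * (9 * len L))"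

lemma runs_Seq:
  assumes "runs L c1 M T1 M'" "runs L c2 M' T2 M''"
  shows "runs L (Seq c1 c2) M (T1 + T2) M''"
  using assms unfolding runs_def by (auto intro!: exec.Seq add_mono simp: add_mult_distrib)

lemma runs_weaken: "runs L c M T M' \<Longrightarrow> T \<le> T' \<Longrightarrow> runs L c M T' M'"
  unfolding runs_def by (meson le_trans mult_le_mono1)

fun small_loc :: "int \<Rightarrow> loc \<Rightarrow> bool" where
  "small_loc L (Reg i) \<longleftrightarrow> \<bar>i\<bar> \<le> L"
| "small_loc L (Ind i) \<longleftrightarrow> \<bar>i\<bar> \<le> L"

fun small_op :: "int \<Rightarrow> operand \<Rightarrow> bool" where
  "small_op L (Const c) \<longleftrightarrow> \<bar>c\<bar> \<le> L"
| "small_op L (Val l) \<longleftrightarrow> small_loc L l"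

lemma loc_cost_le: "bnd L M \<Longrightarrow> small_loc L l \<Longrightarrow> loc_cost M l \<le> 2 * len L"
  unfolding bnd_def by (cases l) (auto simp: len_mono add_mono mult_2 trans_le_add1)

lemma operand_cost_le: "bnd L M \<Longrightarrow> small_op L a \<Longrightarrow> operand_cost M a \<le> 3 * len L"
proof (cases a)
  case (Const c)
  then show "small_op L a \<Longrightarrow> ?thesis" using len_mono[of c L] by simp
next
  case (Val l)
  assume "bnd L M" "small_op L a"
  then have "loc_cost M l \<le> 2 * len L" "len (M (loc_addr M l)) \<le> len L"
    using Val loc_cost_le by (auto simp: bnd_def len_mono)
  then show ?thesis using Val by simp
qed

lemma runs_Assign:
  assumes "bnd L M" "small_loc L l" "small_op L a" "small_op L b"
    and r: "\<bar>binop_val f (operand_val M a) (operand_val M b)\<bar> \<le> L"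
  shows "runs L (Assign l f a b) M 1
    (M(loc_addr M l := binop_val f (operand_val M a) (operand_val M b)))"
proof -
  have "loc_cost M l \<le> 2 * len L" "operand_cost M a \<le> 3 * len L" "operand_cost M b \<le> 3 * len L"
    "len (binop_val f (operand_val M a) (operand_val M b)) \<le> len L"
    using assms loc_cost_le operand_cost_le len_mono by auto
  then show ?thesis
    unfolding runs_def using exec.Assign[where f = f and M = M and a = a and b = b and l = l, OF refl] assms(1) r
    by (fastforce simp: bnd_def)
qed

text \<open>Values of expressions reach \<open>Z ^ W\<close>; turning one into an array address
  multiplies it by 16 and shifts it by at most 16, which 32 covers.\<close>

definition lowbound :: "int \<Rightarrow> nat \<Rightarrow> int" where
  "lowbound Z W = 16 * Z ^ W + 32"

lemma lowbound_ge:
  assumes "2 \<le> Z" "int d \<le> Z" "0 < W"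
  shows "\<bar>tmp d\<bar> \<le> lowbound Z W" "\<bar>addr (S d)\<bar> \<le> lowbound Z W" "int d \<le> lowbound Z W"
    "32 \<le> lowbound Z W"
proof -
  have "Z \<le> Z ^ W" using assms by (intro self_le_power) auto
  then have "16 * int d \<le> 16 * Z ^ W" using assms by linarith
  then show "\<bar>tmp d\<bar> \<le> lowbound Z W" "\<bar>addr (S d)\<bar> \<le> lowbound Z W" "int d \<le> lowbound Z W"
    "32 \<le> lowbound Z W"
    unfolding lowbound_def tmp_def using assms by simp_all
qed

lemma power_le_lowbound:
  assumes "2 \<le> Z" "\<bar>v\<bar> \<le> Z ^ w" "w \<le> W"
  shows "\<bar>v\<bar> \<le> lowbound Z W" "\<bar>v * - 16\<bar> \<le> lowbound Z W"
    "j < 14 \<Longrightarrow> \<bar>v * - 16 + (- 3 - int j)\<bar> \<le> lowbound Z W"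
proof -
  have "Z ^ w \<le> Z ^ W" using assms by (intro power_increasing) auto
  then have "\<bar>v\<bar> \<le> Z ^ W" using assms by linarith
  then show "\<bar>v\<bar> \<le> lowbound Z W" "\<bar>v * - 16\<bar> \<le> lowbound Z W"
    "j < 14 \<Longrightarrow> \<bar>v * - 16 + (- 3 - int j)\<bar> \<le> lowbound Z W"
    unfolding lowbound_def by (auto simp: abs_if split: if_splits)
qed

section \<open>Correctness and running time of compiled code\<close>

lemma asize_pos: "0 < asize e"
  by (cases e) auto

text \<open>Four assignments per unit of size are enough, since the most expensive node,
  \<open>Elt\<close>, adds three. That lower temporaries survive is needed for operands which wait
  on the stack.\<close>

lemma acomp_correct:
  assumes "2 \<le> Z" "bnd Z s"
  shows "rep s M \<Longrightarrow> bnd (lowbound Z W) M \<Longrightarrow> aok e s \<Longrightarrow> asize e \<le> W \<Longrightarrow> int (d + asize e) \<le> Z \<Longrightarrow>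
    \<exists>M'. runs (lowbound Z W) (acomp e d) M (4 * asize e) M' \<and> rep s M' \<and> M' (tmp d) = aval e s \<and>
      (\<forall>d'<d. M' (tmp d') = M (tmp d'))"
proof (induction e arbitrary: d M)
  case (Num c)
  let ?L = "lowbound Z W"
  note lb = lowbound_ge[OF assms(1), of d W]
  have 1: "\<bar>c\<bar> \<le> ?L" using lowbound_ge(3)[OF assms(1), of "nat \<bar>c\<bar>" W] Num by auto
  have "runs ?L (acomp (Num c) d) M 1 (M(tmp d := c))"
    using runs_Assign[of ?L M "Reg (tmp d)" "Const c" "Const 0" Plus] Num 1 lb by auto
  then have "runs ?L (acomp (Num c) d) M (4 * asize (Num c)) (M(tmp d := c))"
    by (rule runs_weaken) simp
  moreover have "rep s (M(tmp d := c))" using Num by simp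
  ultimately show ?case by (metis aval.simps(1) fun_upd_other fun_upd_same nat_neq_iff tmp_eq)
next
  case (Var x)
  let ?L = "lowbound Z W"
  note lb = lowbound_ge[OF assms(1), of d W]
  have 1: "\<bar>addr (S x)\<bar> \<le> ?L" using lowbound_ge(2)[OF assms(1), of x W] Var by auto
  have 2: "M (addr (S x)) = s (S x)" using Var(1) unfolding rep_def by (metis valid.simps(1))
  have 3: "\<bar>s (S x)\<bar> \<le> ?L" using Var(2) 2 unfolding bnd_def by metis
  have "runs ?L (acomp (Var x) d) M 1 (M(tmp d := s (S x)))"
    using runs_Assign[of ?L M "Reg (tmp d)" "Val (Reg (addr (S x)))" "Const 0" Plus] Var 1 lb 2 3
    by (auto simp del: addr.simps)
  then have "runs ?L (acomp (Var x) d) M (4 * asize (Var x)) (M(tmp d := s (S x)))"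
    by (rule runs_weaken) simp
  moreover have "rep s (M(tmp d := s (S x)))" using Var by simp
  ultimately show ?case by (metis aval.simps(2) fun_upd_other fun_upd_same nat_neq_iff tmp_eq)
next
  case (Elt j e)
  let ?L = "lowbound Z W"
  note lb = lowbound_ge[OF assms(1), of d W]
  obtain M1 where M1: "runs ?L (acomp e d) M (4 * asize e) M1" "rep s M1" "M1 (tmp d) = aval e s"
    "\<forall>d'<d. M1 (tmp d') = M (tmp d')"
    using Elt.IH[of M d] Elt.prems by auto
  have b1: "bnd ?L M1" using M1 unfolding runs_def by auto
  have v: "\<bar>aval e s\<bar> \<le> Z ^ asize e" using aval_bound[OF assms(2,1), of e] Elt.prems by auto
  note pl = power_le_lowbound[OF assms(1) v, where W = W]
  let ?M2 = "M1(tmp d := aval e s * - 16)"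
  have 2: "runs ?L (Assign (Reg (tmp d)) Times (Val (Reg (tmp d))) (Const (- 16))) M1 1 ?M2"
    using runs_Assign[of ?L M1 "Reg (tmp d)" "Val (Reg (tmp d))" "Const (-16)" Times] b1 lb pl M1 Elt.prems
    by auto
  let ?a = "aval e s * - 16 + (- 3 - int j)"
  let ?M3 = "?M2(tmp d := ?a)"
  have 3: "runs ?L (Assign (Reg (tmp d)) Plus (Val (Reg (tmp d))) (Const (- 3 - int j))) ?M2 1 ?M3"
    using runs_Assign[of ?L ?M2 "Reg (tmp d)" "Val (Reg (tmp d))" "Const (- 3 - int j)" Plus] 2 lb pl M1 Elt.prems
    by (auto simp: runs_def)
  have r3: "rep s ?M3" using M1 by simp
  have a: "?a = addr (Arr j (aval e s))" by simp
  have x: "?M3 ?a = s (Arr j (aval e s))"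
    unfolding a using r3 Elt.prems unfolding rep_def a by (metis aok.simps(3) valid.simps(2))
  have b3: "bnd ?L ?M3" using 3 unfolding runs_def by simp
  let ?M4 = "?M3(tmp d := s (Arr j (aval e s)))"
  have xL: "\<bar>s (Arr j (aval e s))\<bar> \<le> ?L" using b3 x unfolding bnd_def by metis
  have 4: "runs ?L (Mov (Reg (tmp d)) (Val (Ind (tmp d)))) ?M3 1 ?M4"
    using runs_Assign[of ?L ?M3 "Reg (tmp d)" "Val (Ind (tmp d))" "Const 0" Plus] b3 lb x xL Elt.prems
    by auto
  have "runs ?L (acomp (Elt j e) d) M (4 * asize e + (1 + (1 + 1))) ?M4"
    unfolding acomp.simps by (intro runs_Seq[OF M1(1)] runs_Seq[OF 2] runs_Seq[OF 3] 4)
  then have "runs ?L (acomp (Elt j e) d) M (4 * asize (Elt j e)) ?M4" by (rule runs_weaken) simp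
  moreover have "rep s ?M4" using M1 by simp
  moreover have "?M4 (tmp d) = aval (Elt j e) s" "\<forall>d'<d. ?M4 (tmp d') = M (tmp d')" using M1 by simp_all
  ultimately show ?case by blast
next
  case (In e)
  let ?L = "lowbound Z W"
  note lb = lowbound_ge[OF assms(1), of d W]
  obtain M1 where M1: "runs ?L (acomp e d) M (4 * asize e) M1" "rep s M1" "M1 (tmp d) = aval e s"
    "\<forall>d'<d. M1 (tmp d') = M (tmp d')"
    using In.IH[of M d] In.prems by auto
  have b1: "bnd ?L M1" using M1 unfolding runs_def by auto
  have x: "M1 (aval e s) = s (Inp (aval e s))"
    using M1(2) In.prems unfolding rep_def by (metis addr.simps(3) aok.simps(4) valid.simps(3))
  let ?M4 = "M1(tmp d := s (Inp (aval e s)))"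
  have xL: "\<bar>s (Inp (aval e s))\<bar> \<le> ?L" using b1 x unfolding bnd_def by metis
  have 4: "runs ?L (Mov (Reg (tmp d)) (Val (Ind (tmp d)))) M1 1 ?M4"
    using runs_Assign[of ?L M1 "Reg (tmp d)" "Val (Ind (tmp d))" "Const 0" Plus] b1 lb x xL M1 In.prems
    by auto
  have "runs ?L (acomp (In e) d) M (4 * asize e + 1) ?M4"
    unfolding acomp.simps by (intro runs_Seq[OF M1(1)] 4)
  then have "runs ?L (acomp (In e) d) M (4 * asize (In e)) ?M4" by (rule runs_weaken) simp
  moreover have "rep s ?M4" using M1 by simp
  moreover have "?M4 (tmp d) = aval (In e) s" "\<forall>d'<d. ?M4 (tmp d') = M (tmp d')" using M1 by simp_all
  ultimately show ?case by blast
next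
  case (Bop f a b)
  let ?L = "lowbound Z W"
  note lb = lowbound_ge[OF assms(1), of d W] lowbound_ge[OF assms(1), of "Suc d" W]
  obtain M1 where M1: "runs ?L (acomp a d) M (4 * asize a) M1" "rep s M1" "M1 (tmp d) = aval a s"
    "\<forall>d'<d. M1 (tmp d') = M (tmp d')"
    using Bop.IH(1)[of M d] Bop.prems by auto
  have b1: "bnd ?L M1" using M1 unfolding runs_def by auto
  obtain M2 where M2: "runs ?L (acomp b (Suc d)) M1 (4 * asize b) M2" "rep s M2" "M2 (tmp (Suc d)) = aval b s"
    "\<forall>d'<Suc d. M2 (tmp d') = M1 (tmp d')"
    using Bop.IH(2)[of M1 "Suc d"] Bop.prems M1 b1 by auto
  have b2: "bnd ?L M2" using M2 unfolding runs_def by auto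
  have v: "\<bar>aval (Bop f a b) s\<bar> \<le> Z ^ asize (Bop f a b)"
    using aval_bound[OF assms(2,1), of "Bop f a b"] Bop.prems by auto
  note pl = power_le_lowbound[OF assms(1) v, where W = W]
  let ?M3 = "M2(tmp d := aval (Bop f a b) s)"
  have 3: "runs ?L (Assign (Reg (tmp d)) f (Val (Reg (tmp d))) (Val (Reg (tmp (Suc d))))) M2 1 ?M3"
    using runs_Assign[of ?L M2 "Reg (tmp d)" "Val (Reg (tmp d))" "Val (Reg (tmp (Suc d)))" f] b2 lb pl M1 M2 Bop.prems
      asize_pos[of b]
    by auto
  have "runs ?L (acomp (Bop f a b) d) M (4 * asize a + (4 * asize b + 1)) ?M3"
    unfolding acomp.simps by (intro runs_Seq[OF M1(1)] runs_Seq[OF M2(1)] 3)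
  then have "runs ?L (acomp (Bop f a b) d) M (4 * asize (Bop f a b)) ?M3" by (rule runs_weaken) simp
  moreover have "rep s ?M3" using M1 M2 by simp
  moreover have "?M3 (tmp d) = aval (Bop f a b) s" "\<forall>d'<d. ?M3 (tmp d') = M (tmp d')" using M1 M2 by simp_all
  ultimately show ?case by blast
qed

lemma bnd_upd: "bnd Z s \<Longrightarrow> \<bar>v\<bar> \<le> Z \<Longrightarrow> bnd Z (s(c := v))"
  unfolding bnd_def by simp

lemma bcomp_correct:
  assumes "2 \<le> Z" "bnd Z s" "rep s M" "bnd (lowbound Z W) M" "bok b s" "bsize b \<le> W" "int (d + bsize b) \<le> Z"
  shows "\<exists>M'. runs (lowbound Z W) (bcomp b d) M (4 * bsize b) M' \<and> rep s M' \<and>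
      (cond_val M' (btest b d) \<longleftrightarrow> bval b s) \<and> cond_cost M' (btest b d) \<le> 9 * len (lowbound Z W) \<and>
      (\<forall>d'<d. M' (tmp d') = M (tmp d'))"
proof -
  let ?L = "lowbound Z W"
  obtain a a' where b: "b = BLess a a' \<or> b = BEq a a'" by (cases b) auto
  then have sz: "bsize b = 1 + asize a + asize a'" "aok a s" "aok a' s" using assms by auto
  obtain M1 where M1: "runs ?L (acomp a d) M (4 * asize a) M1" "rep s M1" "M1 (tmp d) = aval a s"
    "\<forall>d'<d. M1 (tmp d') = M (tmp d')"
    using acomp_correct[OF assms(1-4), of a d] sz assms by auto
  have b1: "bnd ?L M1" using M1 unfolding runs_def by auto
  obtain M2 where M2: "runs ?L (acomp a' (Suc d)) M1 (4 * asize a') M2" "rep s M2" "M2 (tmp (Suc d)) = aval a' s"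
    "\<forall>d'<Suc d. M2 (tmp d') = M1 (tmp d')"
    using acomp_correct[OF assms(1-2) M1(2) b1, of a' "Suc d"] sz assms asize_pos[of a] by auto
  have b2: "bnd ?L M2" using M2 unfolding runs_def by auto
  have "runs ?L (Seq (acomp a d) (acomp a' (Suc d))) M (4 * asize a + 4 * asize a') M2"
    by (rule runs_Seq[OF M1(1) M2(1)])
  then have r: "runs ?L (bcomp b d) M (4 * bsize b) M2"
    using b sz by (auto intro: runs_weaken)
  have "small_op ?L (Val (Reg (tmp d)))" "small_op ?L (Val (Reg (tmp (Suc d))))"
    using lowbound_ge[OF assms(1), of d W] lowbound_ge[OF assms(1), of "Suc d" W] assms sz by auto
  note c = this[THEN operand_cost_le[OF b2]]
  have "cond_cost M2 (btest b d) \<le> 9 * len ?L" using b c by (auto)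
  moreover have "cond_val M2 (btest b d) \<longleftrightarrow> bval b s" using b M1 M2 by auto
  ultimately show ?thesis using r M1 M2 by (metis less_Suc_eq)
qed

text \<open>Of the \<open>4 * W + 8\<close> assignments granted per unit of cost,
  \<open>4 * W\<close> pay for the expressions of one command and 8 for its bookkeeping.\<close>

lemma ccomp_correct:
  assumes "2 \<le> Z"
  shows "bnd Z s \<Longrightarrow> rep s M \<Longrightarrow> bnd (lowbound Z W) M \<Longrightarrow> ok Z c s \<Longrightarrow> csize c \<le> W \<Longrightarrow> int (d + csize c) \<le> Z \<Longrightarrow>
    \<exists>M'. runs (lowbound Z W) (ccomp c d) M (cost c s * (4 * W + 8)) M' \<and> rep (run c s) M' \<and> bnd Z (run c s) \<and>
      (\<forall>d'<d. M' (tmp d') = M (tmp d'))"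
proof (induction c arbitrary: s d M)
  case (Set x e)
  let ?L = "lowbound Z W"
  obtain M1 where M1: "runs ?L (acomp e d) M (4 * asize e) M1" "rep s M1" "M1 (tmp d) = aval e s"
    "\<forall>d'<d. M1 (tmp d') = M (tmp d')"
    using acomp_correct[OF assms Set.prems(1-3), of e d] Set.prems by auto
  have b1: "bnd ?L M1" using M1 unfolding runs_def by auto
  let ?M2 = "M1(addr (S x) := aval e s)"
  have v: "\<bar>aval e s\<bar> \<le> ?L" using b1 M1(3) unfolding bnd_def by metis
  have 2: "runs ?L (Mov (Reg (addr (S x))) (Val (Reg (tmp d)))) M1 1 ?M2"
    using runs_Assign[of ?L M1 "Reg (addr (S x))" "Val (Reg (tmp d))" "Const 0" Plus] b1 v M1 Set.prems
      lowbound_ge[OF assms, of d W] lowbound_ge[OF assms, of x W]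
    by (auto simp del: addr.simps)
  have "runs ?L (ccomp (Set x e) d) M (4 * asize e + 1) ?M2"
    unfolding ccomp.simps by (intro runs_Seq[OF M1(1)] 2)
  then have "runs ?L (ccomp (Set x e) d) M (cost (Set x e) s * (4 * W + 8)) ?M2"
    by (rule runs_weaken) (use Set.prems in auto)
  moreover have "rep (run (Set x e) s) ?M2" using rep_upd[OF M1(2), of "S x"] by simp
  moreover have "bnd Z (run (Set x e) s)" using Set.prems by (simp add: bnd_upd)
  moreover have "\<forall>d'<d. ?M2 (tmp d') = M (tmp d')"
    using M1(4) addr_neq_tmp[of "S x"] by (metis fun_upd_other valid.simps(1))
  ultimately show ?case by blast
next
  case (Put j i e)
  let ?L = "lowbound Z W"
  note lb = lowbound_ge[OF assms, of d W] lowbound_ge[OF assms, of "Suc d" W]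
  obtain M1 where M1: "runs ?L (acomp i d) M (4 * asize i) M1" "rep s M1" "M1 (tmp d) = aval i s"
    "\<forall>d'<d. M1 (tmp d') = M (tmp d')"
    using acomp_correct[OF assms Put.prems(1-3), of i d] Put.prems by auto
  have b1: "bnd ?L M1" using M1 unfolding runs_def by auto
  have v: "\<bar>aval i s\<bar> \<le> Z ^ asize i" using aval_bound[OF Put.prems(1) assms, of i] Put.prems by auto
  note pl = power_le_lowbound[OF assms(1) v, where W = W]
  let ?M2 = "M1(tmp d := aval i s * - 16)"
  have 2: "runs ?L (Assign (Reg (tmp d)) Times (Val (Reg (tmp d))) (Const (- 16))) M1 1 ?M2"
    using runs_Assign[of ?L M1 "Reg (tmp d)" "Val (Reg (tmp d))" "Const (-16)" Times] b1 lb pl M1 Put.prems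
    by auto
  let ?a = "aval i s * - 16 + (- 3 - int j)"
  let ?M3 = "?M2(tmp d := ?a)"
  have 3: "runs ?L (Assign (Reg (tmp d)) Plus (Val (Reg (tmp d))) (Const (- 3 - int j))) ?M2 1 ?M3"
    using runs_Assign[of ?L ?M2 "Reg (tmp d)" "Val (Reg (tmp d))" "Const (- 3 - int j)" Plus] 2 lb pl M1 Put.prems
    by (auto simp: runs_def)
  have r3: "rep s ?M3" using M1 by simp
  have b3: "bnd ?L ?M3" using 3 unfolding runs_def by simp
  obtain M4 where M4: "runs ?L (acomp e (Suc d)) ?M3 (4 * asize e) M4" "rep s M4" "M4 (tmp (Suc d)) = aval e s"
    "\<forall>d'<Suc d. M4 (tmp d') = ?M3 (tmp d')"
    using acomp_correct[OF assms Put.prems(1) r3 b3, of e "Suc d"] Put.prems asize_pos[of i] by auto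
  have b4: "bnd ?L M4" using M4 unfolding runs_def by auto
  have a: "?a = addr (Arr j (aval i s))" by simp
  have M4d: "M4 (tmp d) = ?a" using M4(4) by simp
  let ?M5 = "M4(?a := aval e s)"
  have v: "\<bar>aval e s\<bar> \<le> ?L" using b4 M4(3) unfolding bnd_def by metis
  have 5: "runs ?L (Mov (Ind (tmp d)) (Val (Reg (tmp (Suc d))))) M4 1 ?M5"
    using runs_Assign[of ?L M4 "Ind (tmp d)" "Val (Reg (tmp (Suc d)))" "Const 0" Plus] b4 v M4 M4d Put.prems lb asize_pos[of i]
    by auto
  have "runs ?L (ccomp (Put j i e) d) M (4 * asize i + (1 + (1 + (4 * asize e + 1)))) ?M5"
    unfolding ccomp.simps by (intro runs_Seq[OF M1(1)] runs_Seq[OF 2] runs_Seq[OF 3] runs_Seq[OF M4(1)] 5)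
  then have "runs ?L (ccomp (Put j i e) d) M (cost (Put j i e) s * (4 * W + 8)) ?M5"
    by (rule runs_weaken) (use Put.prems in auto)
  moreover have val: "valid (Arr j (aval i s))" using Put.prems by simp
  then have "rep (run (Put j i e) s) ?M5" using rep_upd[OF M4(2) val] unfolding a by simp
  moreover have "bnd Z (run (Put j i e) s)" using Put.prems by (simp add: bnd_upd)
  moreover have "\<forall>d'<d. ?M5 (tmp d') = M (tmp d')"
  proof (intro allI impI)
    fix d' assume "d' < d"
    then have "M4 (tmp d') = M (tmp d')" using M4(4) M1(4) by simp
    then show "?M5 (tmp d') = M (tmp d')"
      using addr_neq_tmp[OF val] unfolding a by (metis fun_upd_other)
  qed
  ultimately show ?case by blast
next
  case (Then c1 c2)
  let ?L = "lowbound Z W"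
  obtain M1 where M1: "runs ?L (ccomp c1 d) M (cost c1 s * (4 * W + 8)) M1" "rep (run c1 s) M1" "bnd Z (run c1 s)"
      "\<forall>d'<d. M1 (tmp d') = M (tmp d')"
    using Then.IH(1)[OF Then.prems(1-3), of d] Then.prems by auto
  have b1: "bnd ?L M1" using M1 unfolding runs_def by auto
  obtain M2 where M2: "runs ?L (ccomp c2 d) M1 (cost c2 (run c1 s) * (4 * W + 8)) M2" "rep (run c2 (run c1 s)) M2"
    "bnd Z (run c2 (run c1 s))" "\<forall>d'<d. M2 (tmp d') = M1 (tmp d')"
    using Then.IH(2)[OF M1(3,2) b1, of d] Then.prems by auto
  have "runs ?L (ccomp (c1 ;; c2) d) M (cost (c1 ;; c2) s * (4 * W + 8)) M2"
    using runs_Seq[OF M1(1) M2(1)] by (simp add: add_mult_distrib)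
  then show ?case using M1 M2 by auto
next
  case (Cond b c1 c2)
  let ?L = "lowbound Z W"
  obtain M1 where M1: "runs ?L (bcomp b d) M (4 * bsize b) M1" "rep s M1"
      "cond_val M1 (btest b d) \<longleftrightarrow> bval b s" "cond_cost M1 (btest b d) \<le> 9 * len ?L"
      "\<forall>d'<d. M1 (tmp d') = M (tmp d')"
    using bcomp_correct[OF assms Cond.prems(1-3), of b d] Cond.prems by auto
  have b1: "bnd ?L M1" using M1 unfolding runs_def by auto
  let ?c = "if bval b s then c1 else c2"
  obtain M2 where M2: "runs ?L (ccomp ?c d) M1 (cost ?c s * (4 * W + 8)) M2" "rep (run ?c s) M2" "bnd Z (run ?c s)"
      "\<forall>d'<d. M2 (tmp d') = M1 (tmp d')"
    using Cond.IH(1)[OF Cond.prems(1) M1(2) b1, of d] Cond.IH(2)[OF Cond.prems(1) M1(2) b1, of d] Cond.prems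
    by (cases "bval b s") auto
  have "runs ?L (If (btest b d) (ccomp c1 d) (ccomp c2 d)) M1 (1 + cost ?c s * (4 * W + 8)) M2"
  proof -
    obtain t where t: "exec (ccomp ?c d) M1 t M2" "t \<le> cost ?c s * (4 * W + 8) * (9 * len ?L)"
      using M2(1) unfolding runs_def by auto
    have "exec (If (btest b d) (ccomp c1 d) (ccomp c2 d)) M1 (cond_cost M1 (btest b d) + t) M2"
      using t(1) M1(3) exec.IfTrue exec.IfFalse by (cases "bval b s") auto
    moreover have "cond_cost M1 (btest b d) + t \<le> (1 + cost ?c s * (4 * W + 8)) * (9 * len ?L)"
      using t(2) M1(4) by (simp add: add_mult_distrib)
    ultimately show ?thesis using M2(1) unfolding runs_def by blast
  qed
  then have "runs ?L (ccomp (Cond b c1 c2) d) M (4 * bsize b + (1 + cost ?c s * (4 * W + 8))) M2"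
    unfolding ccomp.simps by (rule runs_Seq[OF M1(1)])
  then have "runs ?L (ccomp (Cond b c1 c2) d) M (cost (Cond b c1 c2) s * (4 * W + 8)) M2"
    by (rule runs_weaken) (use Cond.prems in \<open>auto simp: add_mult_distrib\<close>)
  then show ?case using M1 M2 by (cases "bval b s") (simp_all, metis+)
next
  case (For x e c)
  let ?L = "lowbound Z W"
  let ?K = "4 * W + 8"
  let ?f = "\<lambda>i s. run c (s(S x := i))"
  let ?it = "\<lambda>i. iter i ?f s"
  let ?st = "\<lambda>i. (?it i)(S x := int i)"
  define m where "m = nat (aval e s)"
  note lb = lowbound_ge[OF assms, of d W] lowbound_ge[OF assms, of "Suc d" W] lowbound_ge[OF assms, of x W]
  have okc: "ok Z c (?st i)" if "i < m" for i
    using For.prems(4) that unfolding m_def by auto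
  have mZ: "int m \<le> Z" using For.prems(4) unfolding m_def by auto
  obtain M1 where M1: "runs ?L (acomp e d) M (4 * asize e) M1" "rep s M1" "M1 (tmp d) = aval e s"
    "\<forall>d'<d. M1 (tmp d') = M (tmp d')"
    using acomp_correct[OF assms For.prems(1-3), of e d] For.prems by auto
  have b1: "bnd ?L M1" using M1 unfolding runs_def by auto
  let ?M2 = "M1(tmp (Suc d) := 0)"
  have 2: "runs ?L (Mov (Reg (tmp (Suc d))) (Const 0)) M1 1 ?M2"
    using runs_Assign[of ?L M1 "Reg (tmp (Suc d))" "Const 0" "Const 0" Plus] b1 For.prems lb
    by auto
  have b2: "bnd ?L ?M2" using 2 unfolding runs_def by auto
  let ?test = "Less (Val (Reg (tmp (Suc d)))) (Val (Reg (tmp d)))"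
  let ?body = "Seq (Mov (Reg (addr (S x))) (Val (Reg (tmp (Suc d)))))
       (Seq (ccomp c (Suc (Suc d)))
            (Assign (Reg (tmp (Suc d))) Plus (Val (Reg (tmp (Suc d)))) (Const 1)))"
  \<comment> \<open>Cost of the iterations from i on; the loop is treated by induction on the number
    that remain.\<close>
  let ?T = "\<lambda>i. \<Sum>j = i..<m. 1 + cost c (?st j)"
  have tc: "cond_cost M ?test \<le> 9 * len ?L" if "bnd ?L M" for M
  proof -
    have "small_op ?L (Val (Reg (tmp d)))" "small_op ?L (Val (Reg (tmp (Suc d))))"
      using lb For.prems by auto
    note c = this[THEN operand_cost_le[OF that]]
    then show ?thesis by simp
  qed
  have loop: "\<exists>M'. runs ?L (While ?test ?body) M (?T i * ?K + 1) M' \<and> rep (?it m) M' \<and> bnd Z (?it m) \<and>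
      (\<forall>d'<d. M' (tmp d') = M (tmp d'))"
    if "i \<le> m" "rep (?it i) M" "bnd Z (?it i)" "bnd ?L M" "M (tmp d) = aval e s" "M (tmp (Suc d)) = int i" for i M
    using that
  proof (induction "m - i" arbitrary: i M)
    case 0
    then have im: "i = m" by simp
    have "\<not> cond_val M ?test" using 0 im unfolding m_def by auto
    then have "exec (While ?test ?body) M (cond_cost M ?test) M" by (rule exec.WhileFalse)
    then have "runs ?L (While ?test ?body) M 1 M"
      unfolding runs_def using tc[OF 0(5)] 0(5) by (metis mult_1)
    then have "runs ?L (While ?test ?body) M (?T i * ?K + 1) M" by (rule runs_weaken) simp
    then show ?case using 0 im by blast
  next
    case (Suc k)
    then have im: "i < m" by simp
    have cv: "cond_val M ?test" using Suc.prems im unfolding m_def by auto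
    let ?N1 = "M(addr (S x) := int i)"
    have iL: "int i \<le> ?L" using im mZ lowbound_ge(3)[OF assms, of i W] For.prems by auto
    have n1: "runs ?L (Mov (Reg (addr (S x))) (Val (Reg (tmp (Suc d))))) M 1 ?N1"
      using runs_Assign[of ?L M "Reg (addr (S x))" "Val (Reg (tmp (Suc d)))" "Const 0" Plus] Suc.prems For.prems lb iL
      by (auto simp del: addr.simps)
    have bn1: "bnd ?L ?N1" using n1 unfolding runs_def by auto
    have r1: "rep (?st i) ?N1" using rep_upd[OF Suc.prems(2), of "S x"] by simp
    have bs: "bnd Z (?st i)" using Suc.prems im mZ by (intro bnd_upd) auto
    have sz: "csize c \<le> W" "int (Suc (Suc d) + csize c) \<le> Z" using For.prems by auto
    obtain N2 where N2: "runs ?L (ccomp c (Suc (Suc d))) ?N1 (cost c (?st i) * ?K) N2"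
      "rep (run c (?st i)) N2" "bnd Z (run c (?st i))" "\<forall>d'<Suc (Suc d). N2 (tmp d') = ?N1 (tmp d')"
      using For.IH[OF bs r1 bn1 okc[OF im] sz] by blast
    have bn2: "bnd ?L N2" using N2 unfolding runs_def by auto
    have keep: "?N1 (tmp d') = M (tmp d')" for d'
      using addr_neq_tmp[of "S x"] by (metis fun_upd_other valid.simps(1))
    let ?N3 = "N2(tmp (Suc d) := int (Suc i))"
    have iL: "int (Suc i) \<le> ?L" using im mZ lowbound_ge(3)[OF assms, of "Suc i" W] For.prems by auto
    have N2s: "N2 (tmp (Suc d)) = int i" using N2(4) keep Suc.prems by (metis lessI)
    have n3: "runs ?L (Assign (Reg (tmp (Suc d))) Plus (Val (Reg (tmp (Suc d)))) (Const 1)) N2 1 ?N3"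
      using runs_Assign[of ?L N2 "Reg (tmp (Suc d))" "Val (Reg (tmp (Suc d)))" "Const 1" Plus] bn2 iL N2s For.prems lb
      by (auto simp: add.commute)
    have bn3: "bnd ?L ?N3" using n3 unfolding runs_def by auto
    have body: "runs ?L ?body M (1 + (cost c (?st i) * ?K + 1)) ?N3"
      by (intro runs_Seq[OF n1] runs_Seq[OF N2(1)] n3)
    have "?N3 (tmp d) = aval e s" using N2(4) keep Suc.prems by (metis fun_upd_other lessI less_Suc_eq n_not_Suc_n tmp_eq)
    moreover have "rep (?it (Suc i)) ?N3" using N2(2) by simp
    moreover have "bnd Z (?it (Suc i))" using N2(3) by simp
    moreover have k: "k = m - Suc i" and im1: "Suc i \<le> m" using Suc.hyps(2) im by auto
    ultimately obtain M' where M': "runs ?L (While ?test ?body) ?N3 (?T (Suc i) * ?K + 1) M'" "rep (?it m) M'"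
        "bnd Z (?it m)" "\<forall>d'<d. M' (tmp d') = ?N3 (tmp d')"
      using Suc.hyps(1)[OF k im1 _ _ bn3 _ fun_upd_same] by blast
    have "\<forall>d'<d. M' (tmp d') = M (tmp d')"
    proof (intro allI impI)
      fix d' assume "d' < d"
      then have "M' (tmp d') = N2 (tmp d')" using M'(4) by simp
      also have "\<dots> = M (tmp d')" using N2(4) keep \<open>d' < d\<close> by simp
      finally show "M' (tmp d') = M (tmp d')" .
    qed
    moreover have "runs ?L (While ?test ?body) M (?T i * ?K + 1) M'"
    proof -
      obtain t1 t2 where t: "exec ?body M t1 ?N3" "t1 \<le> (1 + (cost c (?st i) * ?K + 1)) * (9 * len ?L)"
        "exec (While ?test ?body) ?N3 t2 M'" "t2 \<le> (?T (Suc i) * ?K + 1) * (9 * len ?L)"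
        using body M'(1) unfolding runs_def by auto
      have "exec (While ?test ?body) M (cond_cost M ?test + t1 + t2) M'"
        by (rule exec.WhileTrue[OF cv t(1,3)])
      moreover have "cond_cost M ?test + t1 + t2 \<le> (?T i * ?K + 1) * (9 * len ?L)"
      proof -
        have "cond_cost M ?test + t1 + t2 \<le> 1 * (9 * len ?L) + (1 + (cost c (?st i) * ?K + 1)) * (9 * len ?L)
           + (?T (Suc i) * ?K + 1) * (9 * len ?L)"
          using tc[of M] t Suc.prems by linarith
        also have "\<dots> = (3 + cost c (?st i) * ?K + (?T (Suc i) * ?K + 1)) * (9 * len ?L)"
          by (simp only: add_mult_distrib)
        \<comment> \<open>Test, copy and increment amount to 3 per iteration; they are paid by the
          unit which \<open>cost\<close> charges for each iteration.\<close>
        also have "\<dots> \<le> (?K + cost c (?st i) * ?K + (?T (Suc i) * ?K + 1)) * (9 * len ?L)"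
          by (intro mult_right_mono add_right_mono) auto
        also have "\<dots> = (?T i * ?K + 1) * (9 * len ?L)"
        proof -
          have T: "?T i = 1 + cost c (?st i) + ?T (Suc i)" using im by (rule sum.atLeast_Suc_lessThan)
          have arith: "(K + C * K + (T * K + 1)) * l = ((1 + C + T) * K + 1) * l" for K C T l :: nat
            by (simp add: add_mult_distrib)
          show ?thesis unfolding T by (rule arith)
        qed
        finally show ?thesis .
      qed
      ultimately show ?thesis using M'(1) unfolding runs_def by blast
    qed
    ultimately show ?case using M' by blast
  qed
  have "rep (?it 0) ?M2" "bnd Z (?it 0)" "?M2 (tmp d) = aval e s" "?M2 (tmp (Suc d)) = int 0"
    using M1 For.prems by simp_all
  then have "\<exists>M'. runs ?L (While ?test ?body) ?M2 (?T 0 * ?K + 1) M' \<and> rep (?it m) M' \<and> bnd Z (?it m) \<and>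
      (\<forall>d'<d. M' (tmp d') = ?M2 (tmp d'))"
    by (intro loop[OF le0 _ _ b2])
  then obtain M' where M': "runs ?L (While ?test ?body) ?M2 (?T 0 * ?K + 1) M'" "rep (?it m) M'" "bnd Z (?it m)"
      "\<forall>d'<d. M' (tmp d') = ?M2 (tmp d')" by blast
  have "runs ?L (ccomp (For x e c) d) M (4 * asize e + (1 + (?T 0 * ?K + 1))) M'"
    unfolding ccomp.simps by (intro runs_Seq[OF M1(1)] runs_Seq[OF 2] M'(1))
  moreover have "4 * asize e + (1 + (?T 0 * ?K + 1)) \<le> cost (For x e c) s * ?K"
  proof -
    have "cost (For x e c) s = 1 + ?T 0" unfolding m_def by (simp add: lessThan_atLeast0)
    then show ?thesis using For.prems by (simp only: add_mult_distrib) auto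
  qed
  ultimately have "runs ?L (ccomp (For x e c) d) M (cost (For x e c) s * ?K) M'" by (rule runs_weaken)
  moreover have "run (For x e c) s = ?it m" unfolding m_def by simp
  moreover have "\<forall>d'<d. M' (tmp d') = M (tmp d')" using M'(4) M1(4) by simp
  ultimately show ?case using M' by (metis (no_types, lifting))
qed

definition init_state :: "mem \<Rightarrow> state" where
  "init_state m c = (case c of Inp i \<Rightarrow> m i | _ \<Rightarrow> 0)"

text \<open>The result is moved to register 0 at the very end, because that register holds an
  input.\<close>

definition program :: "cmd \<Rightarrow> nat \<Rightarrow> com" where
  "program c x = Seq (ccomp c 0) (Mov (Reg 0) (Val (Reg (addr (S x)))))"

theorem exec_program:
  assumes Z: "2 \<le> Z" "int W \<le> Z" and W: "csize c + x + 1 \<le> W"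
    and m: "bnd Z m" "\<And>i. i < 0 \<Longrightarrow> m i = 0"
    and ok: "ok Z c (init_state m)"
  shows "\<exists>t M. exec (program c x) m t M \<and> M 0 = run c (init_state m) (S x) \<and>
    t \<le> (cost c (init_state m) + 1) * ((4 * W + 8) * (9 * len (lowbound Z W)))"
proof -
  let ?L = "lowbound Z W" and ?s = "init_state m"
  \<comment> \<open>Scalars and arrays live at negative addresses, where the initial memory is
    0.\<close>
  have rep: "rep ?s m"
    unfolding rep_def
  proof (intro allI impI)
    fix c assume "valid c"
    then show "m (addr c) = ?s c" by (cases c) (simp_all add: init_state_def m(2))
  qed
  have bs: "bnd Z ?s" using m(1) Z(1) unfolding bnd_def init_state_def by (auto split: cell.split)
  have "\<bar>Z\<bar> \<le> ?L" using power_le_lowbound(1)[of Z Z 1 W] Z W by auto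
  then have bL: "bnd ?L m" using m(1) unfolding bnd_def by (meson abs_ge_self order_trans)
  have c: "csize c \<le> W" "int (0 + csize c) \<le> Z" using W Z by auto
  obtain M1 where M1: "runs ?L (ccomp c 0) m (cost c ?s * (4 * W + 8)) M1" "rep (run c ?s) M1"
    using ccomp_correct[OF Z(1) bs rep bL ok c] by blast
  have b1: "bnd ?L M1" using M1 unfolding runs_def by auto
  have v: "M1 (addr (S x)) = run c ?s (S x)" using M1(2) unfolding rep_def by (metis valid.simps(1))
  have "\<bar>run c ?s (S x)\<bar> \<le> ?L" using b1 unfolding bnd_def v[symmetric] by blast
  then have 2: "runs ?L (Mov (Reg 0) (Val (Reg (addr (S x))))) M1 1 (M1(0 := run c ?s (S x)))"
    using runs_Assign[of ?L M1 "Reg 0" "Val (Reg (addr (S x)))" "Const 0" Plus] b1 v Z W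
      lowbound_ge[OF Z(1), of x W]
    by (auto simp del: addr.simps)
  have "runs ?L (program c x) m (cost c ?s * (4 * W + 8) + 1) (M1(0 := run c ?s (S x)))"
    unfolding program_def by (rule runs_Seq[OF M1(1) 2])
  then have "runs ?L (program c x) m ((cost c ?s + 1) * (4 * W + 8)) (M1(0 := run c ?s (S x)))"
    by (rule runs_weaken) simp
  then show ?thesis unfolding runs_def by (metis fun_upd_same mult.assoc)
qed

section \<open>Program verification\<close>

text \<open>A Hoare triple whose precondition is one explicit start state, so that expressions can
  be evaluated by rewriting.\<close>

definition does :: "int \<Rightarrow> cmd \<Rightarrow> state \<Rightarrow> nat \<Rightarrow> (state \<Rightarrow> bool) \<Rightarrow> bool" where
  "does Z c s T Q \<longleftrightarrow> ok Z c s \<and> cost c s \<le> T \<and> Q (run c s)"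

text \<open>A frame analysis of the program text. Indices are known only at run time, hence a
  \<open>Put\<close> counts as writing its whole array.\<close>

fun writes :: "cmd \<Rightarrow> cell \<Rightarrow> bool" where
  "writes (Set x e) c \<longleftrightarrow> c = S x"
| "writes (Put j i e) c \<longleftrightarrow> (\<exists>m. c = Arr j m)"
| "writes (c1 ;; c2) c \<longleftrightarrow> writes c1 c \<or> writes c2 c"
| "writes (Cond b c1 c2) c \<longleftrightarrow> writes c1 c \<or> writes c2 c"
| "writes (For x e c1) c \<longleftrightarrow> c = S x \<or> writes c1 c"

definition agree :: "cmd \<Rightarrow> state \<Rightarrow> state \<Rightarrow> bool" where
  "agree c s s' \<longleftrightarrow> (\<forall>x. \<not> writes c x \<longrightarrow> s' x = s x)"

lemma agreeD: "agree c s s' \<Longrightarrow> \<not> writes c x \<Longrightarrow> s' x = s x"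
  unfolding agree_def by blast

lemma agree_iter:
  assumes "\<And>i s. agree c s (f i s)"
  shows "agree c s (iter m f s)"
  using assms by (induction m) (auto simp: agree_def)

lemma agree_run: "agree c s (run c s)"
proof (induction c arbitrary: s)
  case (For x e c)
  have "agree (For x e c) s (run c (s(S x := i)))" for i s
    using For[of "s(S x := i)"] unfolding agree_def by simp
  then have "agree (For x e c) s (iter m (\<lambda>i s. run c (s(S x := i))) s)" for m
    by (rule agree_iter)
  then show ?case by simp
qed (auto simp: agree_def)

section \<open>Proof rules for correctness with time bounds\<close>

lemma does_Set:
  "aok e s \<Longrightarrow> \<bar>aval e s\<bar> \<le> Z \<Longrightarrow> Q (s(S x := aval e s)) \<Longrightarrow> does Z (Set x e) s 1 Q"
  unfolding does_def by simp

lemma does_Put: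
  "j < 14 \<Longrightarrow> aok i s \<Longrightarrow> 0 \<le> aval i s \<Longrightarrow> aok e s \<Longrightarrow> \<bar>aval e s\<bar> \<le> Z \<Longrightarrow>
    Q (s(Arr j (aval i s) := aval e s)) \<Longrightarrow> does Z (Put j i e) s 1 Q"
  unfolding does_def by simp

lemma does_Then:
  "does Z c1 s T1 (\<lambda>s'. does Z c2 s' T2 Q) \<Longrightarrow> does Z (c1 ;; c2) s (T1 + T2) Q"
  unfolding does_def by auto

lemma does_Cond:
  "bok b s \<Longrightarrow> (bval b s \<Longrightarrow> does Z c1 s T Q) \<Longrightarrow> (\<not> bval b s \<Longrightarrow> does Z c2 s T Q) \<Longrightarrow>
    does Z (Cond b c1 c2) s (1 + T) Q"
  unfolding does_def by auto

text \<open>The frame property comes for free with every command, so specifications only need to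
  describe the cells that change.\<close>

lemma does_conseq:
  "does Z c s T Q \<Longrightarrow> T \<le> T' \<Longrightarrow> (\<And>s'. Q s' \<Longrightarrow> agree c s s' \<Longrightarrow> Q' s') \<Longrightarrow> does Z c s T' Q'"
  unfolding does_def using agree_run by auto

lemma does_SetThen:
  "aok e s \<Longrightarrow> aval e s = v \<Longrightarrow> \<bar>v\<bar> \<le> Z \<Longrightarrow> does Z c (s(S x := v)) T Q \<Longrightarrow>
    does Z (Set x e ;; c) s (1 + T) Q"
  using does_Then[OF does_Set] by blast

lemma does_PutThen:
  "j < 14 \<Longrightarrow> aok i s \<Longrightarrow> aval i s = m \<Longrightarrow> 0 \<le> m \<Longrightarrow> aok e s \<Longrightarrow> aval e s = v \<Longrightarrow> \<bar>v\<bar> \<le> Z \<Longrightarrow>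
    does Z c (s(Arr j m := v)) T Q \<Longrightarrow> does Z (Put j i e ;; c) s (1 + T) Q"
  using does_Then[OF does_Put] by blast

lemma does_ThenI:
  "does Z c1 s T1 P \<Longrightarrow> (\<And>s'. P s' \<Longrightarrow> agree c1 s s' \<Longrightarrow> does Z c2 s' T2 Q) \<Longrightarrow> does Z (c1 ;; c2) s (T1 + T2) Q"
  by (rule does_Then, erule does_conseq) auto

text \<open>Besides the invariant, each iteration may use that cells not written by the loop still
  have their values from before the loop.\<close>

lemma does_For:
  assumes e: "aok e s" "nat (aval e s) = m" "\<bar>aval e s\<bar> \<le> Z" and I0: "I 0 s"
    and step: "\<And>i s'. i < m \<Longrightarrow> I i s' \<Longrightarrow> agree (For x e c) s s' \<Longrightarrow>
      does Z c (s'(S x := int i)) T (I (Suc i))"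
    and Q: "\<And>s'. I m s' \<Longrightarrow> agree (For x e c) s s' \<Longrightarrow> Q s'"
  shows "does Z (For x e c) s (1 + m * (1 + T)) Q"
proof -
  let ?it = "\<lambda>i. iter i (\<lambda>i s. run c (s(S x := i))) s"
  have ag: "agree (For x e c) s (?it i)" for i
  proof (rule agree_iter)
    show "agree (For x e c) s (run c (s(S x := i)))" for i s
      using agree_run[of c "s(S x := i)"] unfolding agree_def by simp
  qed
  have I: "i \<le> m \<Longrightarrow> I i (?it i)" for i
  proof (induction i)
    case (Suc i)
    then have im: "i < m" by simp
    have "I i (?it i)" by (rule Suc.IH) (use im in simp)
    with im have "I (Suc i) (run c ((?it i)(S x := int i)))"
      using step[OF _ _ ag] unfolding does_def by blast
    then show ?case by (simp only: iter.simps)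
  qed (simp add: I0)
  have d: "does Z c ((?it i)(S x := int i)) T (I (Suc i))" if "i < m" for i
    by (rule step[OF that I ag]) (use that in simp)
  have "(\<Sum>i<m. 1 + cost c ((?it i)(S x := int i))) \<le> (\<Sum>i<m. 1 + T)"
    using d unfolding does_def by (intro sum_mono) simp
  then have "cost (For x e c) s \<le> 1 + m * (1 + T)" using e(2) by simp
  moreover have "ok Z (For x e c) s" using e d unfolding does_def by simp
  moreover have "Q (run (For x e c) s)" using Q[OF I[OF order_refl] ag] e(2) by simp
  ultimately show ?thesis unfolding does_def by blast
qed

text \<open>Variable 63 is a dummy target.\<close>

abbreviation "Skp \<equiv> Set 63 (Num 0)"

abbreviation plus_exp (infixl "\<^bold>+" 65) where "plus_exp \<equiv> Bop Plus"
abbreviation minus_exp (infixl "\<^bold>-" 65) where "minus_exp \<equiv> Bop Minus"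
abbreviation times_exp (infixl "\<^bold>*" 70) where "times_exp \<equiv> Bop Times"
abbreviation div_exp (infixl "\<^bold>div" 70) where "div_exp \<equiv> Bop Div"

text \<open>The data are unrolled into straight-line code, which is possible because they depend on
  the bilinear algorithm alone and not on the input.\<close>

primrec table :: "nat \<Rightarrow> (nat \<Rightarrow> int) \<Rightarrow> nat \<Rightarrow> cmd" where
  "table j f 0 = Skp"
| "table j f (Suc m) = table j f m ;; Put j (Num (int m)) (Num (f m))"

lemma does_table:
  assumes "j < 14" "\<And>i. i < m \<Longrightarrow> \<bar>f i\<bar> \<le> Z" "0 \<le> Z"
    and "\<And>s'. (\<forall>i<m. s' (Arr j (int i)) = f i) \<Longrightarrow> agree (table j f m) s s' \<Longrightarrow> Q s'"
  shows "does Z (table j f m) s (1 + m) Q"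
proof -
  have "does Z (table j f m) s (1 + m) (\<lambda>s'. \<forall>i<m. s' (Arr j (int i)) = f i)"
    using assms(2)
  proof (induction m)
    case 0
    then show ?case using assms(3) by (simp add: does_def)
  next
    case (Suc m)
    have "does Z (table j f (Suc m)) s ((1 + m) + 1) (\<lambda>s'. \<forall>i<Suc m. s' (Arr j (int i)) = f i)"
      unfolding table.simps
    proof (rule does_Then, rule does_conseq[OF Suc.IH])
      fix s' assume "\<forall>i<m. s' (Arr j (int i)) = f i"
      then show "does Z (Put j (Num (int m)) (Num (f m))) s' 1 (\<lambda>s'. \<forall>i<Suc m. s' (Arr j (int i)) = f i)"
        using Suc.prems assms(1) by (intro does_Put) (auto simp: less_Suc_eq)
    qed (use Suc.prems in auto)
    then show ?case by simp
  qed
  then show ?thesis by (rule does_conseq) (use assms(4) in auto)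
qed

lemma writes_table[simp]: "writes (table j f m) c \<longleftrightarrow> c = S 63 \<or> (0 < m \<and> (\<exists>i. c = Arr j i))"
  by (induction m) auto

section \<open>Matrix multiplication\<close>

text \<open>Applies the \<open>d\<close>-th Kronecker power of the \<open>r \<times> p\<close> matrix stored in array \<open>j\<close> to the vector in
  array \<open>x\<close>, one tensor factor after the other. Variable 4 holds \<open>d\<close> and variable \<open>sz\<close> the length
  \<open>p ^ d\<close> of the vector.\<close>

definition kron_entry :: "nat \<Rightarrow> nat \<Rightarrow> nat \<Rightarrow> nat \<Rightarrow> cmd" where
  "kron_entry j x p r =
     Set 24 (Var 23 \<^bold>div Var 21) ;;
     Set 25 (Var 24 \<^bold>div Num (int r)) ;;
     Set 26 (Var 24 \<^bold>- Var 25 \<^bold>* Num (int r)) ;;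
     Set 27 (Var 23 \<^bold>- Var 24 \<^bold>* Var 21) ;;
     Set 28 (Num 0) ;;
     For 29 (Num (int p)) (Set 28 (Var 28 \<^bold>+ Elt j (Var 26 \<^bold>* Num (int p) \<^bold>+ Var 29) \<^bold>*
       Elt x ((Var 25 \<^bold>* Num (int p) \<^bold>+ Var 29) \<^bold>* Var 21 \<^bold>+ Var 27))) ;;
     Put 5 (Var 23) (Var 28)"

text \<open>Applies one factor. On entry variables 20 and 21 hold \<open>r ^ l\<close> and
  \<open>p ^ (d - l)\<close>, whose product is the current length. Array 5 is a buffer, since each
  input entry is read for several outputs.\<close>

definition kron_level :: "nat \<Rightarrow> nat \<Rightarrow> nat \<Rightarrow> nat \<Rightarrow> cmd" where
  "kron_level j x p r =
     Set 21 (Var 21 \<^bold>div Num (int p)) ;;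
     For 23 (Var 20 \<^bold>* Num (int r) \<^bold>* Var 21) (kron_entry j x p r) ;;
     Set 20 (Var 20 \<^bold>* Num (int r)) ;;
     For 23 (Var 20 \<^bold>* Var 21) (Put x (Var 23) (Elt 5 (Var 23)))"

definition kron :: "nat \<Rightarrow> nat \<Rightarrow> nat \<Rightarrow> nat \<Rightarrow> nat \<Rightarrow> cmd" where
  "kron j x p r sz = Set 20 (Num 1) ;; Set 21 (Var sz) ;; For 22 (Var 4) (kron_level j x p r)"

text \<open>The vector after l factors have been applied: the l leading digits of its index are in
  base r, the other \<open>d - l\<close> still in base p.\<close>

definition level :: "nat \<Rightarrow> nat \<Rightarrow> (nat \<Rightarrow> nat \<Rightarrow> int) \<Rightarrow> nat \<Rightarrow> (nat \<Rightarrow> int) \<Rightarrow> nat \<Rightarrow> nat \<Rightarrow> int" where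
  "level r p U d y l o' = (\<Sum>g<p ^ l. kpow r p U l (o' div p ^ (d - l)) g * y (g * p ^ (d - l) + o' mod p ^ (d - l)))"

lemma level_0: "o' < p ^ d \<Longrightarrow> level r p U d y 0 o' = y o'"
  unfolding level_def by simp

lemma level_d: "level r p U d y d h = kapply r p U d y h"
  unfolding level_def kapply_def by simp

text \<open>Write the output index as (h r + i) m + t. It depends on the p inputs with index (h p +
  j) m + t, that is, with the digit i replaced by j; the identity is then
  \<open>kpow_step\<close>.\<close>

lemma level_Suc:
  assumes l: "l < d" and p: "0 < p" and r: "0 < r"
  defines "m \<equiv> p ^ (d - Suc l)"
  shows "level r p U d y (Suc l) o' =
    (\<Sum>j<p. U ((o' div m) mod r) j * level r p U d y l (((o' div m) div r * p + j) * m + o' mod m))"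
proof -
  define h where "h = (o' div m) div r"
  define i where "i = (o' div m) mod r"
  define t where "t = o' mod m"
  have m: "0 < m" using p unfolding m_def by simp
  have pm: "p ^ (d - l) = p * m" using l unfolding m_def by (simp add: Suc_diff_Suc flip: power_Suc)
  have t: "t < m" using m unfolding t_def by simp
  have o': "o' div m = h * r + i" unfolding h_def i_def by (simp only: div_mult_mod_eq)
  have lev: "level r p U d y l ((h * p + j) * m + t) =
      (\<Sum>g<p ^ l. kpow r p U l h g * y ((g * p + j) * m + t))" if j: "j < p" for j
  proof -
    have jt: "j * m + t < p * m" using j t by (rule mult_add_less)
    have eq: "(h * p + j) * m + t = h * (p * m) + (j * m + t)" by (simp add: algebra_simps)
    have "((h * p + j) * m + t) div (p * m) = h" "((h * p + j) * m + t) mod (p * m) = j * m + t"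
      unfolding eq using jt m p by (simp_all only: div_mult_self3 mod_mult_self3 div_less mod_less)
    then show ?thesis unfolding level_def pm by (simp add: algebra_simps)
  qed
  have "level r p U d y (Suc l) o' = (\<Sum>g<p ^ Suc l. kpow r p U (Suc l) (h * r + i) g * y (g * m + t))"
    unfolding level_def m_def[symmetric] o' t_def ..
  also have "\<dots> = (\<Sum>j<p. U i j * (\<Sum>g<p ^ l. kpow r p U l h g * y ((g * p + j) * m + t)))"
    using r unfolding i_def by (intro kpow_step[symmetric]) simp
  also have "\<dots> = (\<Sum>j<p. U i j * level r p U d y l ((h * p + j) * m + t))"
    using lev by simp
  finally show ?thesis unfolding h_def i_def t_def .
qed

lemma level_bound:
  assumes "\<And>i j. i < r \<Longrightarrow> j < p \<Longrightarrow> \<bar>U i j\<bar> \<le> \<mu>" "0 < r" "0 < p" "1 \<le> \<mu>" "\<And>g. g < p ^ d \<Longrightarrow> \<bar>y g\<bar> \<le> Y"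
    and l: "l \<le> d"
  shows "\<bar>level r p U d y l o'\<bar> \<le> (int p * \<mu>) ^ l * Y"
proof -
  have "\<bar>y (g * p ^ (d - l) + o' mod p ^ (d - l))\<bar> \<le> Y" if "g < p ^ l" for g
  proof -
    have "g * p ^ (d - l) + o' mod p ^ (d - l) < p ^ l * p ^ (d - l)"
      using that assms(3) by (intro mult_add_less) auto
    also have "\<dots> = p ^ d" using l by (simp flip: power_add)
    finally show ?thesis using assms(5) by blast
  qed
  moreover have "0 \<le> \<mu>" using assms(4) by simp
  ultimately have "\<bar>level r p U d y l o'\<bar> \<le> (\<Sum>g<p ^ l. \<mu> ^ l * Y)"
    unfolding level_def using kpow_bound[OF assms(1-3)]
    by (intro order_trans[OF sum_abs] sum_mono) (simp add: abs_mult mult_mono)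
  also have "\<dots> = (int p * \<mu>) ^ l * Y" by (simp add: power_mult_distrib)
  finally show ?thesis .
qed

lemma does_kron_entry:
  fixes s :: state
  assumes j: "j < 14" "x < 14" and p: "0 < p" and r: "0 < r" and l: "l < d"
  defines "m \<equiv> p ^ (d - Suc l)"
  assumes U: "\<And>i j'. i < r \<Longrightarrow> j' < p \<Longrightarrow> s (Arr j (int (i * p + j'))) = U i j'"
    and y: "\<And>i. i < r ^ l * p ^ (d - l) \<Longrightarrow> s (Arr x (int i)) = level r p U d y l i"
    and m: "s (S 21) = int m" and o': "s (S 23) = int o'" "o' < r ^ Suc l * m"
    and Z: "int (r ^ Suc l * m) \<le> Z" "int r \<le> Z" "int p \<le> Z" "(int p * \<mu>) ^ Suc l * Y \<le> Z"
    and \<mu>: "\<And>i j. i < r \<Longrightarrow> j < p \<Longrightarrow> \<bar>U i j\<bar> \<le> \<mu>" "1 \<le> \<mu>" and Y: "\<And>g. g < p ^ d \<Longrightarrow> \<bar>y g\<bar> \<le> Y"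
  shows "does Z (kron_entry j x p r) s (7 + 2 * p)
    (\<lambda>s'. s' (Arr 5 (int o')) = level r p U d y (Suc l) o' \<and> (\<forall>i. i \<noteq> int o' \<longrightarrow> s' (Arr 5 i) = s (Arr 5 i)))"
proof -
  have m0: "0 < m" using p unfolding m_def by simp
  define q where "q = o' div m"
  define h where "h = q div r"
  define i where "i = q mod r"
  define t where "t = o' mod m"
  have pm: "p ^ (d - l) = p * m" using l unfolding m_def by (simp add: Suc_diff_Suc flip: power_Suc)
  have i: "i < r" using r unfolding i_def by simp
  have t: "t < m" using m0 unfolding t_def by simp
  have od: "q < r ^ l * r" using o' unfolding q_def by (simp add: less_mult_imp_div_less mult.commute)
  then have h: "h < r ^ l" unfolding h_def by (simp add: less_mult_imp_div_less)
  have Y0: "0 \<le> Y" using Y[of 0] p by force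
  have oZ: "int o' \<le> Z" using o' Z(1) by linarith
  have Z0: "0 \<le> Z" using oZ by simp
  have qZ: "int q \<le> Z" using oZ div_le_dividend[of o' m] unfolding q_def by linarith
  have hZ: "int h \<le> Z" using qZ div_le_dividend[of q r] unfolding h_def by linarith
  have iZ: "int i \<le> Z" using i Z by simp
  have tZ: "int t \<le> Z" using oZ mod_less_eq_dividend[of o' m] unfolding t_def by linarith
  have q_eq: "int o' div int m = int q" unfolding q_def by (simp add: zdiv_int)
  have h_eq: "int q div int r = int h" unfolding h_def by (simp add: zdiv_int)
  have i_eq: "int q - int h * int r = int i"
    unfolding h_def i_def by (simp add: minus_div_mult_eq_mod zdiv_int zmod_int)
  have t_eq: "int o' - int q * int m = int t"
    unfolding t_def q_def by (simp add: minus_div_mult_eq_mod zdiv_int zmod_int)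
  let ?lev = "\<lambda>j. level r p U d y l ((h * p + j) * m + t)"
  let ?P = "\<lambda>J. \<Sum>j<J. U i j * ?lev j"
  have lev: "level r p U d y (Suc l) o' = ?P p"
    unfolding level_Suc[OF l p r] m_def[symmetric] h_def i_def t_def q_def ..
  \<comment> \<open>Partial sums have to be bounded too, since variable 28 holds each of them in
    turn.\<close>
  have PZ: "\<bar>?P J\<bar> \<le> Z" if "J \<le> p" for J
  proof -
    have "\<bar>?P J\<bar> \<le> (\<Sum>j<J. \<mu> * ((int p * \<mu>) ^ l * Y))"
    proof (intro order_trans[OF sum_abs] sum_mono)
      fix j assume "j \<in> {..<J}"
      then have "\<bar>U i j\<bar> \<le> \<mu>" using \<mu>(1) i that by simp
      moreover have "\<bar>?lev j\<bar> \<le> (int p * \<mu>) ^ l * Y"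
        by (rule level_bound[OF \<mu>(1) r p \<mu>(2) Y]) (use l in simp_all)
      ultimately show "\<bar>U i j * ?lev j\<bar> \<le> \<mu> * ((int p * \<mu>) ^ l * Y)"
        unfolding abs_mult using \<mu>(2) by (intro mult_mono) auto
    qed
    also have "\<dots> \<le> (\<Sum>j<p. \<mu> * ((int p * \<mu>) ^ l * Y))"
      using that \<mu>(2) Y0 by (intro sum_mono2) auto
    also have "\<dots> = (int p * \<mu>) ^ Suc l * Y" by simp
    finally show ?thesis using Z(4) by linarith
  qed
  have xidx: "s (Arr x (int ((h * p + J) * m + t))) = ?lev J" if "J < p" for J
  proof -
    have "h * p + J < r ^ l * p" using h that by (rule mult_add_less)
    then have "(h * p + J) * m + t < (r ^ l * p) * m" using t by (rule mult_add_less)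
    also have "\<dots> = r ^ l * p ^ (d - l)" unfolding pm by simp
    finally show ?thesis by (rule y)
  qed
  let ?loop = "For 29 (Num (int p)) (Set 28 (Var 28 \<^bold>+ Elt j (Var 26 \<^bold>* Num (int p) \<^bold>+ Var 29) \<^bold>*
       Elt x ((Var 25 \<^bold>* Num (int p) \<^bold>+ Var 29) \<^bold>* Var 21 \<^bold>+ Var 27)))"
  let ?s = "s(S 24 := int q, S 25 := int h, S 26 := int i, S 27 := int t, S 28 := 0)"
  have loop: "does Z ?loop ?s (1 + p * (1 + 1)) (\<lambda>s'. s' (S 28) = ?P p)"
  proof (rule does_For[where I = "\<lambda>J s'. s' (S 28) = ?P J"])
    fix J s' assume J: "J < p" and I: "s' (S 28) = ?P J" and ag: "agree ?loop ?s s'"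
    have v: "s' (S 21) = int m" "s' (S 25) = int h" "s' (S 26) = int i" "s' (S 27) = int t"
      using agreeD[OF ag] m by simp_all
    have e1: "s' (Arr j (int i * int p + int J)) = U i J"
      using agreeD[OF ag, of "Arr j (int i * int p + int J)"] U[OF i J] by simp
    have e2: "s' (Arr x ((int h * int p + int J) * int m + int t)) = ?lev J"
      using agreeD[OF ag, of "Arr x ((int h * int p + int J) * int m + int t)"] xidx[OF J] by simp
    show "does Z (Set 28 (Var 28 \<^bold>+ Elt j (Var 26 \<^bold>* Num (int p) \<^bold>+ Var 29) \<^bold>*
       Elt x ((Var 25 \<^bold>* Num (int p) \<^bold>+ Var 29) \<^bold>* Var 21 \<^bold>+ Var 27))) (s'(S 29 := int J)) 1
       (\<lambda>s'. s' (S 28) = ?P (Suc J))"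
      by (rule does_Set) (use I v e1 e2 j PZ[of "Suc J"] J in simp_all)
  qed (use Z in simp_all)
  have "does Z (kron_entry j x p r) s (1 + (1 + (1 + (1 + (1 + ((1 + p * (1 + 1)) + 1))))))
    (\<lambda>s'. s' (Arr 5 (int o')) = level r p U d y (Suc l) o' \<and> (\<forall>i. i \<noteq> int o' \<longrightarrow> s' (Arr 5 i) = s (Arr 5 i)))"
    unfolding kron_entry_def
    apply (rule does_SetThen[where v = "int q"], (simp; fail), (simp add: o' m q_eq; fail), (simp add: qZ; fail))
    apply (rule does_SetThen[where v = "int h"], (simp; fail), (simp add: h_eq; fail), (simp add: hZ; fail))
    apply (rule does_SetThen[where v = "int i"], (simp; fail), (simp add: i_eq; fail), (simp add: iZ; fail))
    apply (rule does_SetThen[where v = "int t"], (simp; fail), (simp add: o' m t_eq; fail), (simp add: tZ; fail))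
    apply (rule does_SetThen[where v = 0], (simp; fail), (simp; fail), (simp add: Z0; fail))
  proof (rule does_ThenI[OF loop])
    fix s' assume P: "s' (S 28) = ?P p" and ag: "agree ?loop ?s s'"
    have 23: "s' (S 23) = int o'" using agreeD[OF ag] o' by simp
    have A: "s' (Arr 5 i) = s (Arr 5 i)" for i using agreeD[OF ag] by simp
    show "does Z (Put 5 (Var 23) (Var 28)) s' 1
        (\<lambda>s'. s' (Arr 5 (int o')) = level r p U d y (Suc l) o' \<and> (\<forall>i. i \<noteq> int o' \<longrightarrow> s' (Arr 5 i) = s (Arr 5 i)))"
      by (rule does_Put) (use P 23 A lev PZ[of p] in simp_all)
  qed
  then show ?thesis by (rule does_conseq) auto
qed

lemma does_kron_level:
  fixes s :: state
  assumes j: "j < 14" "x < 14" "j \<noteq> 5" "x \<noteq> 5" "j \<noteq> x" and p: "0 < p" and r: "0 < r" and l: "l < d"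
  assumes U: "\<And>i j'. i < r \<Longrightarrow> j' < p \<Longrightarrow> s (Arr j (int (i * p + j'))) = U i j'"
    and y: "\<And>i. i < r ^ l * p ^ (d - l) \<Longrightarrow> s (Arr x (int i)) = level r p U d y l i"
    and s: "s (S 20) = int (r ^ l)" "s (S 21) = int (p ^ (d - l))"
    and B: "r ^ Suc l * p ^ (d - Suc l) \<le> B" "int B \<le> Z" and Z: "int r \<le> Z" "int p \<le> Z" "(int p * \<mu>) ^ d * Y \<le> Z"
    and \<mu>: "\<And>i j. i < r \<Longrightarrow> j < p \<Longrightarrow> \<bar>U i j\<bar> \<le> \<mu>" "1 \<le> \<mu>" and Y: "\<And>g. g < p ^ d \<Longrightarrow> \<bar>y g\<bar> \<le> Y"
  shows "does Z (kron_level j x p r) s (4 + B * (10 + 2 * p))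
    (\<lambda>s'. s' (S 20) = int (r ^ Suc l) \<and> s' (S 21) = int (p ^ (d - Suc l)) \<and>
      (\<forall>i < r ^ Suc l * p ^ (d - Suc l). s' (Arr x (int i)) = level r p U d y (Suc l) i))"
proof -
  define m where "m = p ^ (d - Suc l)"
  define h where "h = r ^ l"
  define E where "E = h * r * m"
  have E: "r ^ Suc l * p ^ (d - Suc l) = E" "E \<le> B" using B unfolding E_def m_def h_def by (simp_all add: mult_ac)
  have pm: "p ^ (d - l) = p * m" using l unfolding m_def by (simp add: Suc_diff_Suc flip: power_Suc)
  have m0: "0 < m" "0 < h" using p r unfolding m_def h_def by simp_all
  \<comment> \<open>The growth factor is at least 1, so the bound for the last level covers all
    earlier ones.\<close>
  have "1 \<le> int p * \<mu>" using mult_mono[of 1 "int p" 1 \<mu>] \<mu>(2) p by simp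
  moreover have Y0: "0 \<le> Y" using Y[of 0] p by force
  ultimately have Z4: "(int p * \<mu>) ^ Suc l * Y \<le> Z"
    using l Z(3) by (intro order_trans[OF mult_right_mono[OF power_increasing[of "Suc l" d]] Z(3)]) auto
  have EZ: "int E \<le> Z" using E B by linarith
  have "1 * m \<le> (h * r) * m" using m0 r by (intro mult_le_mono1) simp
  moreover have "(h * r) * 1 \<le> (h * r) * m" using m0 by (intro mult_le_mono2) simp
  ultimately have "m \<le> E" "h * r \<le> E" unfolding E_def by simp_all
  then have mhZ: "int m \<le> Z" "int (h * r) \<le> Z" using EZ by linarith+
  let ?c1 = "For 23 (Var 20 \<^bold>* Num (int r) \<^bold>* Var 21) (kron_entry j x p r)"
  let ?c2 = "For 23 (Var 20 \<^bold>* Var 21) (Put x (Var 23) (Elt 5 (Var 23)))"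
  let ?s = "s(S 21 := int m)"
  have w1: "\<not> writes ?c1 (S 20)" "\<not> writes ?c1 (S 21)" "\<And>j' i. j' \<noteq> 5 \<Longrightarrow> \<not> writes ?c1 (Arr j' i)"
    unfolding kron_entry_def by simp_all
  have loop1: "does Z ?c1 ?s (1 + E * (1 + (7 + 2 * p))) (\<lambda>s'. \<forall>i<E. s' (Arr 5 (int i)) = level r p U d y (Suc l) i)"
  proof (rule does_For[where I = "\<lambda>e s'. \<forall>i<e. s' (Arr 5 (int i)) = level r p U d y (Suc l) i"])
    fix e s' assume e: "e < E" and I: "\<forall>i<e. s' (Arr 5 (int i)) = level r p U d y (Suc l) i" and ag: "agree ?c1 ?s s'"
    let ?t = "s'(S 23 := int e)"
    have "does Z (kron_entry j x p r) ?t (7 + 2 * p) (\<lambda>s''. s'' (Arr 5 (int e)) = level r p U d y (Suc l) e \<and>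
        (\<forall>i. i \<noteq> int e \<longrightarrow> s'' (Arr 5 i) = ?t (Arr 5 i)))"
    proof (rule does_kron_entry[OF j(1,2) p r l _ _ _ _ _ _ Z(1,2) Z4 \<mu> Y, folded m_def])
      fix i j' assume "i < r" "j' < p"
      then show "?t (Arr j (int (i * p + j'))) = U i j'"
        using agreeD[OF ag w1(3)[OF j(3), of "int (i * p + j')"]] U[of i j'] by simp
    next
      fix i assume "i < r ^ l * p ^ (d - l)"
      then show "?t (Arr x (int i)) = level r p U d y l i"
        using agreeD[OF ag w1(3)[OF j(4), of "int i"]] y[of i] by simp
    next
      show "?t (S 21) = int m" using agreeD[OF ag w1(2)] by simp
    qed (use e E EZ in \<open>simp_all add: m_def\<close>)
    then show "does Z (kron_entry j x p r) ?t (7 + 2 * p) (\<lambda>s'. \<forall>i<Suc e. s' (Arr 5 (int i)) = level r p U d y (Suc l) i)"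
    proof (rule does_conseq)
      fix s'' assume A: "s'' (Arr 5 (int e)) = level r p U d y (Suc l) e \<and>
        (\<forall>i. i \<noteq> int e \<longrightarrow> s'' (Arr 5 i) = ?t (Arr 5 i))"
      show "\<forall>i<Suc e. s'' (Arr 5 (int i)) = level r p U d y (Suc l) i"
      proof (intro allI impI)
        fix i assume "i < Suc e"
        then show "s'' (Arr 5 (int i)) = level r p U d y (Suc l) i" using A I by (cases "i = e") simp_all
      qed
    qed simp
  qed (use s m0 EZ in \<open>simp_all add: E_def h_def nat_mult_distrib nat_power_eq\<close>)
  have main: "does Z (kron_level j x p r) s (1 + ((1 + E * (1 + (7 + 2 * p))) + (1 + (1 + E * (1 + 1)))))
    (\<lambda>s'. s' (S 20) = int (r ^ Suc l) \<and> s' (S 21) = int m \<and>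
      (\<forall>i < E. s' (Arr x (int i)) = level r p U d y (Suc l) i))"
    unfolding kron_level_def
  proof (rule does_SetThen[where v = "int m"])
    show "aval (Var 21 \<^bold>div Num (int p)) s = int m" using s p unfolding pm by simp
    show "does Z (?c1 ;; Set 20 (Var 20 \<^bold>* Num (int r)) ;; ?c2) ?s
       ((1 + E * (1 + (7 + 2 * p))) + (1 + (1 + E * (1 + 1))))
       (\<lambda>s'. s' (S 20) = int (r ^ Suc l) \<and> s' (S 21) = int m \<and>
          (\<forall>i<E. s' (Arr x (int i)) = level r p U d y (Suc l) i))"
    proof (rule does_ThenI[OF loop1])
      fix s1 assume I: "\<forall>i<E. s1 (Arr 5 (int i)) = level r p U d y (Suc l) i" and ag: "agree ?c1 ?s s1"
      have s1: "s1 (S 20) = int h" "s1 (S 21) = int m" using agreeD[OF ag w1(1)] agreeD[OF ag w1(2)] s by (simp_all add: h_def)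
      show "does Z (Set 20 (Var 20 \<^bold>* Num (int r)) ;; ?c2) s1 (1 + (1 + E * (1 + 1)))
         (\<lambda>s'. s' (S 20) = int (r ^ Suc l) \<and> s' (S 21) = int m \<and>
          (\<forall>i<E. s' (Arr x (int i)) = level r p U d y (Suc l) i))"
      proof (rule does_SetThen[where v = "int (h * r)"])
        let ?s1 = "s1(S 20 := int (h * r))"
        show "does Z ?c2 ?s1 (1 + E * (1 + 1)) (\<lambda>s'. s' (S 20) = int (r ^ Suc l) \<and> s' (S 21) = int m \<and>
          (\<forall>i<E. s' (Arr x (int i)) = level r p U d y (Suc l) i))"
        proof (rule does_For[where I = "\<lambda>e s'. \<forall>i<e. s' (Arr x (int i)) = level r p U d y (Suc l) i"])
          fix e s' assume e: "e < E" and I': "\<forall>i<e. s' (Arr x (int i)) = level r p U d y (Suc l) i" and ag: "agree ?c2 ?s1 s'"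
          have v: "s' (Arr 5 (int e)) = level r p U d y (Suc l) e"
            using agreeD[OF ag, of "Arr 5 (int e)"] I e j by simp
          have "\<bar>level r p U d y (Suc l) e\<bar> \<le> (int p * \<mu>) ^ Suc l * Y"
            by (rule level_bound[OF \<mu>(1) r p \<mu>(2) Y]) (use l in simp_all)
          then have vZ: "\<bar>level r p U d y (Suc l) e\<bar> \<le> Z" using Z4 by linarith
          show "does Z (Put x (Var 23) (Elt 5 (Var 23))) (s'(S 23 := int e)) 1
             (\<lambda>s'. \<forall>i<Suc e. s' (Arr x (int i)) = level r p U d y (Suc l) i)"
            by (rule does_Put) (use v vZ j I' in \<open>simp_all add: less_Suc_eq\<close>)
        next
          fix s' assume I': "\<forall>i<E. s' (Arr x (int i)) = level r p U d y (Suc l) i" and ag: "agree ?c2 ?s1 s'"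
          then show "s' (S 20) = int (r ^ Suc l) \<and> s' (S 21) = int m \<and>
          (\<forall>i<E. s' (Arr x (int i)) = level r p U d y (Suc l) i)"
            using agreeD[OF ag, of "S 20"] agreeD[OF ag, of "S 21"] s1 by (simp add: h_def mult.commute)
        qed (use s1 EZ in \<open>simp_all add: E_def nat_mult_distrib\<close>)
      qed (use s1 mhZ in simp_all)
    qed
  qed (use mhZ in simp_all)
  have arith: "1 + ((1 + E * (1 + (7 + 2 * p))) + (1 + (1 + E * (1 + 1)))) \<le> 4 + B * (10 + 2 * p)"
  proof -
    have "1 + ((1 + E * (1 + (7 + 2 * p))) + (1 + (1 + E * (1 + 1)))) = 4 + E * (10 + 2 * p)" by (simp add: algebra_simps)
    also have "\<dots> \<le> 4 + B * (10 + 2 * p)" using E(2) by (intro add_left_mono mult_le_mono1)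
    finally show ?thesis .
  qed
  have E1: "r ^ Suc l * m = E" using E(1) unfolding m_def .
  show ?thesis unfolding m_def[symmetric] E1 using main by (rule does_conseq) (use arith in simp_all)
qed

lemma writes_kron:
  "writes (kron j x p r sz) c \<longleftrightarrow> c \<in> {S 20, S 21, S 22, S 23, S 24, S 25, S 26, S 27, S 28, S 29} \<or> (\<exists>i. c = Arr 5 i \<or> c = Arr x i)"
  unfolding kron_def kron_level_def kron_entry_def
  by auto

text \<open>With b above both p and r, every intermediate vector has at most \<open>b ^ d\<close>
  entries, whether lengths shrink or grow. Variable 20 is set before \<open>sz\<close> is read,
  whence \<open>sz \<noteq> 20\<close>.\<close>

lemma does_kron:
  fixes s :: state
  assumes j: "j < 14" "x < 14" "j \<noteq> 5" "x \<noteq> 5" "j \<noteq> x" and p: "0 < p" "p \<le> b" and r: "0 < r" "r \<le> b"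
    and sz: "sz \<noteq> 20" "s (S sz) = int (p ^ d)" "s (S 4) = int d"
  assumes U: "\<And>i j'. i < r \<Longrightarrow> j' < p \<Longrightarrow> s (Arr j (int (i * p + j'))) = U i j'"
    and y: "\<And>i. i < p ^ d \<Longrightarrow> s (Arr x (int i)) = y i"
    and B: "int (b ^ d) \<le> Z" and Z: "int b \<le> Z" "int d \<le> Z" "(int p * \<mu>) ^ d * Y \<le> Z"
    and \<mu>: "\<And>i j. i < r \<Longrightarrow> j < p \<Longrightarrow> \<bar>U i j\<bar> \<le> \<mu>" "1 \<le> \<mu>" and Y: "\<And>g. g < p ^ d \<Longrightarrow> \<bar>y g\<bar> \<le> Y"
  shows "does Z (kron j x p r sz) s (3 + d * (5 + b ^ d * (10 + 2 * p)))
    (\<lambda>s'. \<forall>i < r ^ d. s' (Arr x (int i)) = kapply r p U d y i)"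
proof -
  have b: "r ^ l * p ^ (d - l) \<le> b ^ d" if "l \<le> d" for l
  proof -
    have "r ^ l * p ^ (d - l) \<le> b ^ l * b ^ (d - l)" using p r by (intro mult_le_mono power_mono) auto
    also have "\<dots> = b ^ d" using that by (simp flip: power_add)
    finally show ?thesis .
  qed
  have "p ^ d \<le> b ^ d" using b[of 0] by simp
  then have pd: "int (p ^ d) \<le> Z" using B by linarith
  have Z': "int r \<le> Z" "int p \<le> Z" using p r Z by linarith+
  let ?c = "For 22 (Var 4) (kron_level j x p r)"
  let ?s = "s(S 20 := 1, S 21 := int (p ^ d))"
  let ?I = "\<lambda>l s'. s' (S 20) = int (r ^ l) \<and> s' (S 21) = int (p ^ (d - l)) \<and>
      (\<forall>i < r ^ l * p ^ (d - l). s' (Arr x (int i)) = level r p U d y l i)"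
  have w: "\<And>i. \<not> writes ?c (Arr j i)" using j unfolding kron_level_def kron_entry_def by simp
  have loop: "does Z ?c ?s (1 + d * (1 + (4 + b ^ d * (10 + 2 * p)))) (\<lambda>s'. \<forall>i < r ^ d. s' (Arr x (int i)) = kapply r p U d y i)"
  proof (rule does_For[where I = ?I])
    fix l s' assume l: "l < d" and I: "?I l s'" and ag: "agree ?c ?s s'"
    show "does Z (kron_level j x p r) (s'(S 22 := int l)) (4 + b ^ d * (10 + 2 * p)) (?I (Suc l))"
    proof (rule does_kron_level[OF j p(1) r(1) l _ _ _ _ _ B Z' Z(3) \<mu> Y])
      fix i j' assume "i < r" "j' < p"
      then show "(s'(S 22 := int l)) (Arr j (int (i * p + j'))) = U i j'"
        using agreeD[OF ag w[of "int (i * p + j')"]] U[of i j'] by simp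
    qed (use I b[of "Suc l"] l in simp_all)
  next
    show "?I 0 ?s" using y by (simp add: level_0)
  next
    fix s' assume "?I d s'"
    then show "\<forall>i<r ^ d. s' (Arr x (int i)) = kapply r p U d y i" by (simp add: level_d)
  qed (use sz Z in simp_all)
  have "does Z (kron j x p r sz) s (1 + (1 + (1 + d * (1 + (4 + b ^ d * (10 + 2 * p))))))
    (\<lambda>s'. \<forall>i < r ^ d. s' (Arr x (int i)) = kapply r p U d y i)"
    unfolding kron_def
    apply (rule does_SetThen[where v = 1], (simp; fail), (simp; fail), (use Z' r in simp; fail))
    apply (rule does_SetThen[where v = "int (p ^ d)"], (simp; fail), (use sz in simp; fail), (use pd in simp; fail))
    by (rule loop)
  then show ?thesis by (rule does_conseq) simp_all
qed

section \<open>Multiplication of two stored matrices\<close>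

lemma not_writes_Inp[simp]: "\<not> writes c (Inp i)"
  by (induction c) auto

text \<open>An integral bilinear algorithm for one fixed size b with r products, correct up to the
  factor \<open>D\<close>. Everything in it is constant as far as the running time is
  concerned.\<close>

locale tensor_algorithm =
  fixes b r :: nat and U V W :: "nat \<Rightarrow> nat \<Rightarrow> int" and D \<mu> :: int
  assumes b: "2 \<le> b" and r: "b * b \<le> r" and D: "0 < D" and \<mu>: "1 \<le> \<mu>"
    and tensor: "\<And>q g h. q < b * b \<Longrightarrow> g < b * b \<Longrightarrow> h < b * b \<Longrightarrow>
      (\<Sum>s<r. W q s * U s g * V s h) = D * of_bool (mm_tensor b q g h)"
    and U: "\<And>s g. s < r \<Longrightarrow> g < b * b \<Longrightarrow> \<bar>U s g\<bar> \<le> \<mu>"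
    and V: "\<And>s g. s < r \<Longrightarrow> g < b * b \<Longrightarrow> \<bar>V s g\<bar> \<le> \<mu>"
    and W: "\<And>g s. g < b * b \<Longrightarrow> s < r \<Longrightarrow> \<bar>W g s\<bar> \<le> \<mu>"
begin

abbreviation "P \<equiv> b * b"

lemma P: "0 < P" "4 \<le> P" "0 < r" "0 < b"
proof -
  have "2 * 2 \<le> b * b" using b by (intro mult_le_mono)
  then show "0 < P" "4 \<le> P" "0 < r" "0 < b" using r b by auto
qed

text \<open>The matrix of the pair \<open>(u, w)\<close> of vertices of \<open>H\<close> occupies the \<open>P ^ d\<close> entries of array 0 from
  \<open>(u * k + w) * P ^ d\<close> on. Variables 30, 31, 32 hold \<open>v\<close>, \<open>a\<close>, \<open>c\<close>; the matrix of \<open>(a, c)\<close> is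
  multiplied entrywise by the product of those of \<open>(a, v)\<close> and \<open>(v, c)\<close>.\<close>

abbreviation block :: "nat \<Rightarrow> nat \<Rightarrow> nat \<Rightarrow> aexp" where
  "block u w q \<equiv> (Var u \<^bold>* Var 1 \<^bold>+ Var w) \<^bold>* Var 5 \<^bold>+ Var q"

definition load_factors :: cmd where
  "load_factors = For 33 (Var 5)
     (Put 3 (Var 33) (Elt 0 (block 31 30 33)) ;; Put 4 (Var 33) (Elt 0 (block 30 32 33)))"

definition pointwise :: cmd where
  "pointwise = For 33 (Var 6) (Put 3 (Var 33) (Elt 3 (Var 33) \<^bold>* Elt 4 (Var 33)))"

definition store_product :: cmd where
  "store_product = For 33 (Var 5)
     (Put 0 (block 31 32 33) (Elt 0 (block 31 32 33) \<^bold>* (Elt 3 (Var 33) \<^bold>div Var 7)))"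

definition multiply :: cmd where
  "multiply = load_factors ;; kron 6 3 P r 5 ;; kron 7 4 P r 5 ;; pointwise ;; kron 8 3 r P 6 ;; store_product"

text \<open>What stays fixed after the setup. Variable 7 is the denominator accumulated over d
  levels; arrays 6 to 8 hold the three coefficient tables.\<close>

definition globals :: "nat \<Rightarrow> nat \<Rightarrow> nat \<Rightarrow> state \<Rightarrow> bool" where
  "globals k n d s \<longleftrightarrow> s (S 1) = int k \<and> s (S 2) = int n \<and> s (S 3) = int (b ^ d) \<and> s (S 4) = int d \<and>
     s (S 5) = int (P ^ d) \<and> s (S 6) = int (r ^ d) \<and> s (S 7) = D ^ d \<and>
     (\<forall>i<r. \<forall>g<P. s (Arr 6 (int (i * P + g))) = U i g) \<and>
     (\<forall>i<r. \<forall>g<P. s (Arr 7 (int (i * P + g))) = V i g) \<and>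
     (\<forall>g<P. \<forall>i<r. s (Arr 8 (int (g * r + i))) = W g i)"

lemma globals_agree:
  assumes "globals k n d s" "agree c s s'"
    and "\<And>x. 1 \<le> x \<Longrightarrow> x \<le> 7 \<Longrightarrow> \<not> writes c (S x)" "\<And>j i. 6 \<le> j \<Longrightarrow> j \<le> 8 \<Longrightarrow> \<not> writes c (Arr j i)"
  shows "globals k n d s'"
proof -
  have x: "s' (S x) = s (S x)" if "1 \<le> x" "x \<le> 7" for x by (rule agreeD[OF assms(2) assms(3)[OF that]])
  have j: "s' (Arr j i) = s (Arr j i)" if "6 \<le> j" "j \<le> 8" for j i by (rule agreeD[OF assms(2) assms(4)[OF that]])
  show ?thesis using assms(1) unfolding globals_def by (simp add: x j)
qed

lemma power_P_le: "P ^ d \<le> r ^ d" "1 \<le> P ^ d" "1 \<le> r ^ d"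
  using r P by (simp_all add: power_mono)

text \<open>Three Kronecker powers at (15 + 2 r) d r^d each give the factor
  \<open>45 + 6 * r\<close>; the linear loops, at most 19 r^d, fit into the remaining term.\<close>

definition mult_time :: "nat \<Rightarrow> nat" where
  "mult_time d = (45 + 6 * r) * ((d + 1) * r ^ d)"

text \<open>Sizes along the way: Y for the entries, (P \<mu>)^d Y for their images under
  \<open>U\<close> and \<open>V\<close>, the square of that after pointwise multiplication, and a
  further factor (r \<mu>)^d after \<open>W\<close>. The last bound dominates the others.\<close>

lemma does_multiply:
  fixes s :: state
  assumes c: "globals k n d s" and v: "s (S 30) = int v" "s (S 31) = int a" "s (S 32) = int c"
    and Z: "int (r ^ d) \<le> Z" "int r \<le> Z" "int d \<le> Z"
    and AY: "\<And>q. q < P ^ d \<Longrightarrow> s (Arr 0 (int ((a * k + v) * P ^ d + q))) = A q \<and> \<bar>A q\<bar> \<le> Y"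
    and BY: "\<And>q. q < P ^ d \<Longrightarrow> s (Arr 0 (int ((v * k + c) * P ^ d + q))) = B q \<and> \<bar>B q\<bar> \<le> Y"
    and Y: "1 \<le> Y" "(int r * \<mu>) ^ d * ((int P * \<mu>) ^ d * Y) ^ 2 \<le> Z"
    and store: "\<And>q. q < P ^ d \<Longrightarrow> \<bar>s (Arr 0 (int ((a * k + c) * P ^ d + q))) *
        (\<Sum>z<b ^ d. A (pair_index b d (row_index b d q) z) * B (pair_index b d z (col_index b d q)))\<bar> \<le> Z"
  shows "does Z multiply s (mult_time d) (\<lambda>s'.
      (\<forall>q<P ^ d. s' (Arr 0 (int ((a * k + c) * P ^ d + q))) = s (Arr 0 (int ((a * k + c) * P ^ d + q))) *
        (\<Sum>z<b ^ d. A (pair_index b d (row_index b d q) z) * B (pair_index b d z (col_index b d q)))) \<and>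
      (\<forall>i. (\<forall>q<P ^ d. i \<noteq> int ((a * k + c) * P ^ d + q)) \<longrightarrow> s' (Arr 0 i) = s (Arr 0 i)))"
proof -
  define N where "N = P ^ d"
  define Q where "Q = r ^ d"
  have NQ: "N \<le> Q" "1 \<le> N" "1 \<le> Q" using power_P_le unfolding N_def Q_def by auto
  have NZ: "int N \<le> Z" "int Q \<le> Z" using NQ Z unfolding Q_def by linarith+
  define Y1 where "Y1 = (int P * \<mu>) ^ d * Y"
  have "1 * 1 \<le> int x * \<mu>" if "0 < x" for x :: nat using \<mu> that by (intro mult_mono) simp_all
  from this[OF P(1)] this[OF P(3)] have p1: "1 \<le> int P * \<mu>" "1 \<le> int r * \<mu>" by (simp_all only: mult_1)
  have p2: "1 \<le> (int P * \<mu>) ^ d" "1 \<le> (int r * \<mu>) ^ d" using p1 by (auto intro: one_le_power)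
  have "1 * Y \<le> Y1" unfolding Y1_def by (rule mult_right_mono[OF p2(1)]) (use Y(1) in simp)
  then have YY1: "Y \<le> Y1" "1 \<le> Y1" using Y(1) by simp_all
  have "Y1 * 1 \<le> Y1 * Y1" using YY1 by (intro mult_left_mono) auto
  then have Y1sq: "Y1 \<le> Y1 ^ 2" by (simp add: power2_eq_square)
  have "1 * Y1 ^ 2 \<le> (int r * \<mu>) ^ d * Y1 ^ 2" using p2(2) by (intro mult_right_mono) auto
  then have YZ: "Y1 ^ 2 \<le> Z" using Y(2) unfolding Y1_def by linarith
  then have Y1Z: "Y1 \<le> Z" using Y1sq by linarith
  have cs: "s (S 1) = int k" "s (S 5) = int N" "s (S 6) = int Q" "s (S 7) = D ^ d"
    using c unfolding globals_def N_def Q_def by auto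
  let ?row = "row_index b d" and ?col = "col_index b d" and ?pair = "pair_index b d"
  let ?prod = "\<lambda>q. \<Sum>z<b ^ d. A (?pair (?row q) z) * B (?pair z (?col q))"
  have load: "does Z load_factors s (1 + N * (1 + (1 + 1)))
      (\<lambda>s'. \<forall>q<N. s' (Arr 3 (int q)) = A q \<and> s' (Arr 4 (int q)) = B q)"
    unfolding load_factors_def
  proof (rule does_For[where I = "\<lambda>i s'. \<forall>q<i. s' (Arr 3 (int q)) = A q \<and> s' (Arr 4 (int q)) = B q"])
    fix i s'
    assume i: "i < N" and I: "\<forall>q<i. s' (Arr 3 (int q)) = A q \<and> s' (Arr 4 (int q)) = B q"
      and ag: "agree (For 33 (Var 5) (Put 3 (Var 33) (Elt 0 (block 31 30 33)) ;; Put 4 (Var 33) (Elt 0 (block 30 32 33)))) s s'"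
    have x: "s' (S 1) = int k" "s' (S 5) = int N" "s' (S 30) = int v" "s' (S 31) = int a" "s' (S 32) = int c"
      using agreeD[OF ag] cs v by simp_all
    have "s' (Arr 0 j) = s (Arr 0 j)" for j using agreeD[OF ag] by simp
    then have y: "s' (Arr 0 ((int a * int k + int v) * int N + int i)) = A i" "s' (Arr 0 ((int v * int k + int c) * int N + int i)) = B i"
      "\<bar>A i\<bar> \<le> Z" "\<bar>B i\<bar> \<le> Z"
      using AY[of i] BY[of i] i YY1 Y1Z unfolding N_def[symmetric] by simp_all
    show "does Z (Put 3 (Var 33) (Elt 0 (block 31 30 33)) ;; Put 4 (Var 33) (Elt 0 (block 30 32 33))) (s'(S 33 := int i)) (1 + 1)
      (\<lambda>s'. \<forall>q<Suc i. s' (Arr 3 (int q)) = A q \<and> s' (Arr 4 (int q)) = B q)"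
    proof (rule does_PutThen[where m = "int i" and v = "A i"])
      show "does Z (Put 4 (Var 33) (Elt 0 (block 30 32 33))) (s'(S 33 := int i, Arr 3 (int i) := A i)) 1
        (\<lambda>s'. \<forall>q<Suc i. s' (Arr 3 (int q)) = A q \<and> s' (Arr 4 (int q)) = B q)"
        by (rule does_Put) (use x y I in \<open>auto simp: less_Suc_eq\<close>)
    qed (use x y in simp_all)
  qed (use cs NZ in simp_all)
  let ?T1 = "3 + d * (5 + Q * (10 + 2 * P))" and ?T2 = "3 + d * (5 + Q * (10 + 2 * r))"
  let ?post = "\<lambda>s'. (\<forall>q<P ^ d. s' (Arr 0 (int ((a * k + c) * P ^ d + q))) = s (Arr 0 (int ((a * k + c) * P ^ d + q))) * ?prod q) \<and>
      (\<forall>i. (\<forall>q<P ^ d. i \<noteq> int ((a * k + c) * P ^ d + q)) \<longrightarrow> s' (Arr 0 i) = s (Arr 0 i))"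
  have main: "does Z multiply s ((1 + N * (1 + (1 + 1))) + (?T1 + (?T1 + ((1 + Q * (1 + 1)) + (?T2 + (1 + N * (1 + 1))))))) ?post"
    unfolding multiply_def
  proof (rule does_ThenI[OF load])
    fix s1 assume s1: "\<forall>q<N. s1 (Arr 3 (int q)) = A q \<and> s1 (Arr 4 (int q)) = B q" and ag1: "agree load_factors s s1"
    have c1: "globals k n d s1" by (rule globals_agree[OF c ag1]) (auto simp: load_factors_def)
    have f1: "s1 (Arr 0 i) = s (Arr 0 i)" "s1 (S 31) = int a" "s1 (S 32) = int c" for i
      using agreeD[OF ag1] v by (simp_all add: load_factors_def)
    have k1: "does Z (kron 6 3 P r 5) s1 ?T1 (\<lambda>s'. \<forall>i<r ^ d. s' (Arr 3 (int i)) = kapply r P U d A i)"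
      unfolding Q_def
    proof (rule does_kron[where Z = Z and \<mu> = \<mu> and Y = Y])
      fix g assume "g < P ^ d" then show "\<bar>A g\<bar> \<le> Y" using AY by blast
    qed (use c1 s1 P r Z U \<mu> Y1Z in \<open>simp_all add: globals_def N_def Y1_def\<close>)
    show "does Z (kron 6 3 P r 5 ;; kron 7 4 P r 5 ;; pointwise ;; kron 8 3 r P 6 ;; store_product) s1
       (?T1 + (?T1 + ((1 + Q * (1 + 1)) + (?T2 + (1 + N * (1 + 1)))))) ?post"
    proof (rule does_ThenI[OF k1])
      fix s2 assume s2: "\<forall>i<r ^ d. s2 (Arr 3 (int i)) = kapply r P U d A i" and ag2: "agree (kron 6 3 P r 5) s1 s2"
      have c2: "globals k n d s2" by (rule globals_agree[OF c1 ag2]) (auto simp: writes_kron)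
      have f2: "s2 (Arr 0 i) = s (Arr 0 i)" "s2 (Arr 4 i) = s1 (Arr 4 i)" "s2 (S 31) = int a" "s2 (S 32) = int c" for i
        using agreeD[OF ag2] f1 by (simp_all add: writes_kron)
      have k2: "does Z (kron 7 4 P r 5) s2 ?T1 (\<lambda>s'. \<forall>i<r ^ d. s' (Arr 4 (int i)) = kapply r P V d B i)"
        unfolding Q_def
      proof (rule does_kron[where Z = Z and \<mu> = \<mu> and Y = Y])
        fix g assume "g < P ^ d" then show "\<bar>B g\<bar> \<le> Y" using BY by blast
      qed (use c2 s1 f2 P r Z V \<mu> Y1Z in \<open>simp_all add: globals_def N_def Y1_def\<close>)
      show "does Z (kron 7 4 P r 5 ;; pointwise ;; kron 8 3 r P 6 ;; store_product) s2
         (?T1 + ((1 + Q * (1 + 1)) + (?T2 + (1 + N * (1 + 1))))) ?post"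
      proof (rule does_ThenI[OF k2])
        fix s3 assume s3: "\<forall>i<r ^ d. s3 (Arr 4 (int i)) = kapply r P V d B i" and ag3: "agree (kron 7 4 P r 5) s2 s3"
        have c3: "globals k n d s3" by (rule globals_agree[OF c2 ag3]) (auto simp: writes_kron)
        have f3: "s3 (Arr 0 i) = s (Arr 0 i)" "s3 (Arr 3 i) = s2 (Arr 3 i)" "s3 (S 31) = int a" "s3 (S 32) = int c" for i
          using agreeD[OF ag3] f2 by (simp_all add: writes_kron)
        let ?y = "\<lambda>i. kapply r P U d A i * kapply r P V d B i"
        have yb: "\<bar>?y i\<bar> \<le> Y1 ^ 2" for i
        proof -
          have "\<bar>kapply r P U d A i\<bar> \<le> Y1" "\<bar>kapply r P V d B i\<bar> \<le> Y1"
            unfolding Y1_def using U V P \<mu> AY BY by (intro kapply_bound; simp)+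
          then show ?thesis unfolding abs_mult power2_eq_square using YY1 by (intro mult_mono) auto
        qed
        have s36: "s3 (S 6) = int Q" using c3 unfolding globals_def Q_def by blast
        have pw: "does Z pointwise s3 (1 + Q * (1 + 1)) (\<lambda>s'. \<forall>i<Q. s' (Arr 3 (int i)) = ?y i)"
          unfolding pointwise_def
        \<comment> \<open>Array 3 is overwritten in place, so the invariant must also say that the
          entries from e on are still the old ones.\<close>
        proof (rule does_For[where I = "\<lambda>e s'. (\<forall>i<e. s' (Arr 3 (int i)) = ?y i) \<and> (\<forall>i\<ge>e. s' (Arr 3 (int i)) = s3 (Arr 3 (int i)))"])
          fix e s' assume e: "e < Q" and I: "(\<forall>i<e. s' (Arr 3 (int i)) = ?y i) \<and> (\<forall>i\<ge>e. s' (Arr 3 (int i)) = s3 (Arr 3 (int i)))"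
            and ag: "agree (For 33 (Var 6) (Put 3 (Var 33) (Elt 3 (Var 33) \<^bold>* Elt 4 (Var 33)))) s3 s'"
          have x: "s' (Arr 3 (int e)) = kapply r P U d A e" using I f3 s2 e unfolding Q_def by simp
          have "s' (Arr 4 (int e)) = s3 (Arr 4 (int e))" using agreeD[OF ag] by simp
          then have y: "s' (Arr 4 (int e)) = kapply r P V d B e" using s3 e unfolding Q_def by simp
          have yz: "\<bar>?y e\<bar> \<le> Z" using yb[of e] YZ by linarith
          show "does Z (Put 3 (Var 33) (Elt 3 (Var 33) \<^bold>* Elt 4 (Var 33))) (s'(S 33 := int e)) 1
            (\<lambda>s'. (\<forall>i<Suc e. s' (Arr 3 (int i)) = ?y i) \<and> (\<forall>i\<ge>Suc e. s' (Arr 3 (int i)) = s3 (Arr 3 (int i))))"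
            by (rule does_Put) (use x y yz I in \<open>simp_all add: less_Suc_eq\<close>)
        qed (use s36 NZ in simp_all)
        show "does Z (pointwise ;; kron 8 3 r P 6 ;; store_product) s3
           ((1 + Q * (1 + 1)) + (?T2 + (1 + N * (1 + 1)))) ?post"
        proof (rule does_ThenI[OF pw])
          fix s4 assume s4: "\<forall>i<Q. s4 (Arr 3 (int i)) = ?y i" and ag4: "agree pointwise s3 s4"
          have c4: "globals k n d s4" by (rule globals_agree[OF c3 ag4]) (auto simp: pointwise_def)
          have f4: "s4 (Arr 0 i) = s (Arr 0 i)" "s4 (S 31) = int a" "s4 (S 32) = int c" for i
            using agreeD[OF ag4] f3 by (simp_all add: pointwise_def)
          have k3: "does Z (kron 8 3 r P 6) s4 ?T2 (\<lambda>s'. \<forall>i<P ^ d. s' (Arr 3 (int i)) = kapply P r W d ?y i)"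
            unfolding Q_def
          proof (rule does_kron[where Z = Z and \<mu> = \<mu> and Y = "Y1 ^ 2"])
            show "(int r * \<mu>) ^ d * Y1\<^sup>2 \<le> Z" using Y(2) unfolding Y1_def .
          qed (use c4 s4 P r Z W \<mu> yb in \<open>simp_all add: globals_def Q_def\<close>)
          show "does Z (kron 8 3 r P 6 ;; store_product) s4 (?T2 + (1 + N * (1 + 1))) ?post"
          proof (rule does_ThenI[OF k3])
            fix s5 assume s5: "\<forall>i<P ^ d. s5 (Arr 3 (int i)) = kapply P r W d ?y i" and ag5: "agree (kron 8 3 r P 6) s4 s5"
            have c5: "globals k n d s5" by (rule globals_agree[OF c4 ag5]) (auto simp: writes_kron)
            have f5: "s5 (Arr 0 i) = s (Arr 0 i)" "s5 (S 31) = int a" "s5 (S 32) = int c" for i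
              using agreeD[OF ag5] f4 by (simp_all add: writes_kron)
            have cs5: "s5 (S 1) = int k" "s5 (S 5) = int N" "s5 (S 7) = D ^ d"
              using c5 unfolding globals_def N_def by auto
            \<comment> \<open>The division is exact: \<open>kapply_product\<close> leaves precisely
              the factor \<open>D ^ d\<close>.\<close>
            have q5: "s5 (Arr 3 (int q)) div D ^ d = ?prod q" if "q < N" for q
            proof -
              have "s5 (Arr 3 (int q)) = D ^ d * ?prod q"
                using s5 that kapply_product[OF tensor P(4), of q d A B] unfolding N_def by simp
              then show ?thesis using D by simp
            qed
            let ?f = "\<lambda>q. int ((a * k + c) * N + q)"
            show "does Z store_product s5 (1 + N * (1 + 1)) ?post"
              unfolding store_product_def N_def[symmetric]
            proof (rule does_For[where I = "\<lambda>e s'. (\<forall>q<e. s' (Arr 0 (?f q)) = s (Arr 0 (?f q)) * ?prod q) \<and>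
                (\<forall>i. (\<forall>q<e. i \<noteq> ?f q) \<longrightarrow> s' (Arr 0 i) = s (Arr 0 i))"])
              fix e s' assume e: "e < N" and I: "(\<forall>q<e. s' (Arr 0 (?f q)) = s (Arr 0 (?f q)) * ?prod q) \<and>
                (\<forall>i. (\<forall>q<e. i \<noteq> ?f q) \<longrightarrow> s' (Arr 0 i) = s (Arr 0 i))"
                and ag: "agree (For 33 (Var 5) (Put 0 (block 31 32 33) (Elt 0 (block 31 32 33) \<^bold>* (Elt 3 (Var 33) \<^bold>div Var 7)))) s5 s'"
              have x: "s' (S 1) = int k" "s' (S 5) = int N" "s' (S 7) = D ^ d" "s' (S 31) = int a" "s' (S 32) = int c"
                "s' (Arr 3 (int e)) = s5 (Arr 3 (int e))"
                using agreeD[OF ag] cs5 f5 by simp_all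
              have idx: "(int a * int k + int c) * int N + int e = ?f e" by simp
              have y: "s' (Arr 0 (?f e)) = s (Arr 0 (?f e))" using I by simp
              have val: "\<bar>s (Arr 0 (?f e)) * ?prod e\<bar> \<le> Z" using store e unfolding N_def by blast
              show "does Z (Put 0 (block 31 32 33) (Elt 0 (block 31 32 33) \<^bold>* (Elt 3 (Var 33) \<^bold>div Var 7))) (s'(S 33 := int e)) 1
                (\<lambda>s'. (\<forall>q<Suc e. s' (Arr 0 (?f q)) = s (Arr 0 (?f q)) * ?prod q) \<and>
                (\<forall>i. (\<forall>q<Suc e. i \<noteq> ?f q) \<longrightarrow> s' (Arr 0 i) = s (Arr 0 i)))"
              proof (rule does_Put)
                have ai: "aval (block 31 32 33) (s'(S 33 := int e)) = ?f e" using x idx by simp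
                have av: "aval (Elt 0 (block 31 32 33) \<^bold>* (Elt 3 (Var 33) \<^bold>div Var 7)) (s'(S 33 := int e)) =
                    s (Arr 0 (?f e)) * ?prod e"
                  using x q5[OF e] y by simp
                show "\<bar>aval (Elt 0 (block 31 32 33) \<^bold>* (Elt 3 (Var 33) \<^bold>div Var 7)) (s'(S 33 := int e))\<bar> \<le> Z"
                  unfolding av by (rule val)
                show "0 \<le> aval (block 31 32 33) (s'(S 33 := int e))" unfolding ai by simp
                show "(\<forall>q<Suc e. ((s'(S 33 := int e))(Arr 0 (aval (block 31 32 33) (s'(S 33 := int e))) :=
                    aval (Elt 0 (block 31 32 33) \<^bold>* (Elt 3 (Var 33) \<^bold>div Var 7)) (s'(S 33 := int e)))) (Arr 0 (?f q)) = s (Arr 0 (?f q)) * ?prod q) \<and>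
                  (\<forall>i. (\<forall>q<Suc e. i \<noteq> ?f q) \<longrightarrow> ((s'(S 33 := int e))(Arr 0 (aval (block 31 32 33) (s'(S 33 := int e))) :=
                    aval (Elt 0 (block 31 32 33) \<^bold>* (Elt 3 (Var 33) \<^bold>div Var 7)) (s'(S 33 := int e)))) (Arr 0 i) = s (Arr 0 i))"
                  unfolding ai av using I by (auto simp: less_Suc_eq simp del: of_nat_add of_nat_mult)
                show "aok (Elt 0 (block 31 32 33) \<^bold>* (Elt 3 (Var 33) \<^bold>div Var 7)) (s'(S 33 := int e))"
                  using ai by simp
              qed simp_all
            qed (use cs5 NZ f5 in simp_all)
          qed
        qed
      qed
    qed
  qed
  have arith: "(1 + N * (1 + (1 + 1))) + (?T1 + (?T1 + ((1 + Q * (1 + 1)) + (?T2 + (1 + N * (1 + 1)))))) \<le> mult_time d"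
  proof -
    have T: "d * (5 + Q * (10 + 2 * x)) \<le> (15 + 2 * r) * (d * Q)" if "x \<le> r" for x
    proof -
      have "d * (5 + Q * (10 + 2 * x)) \<le> d * (Q * 5 + Q * (10 + 2 * r))"
        using NQ that by (intro mult_le_mono2 add_mono) auto
      also have "\<dots> = (15 + 2 * r) * (d * Q)" by (simp add: algebra_simps)
      finally show ?thesis .
    qed
    have "(1 + N * (1 + (1 + 1))) + (?T1 + (?T1 + ((1 + Q * (1 + 1)) + (?T2 + (1 + N * (1 + 1)))))) \<le>
      12 + 7 * Q + 3 * ((15 + 2 * r) * (d * Q))"
    proof -
      have "(1 + N * (1 + (1 + 1))) + ((3 + t) + ((3 + t) + ((1 + Q * (1 + 1)) + ((3 + t') + (1 + N * (1 + 1)))))) \<le>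
          12 + 7 * Q + 3 * x" if "t \<le> x" "t' \<le> x" for t t' x
      proof -
        have "(1 + N * (1 + (1 + 1))) + ((3 + t) + ((3 + t) + ((1 + Q * (1 + 1)) + ((3 + t') + (1 + N * (1 + 1)))))) =
          12 + 5 * N + 2 * Q + 2 * t + t'" by simp
        then show ?thesis using that NQ by linarith
      qed
      then show ?thesis using T[OF r] T[OF order_refl] by blast
    qed
    also have "\<dots> \<le> 45 * Q + 3 * ((15 + 2 * r) * (d * Q))" using NQ by simp
    also have "\<dots> \<le> (45 + 6 * r) * ((d + 1) * Q)" by (simp add: algebra_simps)
    finally show ?thesis unfolding mult_time_def Q_def .
  qed
  show ?thesis by (rule does_conseq[OF main arith])
qed

lemma writes_multiply:
  "writes multiply c \<longleftrightarrow> c \<in> {S 20, S 21, S 22, S 23, S 24, S 25, S 26, S 27, S 28, S 29, S 33} \<or>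
    (\<exists>i. c = Arr 0 i \<or> c = Arr 3 i \<or> c = Arr 4 i \<or> c = Arr 5 i)"
  unfolding multiply_def load_factors_def pointwise_def store_product_def by (auto simp: writes_kron)

end

section \<open>Loading the input\<close>

context tensor_algorithm
begin

lemma does_SetI:
  "aok e s \<Longrightarrow> aval e s = v \<Longrightarrow> \<bar>v\<bar> \<le> Z \<Longrightarrow> Q (s(S x := v)) \<Longrightarrow> does Z (Set x e) s 1 Q"
  by (rule does_Set) auto

definition grow :: cmd where
  "grow = Set 3 (Var 3 \<^bold>* Num (int b)) ;; Set 4 (Var 4 \<^bold>+ Num 1) ;; Set 5 (Var 5 \<^bold>* Num (int P)) ;;
     Set 6 (Var 6 \<^bold>* Num (int r)) ;; Set 7 (Var 7 \<^bold>* Num D)"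

text \<open>The language has no unbounded loop, so d is found in n iterations, of which only the
  first \<open>depth n\<close> change anything.\<close>

definition sizes :: cmd where
  "sizes = Set 1 (In (Num 0)) ;; Set 2 (In (Num 1)) ;; Set 3 (Num 1) ;; Set 4 (Num 0) ;; Set 5 (Num 1) ;;
     Set 6 (Num 1) ;; Set 7 (Num 1) ;; For 8 (Var 2) (Cond (BLess (Var 3) (Var 2)) grow Skp)"

definition tables :: cmd where
  "tables = table 6 (\<lambda>i. U (i div P) (i mod P)) (r * P) ;; table 7 (\<lambda>i. V (i div P) (i mod P)) (r * P) ;;
     table 8 (\<lambda>i. W (i div r) (i mod r)) (P * r)"

text \<open>For positive n the ceiling of the logarithm of n to base b; matrices are padded to size
  \<open>b ^ depth n\<close>.\<close>

definition depth :: "nat \<Rightarrow> nat" where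
  "depth n = (LEAST d. n \<le> b ^ d)"

lemma le_power_self: "n \<le> b ^ n"
proof (induction n)
  case (Suc n)
  have "Suc n \<le> 2 * b ^ n" using Suc P(4) one_le_power[of b n] b by linarith
  also have "\<dots> \<le> b ^ Suc n" using b by simp
  finally show ?case .
qed simp

lemma depth: "n \<le> b ^ depth n" "depth n \<le> n" "l < depth n \<Longrightarrow> b ^ l < n"
proof -
  show "n \<le> b ^ depth n" unfolding depth_def by (rule LeastI[of _ n]) (rule le_power_self)
  show "depth n \<le> n" unfolding depth_def by (rule Least_le) (rule le_power_self)
  show "l < depth n \<Longrightarrow> b ^ l < n" unfolding depth_def using not_less_Least by force
qed

lemma does_sizes:
  fixes s :: state
  assumes inp: "s (Inp 0) = int k" "s (Inp 1) = int n" and d: "d = depth n"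
    and Z: "int k \<le> Z" "int n \<le> Z" "int (r ^ d) \<le> Z" "D ^ d \<le> Z" "1 \<le> Z"
  shows "does Z sizes s (8 + 7 * n) (\<lambda>s'. s' (S 1) = int k \<and> s' (S 2) = int n \<and> s' (S 3) = int (b ^ d) \<and> s' (S 4) = int d \<and>
     s' (S 5) = int (P ^ d) \<and> s' (S 6) = int (r ^ d) \<and> s' (S 7) = D ^ d)"
proof -
  let ?s = "s(S 1 := int k, S 2 := int n, S 3 := 1, S 4 := 0, S 5 := 1, S 6 := 1, S 7 := 1)"
  let ?c = "For 8 (Var 2) (Cond (BLess (Var 3) (Var 2)) grow Skp)"
  let ?I = "\<lambda>l s'. s' (S 3) = int (b ^ l) \<and> s' (S 4) = int l \<and> s' (S 5) = int (P ^ l) \<and> s' (S 6) = int (r ^ l) \<and> s' (S 7) = D ^ l"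
  have loop: "does Z ?c ?s (1 + n * (1 + (1 + 5))) (\<lambda>s'. s' (S 1) = int k \<and> s' (S 2) = int n \<and> ?I d s')"
  \<comment> \<open>The sizes stop growing after d iterations.\<close>
  proof (rule does_For[where I = "\<lambda>i s'. ?I (min i d) s'"])
    fix i s' assume i: "i < n" and I: "?I (min i d) s'" and ag: "agree ?c ?s s'"
    have n: "s' (S 2) = int n" using agreeD[OF ag] by (simp add: grow_def)
    show "does Z (Cond (BLess (Var 3) (Var 2)) grow Skp) (s'(S 8 := int i)) (1 + 5) (?I (min (Suc i) d))"
    proof (rule does_Cond)
      assume "bval (BLess (Var 3) (Var 2)) (s'(S 8 := int i))"
      then have less: "b ^ min i d < n" using I n by (simp flip: of_nat_power)
      have id: "i < d"
      proof (rule ccontr)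
        assume "\<not> i < d"
        then show False using less depth(1)[of n] d by simp
      qed
      then have m: "min i d = i" "min (Suc i) d = Suc i" by auto
      have mono: "b ^ Suc i \<le> r ^ d" "P ^ Suc i \<le> r ^ d" "r ^ Suc i \<le> r ^ d"
      proof -
        show rr: "r ^ Suc i \<le> r ^ d" using id P by (intro power_increasing) auto
        have "P ^ Suc i \<le> r ^ Suc i" using r by (intro power_mono) auto
        then show pr: "P ^ Suc i \<le> r ^ d" using rr by (rule order_trans)
        have "b \<le> P" using P by simp
        then have "b ^ Suc i \<le> P ^ Suc i" by (rule power_mono) simp
        then show "b ^ Suc i \<le> r ^ d" using pr by (rule order_trans)
      qed
      have DZ: "\<bar>D ^ Suc i\<bar> \<le> Z"
      proof -
        have "D ^ Suc i \<le> D ^ d" using id D by (intro power_increasing) auto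
        then show ?thesis using Z D by simp
      qed
      have dZ: "int (Suc i) \<le> Z" using id d depth(2)[of n] Z by linarith
      have rz: "int (b ^ Suc i) \<le> Z" "int (P ^ Suc i) \<le> Z" "int (r ^ Suc i) \<le> Z" using mono Z(3) by linarith+
      have "does Z grow (s'(S 8 := int i)) (1 + (1 + (1 + (1 + 1)))) (?I (Suc i))"
        unfolding grow_def
        apply (rule does_SetThen[where v = "int (b ^ Suc i)"], (simp; fail), (use I m in simp; fail), (use rz in simp; fail))
        apply (rule does_SetThen[where v = "int (Suc i)"], (simp; fail), (use I m in simp; fail), (use dZ in simp; fail))
        apply (rule does_SetThen[where v = "int (P ^ Suc i)"], (simp; fail), (use I m in simp; fail), (use rz in simp; fail))
        apply (rule does_SetThen[where v = "int (r ^ Suc i)"], (simp; fail), (use I m in simp; fail), (use rz in simp; fail))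
        by (rule does_Set) (use I m DZ in \<open>simp_all add: mult.commute\<close>)
      then show "does Z grow (s'(S 8 := int i)) 5 (?I (min (Suc i) d))" unfolding m by (rule does_conseq) auto
    next
      assume "\<not> bval (BLess (Var 3) (Var 2)) (s'(S 8 := int i))"
      then have less: "n \<le> b ^ min i d" using I n by (simp flip: of_nat_power)
      have "d \<le> i"
      proof (rule ccontr)
        assume "\<not> d \<le> i"
        then show False using less depth(3)[of i n] d by simp
      qed
      then have "min i d = d" "min (Suc i) d = d" by auto
      then have "does Z Skp (s'(S 8 := int i)) 1 (?I (min (Suc i) d))"
        using I Z by (intro does_Set) simp_all
      then show "does Z Skp (s'(S 8 := int i)) 5 (?I (min (Suc i) d))" by (rule does_conseq) auto
    qed simp
  next
    fix s' assume I: "?I (min n d) s'" and ag: "agree ?c ?s s'"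
    have "min n d = d" using d depth(2) by simp
    then show "s' (S 1) = int k \<and> s' (S 2) = int n \<and> ?I d s'" using I agreeD[OF ag] by (simp add: grow_def)
  qed (use Z in simp_all)
  have "does Z sizes s (1 + (1 + (1 + (1 + (1 + (1 + (1 + (1 + n * (1 + (1 + 5)))))))))) (\<lambda>s'. s' (S 1) = int k \<and> s' (S 2) = int n \<and> ?I d s')"
    unfolding sizes_def
    apply (rule does_SetThen[where v = "int k"], (simp; fail), (simp add: inp; fail), (use Z in simp; fail))
    apply (rule does_SetThen[where v = "int n"], (simp; fail), (simp add: inp; fail), (use Z in simp; fail))
    apply (rule does_SetThen[where v = 1], (simp; fail), (simp; fail), (use Z in simp; fail))
    apply (rule does_SetThen[where v = 0], (simp; fail), (simp; fail), (use Z in simp; fail))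
    apply (rule does_SetThen[where v = 1], (simp; fail), (simp; fail), (use Z in simp; fail))
    apply (rule does_SetThen[where v = 1], (simp; fail), (simp; fail), (use Z in simp; fail))
    apply (rule does_SetThen[where v = 1], (simp; fail), (simp; fail), (use Z in simp; fail))
    by (rule loop)
  then show ?thesis by (rule does_conseq) auto
qed

lemma does_tables:
  fixes s :: state
  assumes Z: "\<mu> \<le> Z"
  shows "does Z tables s (3 + 3 * (r * P)) (\<lambda>s'. (\<forall>i<r. \<forall>g<P. s' (Arr 6 (int (i * P + g))) = U i g) \<and>
     (\<forall>i<r. \<forall>g<P. s' (Arr 7 (int (i * P + g))) = V i g) \<and>
     (\<forall>g<P. \<forall>i<r. s' (Arr 8 (int (g * r + i))) = W g i))"
proof -
  have Z0: "0 \<le> Z" using Z \<mu> by simp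
  have bd: "i div P < r" "i mod P < P" if "i < r * P" for i
    using that P by (simp_all add: less_mult_imp_div_less)
  have bd': "i div r < P" "i mod r < r" if "i < P * r" for i
    using that P by (simp_all add: less_mult_imp_div_less)
  have UZ: "\<bar>U (i div P) (i mod P)\<bar> \<le> Z" "\<bar>V (i div P) (i mod P)\<bar> \<le> Z" if "i < r * P" for i
    using order_trans[OF U Z] order_trans[OF V Z] bd[OF that] by blast+
  have WZ: "\<bar>W (i div r) (i mod r)\<bar> \<le> Z" if "i < P * r" for i
    using order_trans[OF W Z] bd'[OF that] by blast
  have dm: "(i * c + g) div c = i" "(i * c + g) mod c = g" if "g < c" for i g c :: nat using that by auto
  have t1: "does Z (table 6 (\<lambda>i. U (i div P) (i mod P)) (r * P)) s (1 + r * P) (\<lambda>s'. \<forall>i<r * P. s' (Arr 6 (int i)) = U (i div P) (i mod P))" for s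
    by (rule does_table) (use Z0 UZ in simp_all)
  have t2: "does Z (table 7 (\<lambda>i. V (i div P) (i mod P)) (r * P)) s (1 + r * P) (\<lambda>s'. \<forall>i<r * P. s' (Arr 7 (int i)) = V (i div P) (i mod P))" for s
    by (rule does_table) (use Z0 UZ in simp_all)
  have t3: "does Z (table 8 (\<lambda>i. W (i div r) (i mod r)) (P * r)) s (1 + P * r) (\<lambda>s'. \<forall>i<P * r. s' (Arr 8 (int i)) = W (i div r) (i mod r))" for s
    by (rule does_table) (use Z0 WZ in simp_all)
  have "does Z tables s ((1 + r * P) + ((1 + r * P) + (1 + P * r))) (\<lambda>s'. (\<forall>i<r * P. s' (Arr 6 (int i)) = U (i div P) (i mod P)) \<and>
      (\<forall>i<r * P. s' (Arr 7 (int i)) = V (i div P) (i mod P)) \<and> (\<forall>i<P * r. s' (Arr 8 (int i)) = W (i div r) (i mod r)))"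
    unfolding tables_def
  proof (rule does_ThenI[OF t1], rule does_ThenI[OF t2], rule does_conseq[OF t3])
    fix s1 s2 s3
    assume 1: "\<forall>i<r * P. s1 (Arr 6 (int i)) = U (i div P) (i mod P)"
      and 2: "\<forall>i<r * P. s2 (Arr 7 (int i)) = V (i div P) (i mod P)" "agree (table 7 (\<lambda>i. V (i div P) (i mod P)) (r * P)) s1 s2"
      and 3: "\<forall>i<P * r. s3 (Arr 8 (int i)) = W (i div r) (i mod r)" "agree (table 8 (\<lambda>i. W (i div r) (i mod r)) (P * r)) s2 s3"
    have f: "s3 (Arr 6 i) = s1 (Arr 6 i)" "s3 (Arr 7 i) = s2 (Arr 7 i)" for i
      using agreeD[OF 2(2), of "Arr 6 i"] agreeD[OF 3(2)] by simp_all
    show "(\<forall>i<r * P. s3 (Arr 6 (int i)) = U (i div P) (i mod P)) \<and>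
      (\<forall>i<r * P. s3 (Arr 7 (int i)) = V (i div P) (i mod P)) \<and> (\<forall>i<P * r. s3 (Arr 8 (int i)) = W (i div r) (i mod r))"
      using 1 2(1) 3(1) unfolding f by (intro conjI)
  qed simp
  then show ?thesis
  proof (rule does_conseq)
    fix s' assume A: "(\<forall>i<r * P. s' (Arr 6 (int i)) = U (i div P) (i mod P)) \<and>
      (\<forall>i<r * P. s' (Arr 7 (int i)) = V (i div P) (i mod P)) \<and> (\<forall>i<P * r. s' (Arr 8 (int i)) = W (i div r) (i mod r))"
    show "(\<forall>i<r. \<forall>g<P. s' (Arr 6 (int (i * P + g))) = U i g) \<and>
     (\<forall>i<r. \<forall>g<P. s' (Arr 7 (int (i * P + g))) = V i g) \<and>
     (\<forall>g<P. \<forall>i<r. s' (Arr 8 (int (g * r + i))) = W g i)"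
    proof (intro conjI allI impI)
      fix i g assume ig: "i < r" "g < P"
      have "s' (Arr 6 (int (i * P + g))) = U ((i * P + g) div P) ((i * P + g) mod P)"
        "s' (Arr 7 (int (i * P + g))) = V ((i * P + g) div P) ((i * P + g) mod P)"
        "s' (Arr 8 (int (g * r + i))) = W ((g * r + i) div r) ((g * r + i) mod r)"
        using A mult_add_less[OF ig] mult_add_less[OF ig(2,1)] by blast+
      then show "s' (Arr 6 (int (i * P + g))) = U i g" "s' (Arr 7 (int (i * P + g))) = V i g"
        "s' (Arr 8 (int (g * r + i))) = W g i"
        by (simp_all only: dm[OF ig(2)] dm[OF ig(1)])
    qed
  qed (simp add: mult.commute)
qed

lemma does_setup:
  fixes s :: state
  assumes inp: "s (Inp 0) = int k" "s (Inp 1) = int n" and d: "d = depth n"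
    and Z: "int k \<le> Z" "int n \<le> Z" "int (r ^ d) \<le> Z" "D ^ d \<le> Z" "\<mu> \<le> Z"
  shows "does Z (tables ;; sizes) s (11 + 3 * (r * P) + 7 * n) (globals k n d)"
proof -
  have "does Z (tables ;; sizes) s ((3 + 3 * (r * P)) + (8 + 7 * n)) (globals k n d)"
  proof (rule does_ThenI[OF does_tables[OF Z(5)]])
    fix s1 assume 1: "(\<forall>i<r. \<forall>g<P. s1 (Arr 6 (int (i * P + g))) = U i g) \<and>
     (\<forall>i<r. \<forall>g<P. s1 (Arr 7 (int (i * P + g))) = V i g) \<and>
     (\<forall>g<P. \<forall>i<r. s1 (Arr 8 (int (g * r + i))) = W g i)" and ag: "agree tables s s1"
    have inp1: "s1 (Inp 0) = int k" "s1 (Inp 1) = int n" using agreeD[OF ag not_writes_Inp] inp by simp_all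
    show "does Z sizes s1 (8 + 7 * n) (globals k n d)"
    proof (rule does_conseq[OF does_sizes[OF inp1 d Z(1-4)]])
      show "1 \<le> Z" using Z(5) \<mu> by simp
      fix s' assume 2: "s' (S 1) = int k \<and> s' (S 2) = int n \<and> s' (S 3) = int (b ^ d) \<and> s' (S 4) = int d \<and>
        s' (S 5) = int (P ^ d) \<and> s' (S 6) = int (r ^ d) \<and> s' (S 7) = D ^ d" and ag: "agree sizes s1 s'"
      have "s' (Arr j i) = s1 (Arr j i)" for j i using agreeD[OF ag] by (simp add: sizes_def grow_def)
      then show "globals k n d s'" using 1 2 unfolding globals_def by simp
    qed simp
  qed
  then show ?thesis by (rule does_conseq) auto
qed

text \<open>Digits are read from the least significant end. Variable 12 is the unread part of q,
  variable 13 the weight b^l, variables 10 and 11 are the row and column found so far. Remainders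
  are expressed by \<open>Div\<close>.\<close>

definition digit :: cmd where
  "digit = Set 15 (Var 12 \<^bold>- (Var 12 \<^bold>div Num (int P)) \<^bold>* Num (int P)) ;;
     Set 10 (Var 10 \<^bold>+ (Var 15 \<^bold>div Num (int b)) \<^bold>* Var 13) ;;
     Set 11 (Var 11 \<^bold>+ (Var 15 \<^bold>- (Var 15 \<^bold>div Num (int b)) \<^bold>* Num (int b)) \<^bold>* Var 13) ;;
     Set 13 (Var 13 \<^bold>* Num (int b)) ;; Set 12 (Var 12 \<^bold>div Num (int P))"

definition decode :: cmd where
  "decode = Set 10 (Num 0) ;; Set 11 (Num 0) ;; Set 12 (Var 9) ;; Set 13 (Num 1) ;; For 14 (Var 4) digit ;;
     Put 9 (Var 9) (Var 10) ;; Put 10 (Var 9) (Var 11)"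

definition index_tables :: cmd where
  "index_tables = For 9 (Var 5) decode"

lemma int_mod_eq: "int x - int x div int y * int y = int (x mod y)"
  by (simp add: minus_div_mult_eq_mod zmod_int)

lemma does_decode:
  fixes s :: state
  assumes q: "s (S 9) = int q" "q < P ^ d" and d: "s (S 4) = int d"
    and Z: "int (P ^ d) \<le> Z" "int r \<le> Z" "int d \<le> Z"
  shows "does Z decode s (7 + 6 * d) (\<lambda>s'. s' (Arr 9 (int q)) = int (row_index b d q) \<and> s' (Arr 10 (int q)) = int (col_index b d q) \<and>
     (\<forall>i. i \<noteq> int q \<longrightarrow> s' (Arr 9 i) = s (Arr 9 i) \<and> s' (Arr 10 i) = s (Arr 10 i)))"
proof -
  have PZ: "int P \<le> Z" using r Z by linarith
  have bd: "b ^ l \<le> P ^ d" if "l \<le> d" for l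
  proof -
    have "b ^ l \<le> b ^ d" using that P by (intro power_increasing) auto
    also have "\<dots> \<le> P ^ d" using P by (intro power_mono) auto
    finally show ?thesis .
  qed
  have rcZ: "int (row_index b d q) \<le> Z" "int (col_index b d q) \<le> Z"
    using row_index_less[OF P(4), of d q] col_index_less[OF P(4), of d q] bd[of d] Z by linarith+
  let ?s = "s(S 10 := 0, S 11 := 0, S 12 := int q, S 13 := 1)"
  \<comment> \<open>The part decoded so far plus the weighted index of the unread digits is
    constant; the same equations bound the partial results.\<close>
  let ?I = "\<lambda>l s'. \<exists>x y. s' (S 10) = int x \<and> s' (S 11) = int y \<and> s' (S 12) = int (q div P ^ l) \<and> s' (S 13) = int (b ^ l) \<and>
     x + b ^ l * row_index b (d - l) (q div P ^ l) = row_index b d q \<and>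
     y + b ^ l * col_index b (d - l) (q div P ^ l) = col_index b d q"
  have loop: "does Z (For 14 (Var 4) digit) ?s (1 + d * (1 + 5))
    (\<lambda>s'. s' (S 10) = int (row_index b d q) \<and> s' (S 11) = int (col_index b d q))"
  proof (rule does_For[where I = ?I])
    fix l s' assume l: "l < d" and I: "?I l s'" and ag: "agree (For 14 (Var 4) digit) ?s s'"
    then obtain x y where xy: "s' (S 10) = int x" "s' (S 11) = int y" and tw: "s' (S 12) = int (q div P ^ l)" "s' (S 13) = int (b ^ l)"
      and x: "x + b ^ l * row_index b (d - l) (q div P ^ l) = row_index b d q"
      and y: "y + b ^ l * col_index b (d - l) (q div P ^ l) = col_index b d q" by blast
    define t where "t = q div P ^ l"
    define g where "g = t mod P"
    define m where "m = d - Suc l"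
    have dl: "d - l = Suc m" using l unfolding m_def by simp
    have t': "q div P ^ Suc l = t div P" unfolding t_def by (simp add: div_mult2_eq mult.commute[of P])
    define x' where "x' = x + (g div b) * b ^ l"
    define y' where "y' = y + (g mod b) * b ^ l"
    have x': "x' + b ^ Suc l * row_index b m (t div P) = row_index b d q"
      unfolding x[symmetric] dl t_def[symmetric] x'_def g_def by (simp add: algebra_simps)
    have y': "y' + b ^ Suc l * col_index b m (t div P) = col_index b d q"
      unfolding y[symmetric] dl t_def[symmetric] y'_def g_def by (simp add: algebra_simps)
    have gZ: "int g \<le> Z" using PZ P mod_less_divisor[of P t] unfolding g_def by linarith
    have xZ: "int x' \<le> Z" using x' rcZ by linarith
    have yZ: "int y' \<le> Z" using y' rcZ by linarith
    have pZ: "int (b ^ Suc l) \<le> Z" using bd[of "Suc l"] l Z by linarith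
    have "t div P \<le> q" unfolding t_def by (meson div_le_dividend le_trans)
    then have tZ: "int (t div P) \<le> Z" using q Z by linarith
    have t12: "s' (S 12) = int t" using tw unfolding t_def by simp
    have g_val: "aval (Var 12 \<^bold>- (Var 12 \<^bold>div Num (int P)) \<^bold>* Num (int P)) (s'(S 14 := int l)) = int g"
    proof -
      have "(s'(S 14 := int l)) (S 12) = int t" using t12 by simp
      then show ?thesis unfolding aval.simps binop_val.simps g_def by (simp only: int_mod_eq)
    qed
    have "does Z digit (s'(S 14 := int l)) (1 + (1 + (1 + (1 + 1))))
       (\<lambda>s'. s' (S 10) = int x' \<and> s' (S 11) = int y' \<and> s' (S 12) = int (t div P) \<and> s' (S 13) = int (b ^ Suc l))"
      unfolding digit_def
      apply (rule does_SetThen[where v = "int g"], (simp; fail), (rule g_val), (use gZ in simp; fail))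
      apply (rule does_SetThen[where v = "int x'"], (simp; fail), (simp add: xy tw x'_def zdiv_int; fail), (use xZ in simp; fail))
      apply (rule does_SetThen[where v = "int y'"], (simp; fail), (simp add: xy tw y'_def int_mod_eq; fail), (use yZ in simp; fail))
      apply (rule does_SetThen[where v = "int (b ^ Suc l)"], (simp; fail), (simp add: xy tw; fail), (use pZ in simp; fail))
      by (rule does_SetI[where v = "int (t div P)"], simp, simp add: t12 zdiv_int, use tZ in simp, simp)
    then show "does Z digit (s'(S 14 := int l)) 5 (?I (Suc l))"
      unfolding t' by (rule does_conseq) (use x' y' in \<open>auto simp: m_def\<close>)
  next
    show "?I 0 ?s" using q by (intro exI[of _ 0]) simp
  qed (use d Z in auto)
  have "does Z decode s (1 + (1 + (1 + (1 + ((1 + d * (1 + 5)) + (1 + 1))))))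
    (\<lambda>s'. s' (Arr 9 (int q)) = int (row_index b d q) \<and> s' (Arr 10 (int q)) = int (col_index b d q) \<and>
     (\<forall>i. i \<noteq> int q \<longrightarrow> s' (Arr 9 i) = s (Arr 9 i) \<and> s' (Arr 10 i) = s (Arr 10 i)))"
    unfolding decode_def
    apply (rule does_SetThen[where v = 0], (simp; fail), (simp; fail), (use Z in simp; fail))
    apply (rule does_SetThen[where v = 0], (simp; fail), (simp; fail), (use Z in simp; fail))
    apply (rule does_SetThen[where v = "int q"], (simp; fail), (simp add: q; fail), (use q Z in linarith))
    apply (rule does_SetThen[where v = 1], (simp; fail), (simp; fail), (use PZ P in linarith))
  proof (rule does_ThenI[OF loop])
    fix s1 assume 1: "s1 (S 10) = int (row_index b d q) \<and> s1 (S 11) = int (col_index b d q)"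
      and ag: "agree (For 14 (Var 4) digit) ?s s1"
    have 2: "s1 (S 9) = int q" "s1 (Arr 9 i) = s (Arr 9 i)" "s1 (Arr 10 i) = s (Arr 10 i)" for i
      using agreeD[OF ag] q by (simp_all add: digit_def)
    show "does Z (Put 9 (Var 9) (Var 10) ;; Put 10 (Var 9) (Var 11)) s1 (1 + 1)
       (\<lambda>s'. s' (Arr 9 (int q)) = int (row_index b d q) \<and> s' (Arr 10 (int q)) = int (col_index b d q) \<and>
     (\<forall>i. i \<noteq> int q \<longrightarrow> s' (Arr 9 i) = s (Arr 9 i) \<and> s' (Arr 10 i) = s (Arr 10 i)))"
    proof (rule does_PutThen[where m = "int q" and v = "int (row_index b d q)"])
      show "does Z (Put 10 (Var 9) (Var 11)) (s1(Arr 9 (int q) := int (row_index b d q))) 1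
       (\<lambda>s'. s' (Arr 9 (int q)) = int (row_index b d q) \<and> s' (Arr 10 (int q)) = int (col_index b d q) \<and>
     (\<forall>i. i \<noteq> int q \<longrightarrow> s' (Arr 9 i) = s (Arr 9 i) \<and> s' (Arr 10 i) = s (Arr 10 i)))"
        by (rule does_Put) (use 1 2 rcZ in simp_all)
    qed (use 1 2 rcZ in simp_all)
  qed
  then show ?thesis by (rule does_conseq) auto
qed

lemma does_index_tables:
  fixes s :: state
  assumes g: "globals k n d s" and Z: "int (r ^ d) \<le> Z" "int r \<le> Z" "int d \<le> Z"
  shows "does Z index_tables s (1 + P ^ d * (8 + 6 * d))
    (\<lambda>s'. \<forall>q<P ^ d. s' (Arr 9 (int q)) = int (row_index b d q) \<and> s' (Arr 10 (int q)) = int (col_index b d q))"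
proof -
  have PZ: "int (P ^ d) \<le> Z" using power_P_le(1)[of d] Z by linarith
  have s: "s (S 4) = int d" "s (S 5) = int (P ^ d)" using g unfolding globals_def by auto
  have "does Z index_tables s (1 + P ^ d * (1 + (7 + 6 * d)))
    (\<lambda>s'. \<forall>q<P ^ d. s' (Arr 9 (int q)) = int (row_index b d q) \<and> s' (Arr 10 (int q)) = int (col_index b d q))"
    unfolding index_tables_def
  proof (rule does_For[where I = "\<lambda>i s'. \<forall>q<i. s' (Arr 9 (int q)) = int (row_index b d q) \<and> s' (Arr 10 (int q)) = int (col_index b d q)"])
    fix i s' assume i: "i < P ^ d" and I: "\<forall>q<i. s' (Arr 9 (int q)) = int (row_index b d q) \<and> s' (Arr 10 (int q)) = int (col_index b d q)"
      and ag: "agree (For 9 (Var 5) decode) s s'"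
    have "s' (S 4) = int d" using agreeD[OF ag] s by (simp add: decode_def digit_def)
    then have 4: "(s'(S 9 := int i)) (S 4) = int d" by simp
    have 9: "(s'(S 9 := int i)) (S 9) = int i" by simp
    show "does Z decode (s'(S 9 := int i)) (7 + 6 * d)
      (\<lambda>s'. \<forall>q<Suc i. s' (Arr 9 (int q)) = int (row_index b d q) \<and> s' (Arr 10 (int q)) = int (col_index b d q))"
      by (rule does_conseq[OF does_decode[OF 9 i 4 PZ Z(2,3)]]) (use I in \<open>simp_all add: less_Suc_eq\<close>)
  next
    show "nat (aval (Var 5) s) = P ^ d" unfolding aval.simps s(2) by (rule nat_int)
    show "\<bar>aval (Var 5) s\<bar> \<le> Z" unfolding aval.simps s(2) using PZ by linarith
  qed simp_all
  then show ?thesis by (rule does_conseq) auto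
qed

text \<open>Produces \<open>hom_weight\<close> padded by 0 outside the n by n square. The two sizes
  come first in the input, then the \<open>k * k\<close> entries for \<open>H\<close>, then those
  for \<open>G\<close>.\<close>

definition input_entry :: cmd where
  "input_entry = Cond (BLess (Var 18) (Var 2)) (Cond (BLess (Var 19) (Var 2))
     (Cond (BEq (In (Num 2 \<^bold>+ Var 16)) (Num 1))
       (Set 11 (In (Num 2 \<^bold>+ Var 1 \<^bold>* Var 1 \<^bold>+ Var 18 \<^bold>* Var 2 \<^bold>+ Var 19))) (Set 11 (Num 1)))
     (Set 11 (Num 0))) (Set 11 (Num 0))"

definition load_entry :: cmd where
  "load_entry = Set 16 (Var 9 \<^bold>div Var 5) ;; Set 17 (Var 9 \<^bold>- Var 9 \<^bold>div Var 5 \<^bold>* Var 5) ;; Set 18 (Elt 9 (Var 17)) ;;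
     Set 19 (Elt 10 (Var 17)) ;; input_entry ;; Put 0 (Var 9) (Var 11)"

definition load_matrices :: cmd where
  "load_matrices = For 9 (Var 1 \<^bold>* Var 1 \<^bold>* Var 5) load_entry"

definition entry :: "nat \<Rightarrow> nat \<Rightarrow> nat \<Rightarrow> state \<Rightarrow> nat \<Rightarrow> nat \<Rightarrow> int" where
  "entry k n d s e q = (let x = row_index b d q; y = col_index b d q in
     if x < n \<and> y < n then if s (Inp (2 + int e)) = 1 then s (Inp (int (2 + k * k + x * n + y))) else 1 else 0)"

lemma does_load_matrices:
  fixes s :: state
  assumes g: "globals k n d s" and Z: "int (k * k * P ^ d) \<le> Z" "int (r ^ d) \<le> Z" "1 \<le> Z" and inp: "\<And>i. \<bar>s (Inp i)\<bar> \<le> Z"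
    and ix: "\<forall>q<P ^ d. s (Arr 9 (int q)) = int (row_index b d q) \<and> s (Arr 10 (int q)) = int (col_index b d q)"
  shows "does Z load_matrices s (1 + k * k * P ^ d * 10)
    (\<lambda>s'. \<forall>e<k * k * P ^ d. s' (Arr 0 (int e)) = entry k n d s (e div P ^ d) (e mod P ^ d))"
proof -
  define N where "N = P ^ d"
  have N: "1 \<le> N" "int N \<le> Z" using power_P_le[of d] Z unfolding N_def by linarith+
  have s: "s (S 1) = int k" "s (S 2) = int n" "s (S 5) = int N" using g unfolding globals_def N_def by auto
  have ZN: "int (k * k * N) \<le> Z" using Z(1) unfolding N_def .
  have bN: "b ^ d \<le> N" unfolding N_def using P by (intro power_mono) auto
  have "does Z load_matrices s (1 + k * k * N * (1 + 9))
    (\<lambda>s'. \<forall>e<k * k * N. s' (Arr 0 (int e)) = entry k n d s (e div N) (e mod N))"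
    unfolding load_matrices_def
  proof (rule does_For[where I = "\<lambda>i s'. \<forall>e<i. s' (Arr 0 (int e)) = entry k n d s (e div N) (e mod N)"])
    fix i s' assume i: "i < k * k * N" and I: "\<forall>e<i. s' (Arr 0 (int e)) = entry k n d s (e div N) (e mod N)"
      and ag: "agree (For 9 (Var 1 \<^bold>* Var 1 \<^bold>* Var 5) load_entry) s s'"
    have s': "s' (S 1) = int k" "s' (S 2) = int n" "s' (S 5) = int N" "s' (Arr 9 j) = s (Arr 9 j)" "s' (Arr 10 j) = s (Arr 10 j)" "s' (Inp j) = s (Inp j)" for j
      using agreeD[OF ag] s by (simp_all add: load_entry_def input_entry_def)
    define e where "e = i div N"
    define q where "q = i mod N"
    define x where "x = row_index b d q"
    define y where "y = col_index b d q"
    have q: "q < N" using N unfolding q_def by simp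
    have eZ: "int e \<le> Z" "int q \<le> Z" using i q N Z div_le_dividend[of i N] unfolding e_def N_def by linarith+
    have xyZ: "int x \<le> Z" "int y \<le> Z"
      using row_index_less[OF P(4), of d q] col_index_less[OF P(4), of d q] bN N unfolding x_def y_def by linarith+
    have xy: "s (Arr 9 (int q)) = int x" "s (Arr 10 (int q)) = int y" using ix q unfolding N_def x_def y_def by auto
    let ?v = "entry k n d s e q"
    have vZ: "\<bar>?v\<bar> \<le> Z" unfolding entry_def Let_def using inp Z by auto
    let ?t = "s'(S 9 := int i, S 16 := int e, S 17 := int q, S 18 := int x, S 19 := int y)"
    have ie: "does Z input_entry ?t (1 + (1 + (1 + 1))) (\<lambda>s''. s'' (S 11) = ?v)"
    proof -
      have idx: "2 + int k * int k + int x * int n + int y = int (2 + k * k + x * n + y)" by simp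
      have "does Z (Set 11 (Num 0)) ?t 1 (\<lambda>s''. s'' (S 11) = ?v)" if "\<not> (x < n \<and> y < n)"
        by (rule does_Set) (use that Z in \<open>auto simp: entry_def Let_def x_def y_def\<close>)
      note zero = this
      have z2: "does Z (Set 11 (Num 0)) ?t (1 + 1) (\<lambda>s''. s'' (S 11) = ?v)" if "\<not> (x < n \<and> y < n)"
        by (rule does_conseq[OF zero[OF that]]) simp_all
      have z3: "does Z (Set 11 (Num 0)) ?t (1 + (1 + 1)) (\<lambda>s''. s'' (S 11) = ?v)" if "\<not> (x < n \<and> y < n)"
        by (rule does_conseq[OF zero[OF that]]) simp_all
      show ?thesis unfolding input_entry_def
      proof (rule does_Cond)
        assume "bval (BLess (Var 18) (Var 2)) ?t"
        then have xn: "x < n" using s' by simp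
        show "does Z (Cond (BLess (Var 19) (Var 2)) (Cond (BEq (In (Num 2 \<^bold>+ Var 16)) (Num 1))
           (Set 11 (In (Num 2 \<^bold>+ Var 1 \<^bold>* Var 1 \<^bold>+ Var 18 \<^bold>* Var 2 \<^bold>+ Var 19))) (Set 11 (Num 1))) (Set 11 (Num 0))) ?t (1 + (1 + 1)) (\<lambda>s''. s'' (S 11) = ?v)"
        proof (rule does_Cond)
          assume "bval (BLess (Var 19) (Var 2)) ?t"
          then have yn: "y < n" using s' by simp
          have v: "?v = (if s (Inp (2 + int e)) = 1 then s (Inp (int (2 + k * k + x * n + y))) else 1)"
            using xn yn unfolding entry_def Let_def x_def y_def by simp
          show "does Z (Cond (BEq (In (Num 2 \<^bold>+ Var 16)) (Num 1))
           (Set 11 (In (Num 2 \<^bold>+ Var 1 \<^bold>* Var 1 \<^bold>+ Var 18 \<^bold>* Var 2 \<^bold>+ Var 19))) (Set 11 (Num 1))) ?t (1 + 1) (\<lambda>s''. s'' (S 11) = ?v)"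
          proof (rule does_Cond)
            assume "bval (BEq (In (Num 2 \<^bold>+ Var 16)) (Num 1)) ?t"
            then have c1: "s (Inp (2 + int e)) = 1" using s' by simp
            have "?v = s (Inp (2 + int k * int k + int x * int n + int y))" unfolding v idx using c1 by simp
            then show "does Z (Set 11 (In (Num 2 \<^bold>+ Var 1 \<^bold>* Var 1 \<^bold>+ Var 18 \<^bold>* Var 2 \<^bold>+ Var 19))) ?t 1 (\<lambda>s''. s'' (S 11) = ?v)"
              by (intro does_Set) (use s' inp in simp_all)
          next
            assume "\<not> bval (BEq (In (Num 2 \<^bold>+ Var 16)) (Num 1)) ?t"
            then have "?v = 1" using s' v by simp
            then show "does Z (Set 11 (Num 1)) ?t 1 (\<lambda>s''. s'' (S 11) = ?v)"
              by (intro does_Set) (use Z in simp_all)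
          qed simp
        next
          assume "\<not> bval (BLess (Var 19) (Var 2)) ?t"
          then show "does Z (Set 11 (Num 0)) ?t (1 + 1) (\<lambda>s''. s'' (S 11) = ?v)" using s' by (intro z2) simp
        qed simp
      next
        assume "\<not> bval (BLess (Var 18) (Var 2)) ?t"
        then show "does Z (Set 11 (Num 0)) ?t (1 + (1 + 1)) (\<lambda>s''. s'' (S 11) = ?v)" using s' by (intro z3) simp
      qed simp
    qed
    have "does Z load_entry (s'(S 9 := int i)) (1 + (1 + (1 + (1 + ((1 + (1 + (1 + 1))) + 1)))))
      (\<lambda>s'. \<forall>e<Suc i. s' (Arr 0 (int e)) = entry k n d s (e div N) (e mod N))"
      unfolding load_entry_def
      apply (rule does_SetThen[where v = "int e"], (simp; fail), (simp add: s' e_def zdiv_int; fail), (use eZ in simp; fail))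
      apply (rule does_SetThen[where v = "int q"], (simp; fail), (simp add: s' q_def int_mod_eq; fail), (use eZ in simp; fail))
      apply (rule does_SetThen[where v = "int x"], (simp; fail), (simp add: s' xy; fail), (use xyZ in simp; fail))
      apply (rule does_SetThen[where v = "int y"], (simp; fail), (simp add: s' xy; fail), (use xyZ in simp; fail))
    proof (rule does_ThenI[OF ie])
      fix s1 assume 1: "s1 (S 11) = ?v" and ag: "agree input_entry ?t s1"
      have 2: "s1 (S 9) = int i" "s1 (Arr 0 j) = s' (Arr 0 j)" for j using agreeD[OF ag] by (simp_all add: input_entry_def)
      show "does Z (Put 0 (Var 9) (Var 11)) s1 1 (\<lambda>s'. \<forall>e<Suc i. s' (Arr 0 (int e)) = entry k n d s (e div N) (e mod N))"
        by (rule does_Put) (use 1 2 vZ I in \<open>simp_all add: less_Suc_eq e_def q_def\<close>)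
    qed
    then show "does Z load_entry (s'(S 9 := int i)) 9
      (\<lambda>s'. \<forall>e<Suc i. s' (Arr 0 (int e)) = entry k n d s (e div N) (e mod N))" by (rule does_conseq) auto
  qed (use s ZN in \<open>simp_all add: nat_mult_distrib\<close>)
  then show ?thesis unfolding N_def by (rule does_conseq) auto
qed

text \<open>Array 1 is a working copy of the adjacency matrix of \<open>H\<close>, to which
  eliminations add edges; array 2 marks the vertices that remain.\<close>

definition load_graph :: cmd where
  "load_graph = For 9 (Var 1 \<^bold>* Var 1) (Put 1 (Var 9) (In (Num 2 \<^bold>+ Var 9))) ;; For 9 (Var 1) (Put 2 (Var 9) (Num 1))"

lemma does_load_graph:
  fixes s :: state
  assumes k: "s (S 1) = int k" and Z: "int (k * k) \<le> Z" "int k \<le> Z" "1 \<le> Z" and inp: "\<And>i. \<bar>s (Inp i)\<bar> \<le> Z"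
  shows "does Z load_graph s (2 + k * k * 2 + k * 2)
    (\<lambda>s'. (\<forall>e<k * k. s' (Arr 1 (int e)) = s (Inp (2 + int e))) \<and> (\<forall>u<k. s' (Arr 2 (int u)) = 1))"
proof -
  let ?c1 = "For 9 (Var 1 \<^bold>* Var 1) (Put 1 (Var 9) (In (Num 2 \<^bold>+ Var 9)))"
  let ?c2 = "For 9 (Var 1) (Put 2 (Var 9) (Num 1))"
  have 1: "does Z ?c1 s (1 + k * k * (1 + 1)) (\<lambda>s'. \<forall>e<k * k. s' (Arr 1 (int e)) = s (Inp (2 + int e)))"
  proof (rule does_For[where I = "\<lambda>i s'. \<forall>e<i. s' (Arr 1 (int e)) = s (Inp (2 + int e))"])
    fix i s' assume I: "\<forall>e<i. s' (Arr 1 (int e)) = s (Inp (2 + int e))" and ag: "agree ?c1 s s'"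
    have "s' (Inp j) = s (Inp j)" for j using agreeD[OF ag] by simp
    then show "does Z (Put 1 (Var 9) (In (Num 2 \<^bold>+ Var 9))) (s'(S 9 := int i)) 1 (\<lambda>s'. \<forall>e<Suc i. s' (Arr 1 (int e)) = s (Inp (2 + int e)))"
      by (intro does_Put) (use I inp in \<open>simp_all add: less_Suc_eq\<close>)
  qed (use k Z in \<open>simp_all add: nat_mult_distrib\<close>)
  have "does Z load_graph s ((1 + k * k * (1 + 1)) + (1 + k * (1 + 1)))
    (\<lambda>s'. (\<forall>e<k * k. s' (Arr 1 (int e)) = s (Inp (2 + int e))) \<and> (\<forall>u<k. s' (Arr 2 (int u)) = 1))"
    unfolding load_graph_def
  proof (rule does_ThenI[OF 1])
    fix s1 assume A: "\<forall>e<k * k. s1 (Arr 1 (int e)) = s (Inp (2 + int e))" and ag: "agree ?c1 s s1"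
    have k1: "s1 (S 1) = int k" using agreeD[OF ag] k by simp
    show "does Z ?c2 s1 (1 + k * (1 + 1)) (\<lambda>s'. (\<forall>e<k * k. s' (Arr 1 (int e)) = s (Inp (2 + int e))) \<and> (\<forall>u<k. s' (Arr 2 (int u)) = 1))"
    proof (rule does_For[where I = "\<lambda>i s'. \<forall>u<i. s' (Arr 2 (int u)) = 1"])
      fix i and s' :: state assume "\<forall>u<i. s' (Arr 2 (int u)) = 1"
      then show "does Z (Put 2 (Var 9) (Num 1)) (s'(S 9 := int i)) 1 (\<lambda>s'. \<forall>u<Suc i. s' (Arr 2 (int u)) = 1)"
        by (intro does_Put) (use Z in \<open>simp_all add: less_Suc_eq\<close>)
    next
      fix s' assume "\<forall>u<k. s' (Arr 2 (int u)) = 1" and ag: "agree ?c2 s1 s'"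
      then show "(\<forall>e<k * k. s' (Arr 1 (int e)) = s (Inp (2 + int e))) \<and> (\<forall>u<k. s' (Arr 2 (int u)) = 1)"
        using A agreeD[OF ag] by simp
    qed (use k1 Z in simp_all)
  qed
  then show ?thesis by (rule does_conseq) auto
qed

end

section \<open>Elimination rounds\<close>

context tensor_algorithm
begin

definition stores_graph :: "nat \<Rightarrow> nat set \<Rightarrow> (nat \<Rightarrow> nat \<Rightarrow> bool) \<Rightarrow> state \<Rightarrow> bool" where
  "stores_graph k R E s \<longleftrightarrow> (\<forall>u<k. s (Arr 2 (int u)) = of_bool (u \<in> R)) \<and>
     (\<forall>u<k. \<forall>w<k. s (Arr 1 (int (u * k + w))) = of_bool (E u w))"

text \<open>Variables 41 and 42 count violations of the conditions on the neighbours of \<open>v\<close> and \<open>a\<close>.\<close>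

definition scan :: cmd where
  "scan = Set 41 (Var 41 \<^bold>+ Elt 2 (Var 43) \<^bold>* Elt 1 (Var 30 \<^bold>* Var 1 \<^bold>+ Var 43) \<^bold>*
       (((Var 43 \<^bold>- Var 31) \<^bold>* (Var 43 \<^bold>- Var 32)) \<^bold>* ((Var 43 \<^bold>- Var 31) \<^bold>* (Var 43 \<^bold>- Var 32)))) ;;
     Set 42 (Var 42 \<^bold>+ Elt 2 (Var 43) \<^bold>* Elt 1 (Var 31 \<^bold>* Var 1 \<^bold>+ Var 43) \<^bold>*
       ((Var 43 \<^bold>- Var 30) \<^bold>* (Var 43 \<^bold>- Var 30)))"

definition distinct_exp :: aexp where
  "distinct_exp = (Var 30 \<^bold>- Var 31) \<^bold>* (Var 30 \<^bold>- Var 32) \<^bold>* (Var 31 \<^bold>- Var 32)"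

text \<open>Conditions are evaluated arithmetically: products of flags stand for conjunctions, sums
  for disjunctions, and a square is positive exactly if the differences in it are nonzero.\<close>

definition check_triple :: cmd where
  "check_triple = Cond (BLess (Num 0) (Elt 2 (Var 30) \<^bold>* Elt 2 (Var 31) \<^bold>* Elt 2 (Var 32) \<^bold>* (distinct_exp \<^bold>* distinct_exp)))
     (Cond (BEq (Var 41) (Num 0))
       (Cond (BLess (Num 0) (Elt 1 (Var 31 \<^bold>* Var 1 \<^bold>+ Var 32) \<^bold>+
            Elt 1 (Var 30 \<^bold>* Var 1 \<^bold>+ Var 31) \<^bold>* Elt 1 (Var 30 \<^bold>* Var 1 \<^bold>+ Var 32)))
         (Set 39 (Num 1)) (Cond (BEq (Var 42) (Num 0)) (Set 39 (Num 1)) Skp)) Skp) Skp"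

definition try_triple :: cmd where
  "try_triple = Set 30 (Var 36 \<^bold>div (Var 1 \<^bold>* Var 1)) ;; Set 40 (Var 36 \<^bold>- Var 30 \<^bold>* (Var 1 \<^bold>* Var 1)) ;;
     Set 31 (Var 40 \<^bold>div Var 1) ;; Set 32 (Var 40 \<^bold>- Var 31 \<^bold>* Var 1) ;; Set 41 (Num 0) ;; Set 42 (Num 0) ;;
     For 43 (Var 1) scan ;; check_triple"

text \<open>All \<open>k ^ 3\<close> triples are tried. Once variable 39 is set the other iterations
  do nothing, so variables 30 to 32 keep the first triple found.\<close>

definition search :: cmd where
  "search = Set 39 (Num 0) ;; For 36 (Var 1 \<^bold>* Var 1 \<^bold>* Var 1) (Cond (BEq (Var 39) (Num 0)) try_triple Skp)"

lemma does_check_triple: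
  fixes s :: state
  assumes k: "s (S 1) = int k" and st: "stores_graph k R E s" and
    vac: "v < k" "a < k" "c < k" "s (S 30) = int v" "s (S 31) = int a" "s (S 32) = int c" and found: "s (S 39) = 0"
    and 41: "s (S 41) = 0 \<longleftrightarrow> (\<forall>u<k. u \<in> R \<and> u \<noteq> a \<and> u \<noteq> c \<longrightarrow> \<not> E v u)"
    and 42: "s (S 42) = 0 \<longleftrightarrow> (\<forall>u<k. u \<in> R \<and> u \<noteq> v \<longrightarrow> \<not> E a u)"
    and E: "\<And>u. \<not> E u u" and R: "R \<subseteq> {..<k}" and Z: "1 \<le> Z"
  shows "does Z check_triple s 5 (\<lambda>s'. s' (S 39) = of_bool (eliminable R E v a c) \<and>
    s' (S 30) = int v \<and> s' (S 31) = int a \<and> s' (S 32) = int c)"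
proof -
  have act: "s (Arr 2 (int v)) = of_bool (v \<in> R)" "s (Arr 2 (int a)) = of_bool (a \<in> R)" "s (Arr 2 (int c)) = of_bool (c \<in> R)"
    using st vac unfolding stores_graph_def by auto
  have ed: "s (Arr 1 (int a * int k + int c)) = of_bool (E a c)" "s (Arr 1 (int v * int k + int a)) = of_bool (E v a)"
    "s (Arr 1 (int v * int k + int c)) = of_bool (E v c)"
    using st vac unfolding stores_graph_def by simp_all
  let ?X = "(int v - int a) * (int v - int c) * (int a - int c)"
  have X: "0 < ?X * ?X \<longleftrightarrow> v \<noteq> a \<and> v \<noteq> c \<and> a \<noteq> c"
  proof -
    have "0 < x * x \<longleftrightarrow> x \<noteq> 0" for x :: int by (auto simp: zero_less_mult_iff linorder_neq_iff)
    from this[of ?X] show ?thesis by simp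
  qed
  have good: "bval (BLess (Num 0) (Elt 2 (Var 30) \<^bold>* Elt 2 (Var 31) \<^bold>* Elt 2 (Var 32) \<^bold>* (distinct_exp \<^bold>* distinct_exp))) s \<longleftrightarrow>
      v \<in> R \<and> a \<in> R \<and> c \<in> R \<and> v \<noteq> a \<and> v \<noteq> c \<and> a \<noteq> c"
  proof -
    have "aval (distinct_exp \<^bold>* distinct_exp) s = ?X * ?X" using vac by (simp add: distinct_exp_def)
    then have val: "aval (Elt 2 (Var 30) \<^bold>* Elt 2 (Var 31) \<^bold>* Elt 2 (Var 32) \<^bold>* (distinct_exp \<^bold>* distinct_exp)) s =
        of_bool (v \<in> R \<and> a \<in> R \<and> c \<in> R) * (?X * ?X)"
      using vac act by simp
    show ?thesis unfolding bval.simps val aval.simps(1)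
      using X by (cases "v \<in> R \<and> a \<in> R \<and> c \<in> R") auto
  qed
  have el: "eliminable R E v a c \<longleftrightarrow> (v \<in> R \<and> a \<in> R \<and> c \<in> R \<and> v \<noteq> a \<and> v \<noteq> c \<and> a \<noteq> c) \<and>
     s (S 41) = 0 \<and> ((E a c \<or> E v a \<and> E v c) \<or> s (S 42) = 0)"
  proof -
    \<comment> \<open>The counters do not exempt the vertex itself as \<open>eliminable\<close>
      does; irreflexivity of \<open>E\<close> makes up for it.\<close>
    have "(\<forall>u\<in>R. u \<noteq> v \<and> u \<noteq> a \<and> u \<noteq> c \<longrightarrow> \<not> E v u) \<longleftrightarrow> s (S 41) = 0"
      unfolding 41 using E R by (metis lessThan_iff subset_eq)
    moreover have "(\<forall>u\<in>R. u \<noteq> a \<and> u \<noteq> v \<longrightarrow> \<not> E a u) \<longleftrightarrow> s (S 42) = 0"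
      unfolding 42 using E R by (metis lessThan_iff subset_eq)
    ultimately show ?thesis unfolding eliminable_def by blast
  qed
  let ?Q = "\<lambda>s'. s' (S 39) = of_bool (eliminable R E v a c) \<and> s' (S 30) = int v \<and> s' (S 31) = int a \<and> s' (S 32) = int c"
  have yes: "does Z (Set 39 (Num 1)) s 1 ?Q" if "eliminable R E v a c"
    by (rule does_Set) (use that vac Z in simp_all)
  have no: "does Z Skp s T ?Q" if "\<not> eliminable R E v a c" "1 \<le> T" for T
  proof -
    have "does Z Skp s 1 ?Q" by (rule does_Set) (use that vac found Z in simp_all)
    then show ?thesis by (rule does_conseq) (use that in auto)
  qed
  have third: "bval (BLess (Num 0) (Elt 1 (Var 31 \<^bold>* Var 1 \<^bold>+ Var 32) \<^bold>+
            Elt 1 (Var 30 \<^bold>* Var 1 \<^bold>+ Var 31) \<^bold>* Elt 1 (Var 30 \<^bold>* Var 1 \<^bold>+ Var 32))) s \<longleftrightarrow> E a c \<or> E v a \<and> E v c"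
    using vac k ed by simp
  have "does Z check_triple s (1 + (1 + (1 + (1 + 1)))) ?Q"
    unfolding check_triple_def
  proof (rule does_Cond, goal_cases)
    case 2
    note g = this[unfolded good]
    show ?case
    proof (rule does_Cond, goal_cases)
      case 2
      then have h: "s (S 41) = 0" by simp
      show ?case
      proof (rule does_Cond, goal_cases)
        case 2
        then have "eliminable R E v a c" unfolding third el using g h by blast
        then show ?case by (rule does_conseq[OF yes]) simp_all
      next
        case 3
        note n3 = this[unfolded third]
        show ?case
        proof (rule does_Cond, goal_cases)
          case 2
          then have "eliminable R E v a c" unfolding el using g h by simp
          then show ?case by (rule yes)
        next
          case 3
          then have "\<not> eliminable R E v a c" unfolding el using n3 by simp
          then show ?case by (rule no) simp
        qed simp
      qed (use vac k in simp)
    next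
      case 3
      then have "\<not> eliminable R E v a c" unfolding el by simp
      then show ?case by (rule no) simp
    qed simp
  next
    case 3
    then have "\<not> eliminable R E v a c" unfolding el good by blast
    then show ?case by (rule no) simp
  qed (use vac in \<open>simp add: distinct_exp_def\<close>)
  then show ?thesis by (rule does_conseq) auto
qed

text \<open>The bound \<open>int k ^ 5\<close> is for the counters: k summands, each a product of at
  most four differences below k.\<close>

lemma does_try_triple:
  fixes s :: state
  assumes k: "s (S 1) = int k" and st: "stores_graph k R E s" and i: "s (S 36) = int i" "i < k * k * k"
    and found: "s (S 39) = 0" and E: "\<And>u. \<not> E u u" and R: "R \<subseteq> {..<k}" and Z: "1 \<le> Z" "int k ^ 5 \<le> Z"
  defines "v \<equiv> i div (k * k)" and "a \<equiv> i mod (k * k) div k" and "c \<equiv> i mod (k * k) mod k"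
  shows "does Z try_triple s (12 + 3 * k) (\<lambda>s'. s' (S 39) = of_bool (eliminable R E v a c) \<and>
    s' (S 30) = int v \<and> s' (S 31) = int a \<and> s' (S 32) = int c)"
proof -
  have k0: "0 < k" using i by (cases k) auto
  have vac: "v < k" "a < k" "c < k"
    unfolding v_def a_def c_def using i k0 by (simp_all add: less_mult_imp_div_less)
  define j where "j = i mod (k * k)"
  have k1: "int k ^ m \<le> int k ^ 5" if "m \<le> 5" for m using k0 that by (intro power_increasing) auto
  then have kZ: "int k ^ m \<le> Z" if "m \<le> 5" for m using Z that order_trans by blast
  have kZ1: "int k \<le> Z" using kZ[of 1] by simp
  have "j < k * k" unfolding j_def using k0 by simp
  then have "int j < int (k * k)" by (simp only: of_nat_less_iff)
  then have jZ: "int j \<le> Z" using kZ[of 2] by (simp add: power2_eq_square)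
  let ?s = "s(S 30 := int v, S 40 := int j, S 31 := int a, S 32 := int c, S 41 := 0, S 42 := 0)"
  have st': "stores_graph k R E ?s" using st unfolding stores_graph_def by simp
  define f1 where "f1 u = (of_bool (u \<in> R) * of_bool (E v u) * (((int u - int a) * (int u - int c)) * ((int u - int a) * (int u - int c))) :: int)" for u
  define f2 where "f2 u = (of_bool (u \<in> R) * of_bool (E a u) * ((int u - int v) * (int u - int v)) :: int)" for u
  have f0: "0 \<le> f1 u" "0 \<le> f2 u" for u unfolding f1_def f2_def by simp_all
  have fb: "f1 u \<le> int k ^ 4" "f2 u \<le> int k ^ 4" if u: "u < k" for u
  proof -
    have d: "\<bar>int u - int x\<bar> \<le> int k" if "x < k" for x using u that by linarith
    have dd: "\<bar>(int u - int x) * (int u - int y)\<bar> \<le> int k * int k" if "x < k" "y < k" for x y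
      unfolding abs_mult using d[OF that(1)] d[OF that(2)] by (intro mult_mono) auto
    have "\<bar>((int u - int a) * (int u - int c)) * ((int u - int a) * (int u - int c))\<bar> \<le> (int k * int k) * (int k * int k)"
      unfolding abs_mult[of "(int u - int a) * (int u - int c)"] using dd[OF vac(2,3)] by (intro mult_mono) auto
    then show "f1 u \<le> int k ^ 4" unfolding f1_def by (auto simp: of_bool_def power4_eq_xxxx mult.assoc)
    have "(int u - int v) * (int u - int v) \<le> int k * int k" using dd[OF vac(1,1)] by linarith
    also have "\<dots> \<le> int k ^ 4" using k0 power_increasing[of 2 4 "int k"] by (simp add: power2_eq_square)
    finally show "f2 u \<le> int k ^ 4" unfolding f2_def by (auto simp: of_bool_def)
  qed
  have sb: "\<bar>\<Sum>u<J. f1 u\<bar> \<le> Z" "\<bar>\<Sum>u<J. f2 u\<bar> \<le> Z" if "J \<le> k" for J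
  proof -
    have b: "\<bar>\<Sum>u<J. f u\<bar> \<le> Z" if f: "\<And>u. 0 \<le> f u" "\<And>u. u < k \<Longrightarrow> f u \<le> int k ^ 4" for f :: "nat \<Rightarrow> int"
    proof -
      have "(\<Sum>u<J. f u) \<le> (\<Sum>u<J. int k ^ 4)" using f \<open>J \<le> k\<close> by (intro sum_mono) auto
      also have "\<dots> = int J * int k ^ 4" by simp
      also have "\<dots> \<le> int k * int k ^ 4" using \<open>J \<le> k\<close> by (intro mult_right_mono) auto
      also have "\<dots> = int k ^ 5" by (simp add: eval_nat_numeral)
      finally show ?thesis using Z(2) sum_nonneg[of "{..<J}" f] f(1) by simp
    qed
    show "\<bar>\<Sum>u<J. f1 u\<bar> \<le> Z" "\<bar>\<Sum>u<J. f2 u\<bar> \<le> Z" using b f0 fb by blast+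
  qed
  have loop: "does Z (For 43 (Var 1) scan) ?s (1 + k * (1 + (1 + 1))) (\<lambda>s'. s' (S 41) = (\<Sum>u<k. f1 u) \<and> s' (S 42) = (\<Sum>u<k. f2 u))"
  proof (rule does_For[where I = "\<lambda>J s'. s' (S 41) = (\<Sum>u<J. f1 u) \<and> s' (S 42) = (\<Sum>u<J. f2 u)"])
    fix J s' assume J: "J < k" and I: "s' (S 41) = (\<Sum>u<J. f1 u) \<and> s' (S 42) = (\<Sum>u<J. f2 u)"
      and ag: "agree (For 43 (Var 1) scan) ?s s'"
    have x: "s' (S 1) = int k" "s' (S 30) = int v" "s' (S 31) = int a" "s' (S 32) = int c"
      "s' (Arr 2 m) = s (Arr 2 m)" "s' (Arr 1 m) = s (Arr 1 m)" for m
      using agreeD[OF ag] k by (simp_all add: scan_def)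
    have y: "s (Arr 2 (int J)) = of_bool (J \<in> R)" "s (Arr 1 (int v * int k + int J)) = of_bool (E v J)"
      "s (Arr 1 (int a * int k + int J)) = of_bool (E a J)"
      using st J vac unfolding stores_graph_def by simp_all
    show "does Z scan (s'(S 43 := int J)) (1 + 1) (\<lambda>s'. s' (S 41) = (\<Sum>u<Suc J. f1 u) \<and> s' (S 42) = (\<Sum>u<Suc J. f2 u))"
      unfolding scan_def
    proof (rule does_SetThen[where v = "\<Sum>u<Suc J. f1 u"])
      show "does Z (Set 42 (Var 42 \<^bold>+ Elt 2 (Var 43) \<^bold>* Elt 1 (Var 31 \<^bold>* Var 1 \<^bold>+ Var 43) \<^bold>*
         ((Var 43 \<^bold>- Var 30) \<^bold>* (Var 43 \<^bold>- Var 30)))) (s'(S 43 := int J, S 41 := \<Sum>u<Suc J. f1 u)) 1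
         (\<lambda>s'. s' (S 41) = (\<Sum>u<Suc J. f1 u) \<and> s' (S 42) = (\<Sum>u<Suc J. f2 u))"
      proof (rule does_SetI[where v = "\<Sum>u<Suc J. f2 u"])
        show "\<bar>\<Sum>u<Suc J. f2 u\<bar> \<le> Z" by (rule sb(2)) (use J in simp)
      qed (use I x y in \<open>simp_all add: f2_def\<close>)
      show "\<bar>\<Sum>u<Suc J. f1 u\<bar> \<le> Z" by (rule sb(1)) (use J in simp)
    qed (use I x y in \<open>simp_all add: f1_def\<close>)
  qed (use k kZ1 in simp_all)
  have z1: "(\<Sum>u<k. f1 u) = 0 \<longleftrightarrow> (\<forall>u<k. u \<in> R \<and> u \<noteq> a \<and> u \<noteq> c \<longrightarrow> \<not> E v u)"
  proof -
    have "(\<Sum>u<k. f1 u) = 0 \<longleftrightarrow> (\<forall>u\<in>{..<k}. f1 u = 0)" using f0 by (intro sum_nonneg_eq_0_iff) auto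
    then show ?thesis by (auto simp: f1_def)
  qed
  have z2: "(\<Sum>u<k. f2 u) = 0 \<longleftrightarrow> (\<forall>u<k. u \<in> R \<and> u \<noteq> v \<longrightarrow> \<not> E a u)"
  proof -
    have "(\<Sum>u<k. f2 u) = 0 \<longleftrightarrow> (\<forall>u\<in>{..<k}. f2 u = 0)" using f0 by (intro sum_nonneg_eq_0_iff) auto
    then show ?thesis by (auto simp: f2_def)
  qed
  have a': "a = j div k" and c': "c = j mod k" unfolding a_def c_def j_def by simp_all
  have eqs: "int i div (int k * int k) = int v" "int i - int v * (int k * int k) = int j"
    "int j div int k = int a" "int j - int a * int k = int c"
    using int_mod_eq[of i "k * k"] int_mod_eq[of j k]
    unfolding a' c' by (simp_all add: v_def j_def zdiv_int)
  have vacZ: "int v \<le> Z" "int a \<le> Z" "int c \<le> Z" using vac kZ1 by linarith+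
  have "does Z try_triple s (1 + (1 + (1 + (1 + (1 + (1 + ((1 + k * (1 + (1 + 1))) + 5)))))))
    (\<lambda>s'. s' (S 39) = of_bool (eliminable R E v a c) \<and> s' (S 30) = int v \<and> s' (S 31) = int a \<and> s' (S 32) = int c)"
    unfolding try_triple_def
    apply (rule does_SetThen[where v = "int v"], (simp; fail), (use k i eqs in simp; fail), (use vacZ in simp; fail))
    apply (rule does_SetThen[where v = "int j"], (simp; fail), (use k i eqs in simp; fail), (use jZ in simp; fail))
    apply (rule does_SetThen[where v = "int a"], (simp; fail), (use k i eqs in simp; fail), (use vacZ in simp; fail))
    apply (rule does_SetThen[where v = "int c"], (simp; fail), (use k i eqs in simp; fail), (use vacZ in simp; fail))
    apply (rule does_SetThen[where v = 0], (simp; fail), (simp; fail), (use Z in simp; fail))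
    apply (rule does_SetThen[where v = 0], (simp; fail), (simp; fail), (use Z in simp; fail))
  proof (rule does_ThenI[OF loop])
    fix s1 assume I: "s1 (S 41) = (\<Sum>u<k. f1 u) \<and> s1 (S 42) = (\<Sum>u<k. f2 u)" and ag: "agree (For 43 (Var 1) scan) ?s s1"
    have x: "s1 (S 1) = int k" "s1 (S 30) = int v" "s1 (S 31) = int a" "s1 (S 32) = int c" "s1 (S 39) = 0"
      "s1 (Arr 2 m) = s (Arr 2 m)" "s1 (Arr 1 m) = s (Arr 1 m)" for m
      using agreeD[OF ag] k found by (simp_all add: scan_def)
    have "stores_graph k R E s1" using st x unfolding stores_graph_def by simp
    then show "does Z check_triple s1 5 (\<lambda>s'. s' (S 39) = of_bool (eliminable R E v a c) \<and> s' (S 30) = int v \<and> s' (S 31) = int a \<and> s' (S 32) = int c)"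
      using x I z1 z2 E R Z(1) vac by (intro does_check_triple) auto
  qed
  then show ?thesis by (rule does_conseq) auto
qed

lemma does_search:
  fixes s :: state
  assumes k: "s (S 1) = int k" and st: "stores_graph k R E s"
    and E: "\<And>u. \<not> E u u" and R: "R \<subseteq> {..<k}" and Z: "1 \<le> Z" "int k ^ 5 \<le> Z" and ex: "\<exists>v a c. eliminable R E v a c"
  shows "does Z search s (2 + k * k * k * (14 + 3 * k)) (\<lambda>s'. \<exists>v a c. eliminable R E v a c \<and>
    s' (S 30) = int v \<and> s' (S 31) = int a \<and> s' (S 32) = int c)"
proof -
  define v a c where "v i = i div (k * k)" and "a i = i mod (k * k) div k" and "c i = i mod (k * k) mod k" for i
  let ?body = "Cond (BEq (Var 39) (Num 0)) try_triple Skp"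
  let ?el = "\<lambda>i. eliminable R E (v i) (a i) (c i)"
  \<comment> \<open>Either nothing is found and all earlier triples fail, or a good triple sits in
    variables 30 to 32.\<close>
  let ?I = "\<lambda>i s'. (s' (S 39) = 0 \<and> (\<forall>j<i. \<not> ?el j)) \<or>
     (s' (S 39) = 1 \<and> (\<exists>v a c. eliminable R E v a c \<and> s' (S 30) = int v \<and> s' (S 31) = int a \<and> s' (S 32) = int c))"
  let ?s = "s(S 39 := 0)"
  have kZ: "int (k * k * k) \<le> Z"
  proof (cases "k = 0")
    case False
    then have "int k ^ 3 \<le> int k ^ 5" by (intro power_increasing) auto
    then show ?thesis using Z by (simp add: power3_eq_cube)
  qed (use Z in simp)
  have loop: "does Z (For 36 (Var 1 \<^bold>* Var 1 \<^bold>* Var 1) ?body) ?s (1 + k * k * k * (1 + (1 + (12 + 3 * k))))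
     (\<lambda>s'. \<exists>v a c. eliminable R E v a c \<and> s' (S 30) = int v \<and> s' (S 31) = int a \<and> s' (S 32) = int c)"
  proof (rule does_For[where I = ?I])
    fix i s' assume i: "i < k * k * k" and I: "?I i s'" and ag: "agree (For 36 (Var 1 \<^bold>* Var 1 \<^bold>* Var 1) ?body) ?s s'"
    let ?t = "s'(S 36 := int i)"
    have x: "s' (S 1) = int k" "s' (Arr 2 m) = s (Arr 2 m)" "s' (Arr 1 m) = s (Arr 1 m)" for m
      using agreeD[OF ag] k by (simp_all add: try_triple_def scan_def check_triple_def)
    have st': "stores_graph k R E ?t" using st x unfolding stores_graph_def by simp
    show "does Z ?body ?t (1 + (12 + 3 * k)) (?I (Suc i))"
    proof (rule does_Cond)
      assume "bval (BEq (Var 39) (Num 0)) ?t"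
      then have f0: "s' (S 39) = 0" by simp
      have "does Z try_triple ?t (12 + 3 * k) (\<lambda>s'. s' (S 39) = of_bool (?el i) \<and> s' (S 30) = int (v i) \<and> s' (S 31) = int (a i) \<and> s' (S 32) = int (c i))"
        unfolding v_def a_def c_def using x f0 i st' E R Z by (intro does_try_triple) simp_all
      then show "does Z try_triple ?t (12 + 3 * k) (?I (Suc i))"
      proof (rule does_conseq)
        fix s'' assume A: "s'' (S 39) = of_bool (?el i) \<and> s'' (S 30) = int (v i) \<and> s'' (S 31) = int (a i) \<and> s'' (S 32) = int (c i)"
        have none: "\<forall>j<i. \<not> ?el j" using I f0 by simp
        show "?I (Suc i) s''"
        proof (cases "?el i")
          case True
          then have "s'' (S 39) = 1" using A by simp
          then show ?thesis using A True by blast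
        next
          case False
          then show ?thesis using A none by (simp add: less_Suc_eq)
        qed
      qed simp
    next
      assume "\<not> bval (BEq (Var 39) (Num 0)) ?t"
      then have "s' (S 39) = 1 \<and> (\<exists>v a c. eliminable R E v a c \<and> s' (S 30) = int v \<and> s' (S 31) = int a \<and> s' (S 32) = int c)"
        using I by auto
      then have "does Z Skp ?t 1 (?I (Suc i))" using Z by (intro does_Set) simp_all
      then show "does Z Skp ?t (12 + 3 * k) (?I (Suc i))" by (rule does_conseq) auto
    qed simp
  next
    fix s' assume I: "?I (k * k * k) s'"
    \<comment> \<open>The eliminable triple that exists has a code below k^3, so the first
      alternative of the invariant is impossible at the end.\<close>
    have "\<not> (\<forall>j<k * k * k. \<not> ?el j)"
    proof -
      obtain x y z where el: "eliminable R E x y z" using ex by blast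
      then have xyz: "x < k" "y < k" "z < k" using R unfolding eliminable_def by auto
      define j where "j = x * (k * k) + (y * k + z)"
      have yz: "y * k + z < k * k" using xyz by (intro mult_add_less)
      have "j < k * (k * k)" unfolding j_def using xyz yz by (intro mult_add_less)
      moreover have "v j = x" "a j = y" "c j = z" unfolding v_def a_def c_def j_def using yz xyz by simp_all
      ultimately show ?thesis using el by (metis mult.assoc)
    qed
    then show "\<exists>v a c. eliminable R E v a c \<and> s' (S 30) = int v \<and> s' (S 31) = int a \<and> s' (S 32) = int c" using I by blast
  qed (use k kZ in \<open>simp_all add: nat_mult_distrib\<close>)
  have "does Z search s (1 + (1 + k * k * k * (1 + (1 + (12 + 3 * k)))))
     (\<lambda>s'. \<exists>v a c. eliminable R E v a c \<and> s' (S 30) = int v \<and> s' (S 31) = int a \<and> s' (S 32) = int c)"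
    unfolding search_def
    by (rule does_SetThen[where v = 0], simp, simp, use Z in simp, rule loop)
  then show ?thesis by (rule does_conseq) auto
qed

end

section \<open>One elimination on the stored weights\<close>

context tensor_algorithm
begin

definition padded :: "nat \<Rightarrow> nat \<Rightarrow> (nat \<Rightarrow> nat \<Rightarrow> int) \<Rightarrow> nat \<Rightarrow> int" where
  "padded n d m q = (if row_index b d q < n \<and> col_index b d q < n then m (row_index b d q) (col_index b d q) else 0)"

definition stores_weights :: "nat \<Rightarrow> nat \<Rightarrow> nat \<Rightarrow> (nat \<Rightarrow> nat \<Rightarrow> nat \<Rightarrow> nat \<Rightarrow> int) \<Rightarrow> state \<Rightarrow> bool" where
  "stores_weights k n d M s \<longleftrightarrow>
     (\<forall>u<k. \<forall>w<k. \<forall>q<P ^ d. s (Arr 0 (int ((u * k + w) * P ^ d + q))) = padded n d (M u w) q)"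

text \<open>The effect of a single \<open>multiply\<close>, which changes only the matrix of the
  ordered pair (a, c).\<close>

definition half_elim :: "nat \<Rightarrow> nat \<Rightarrow> nat \<Rightarrow> nat \<Rightarrow> (nat \<Rightarrow> nat \<Rightarrow> nat \<Rightarrow> nat \<Rightarrow> int) \<Rightarrow> nat \<Rightarrow> nat \<Rightarrow> nat \<Rightarrow> nat \<Rightarrow> int" where
  "half_elim n v a c M u w x y = (if u = a \<and> w = c then M u w x y * (\<Sum>z<n. M u v x z * M v w z y) else M u w x y)"

text \<open>The second half reads the matrices of (c, v), (v, a) and (c, a), none of which the first
  half has changed.\<close>

lemma half_elim_twice:
  assumes "v \<noteq> a" "v \<noteq> c" "a \<noteq> c"
  shows "half_elim n v c a (half_elim n v a c M) = elim_weight n v a c M"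
  using assms unfolding half_elim_def elim_weight_def by (auto simp: fun_eq_iff)

text \<open>Padding by zeros commutes with multiplication, since inner indices from n on contribute
  nothing.\<close>

lemma padded_product:
  assumes n: "n \<le> b ^ d"
  shows "(\<Sum>z<b ^ d. padded n d A (pair_index b d (row_index b d q) z) * padded n d B (pair_index b d z (col_index b d q))) =
    padded n d (\<lambda>x y. \<Sum>z<n. A x z * B z y) q"
proof -
  let ?x = "row_index b d q" and ?y = "col_index b d q"
  have xy: "?x < b ^ d" "?y < b ^ d" using row_index_less col_index_less P by auto
  have "(\<Sum>z<b ^ d. padded n d A (pair_index b d ?x z) * padded n d B (pair_index b d z ?y)) =
      (\<Sum>z<b ^ d. if z < n then (if ?x < n \<and> ?y < n then A ?x z * B z ?y else 0) else 0)"
    using xy P by (intro sum.cong refl) (simp add: padded_def row_pair_index col_pair_index)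
  also have "\<dots> = (\<Sum>z<n. if ?x < n \<and> ?y < n then A ?x z * B z ?y else 0)"
    using n by (intro sum.mono_neutral_cong_right) auto
  also have "\<dots> = padded n d (\<lambda>x y. \<Sum>z<n. A x z * B z y) q"
  proof (cases "?x < n \<and> ?y < n")
    case True
    then show ?thesis by (simp only: padded_def if_True simp_thms)
  next
    case False
    then show ?thesis by (simp only: padded_def if_False sum.neutral_const)
  qed
  finally show ?thesis .
qed

lemma does_multiply_weights:
  fixes s :: state
  assumes g: "globals k n d s" and w: "stores_weights k n d M s" and n: "n \<le> b ^ d"
    and v: "s (S 30) = int v" "s (S 31) = int a" "s (S 32) = int c" and vac: "v < k" "a < k" "c < k"
    and Z: "int (r ^ d) \<le> Z" "int r \<le> Z" "int d \<le> Z"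
    and Y: "1 \<le> Y" "(int r * \<mu>) ^ d * ((int P * \<mu>) ^ d * Y) ^ 2 \<le> Z" "Y \<le> Z"
    and M: "\<And>x y. x < n \<Longrightarrow> y < n \<Longrightarrow> \<bar>M a v x y\<bar> \<le> Y" "\<And>x y. x < n \<Longrightarrow> y < n \<Longrightarrow> \<bar>M v c x y\<bar> \<le> Y"
      "\<And>x y. x < n \<Longrightarrow> y < n \<Longrightarrow> \<bar>half_elim n v a c M a c x y\<bar> \<le> Y"
  shows "does Z multiply s (mult_time d) (stores_weights k n d (half_elim n v a c M))"
proof -
  define N where "N = P ^ d"
  have N0: "0 < N" using P unfolding N_def by simp
  have st: "s (Arr 0 (int ((u * k + w) * N + q))) = padded n d (M u w) q" if "u < k" "w < k" "q < N" for u w q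
    using w that unfolding stores_weights_def N_def by blast
  have pb: "\<bar>padded n d m q\<bar> \<le> Y" if "\<And>x y. x < n \<Longrightarrow> y < n \<Longrightarrow> \<bar>m x y\<bar> \<le> Y" for m q
    using that Y(1) unfolding padded_def by auto
  let ?pr = "\<lambda>q. \<Sum>z<b ^ d. padded n d (M a v) (pair_index b d (row_index b d q) z) * padded n d (M v c) (pair_index b d z (col_index b d q))"
  have pr: "padded n d (M a c) q * ?pr q = padded n d (half_elim n v a c M a c) q" for q
    by (simp only: padded_product[OF n]) (simp add: padded_def half_elim_def)
  show ?thesis
  proof (rule does_conseq[OF does_multiply[OF g v Z, where A = "padded n d (M a v)" and B = "padded n d (M v c)" and Y = Y]])
    fix q assume q: "q < P ^ d"
    show "s (Arr 0 (int ((a * k + v) * P ^ d + q))) = padded n d (M a v) q \<and> \<bar>padded n d (M a v) q\<bar> \<le> Y"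
      "s (Arr 0 (int ((v * k + c) * P ^ d + q))) = padded n d (M v c) q \<and> \<bar>padded n d (M v c) q\<bar> \<le> Y"
      using st[unfolded N_def] vac q pb M by blast+
    have "\<bar>padded n d (half_elim n v a c M a c) q\<bar> \<le> Z" using pb[of "half_elim n v a c M a c" q] M(3) Y(3) by force
    then show "\<bar>s (Arr 0 (int ((a * k + c) * P ^ d + q))) * ?pr q\<bar> \<le> Z"
      using st[OF vac(2,3), unfolded N_def, OF q] pr by simp
  next
    fix s' assume A: "(\<forall>q<P ^ d. s' (Arr 0 (int ((a * k + c) * P ^ d + q))) = s (Arr 0 (int ((a * k + c) * P ^ d + q))) * ?pr q) \<and>
      (\<forall>i. (\<forall>q<P ^ d. i \<noteq> int ((a * k + c) * P ^ d + q)) \<longrightarrow> s' (Arr 0 i) = s (Arr 0 i))"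
    show "stores_weights k n d (half_elim n v a c M) s'"
      unfolding stores_weights_def N_def[symmetric]
    proof (intro allI impI)
      fix u w q assume uw: "u < k" "w < k" "q < N"
      show "s' (Arr 0 (int ((u * k + w) * N + q))) = padded n d (half_elim n v a c M u w) q"
      proof (cases "u = a \<and> w = c")
        case True
        then show ?thesis using A uw st[OF vac(2,3) uw(3)] pr unfolding N_def by simp
      next
        case False
        \<comment> \<open>Blocks of different pairs are disjoint, because u, w and q can be
          recovered from the address.\<close>
        have "(u * k + w) * N + q \<noteq> (a * k + c) * N + q'" if q': "q' < N" for q'
        proof
          assume eq: "(u * k + w) * N + q = (a * k + c) * N + q'"
          then have "u * k + w = a * k + c" using uw(3) q' by (metis digits_eq_iff)
          then show False using uw(2) vac(3) False by (metis digits_eq_iff)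
        qed
        then have "s' (Arr 0 (int ((u * k + w) * N + q))) = s (Arr 0 (int ((u * k + w) * N + q)))"
          using A unfolding N_def[symmetric] by (metis of_nat_eq_iff)
        moreover have "half_elim n v a c M u w = M u w" using False unfolding half_elim_def by (auto simp: fun_eq_iff)
        ultimately show ?thesis using st uw by simp
      qed
    qed
  qed (use Y in simp_all)
qed

definition mark :: cmd where
  "mark = Put 1 (Var 31 \<^bold>* Var 1 \<^bold>+ Var 32) (Num 1) ;; Put 1 (Var 32 \<^bold>* Var 1 \<^bold>+ Var 31) (Num 1) ;; Put 2 (Var 30) (Num 0)"

definition swap :: cmd where
  "swap = Set 34 (Var 31) ;; Set 31 (Var 32) ;; Set 32 (Var 34)"

definition eliminate :: cmd where
  "eliminate = search ;; mark ;; multiply ;; swap ;; multiply"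

text \<open>\<open>h\<close> is the number of homomorphisms, \<open>m\<close> the number of vertices of \<open>H\<close> that remain.\<close>

definition invariant :: "nat \<Rightarrow> nat \<Rightarrow> nat \<Rightarrow> int \<Rightarrow> nat \<Rightarrow> state \<Rightarrow> bool" where
  "invariant k n d h m s \<longleftrightarrow> globals k n d s \<and> (\<exists>R E M. R \<subseteq> {..<k} \<and> card R = m \<and>
     stores_graph k R E s \<and> stores_weights k n d M s \<and> (\<forall>u w. E u w \<longrightarrow> E w u) \<and> (\<forall>u. \<not> E u u) \<and> tw2 R E \<and>
     symmetric_weights n M \<and> (\<forall>u\<in>R. \<forall>w\<in>R. u \<noteq> w \<longrightarrow> \<not> E u w \<longrightarrow> (\<forall>x<n. \<forall>y<n. M u w x y = 1)) \<and>
     weights_bounded R n k M \<and> weight_sum R n M = h)"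

lemma writes_search: "writes search x \<longleftrightarrow> x \<in> {S 30, S 31, S 32, S 36, S 39, S 40, S 41, S 42, S 43, S 63}"
  unfolding search_def try_triple_def scan_def check_triple_def by auto

lemma writes_mark: "writes mark x \<longleftrightarrow> (\<exists>i. x = Arr 1 i \<or> x = Arr 2 i)"
  unfolding mark_def by auto

lemma writes_swap: "writes swap x \<longleftrightarrow> x \<in> {S 31, S 32, S 34}"
  unfolding swap_def by auto

lemma does_mark:
  fixes s :: state
  assumes k: "s (S 1) = int k" and st: "stores_graph k R E s" and vac: "v < k" "a < k" "c < k"
    and v: "s (S 30) = int v" "s (S 31) = int a" "s (S 32) = int c" and Z: "1 \<le> Z"
  shows "does Z mark s 3 (stores_graph k (R - {v}) (elim_edge a c E))"
proof -
  have "does Z mark s (1 + (1 + 1)) (stores_graph k (R - {v}) (elim_edge a c E))"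
    unfolding mark_def
  proof (rule does_PutThen[where m = "int (a * k + c)" and v = 1], goal_cases)
    case 8
    let ?s1 = "s(Arr 1 (int (a * k + c)) := 1)"
    show ?case
    proof (rule does_PutThen[where m = "int (c * k + a)" and v = 1], goal_cases)
      case 8
      let ?s2 = "?s1(Arr 1 (int (c * k + a)) := 1)"
      let ?s3 = "?s2(Arr 2 (int v) := 0)"
      have "stores_graph k (R - {v}) (elim_edge a c E) ?s3"
        unfolding stores_graph_def
      proof (intro conjI allI impI)
        fix u assume "u < k"
        then show "?s3 (Arr 2 (int u)) = of_bool (u \<in> R - {v})" using st unfolding stores_graph_def by simp
      next
        fix u w assume uw: "u < k" "w < k"
        have e: "s (Arr 1 (int (u * k + w))) = of_bool (E u w)" using st uw unfolding stores_graph_def by blast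
        have i1: "int (u * k + w) = int (a * k + c) \<longleftrightarrow> u = a \<and> w = c"
          unfolding of_nat_eq_iff by (rule digits_eq_iff[OF uw(2) vac(3)])
        have i2: "int (u * k + w) = int (c * k + a) \<longleftrightarrow> u = c \<and> w = a"
          unfolding of_nat_eq_iff by (rule digits_eq_iff[OF uw(2) vac(2)])
        have "?s3 (Arr 1 (int (u * k + w))) = (if int (u * k + w) = int (c * k + a) then 1
            else if int (u * k + w) = int (a * k + c) then 1 else s (Arr 1 (int (u * k + w))))"
          by (simp only: fun_upd_apply cell.inject cell.distinct if_False simp_thms) simp
        moreover have "(if x then 1 else if y then 1 else of_bool z) = (of_bool (z \<or> y \<or> x) :: int)" for x y z
          by simp
        ultimately show "?s3 (Arr 1 (int (u * k + w))) = of_bool (elim_edge a c E u w)"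
          unfolding i1 i2 e elim_edge_def by (simp only:)
      qed
      then show ?case by (intro does_Put) (use v Z in simp_all)
    qed (use k v Z in simp_all)
  qed (use k v Z in simp_all)
  then show ?thesis by (rule does_conseq) auto
qed

definition round_time :: "nat \<Rightarrow> nat \<Rightarrow> nat" where
  "round_time k d = 8 + k * k * k * (14 + 3 * k) + 2 * mult_time d"

text \<open>Although the state between the two multiplications is not symmetric, its numbers are
  under control: each matrix read belongs to \<open>M\<close>, and each matrix written to
  \<open>elim_weight\<close>, and \<open>weights_bounded\<close> holds for both.\<close>

lemma does_eliminate:
  fixes s :: state
  assumes inv: "invariant k n d h m s" and m: "3 \<le> m" and n: "n \<le> b ^ d"
    and Z: "int (r ^ d) \<le> Z" "int r \<le> Z" "int d \<le> Z" "int k ^ 5 \<le> Z"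
      "(int r * \<mu>) ^ d * ((int P * \<mu>) ^ d * int (b ^ d) ^ k) ^ 2 \<le> Z" "int (b ^ d) ^ k \<le> Z"
  shows "does Z eliminate s (round_time k d) (invariant k n d h (m - 1))"
proof -
  from inv have g: "globals k n d s" unfolding invariant_def by (rule conjunct1)
  from inv[unfolded invariant_def, THEN conjunct2]
  obtain R E M where R: "R \<subseteq> {..<k}" "card R = m" and sg: "stores_graph k R E s" and sw: "stores_weights k n d M s" and
     E0: "\<forall>u w. E u w \<longrightarrow> E w u" "\<forall>u. \<not> E u u" and tw: "tw2 R E" and
     M: "symmetric_weights n M" "\<forall>u\<in>R. \<forall>w\<in>R. u \<noteq> w \<longrightarrow> \<not> E u w \<longrightarrow> (\<forall>x<n. \<forall>y<n. M u w x y = 1)"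
     "weights_bounded R n k M" "weight_sum R n M = h"
    by (elim exE conjE)
  have E: "E w u" if "E u w" for u w using E0(1) that by blast
  have E2: "\<not> E u u" for u using E0(2) by blast
  have fin: "finite R" using R(1) finite_subset by blast
  have Z1: "1 \<le> Z" using Z(2) P(3) by linarith
  define Y where "Y = int (b ^ d) ^ k"
  have "1 \<le> int (b ^ d)" using P by simp
  then have Y: "1 \<le> Y" unfolding Y_def by (rule one_le_power)
  have nY: "int n ^ k \<le> Y" unfolding Y_def using n by (intro power_mono) auto
  have k1: "s (S 1) = int k" using g unfolding globals_def by blast
  have ex: "\<exists>v a c. eliminable R E v a c" using eliminable_exists[OF tw fin _ E] R(2) m by simp
  have "does Z eliminate s ((2 + k * k * k * (14 + 3 * k)) + (3 + (mult_time d + (3 + mult_time d)))) (invariant k n d h (m - 1))"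
    unfolding eliminate_def
  proof (rule does_ThenI[OF does_search[OF k1 sg E2 R(1) Z1 Z(4) ex]])
    fix s1 assume "\<exists>v a c. eliminable R E v a c \<and> s1 (S 30) = int v \<and> s1 (S 31) = int a \<and> s1 (S 32) = int c"
      and ag: "agree search s s1"
    then obtain v a c where el: "eliminable R E v a c" and v1: "s1 (S 30) = int v" "s1 (S 31) = int a" "s1 (S 32) = int c" by blast
    have vacR: "v \<in> R" "a \<in> R" "c \<in> R" and ne: "v \<noteq> a" "v \<noteq> c" "a \<noteq> c" using el unfolding eliminable_def by auto
    have vac: "v < k" "a < k" "c < k" using vacR R(1) by auto
    have g1: "globals k n d s1" by (rule globals_agree[OF g ag]) (auto simp: writes_search)
    have f1: "s1 (Arr j i) = s (Arr j i)" for j i using agreeD[OF ag] by (simp add: writes_search)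
    have sg1: "stores_graph k R E s1" using sg unfolding stores_graph_def f1 .
    have sw1: "stores_weights k n d M s1" using sw unfolding stores_weights_def f1 .
    have k1: "s1 (S 1) = int k" using g1 unfolding globals_def by blast
    let ?R = "R - {v}" and ?E = "elim_edge a c E" and ?M1 = "half_elim n v a c M" and ?M = "elim_weight n v a c M"
    have wb: "weights_bounded ?R n k ?M" by (rule weights_bounded_eliminate[OF fin vacR ne M(3)])
    have finR: "finite ?R" using fin by simp
    have aR: "a \<in> ?R" "c \<in> ?R" using vacR ne by auto
    have old: "\<bar>M u w x y\<bar> \<le> Y" if "u \<in> R" "w \<in> R" "u \<noteq> w" "x < n" "y < n" for u w x y
      using weights_bounded_le[OF M(3) fin that] nY by simp
    have new: "\<bar>?M u w x y\<bar> \<le> Y" if "u \<in> ?R" "w \<in> ?R" "u \<noteq> w" "x < n" "y < n" for u w x y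
      using weights_bounded_le[OF wb finR that] nY by simp
    have M1ac: "?M1 a c x y = ?M a c x y" for x y unfolding half_elim_def elim_weight_def by simp
    have M1v: "?M1 c v = M c v" "?M1 v a = M v a" unfolding half_elim_def using ne by (auto simp: fun_eq_iff)
    have inv': "invariant k n d h (m - 1) s'" if "globals k n d s'" "stores_graph k ?R ?E s'" "stores_weights k n d ?M s'" for s'
    proof -
      have tw': "tw2 ?R ?E" by (rule tw2_eliminate[OF tw el E])
      have "weight_sum ?R n ?M = h"
      proof -
        have "M u v x y = 1" if u: "u \<in> R" "u \<noteq> v" "u \<noteq> a" "u \<noteq> c" "x < n" "y < n" for u x y
        proof -
          have "\<not> E v u" using el u unfolding eliminable_def by blast
          then have "\<not> E u v" using E by blast
          then show ?thesis using M(2) u vacR(1) by blast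
        qed
        then show ?thesis using weight_sum_eliminate[OF fin vacR ne M(1)] M(4) by metis
      qed
      moreover have "\<forall>u\<in>?R. \<forall>w\<in>?R. u \<noteq> w \<longrightarrow> \<not> ?E u w \<longrightarrow> (\<forall>x<n. \<forall>y<n. ?M u w x y = 1)"
        using M(2) unfolding elim_edge_def elim_weight_def by auto
      moreover have "card ?R = m - 1" using R(2) vacR(1) fin by simp
      moreover have "?R \<subseteq> {..<k}" using R(1) by blast
      moreover have "\<forall>u w. ?E u w \<longrightarrow> ?E w u" "\<forall>u. \<not> ?E u u" using E0 ne unfolding elim_edge_def by blast+
      ultimately show ?thesis unfolding invariant_def
        using that tw' symmetric_elim_weight[OF M(1)] wb
        by (intro conjI exI[of _ ?R] exI[of _ ?E] exI[of _ ?M])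
    qed
    show "does Z (mark ;; multiply ;; swap ;; multiply) s1 (3 + (mult_time d + (3 + mult_time d))) (invariant k n d h (m - 1))"
    proof (rule does_ThenI[OF does_mark[OF k1 sg1 vac v1 Z1]])
      fix s2 assume sg2: "stores_graph k ?R ?E s2" and ag: "agree mark s1 s2"
      have g2: "globals k n d s2" by (rule globals_agree[OF g1 ag]) (auto simp: writes_mark)
      have f2: "s2 (Arr 0 i) = s1 (Arr 0 i)" "s2 (S x) = s1 (S x)" for i x using agreeD[OF ag] by (simp_all add: writes_mark)
      have sw2: "stores_weights k n d M s2" using sw1 unfolding stores_weights_def f2 .
      have v2: "s2 (S 30) = int v" "s2 (S 31) = int a" "s2 (S 32) = int c" using v1 f2 by simp_all
      have d2: "does Z multiply s2 (mult_time d) (stores_weights k n d ?M1)"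
      proof (rule does_multiply_weights[OF g2 sw2 n v2 vac Z(1-3) Y])
        fix x y assume xy: "x < n" "y < n"
        show "\<bar>M a v x y\<bar> \<le> Y" "\<bar>M v c x y\<bar> \<le> Y" using old vacR ne xy by auto
        show "\<bar>?M1 a c x y\<bar> \<le> Y" unfolding M1ac using new aR ne xy by auto
      qed (use Z in \<open>simp_all add: Y_def\<close>)
      show "does Z (multiply ;; swap ;; multiply) s2 (mult_time d + (3 + mult_time d)) (invariant k n d h (m - 1))"
      proof (rule does_ThenI[OF d2])
        fix s3 assume sw3: "stores_weights k n d ?M1 s3" and ag: "agree multiply s2 s3"
        have g3: "globals k n d s3" by (rule globals_agree[OF g2 ag]) (auto simp: writes_multiply)
        have f3: "s3 (Arr 1 i) = s2 (Arr 1 i)" "s3 (Arr 2 i) = s2 (Arr 2 i)" "s3 (S 30) = int v" "s3 (S 31) = int a" "s3 (S 32) = int c" for i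
          using agreeD[OF ag] v2 by (simp_all add: writes_multiply)
        have sg3: "stores_graph k ?R ?E s3" using sg2 unfolding stores_graph_def f3 .
        have kZ: "int k \<le> Z"
        proof (cases "k = 0")
          case False
          then have "int k ^ 1 \<le> int k ^ 5" by (intro power_increasing) auto
          then have "int k \<le> int k ^ 5" by (simp only: power_one_right)
          then show ?thesis using Z(4) by linarith
        qed (use Z1 in simp)
        have sw: "does Z swap s3 (1 + (1 + 1)) (\<lambda>s'. s' (S 31) = int c \<and> s' (S 32) = int a)"
          unfolding swap_def
          apply (rule does_SetThen[where v = "int a"], (simp; fail), (simp add: f3; fail), (use kZ vac in simp; fail))
          apply (rule does_SetThen[where v = "int c"], (simp; fail), (simp add: f3; fail), (use kZ vac in simp; fail))
          by (rule does_Set) (use kZ vac in simp_all)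
        then have sw: "does Z swap s3 3 (\<lambda>s'. s' (S 31) = int c \<and> s' (S 32) = int a)" by (rule does_conseq) auto
        show "does Z (swap ;; multiply) s3 (3 + mult_time d) (invariant k n d h (m - 1))"
        proof (rule does_ThenI[OF sw])
          fix s4 assume v4: "s4 (S 31) = int c \<and> s4 (S 32) = int a" and ag: "agree swap s3 s4"
          have g4: "globals k n d s4" by (rule globals_agree[OF g3 ag]) (auto simp: writes_swap)
          have f4: "s4 (Arr j i) = s3 (Arr j i)" "s4 (S 30) = int v" for i j
            using agreeD[OF ag] f3 by (simp_all add: writes_swap)
          have sg4: "stores_graph k ?R ?E s4" using sg3 unfolding stores_graph_def f4 .
          have sw4: "stores_weights k n d ?M1 s4" using sw3 unfolding stores_weights_def f4 .
          have "does Z multiply s4 (mult_time d) (stores_weights k n d (half_elim n v c a ?M1))"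
          proof (rule does_multiply_weights[OF g4 sw4 n f4(2) v4[THEN conjunct1] v4[THEN conjunct2] vac(1,3,2) Z(1-3) Y])
            fix x y assume xy: "x < n" "y < n"
            show "\<bar>?M1 c v x y\<bar> \<le> Y" "\<bar>?M1 v a x y\<bar> \<le> Y" unfolding M1v using old vacR ne xy by auto
            show "\<bar>half_elim n v c a ?M1 c a x y\<bar> \<le> Y"
              unfolding half_elim_twice[OF ne] using new aR ne xy by auto
          qed (use Z in \<open>simp_all add: Y_def\<close>)
          then show "does Z multiply s4 (mult_time d) (invariant k n d h (m - 1))"
          proof (rule does_conseq)
            fix s5 assume sw5: "stores_weights k n d (half_elim n v c a ?M1) s5" and ag: "agree multiply s4 s5"
            have g5: "globals k n d s5" by (rule globals_agree[OF g4 ag]) (auto simp: writes_multiply)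
            have f5: "s5 (Arr 1 i) = s4 (Arr 1 i)" "s5 (Arr 2 i) = s4 (Arr 2 i)" for i
              using agreeD[OF ag] by (simp_all add: writes_multiply)
            have "stores_graph k ?R ?E s5" using sg4 unfolding stores_graph_def f5 .
            then show "invariant k n d h (m - 1) s5" using g5 sw5 unfolding half_elim_twice[OF ne] by (intro inv')
          qed simp
        qed
      qed
    qed
  qed
  then show ?thesis by (rule does_conseq) (simp_all add: round_time_def)
qed

end

section \<open>The final sum\<close>

context
  fixes H G :: "nat sgraph" and k n :: nat
  assumes HG: "verts H = {..<k}" "verts G = {..<n}"
begin

lemma length_adj_matrix: "verts F = {..<m} \<Longrightarrow> length (adj_matrix F) = m * m"
  unfolding adj_matrix_def Let_def by (simp add: length_concat_map)

lemma nth_adj_matrix: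
  assumes "verts F = {..<m}" "u < m" "v < m"
  shows "adj_matrix F ! (u * m + v) = of_bool ({u, v} \<in> edges F)"
  using nth_concat_map[of m "\<lambda>u. map (\<lambda>v. of_bool ({u, v} \<in> edges F)) [0..<m]" m u v] assms
  unfolding adj_matrix_def Let_def by simp

lemma adj_matrix_01: "x \<in> set (adj_matrix F) \<Longrightarrow> x = 0 \<or> x = 1"
  unfolding adj_matrix_def Let_def by auto

lemma input_mem_values:
  "input_mem H G 0 = int k" "input_mem H G 1 = int n"
  "u < k \<Longrightarrow> w < k \<Longrightarrow> input_mem H G (2 + int (u * k + w)) = of_bool ({u, w} \<in> edges H)"
  "x < n \<Longrightarrow> y < n \<Longrightarrow> input_mem H G (int (2 + k * k + x * n + y)) = of_bool ({x, y} \<in> edges G)"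
proof -
  have c: "card (verts H) = k" "card (verts G) = n" using HG by simp_all
  have l: "length (adj_matrix H) = k * k" "length (adj_matrix G) = n * n" using HG by (simp_all add: length_adj_matrix)
  have mem: "input_mem H G (int i) = ([int k, int n] @ adj_matrix H @ adj_matrix G) ! i" if "i < 2 + k * k + n * n" for i
    using that unfolding input_mem_def Let_def c by (simp add: l)
  show "input_mem H G 0 = int k" "input_mem H G 1 = int n" using mem[of 0] mem[of 1] by simp_all
  show "input_mem H G (2 + int (u * k + w)) = of_bool ({u, w} \<in> edges H)" if uw: "u < k" "w < k"
  proof -
    have i: "u * k + w < k * k" using uw by (rule mult_add_less)
    have "2 + int (u * k + w) = int (2 + (u * k + w))" by simp
    then have "input_mem H G (2 + int (u * k + w)) = ([int k, int n] @ adj_matrix H @ adj_matrix G) ! (2 + (u * k + w))"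
      using mem[of "2 + (u * k + w)"] i by simp
    also have "\<dots> = adj_matrix H ! (u * k + w)" using i l by (simp add: nth_append)
    finally show ?thesis using nth_adj_matrix[OF HG(1) uw] by simp
  qed
  show "input_mem H G (int (2 + k * k + x * n + y)) = of_bool ({x, y} \<in> edges G)" if xy: "x < n" "y < n"
  proof -
    have i: "x * n + y < n * n" using xy by (rule mult_add_less)
    have "input_mem H G (int (2 + k * k + x * n + y)) = ([int k, int n] @ adj_matrix H @ adj_matrix G) ! (2 + k * k + (x * n + y))"
      using mem[of "2 + k * k + (x * n + y)"] i by (simp add: add.assoc)
    also have "\<dots> = adj_matrix G ! (x * n + y)" using i l by (simp add: nth_append)
    finally show ?thesis using nth_adj_matrix[OF HG(2) xy] by simp
  qed
qed

lemma input_mem_bound: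
  assumes "1 \<le> Z" "int k \<le> Z" "int n \<le> Z"
  shows "\<bar>input_mem H G i\<bar> \<le> Z"
proof -
  define xs where "xs = [int (card (verts H)), int (card (verts G))] @ adj_matrix H @ adj_matrix G"
  have xs: "\<bar>x\<bar> \<le> Z" if "x \<in> set xs" for x using that assms HG adj_matrix_01 unfolding xs_def by force
  have "input_mem H G i = (if 0 \<le> i \<and> nat i < length xs then xs ! nat i else 0)"
    unfolding input_mem_def Let_def xs_def by simp
  then show ?thesis using xs[of "xs ! nat i"] assms by auto
qed

lemma input_mem_neg: "i < 0 \<Longrightarrow> input_mem H G i = 0"
  unfolding input_mem_def Let_def by simp

end

section \<open>Summing over the last pair of vertices\<close>

context tensor_algorithm
begin

definition sum_block :: cmd where
  "sum_block = For 47 (Var 5) (Set 0 (Var 0 \<^bold>+ Elt 0 (Var 9 \<^bold>* Var 5 \<^bold>+ Var 47)))"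

definition try_pair :: cmd where
  "try_pair = Set 45 (Var 9 \<^bold>div Var 1) ;; Set 46 (Var 9 \<^bold>- Var 45 \<^bold>* Var 1) ;;
     Cond (BLess (Var 45) (Var 46))
       (Cond (BLess (Num 0) (Elt 2 (Var 45) \<^bold>* Elt 2 (Var 46))) (Set 0 (Num 0) ;; sum_block) Skp) Skp"

text \<open>The loop finds the one increasing pair of vertices that remain and sums its matrix. With
  fewer than two vertices there is no pair: the empty graph has one homomorphism, a single vertex
  has n.\<close>

definition finish :: cmd where
  "finish = For 9 (Var 1 \<^bold>* Var 1) try_pair ;;
     Cond (BEq (Var 1) (Num 0)) (Set 0 (Num 1)) (Cond (BEq (Var 1) (Num 1)) (Set 0 (Var 2)) Skp)"

lemma sum_padded:
  assumes n: "n \<le> b ^ d"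
  shows "(\<Sum>q<P ^ d. padded n d m q) = (\<Sum>x<n. \<Sum>y<n. m x y)"
proof -
  have "(\<Sum>q<P ^ d. padded n d m q) = (\<Sum>(x, y)\<in>{..<b ^ d} \<times> {..<b ^ d}. if x < n \<and> y < n then m x y else 0)"
    by (rule sum.reindex_bij_witness[of _ "\<lambda>(x, y). pair_index b d x y" "\<lambda>q. (row_index b d q, col_index b d q)"])
      (use P in \<open>auto simp: row_pair_index col_pair_index pair_index_row_col row_index_less col_index_less pair_index_less padded_def\<close>)
  also have "\<dots> = (\<Sum>(x, y)\<in>{..<n} \<times> {..<n}. m x y)"
    using n by (intro sum.mono_neutral_cong_right) (auto split: if_splits)
  finally show ?thesis by (simp add: sum.cartesian_product)
qed

lemma does_sum_block:
  fixes s :: state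
  assumes N: "s (S 5) = int (P ^ d)" and e: "s (S 9) = int e" and s0: "s (S 0) = 0"
    and A: "\<And>q. q < P ^ d \<Longrightarrow> s (Arr 0 (int (e * P ^ d + q))) = A q" "\<And>q. q < P ^ d \<Longrightarrow> 0 \<le> A q" "\<And>q. q < P ^ d \<Longrightarrow> A q \<le> Y"
    and Z: "int (P ^ d) * Y \<le> Z" "int (P ^ d) \<le> Z"
  shows "does Z sum_block s (1 + P ^ d * 2) (\<lambda>s'. s' (S 0) = (\<Sum>q<P ^ d. A q))"
proof -
  define N where "N = P ^ d"
  have N: "s (S 5) = int N" "int N \<le> Z" using assms unfolding N_def by simp_all
  have Y0: "0 \<le> Y" using A(2,3)[of 0] P by force
  have sb: "\<bar>\<Sum>q<J. A q\<bar> \<le> Z" if "J \<le> N" for J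
  proof -
    have "(\<Sum>q<J. A q) \<le> (\<Sum>q<J. Y)" using A that unfolding N_def by (intro sum_mono) auto
    also have "\<dots> \<le> int N * Y" using that Y0 by (simp add: mult_right_mono)
    also have "\<dots> \<le> Z" using Z unfolding N_def by simp
    finally have "(\<Sum>q<J. A q) \<le> Z" .
    moreover have "0 \<le> (\<Sum>q<J. A q)" using A(2) that unfolding N_def by (intro sum_nonneg) auto
    ultimately show ?thesis by linarith
  qed
  have "does Z sum_block s (1 + N * (1 + 1)) (\<lambda>s'. s' (S 0) = (\<Sum>q<N. A q))"
    unfolding sum_block_def
  proof (rule does_For[where I = "\<lambda>J s'. s' (S 0) = (\<Sum>q<J. A q)"])
    fix J s' assume J: "J < N" and I: "s' (S 0) = (\<Sum>q<J. A q)"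
      and ag: "agree (For 47 (Var 5) (Set 0 (Var 0 \<^bold>+ Elt 0 (Var 9 \<^bold>* Var 5 \<^bold>+ Var 47)))) s s'"
    have x: "s' (S 5) = int N" "s' (S 9) = int e" "s' (Arr 0 i) = s (Arr 0 i)" for i using agreeD[OF ag] N e by simp_all
    have y: "s (Arr 0 (int e * int N + int J)) = A J" using A(1)[of J] J unfolding N_def[symmetric] by simp
    show "does Z (Set 0 (Var 0 \<^bold>+ Elt 0 (Var 9 \<^bold>* Var 5 \<^bold>+ Var 47))) (s'(S 47 := int J)) 1 (\<lambda>s'. s' (S 0) = (\<Sum>q<Suc J. A q))"
    proof (rule does_SetI[where v = "\<Sum>q<Suc J. A q"])
      show "\<bar>\<Sum>q<Suc J. A q\<bar> \<le> Z" by (rule sb) (use J in simp)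
    qed (use I x y in simp_all)
  qed (use N s0 in simp_all)
  then show ?thesis unfolding N_def by (rule does_conseq) auto
qed

lemma does_finish:
  fixes s :: state
  assumes inv: "invariant k n d h (min k 2) s" and n: "n \<le> b ^ d" and h: "k = 0 \<Longrightarrow> h = 1" "k = 1 \<Longrightarrow> h = int n"
    and Z: "int (P ^ d) * int (b ^ d) ^ k \<le> Z" "int (P ^ d) \<le> Z" "int (k * k) \<le> Z" "1 \<le> Z"
  shows "does Z finish s (4 + k * k * (7 + 2 * P ^ d)) (\<lambda>s'. s' (S 0) = h)"
proof -
  from inv have g: "globals k n d s" unfolding invariant_def by (rule conjunct1)
  from inv[unfolded invariant_def, THEN conjunct2]
  obtain R E M where R: "R \<subseteq> {..<k}" "card R = min k 2" and sg: "stores_graph k R E s" and sw: "stores_weights k n d M s" and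
     "\<forall>u w. E u w \<longrightarrow> E w u" "\<forall>u. \<not> E u u" "tw2 R E" "symmetric_weights n M"
     "\<forall>u\<in>R. \<forall>w\<in>R. u \<noteq> w \<longrightarrow> \<not> E u w \<longrightarrow> (\<forall>x<n. \<forall>y<n. M u w x y = 1)" and
     M: "weights_bounded R n k M" "weight_sum R n M = h"
    by (elim exE conjE)
  define N where "N = P ^ d"
  have fin: "finite R" using R(1) finite_subset by blast
  have s: "s (S 1) = int k" "s (S 2) = int n" "s (S 5) = int N" using g unfolding globals_def N_def by auto
  have "k * 1 \<le> k * k" if "0 < k" using that by (intro mult_le_mono2) simp
  then have "k \<le> k * k" by (cases k) auto
  then have kZ: "int k \<le> Z" using Z(3) by linarith
  have NZ: "int N \<le> Z" using Z unfolding N_def by simp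
  have "n \<le> N"
  proof -
    have "b ^ d \<le> N" unfolding N_def using P by (intro power_mono) auto
    then show ?thesis using n by simp
  qed
  then have nZ: "int n \<le> Z" using NZ by linarith
  have pair: "R = {u, w} \<and> h = (\<Sum>q<N. padded n d (M u w) q)" if uw: "u \<in> R" "w \<in> R" "u < w" for u w
  proof -
    have "{u, w} \<subseteq> R" "card R \<le> card {u, w}" using uw R(2) by auto
    then have "R = {u, w}" using fin by (metis card_seteq)
    then show ?thesis using M(2) weight_sum_pair[OF uw(3)] sum_padded[OF n] unfolding N_def by simp
  qed
  \<comment> \<open>Variable 0 holds the result as soon as the code of the remaining pair has been
    passed, and later pairs leave it alone.\<close>
  let ?I = "\<lambda>e s'. \<forall>u w. u \<in> R \<and> w \<in> R \<and> u < w \<and> u * k + w < e \<longrightarrow> s' (S 0) = h"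
  have loop: "does Z (For 9 (Var 1 \<^bold>* Var 1) try_pair) s (1 + k * k * (1 + (1 + (1 + (1 + (1 + (1 + (1 + N * 2)))))))) (?I (k * k))"
  proof (rule does_For[where I = ?I])
    fix e s' assume e: "e < k * k" and I: "?I e s'" and ag: "agree (For 9 (Var 1 \<^bold>* Var 1) try_pair) s s'"
    have x: "s' (S 1) = int k" "s' (S 5) = int N" "s' (Arr j i) = s (Arr j i)" for i j
      using agreeD[OF ag] s by (simp_all add: try_pair_def sum_block_def)
    have k0: "0 < k" using e by (cases k) auto
    define u where "u = e div k"
    define w where "w = e mod k"
    have uw: "u < k" "w < k" using e k0 unfolding u_def w_def by (simp_all add: less_mult_imp_div_less)
    have e_eq: "u * k + w = e" unfolding u_def w_def by simp
    have code: "u' = u \<and> w' = w" if "u' * k + w' = e" "w' < k" for u' w'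
      using digits_eq_iff[OF that(2) uw(2), of u' u] that(1) e_eq by simp
    have eqs: "int e div int k = int u" "int e - int u * int k = int w"
      using int_mod_eq[of e k] unfolding u_def w_def by (simp_all add: zdiv_int)
    have uwZ: "int u \<le> Z" "int w \<le> Z" using uw kZ by linarith+
    let ?t = "s'(S 9 := int e, S 45 := int u, S 46 := int w)"
    have act: "s (Arr 2 (int u)) = of_bool (u \<in> R)" "s (Arr 2 (int w)) = of_bool (w \<in> R)"
      using sg uw unfolding stores_graph_def by simp_all
    have skip: "does Z Skp ?t T (?I (Suc e))" if no: "\<not> (u \<in> R \<and> w \<in> R \<and> u < w)" and T: "1 \<le> T" for T
    proof -
      have "s' (S 0) = h" if "u' \<in> R" "w' \<in> R" "u' < w'" "u' * k + w' < Suc e" for u' w'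
      proof -
        have "w' < k" using R(1) that(2) by auto
        then have "u' * k + w' \<noteq> e" using code no that by blast
        then show ?thesis using I that by (meson less_SucE)
      qed
      then have "does Z Skp ?t 1 (?I (Suc e))" by (intro does_Set) (use Z in auto)
      then show ?thesis by (rule does_conseq) (use T in auto)
    qed
    have "does Z try_pair (s'(S 9 := int e)) (1 + (1 + (1 + (1 + (1 + (1 + N * 2)))))) (?I (Suc e))"
      unfolding try_pair_def
      apply (rule does_SetThen[where v = "int u"], (simp; fail), (use x eqs in simp; fail), (use uwZ in simp; fail))
      apply (rule does_SetThen[where v = "int w"], (simp; fail), (use x eqs in simp; fail), (use uwZ in simp; fail))
    proof (rule does_Cond)
      assume "bval (BLess (Var 45) (Var 46)) ?t"
      then have less: "u < w" by simp
      show "does Z (Cond (BLess (Num 0) (Elt 2 (Var 45) \<^bold>* Elt 2 (Var 46))) (Set 0 (Num 0) ;; sum_block) Skp) ?t (1 + (1 + (1 + N * 2))) (?I (Suc e))"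
      proof (rule does_Cond)
        assume "bval (BLess (Num 0) (Elt 2 (Var 45) \<^bold>* Elt 2 (Var 46))) ?t"
        then have uwR: "u \<in> R" "w \<in> R" using x act by (auto simp: of_bool_def split: if_splits)
        show "does Z (Set 0 (Num 0) ;; sum_block) ?t (1 + (1 + N * 2)) (?I (Suc e))"
        proof (rule does_SetThen[where v = 0])
          let ?t' = "?t(S 0 := 0)"
          have b: "0 \<le> padded n d (M u w) q" "padded n d (M u w) q \<le> int (b ^ d) ^ k" for q
          proof -
            have ne: "u \<noteq> w" using less by simp
            have "int n ^ k \<le> int (b ^ d) ^ k" using n by (intro power_mono) auto
            then have w: "0 \<le> M u w x y" "M u w x y \<le> int (b ^ d) ^ k" if "x < n" "y < n" for x y
              using weights_bounded_le[OF M(1) fin uwR ne that] by linarith+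
            show "0 \<le> padded n d (M u w) q" "padded n d (M u w) q \<le> int (b ^ d) ^ k"
              using w unfolding padded_def by auto
          qed
          have "does Z sum_block ?t' (1 + P ^ d * 2) (\<lambda>s'. s' (S 0) = (\<Sum>q<P ^ d. padded n d (M u w) q))"
          proof (rule does_sum_block[where e = e and Y = "int (b ^ d) ^ k"])
            fix q assume "q < P ^ d"
            then have "s (Arr 0 (int (e * P ^ d + q))) = padded n d (M u w) q"
              using sw uw unfolding stores_weights_def e_eq[symmetric] by blast
            then show "?t' (Arr 0 (int (e * P ^ d + q))) = padded n d (M u w) q"
              using x(3) by (simp del: of_nat_add of_nat_mult of_nat_power)
          qed (use x b Z in \<open>simp_all add: N_def\<close>)
          then show "does Z sum_block ?t' (1 + N * 2) (?I (Suc e))"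
            unfolding N_def[symmetric] by (rule does_conseq) (use pair[OF uwR less] in auto)
        qed (use Z in simp_all)
      next
        assume "\<not> bval (BLess (Num 0) (Elt 2 (Var 45) \<^bold>* Elt 2 (Var 46))) ?t"
        then show "does Z Skp ?t (1 + (1 + N * 2)) (?I (Suc e))" using x act by (intro skip) auto
      qed simp
    next
      assume "\<not> bval (BLess (Var 45) (Var 46)) ?t"
      then show "does Z Skp ?t (1 + (1 + (1 + N * 2))) (?I (Suc e))" by (intro skip) auto
    qed simp
    then show "does Z try_pair (s'(S 9 := int e)) (1 + (1 + (1 + (1 + (1 + (1 + N * 2)))))) (?I (Suc e))" .
  qed (use s Z in \<open>simp_all add: nat_mult_distrib\<close>)
  have "does Z finish s ((1 + k * k * (1 + (1 + (1 + (1 + (1 + (1 + (1 + N * 2)))))))) + (1 + (1 + 1))) (\<lambda>s'. s' (S 0) = h)"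
    unfolding finish_def
  proof (rule does_ThenI[OF loop])
    fix s1 assume I: "?I (k * k) s1" and ag: "agree (For 9 (Var 1 \<^bold>* Var 1) try_pair) s s1"
    have x: "s1 (S 1) = int k" "s1 (S 2) = int n" using agreeD[OF ag] s by (simp_all add: try_pair_def sum_block_def)
    show "does Z (Cond (BEq (Var 1) (Num 0)) (Set 0 (Num 1)) (Cond (BEq (Var 1) (Num 1)) (Set 0 (Var 2)) Skp)) s1 (1 + (1 + 1)) (\<lambda>s'. s' (S 0) = h)"
    proof (rule does_Cond)
      assume "bval (BEq (Var 1) (Num 0)) s1"
      then have "k = 0" using x by simp
      then have "does Z (Set 0 (Num 1)) s1 1 (\<lambda>s'. s' (S 0) = h)" using h Z by (intro does_Set) simp_all
      then show "does Z (Set 0 (Num 1)) s1 (1 + 1) (\<lambda>s'. s' (S 0) = h)" by (rule does_conseq) auto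
    next
      assume "\<not> bval (BEq (Var 1) (Num 0)) s1"
      then have k0: "k \<noteq> 0" using x by simp
      show "does Z (Cond (BEq (Var 1) (Num 1)) (Set 0 (Var 2)) Skp) s1 (1 + 1) (\<lambda>s'. s' (S 0) = h)"
      proof (rule does_Cond)
        assume "bval (BEq (Var 1) (Num 1)) s1"
        then have "k = 1" using x by simp
        then show "does Z (Set 0 (Var 2)) s1 1 (\<lambda>s'. s' (S 0) = h)" using h x nZ by (intro does_Set) simp_all
      next
        assume "\<not> bval (BEq (Var 1) (Num 1)) s1"
        then have "k \<noteq> 1" using x by simp
        then have "card R = 2" using R(2) k0 by simp
        then obtain u w where "R = {u, w}" "u \<noteq> w" by (meson card_2_iff)
        then obtain u w where uw: "u \<in> R" "w \<in> R" "u < w" by (metis insertCI linorder_neqE_nat)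
        then have "u * k + w < k * k" using R(1) by (intro mult_add_less) auto
        then have "s1 (S 0) = h" using I uw by blast
        then show "does Z Skp s1 1 (\<lambda>s'. s' (S 0) = h)" using Z by (intro does_Set) simp_all
      qed simp
    qed simp
  qed
  then show ?thesis by (rule does_conseq) (auto simp: N_def algebra_simps)
qed

end

section \<open>Running time\<close>

context tensor_algorithm
begin

text \<open>For \<open>k < 2\<close> the limit \<open>k - 2\<close> is negative as an integer and
  the loop is empty; otherwise it leaves exactly two vertices.\<close>

definition main :: cmd where
  "main = (tables ;; sizes) ;; index_tables ;; load_matrices ;; load_graph ;; For 44 (Var 1 \<^bold>- Num 2) eliminate ;; finish"

definition main_time :: "nat \<Rightarrow> nat \<Rightarrow> nat \<Rightarrow> nat" where
  "main_time k n d = (11 + 3 * (r * P) + 7 * n) + ((1 + P ^ d * (8 + 6 * d)) + ((1 + k * k * P ^ d * 10) +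
     ((2 + k * k * 2 + k * 2) + ((1 + (k - 2) * (1 + round_time k d)) + (4 + k * k * (7 + 2 * P ^ d))))))"

lemma invariant_upd: "invariant k n d h m (s(S 44 := x)) \<longleftrightarrow> invariant k n d h m s"
  unfolding invariant_def globals_def stores_graph_def stores_weights_def by simp

lemma weight_sum_small: "weight_sum {} n M = 1" "weight_sum {0} n M = int n"
proof -
  have e: "pairs {} = {}" "pairs {0} = {}" by auto
  show "weight_sum {} n M = 1" unfolding weight_sum_def e by simp
  show "weight_sum {0} n M = int n" unfolding weight_sum_def e by (simp add: card_PiE)
qed

lemma does_main:
  assumes H: "simple_graph H" "verts H = {..<k}" "treewidth H \<le> 2" and G: "verts G = {..<n}" and d: "d = depth n"
    and Z: "int (r ^ d) \<le> Z" "int r \<le> Z" "int k ^ 5 \<le> Z" "D ^ d \<le> Z" "\<mu> \<le> Z" "int (k * k * P ^ d) \<le> Z" "2 \<le> Z"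
      "(int r * \<mu>) ^ d * ((int P * \<mu>) ^ d * int (b ^ d) ^ k) ^ 2 \<le> Z" "int (P ^ d) * int (b ^ d) ^ k \<le> Z"
  shows "does Z main (init_state (input_mem H G)) (main_time k n d) (\<lambda>s'. s' (S 0) = int (card (Hom H G)))"
proof -
  let ?m = "input_mem H G" and ?h = "int (card (Hom H G))"
  define s where "s = init_state ?m"
  have inp: "s (Inp i) = ?m i" for i unfolding s_def init_state_def by simp
  note vals = input_mem_values[OF H(2) G]
  have bN: "b ^ d \<le> P ^ d" using P by (intro power_mono) auto
  have n: "n \<le> b ^ d" using depth(1) d by simp
  have NZ: "int (P ^ d) \<le> Z" using power_P_le(1)[of d] Z(1) by linarith
  have nZ: "int n \<le> Z" using n bN NZ by linarith
  have dZ: "int d \<le> Z" using depth(2)[of n] d nZ by linarith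
  have kk: "int k \<le> int k ^ 5" "int (k * k) \<le> int k ^ 5"
  proof -
    have "int k ^ 1 \<le> int k ^ 5" "int k ^ 2 \<le> int k ^ 5" if "k \<noteq> 0" using that by (intro power_increasing; simp)+
    then show "int k \<le> int k ^ 5" "int (k * k) \<le> int k ^ 5" by (cases "k = 0"; simp add: power2_eq_square)+
  qed
  then have kZ: "int k \<le> Z" "int (k * k) \<le> Z" using Z(3) by linarith+
  have Z1: "1 \<le> Z" using Z by simp
  have YZ: "int (b ^ d) ^ k \<le> Z"
  proof -
    have "1 \<le> int (P ^ d)" using power_P_le(2)[of d] by linarith
    then have "1 * int (b ^ d) ^ k \<le> int (P ^ d) * int (b ^ d) ^ k" by (intro mult_right_mono) auto
    then show ?thesis using Z(9) by linarith
  qed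
  have inpZ: "\<bar>?m i\<bar> \<le> Z" for i by (rule input_mem_bound[OF H(2) G Z1 kZ(1) nZ])
  let ?E = "\<lambda>u w. {u, w} \<in> edges H"
  have irr: "\<not> ?E u u" for u using H(1) unfolding simple_graph_def by force
  have "does Z main s ((11 + 3 * (r * P) + 7 * n) + ((1 + P ^ d * (8 + 6 * d)) + ((1 + k * k * P ^ d * 10) +
     ((2 + k * k * 2 + k * 2) + ((1 + (k - 2) * (1 + round_time k d)) + (4 + k * k * (7 + 2 * P ^ d)))))))
     (\<lambda>s'. s' (S 0) = ?h)"
    unfolding main_def
  proof (rule does_ThenI[OF does_setup[OF _ _ d kZ(1) nZ Z(1,4,5)]])
    show "s (Inp 0) = int k" "s (Inp 1) = int n" unfolding inp by (rule vals)+
    fix s1 assume g1: "globals k n d s1" and ag: "agree (tables ;; sizes) s s1"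
    have i1: "s1 (Inp i) = ?m i" for i using agreeD[OF ag not_writes_Inp] inp by simp
    show "does Z (index_tables ;; load_matrices ;; load_graph ;; For 44 (Var 1 \<^bold>- Num 2) eliminate ;; finish) s1
      ((1 + P ^ d * (8 + 6 * d)) + ((1 + k * k * P ^ d * 10) +
     ((2 + k * k * 2 + k * 2) + ((1 + (k - 2) * (1 + round_time k d)) + (4 + k * k * (7 + 2 * P ^ d)))))) (\<lambda>s'. s' (S 0) = ?h)"
    proof (rule does_ThenI[OF does_index_tables[OF g1 Z(1,2) dZ]])
      fix s2 assume ix: "\<forall>q<P ^ d. s2 (Arr 9 (int q)) = int (row_index b d q) \<and> s2 (Arr 10 (int q)) = int (col_index b d q)"
        and ag: "agree index_tables s1 s2"
      have i2: "s2 (Inp i) = ?m i" for i using agreeD[OF ag not_writes_Inp] i1 by simp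
      have g2: "globals k n d s2" by (rule globals_agree[OF g1 ag]) (auto simp: index_tables_def decode_def digit_def)
      have inp2: "\<bar>s2 (Inp i)\<bar> \<le> Z" for i unfolding i2 by (rule inpZ)
      show "does Z (load_matrices ;; load_graph ;; For 44 (Var 1 \<^bold>- Num 2) eliminate ;; finish) s2
        ((1 + k * k * P ^ d * 10) + ((2 + k * k * 2 + k * 2) + ((1 + (k - 2) * (1 + round_time k d)) + (4 + k * k * (7 + 2 * P ^ d))))) (\<lambda>s'. s' (S 0) = ?h)"
      proof (rule does_ThenI[OF does_load_matrices[OF g2 Z(6,1) Z1 inp2 ix]])
        fix s3 assume A: "\<forall>e<k * k * P ^ d. s3 (Arr 0 (int e)) = entry k n d s2 (e div P ^ d) (e mod P ^ d)"
          and ag: "agree load_matrices s2 s3"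
        have i3: "s3 (Inp i) = ?m i" for i using agreeD[OF ag not_writes_Inp] i2 by simp
        have g3: "globals k n d s3" by (rule globals_agree[OF g2 ag]) (auto simp: load_matrices_def load_entry_def input_entry_def)
        have k3: "s3 (S 1) = int k" using g3 unfolding globals_def by blast
        have inp3: "\<bar>s3 (Inp i)\<bar> \<le> Z" for i unfolding i3 by (rule inpZ)
        have sw3: "stores_weights k n d (hom_weight H G) s3"
          unfolding stores_weights_def
        proof (intro allI impI)
          fix u w q assume uw: "u < k" "w < k" and q: "q < P ^ d"
          let ?e = "(u * k + w) * P ^ d + q"
          have "u * k + w < k * k" using uw by (rule mult_add_less)
          then have e: "?e < k * k * P ^ d" using q by (rule mult_add_less)
          have "(x * c + y) div c = x" "(x * c + y) mod c = y" if "y < c" for x y c :: nat using that by auto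
          note dm = this[OF q, of "u * k + w"]
          have "s3 (Arr 0 (int ?e)) = entry k n d s2 (u * k + w) q" using A e dm by metis
          also have "\<dots> = padded n d (hom_weight H G u w) q"
          proof (cases "row_index b d q < n \<and> col_index b d q < n")
            case True
            have "s2 (Inp (int (2 + k * k + row_index b d q * n + col_index b d q))) = of_bool ({row_index b d q, col_index b d q} \<in> edges G)"
              unfolding i2 using True by (intro vals) auto
            moreover have "s2 (Inp (2 + int (u * k + w))) = of_bool (?E u w)" unfolding i2 by (rule vals(3)[OF uw])
            ultimately show ?thesis using True unfolding entry_def Let_def padded_def hom_weight_def
              by (simp del: of_nat_add of_nat_mult)
          next
            case False
            then show ?thesis unfolding entry_def Let_def padded_def by (simp only: if_False)
          qed
          finally show "s3 (Arr 0 (int ?e)) = padded n d (hom_weight H G u w) q" .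
        qed
        show "does Z (load_graph ;; For 44 (Var 1 \<^bold>- Num 2) eliminate ;; finish) s3
          ((2 + k * k * 2 + k * 2) + ((1 + (k - 2) * (1 + round_time k d)) + (4 + k * k * (7 + 2 * P ^ d)))) (\<lambda>s'. s' (S 0) = ?h)"
        proof (rule does_ThenI[OF does_load_graph[OF k3 kZ(2,1) Z1 inp3]])
          fix s4 assume B: "(\<forall>e<k * k. s4 (Arr 1 (int e)) = s3 (Inp (2 + int e))) \<and> (\<forall>u<k. s4 (Arr 2 (int u)) = 1)"
            and ag: "agree load_graph s3 s4"
          have g4: "globals k n d s4" by (rule globals_agree[OF g3 ag]) (auto simp: load_graph_def)
          have f4: "s4 (Arr 0 i) = s3 (Arr 0 i)" for i using agreeD[OF ag] by (simp add: load_graph_def)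
          have sw4: "stores_weights k n d (hom_weight H G) s4" using sw3 unfolding stores_weights_def f4 .
          have sg4: "stores_graph k {..<k} ?E s4"
            unfolding stores_graph_def
          proof (intro conjI allI impI)
            fix u w assume uw: "u < k" "w < k"
            have lt: "u * k + w < k * k" using uw by (rule mult_add_less)
            have "s4 (Arr 1 (int (u * k + w))) = ?m (2 + int (u * k + w))"
              using B[THEN conjunct1, rule_format, OF lt] unfolding i3 .
            then show "s4 (Arr 1 (int (u * k + w))) = of_bool (?E u w)" unfolding vals(3)[OF uw] .
          qed (use B in simp)
          have ws: "weight_sum {..<k} n (hom_weight H G) = ?h"
            using weight_sum_hom_weight[OF H(1) G] H(2) by simp
          have "invariant k n d ?h k s4"
            unfolding invariant_def
          proof (intro conjI exI[of _ "{..<k}"] exI[of _ ?E] exI[of _ "hom_weight H G"])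
            show "tw2 {..<k} ?E" using tw2_of_treewidth[OF H(1,3)] H(2) by simp
            show "\<forall>u\<in>{..<k}. \<forall>w\<in>{..<k}. u \<noteq> w \<longrightarrow> \<not> ?E u w \<longrightarrow> (\<forall>x<n. \<forall>y<n. hom_weight H G u w x y = 1)"
              by (simp add: hom_weight_def)
            show "\<forall>u w. ?E u w \<longrightarrow> ?E w u" by (simp add: insert_commute)
          qed (use g4 sg4 sw4 irr ws symmetric_hom_weight weights_bounded_hom_weight in simp_all)
          then have I0: "invariant k n d ?h (k - 0) s4" by simp
          have k4: "s4 (S 1) = int k" using g4 unfolding globals_def by blast
          let ?c = "For 44 (Var 1 \<^bold>- Num 2) eliminate"
          have loop: "does Z ?c s4 (1 + (k - 2) * (1 + round_time k d)) (invariant k n d ?h (k - (k - 2)))"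
          proof (rule does_For[where I = "\<lambda>i. invariant k n d ?h (k - i)"])
            fix i s' assume i: "i < k - 2" and I: "invariant k n d ?h (k - i) s'"
            have "does Z eliminate (s'(S 44 := int i)) (round_time k d) (invariant k n d ?h (k - i - 1))"
              using I i n Z dZ YZ by (intro does_eliminate) (simp_all add: invariant_upd)
            then show "does Z eliminate (s'(S 44 := int i)) (round_time k d) (invariant k n d ?h (k - Suc i))" by simp
          next
            show "nat (aval (Var 1 \<^bold>- Num 2) s4) = k - 2" using k4 by simp
            show "\<bar>aval (Var 1 \<^bold>- Num 2) s4\<bar> \<le> Z" using k4 kZ Z by simp
          qed (use I0 in simp_all)
          show "does Z (?c ;; finish) s4 ((1 + (k - 2) * (1 + round_time k d)) + (4 + k * k * (7 + 2 * P ^ d))) (\<lambda>s'. s' (S 0) = ?h)"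
          proof (rule does_ThenI[OF loop])
            fix s5 assume "invariant k n d ?h (k - (k - 2)) s5"
            moreover have "k - (k - 2) = min k 2" by simp
            ultimately have I5: "invariant k n d ?h (min k 2) s5" by simp
            show "does Z finish s5 (4 + k * k * (7 + 2 * P ^ d)) (\<lambda>s'. s' (S 0) = ?h)"
            proof (rule does_finish[OF I5 n _ _ Z(9) NZ kZ(2) Z1])
              show "?h = 1" if "k = 0" using ws weight_sum_small(1) that by simp
              show "?h = int n" if "k = 1"
              proof -
                have "{..<k} = {0}" using that by auto
                then show ?thesis using ws weight_sum_small(2) by simp
              qed
            qed
          qed
        qed
      qed
    qed
  qed
  then show ?thesis unfolding main_time_def s_def .
qed

text \<open>There are at most k rounds, each with a search of order k^4 and two multiplications of
  order (d + 1) r^d. The setup is linear in n, which is covered by n \<le> b^d \<le> r^d.\<close>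

lemma main_time_bound:
  assumes n: "n \<le> b ^ d"
  shows "main_time k n d \<le> (200 + 20 * r + 3 * (r * P)) * ((k + 1) ^ 5 * ((d + 1) * r ^ d))"
proof -
  define X where "X = (d + 1) * r ^ d"
  define K where "K = (k + 1) ^ 5"
  have Q: "P ^ d \<le> r ^ d" "1 \<le> r ^ d" using power_P_le by auto
  have QX: "r ^ d \<le> X" unfolding X_def by simp
  have X1: "1 \<le> X" using Q QX by linarith
  have kp: "(k + 1) ^ i \<le> K" if "i \<le> 5" for i unfolding K_def using that by (intro power_increasing) auto
  have K1: "1 \<le> K" "k * k \<le> K" "k \<le> K" "k + 1 \<le> K"
  proof -
    show "1 \<le> K" "k + 1 \<le> K" using kp[of 0] kp[of 1] by simp_all
    have "k * k \<le> (k + 1) ^ 2" by (simp add: power2_eq_square)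
    then show "k * k \<le> K" using kp[of 2] by simp
    show "k \<le> K" using kp[of 1] by simp
  qed
  have KX: "1 \<le> K * X" "K \<le> K * X" "X \<le> K * X" using K1 X1 by simp_all
  have bP: "b ^ d \<le> P ^ d" using P by (intro power_mono) auto
  have t1: "11 + 3 * (r * P) + 7 * n \<le> (18 + 3 * (r * P)) * (K * X)"
  proof -
    have "n \<le> K * X" using n bP Q QX KX by linarith
    moreover have "t * 1 \<le> t * (K * X)" for t :: nat using KX by (intro mult_le_mono2)
    moreover have "11 + t + 7 * n \<le> (18 + t) * y" if "n \<le> y" "t * 1 \<le> t * y" "1 \<le> y" for t y :: nat
      using that unfolding add_mult_distrib by linarith
    ultimately show ?thesis using KX(1) by blast
  qed
  have t2: "1 + P ^ d * (8 + 6 * d) \<le> 9 * (K * X)"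
  proof -
    have "P ^ d * (8 + 6 * d) \<le> r ^ d * (8 * (d + 1))" using Q by (intro mult_le_mono) auto
    also have "\<dots> = 8 * X" unfolding X_def by (simp add: algebra_simps)
    finally show ?thesis using KX by linarith
  qed
  have t3: "1 + k * k * P ^ d * 10 \<le> 11 * (K * X)"
  proof -
    have "k * k * P ^ d \<le> K * X" using K1 Q QX by (intro mult_le_mono) auto
    then show ?thesis using KX by linarith
  qed
  have t4: "2 + k * k * 2 + k * 2 \<le> 6 * (K * X)" using K1 KX by linarith
  have t5: "1 + (k - 2) * (1 + round_time k d) \<le> (120 + 12 * r) * (K * X)"
  proof -
    have "k * k * k * (14 + 3 * k) \<le> (k + 1) * (k + 1) * (k + 1) * (17 * (k + 1))" by (intro mult_le_mono) auto
    moreover have "x * x * x * (17 * x) = 17 * x ^ 4" for x :: nat by (simp add: power4_eq_xxxx)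
    ultimately have a: "k * k * k * (14 + 3 * k) \<le> 17 * (k + 1) ^ 4" by metis
    have "1 \<le> (k + 1) ^ 4" by simp
    have "1 + round_time k d = 9 + k * k * k * (14 + 3 * k) + (90 + 12 * r) * X"
      unfolding round_time_def mult_time_def X_def by (simp add: algebra_simps)
    also have "\<dots> \<le> 26 * (k + 1) ^ 4 + (90 + 12 * r) * X" using a \<open>1 \<le> (k + 1) ^ 4\<close> by linarith
    finally have "(k - 2) * (1 + round_time k d) \<le> (k + 1) * (26 * (k + 1) ^ 4 + (90 + 12 * r) * X)"
      by (intro mult_le_mono) auto
    also have "\<dots> = 26 * K + (90 + 12 * r) * ((k + 1) * X)"
    proof -
      have "x * (26 * x ^ 4 + c * y) = 26 * x ^ 5 + c * (x * y)" for x y c :: nat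
        by (simp add: eval_nat_numeral algebra_simps)
      then show ?thesis unfolding K_def .
    qed
    also have "\<dots> \<le> 26 * (K * X) + (90 + 12 * r) * (K * X)"
      using KX K1 by (intro add_mono mult_le_mono) auto
    finally have "(k - 2) * (1 + round_time k d) \<le> 26 * (K * X) + (90 + 12 * r) * (K * X)" .
    moreover have "1 + t \<le> (120 + c) * y" if "t \<le> 26 * y + (90 + c) * y" "1 \<le> y" for t c y :: nat
      using that unfolding add_mult_distrib by linarith
    ultimately show ?thesis using KX(1) by blast
  qed
  have t6: "4 + k * k * (7 + 2 * P ^ d) \<le> 13 * (K * X)"
  proof -
    have "k * k * (7 + 2 * P ^ d) \<le> K * (9 * X)" using K1 Q QX by (intro mult_le_mono) auto
    then show ?thesis using KX by linarith
  qed
  have "main_time k n d \<le> (18 + 3 * (r * P)) * (K * X) + (9 * (K * X) + (11 * (K * X) + (6 * (K * X) + ((120 + 12 * r) * (K * X) + 13 * (K * X)))))"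
    unfolding main_time_def by (intro add_mono t1 t2 t3 t4 t5 t6)
  also have "\<dots> \<le> (200 + 20 * r + 3 * (r * P)) * (K * X)" by (simp add: add_mult_distrib)
  finally show ?thesis unfolding K_def X_def .
qed

end

text \<open>Absorbs logarithmic factors into an arbitrarily small power. Bernoulli's inequality for
  the square root of \<rho> gives a linear lower bound for its d-th power, and squaring gives the
  claim.\<close>

lemma square_le_exponential:
  assumes "1 < \<rho>"
  shows "\<exists>C > 0. \<forall>d. (real d + 1) ^ 2 \<le> C * \<rho> ^ d"
proof -
  define \<delta> where "\<delta> = sqrt \<rho> - 1"
  define c where "c = min 1 \<delta>"
  have \<delta>: "0 < \<delta>" using assms unfolding \<delta>_def by simp
  then have c: "0 < c" "c \<le> 1" "c \<le> \<delta>" unfolding c_def by auto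
  have "(real d + 1) ^ 2 \<le> (1 / c ^ 2) * \<rho> ^ d" for d
  proof -
    have "c * (real d + 1) = real d * c + c" by (simp add: algebra_simps)
    also have "\<dots> \<le> real d * \<delta> + 1" using c by (intro add_mono mult_left_mono) auto
    also have "\<dots> \<le> (1 + \<delta>) ^ d" using Bernoulli_inequality[of \<delta> d] \<delta> by simp
    finally have "(c * (real d + 1)) ^ 2 \<le> ((1 + \<delta>) ^ d) ^ 2" using c by (intro power_mono) auto
    also have "\<dots> = ((1 + \<delta>) ^ 2) ^ d" by (simp add: power_mult[symmetric] mult.commute)
    also have "(1 + \<delta>) ^ 2 = \<rho>" using assms unfolding \<delta>_def by simp
    finally have "(real d + 1) ^ 2 * c ^ 2 \<le> \<rho> ^ d" by (simp only: power_mult_distrib mult.commute)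
    moreover have "0 < c ^ 2" using c by simp
    ultimately have "(real d + 1) ^ 2 \<le> \<rho> ^ d / c ^ 2" by (simp only: pos_le_divide_eq)
    then show ?thesis by simp
  qed
  then show ?thesis using c by (intro exI[of _ "1 / c ^ 2"]) auto
qed

lemma len_less_power:
  assumes "0 \<le> x" "x < 2 ^ m"
  shows "len x \<le> max 1 m"
proof -
  have "nat \<bar>x\<bar> < 2 ^ m" using assms by (simp add: nat_less_iff)
  then have "floorlog 2 (nat \<bar>x\<bar>) \<le> m" by (intro floorlog_leI) auto
  then show ?thesis unfolding len_def by simp
qed

section \<open>Bit lengths and total running time\<close>

context tensor_algorithm
begin

definition word :: nat where
  "word = csize main + 1"

text \<open>A crude bound for all constants of the program at once; \<open>word\<close> is included
  because constants and variable numbers must stay below \<open>Z\<close>.\<close>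

definition base :: nat where
  "base = 2 + r + nat D + r * nat \<mu> + word"

text \<open>The factor 5 is dictated by k^5 \<le> base^(5 k); the largest number inside a
  multiplication needs the exponent 3 d + 2 d k only.\<close>

definition value_bound :: "nat \<Rightarrow> nat \<Rightarrow> int" where
  "value_bound k d = int base ^ (5 * ((k + 1) * (d + 1)))"

lemma base_ge: "2 \<le> int base" "int r \<le> int base" "int P \<le> int base" "int b \<le> int base" "D \<le> int base" "\<mu> \<le> int base"
  "int r * \<mu> \<le> int base" "int P * \<mu> \<le> int base" "int word \<le> int base"
proof -
  have rm: "int (r * nat \<mu>) = int r * \<mu>" using \<mu> by simp
  have D': "int (nat D) = D" using D by simp
  have base: "int base = 2 + int r + D + int r * \<mu> + int word" unfolding base_def of_nat_add rm D' by simp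
  have nn: "0 \<le> int r * \<mu>" using \<mu> by simp
  have "1 * \<mu> \<le> int r * \<mu>" using P(3) \<mu> by (intro mult_right_mono) auto
  then show "\<mu> \<le> int base" using base D by simp
  have "b \<le> P" using P by simp
  then have "int b \<le> int r" "int P \<le> int r" using r by linarith+
  moreover from this(2) have "int P * \<mu> \<le> int r * \<mu>" using \<mu> by (intro mult_right_mono) auto
  ultimately show "2 \<le> int base" "int r \<le> int base" "int P \<le> int base" "int b \<le> int base" "D \<le> int base"
    "int r * \<mu> \<le> int base" "int P * \<mu> \<le> int base" "int word \<le> int base" using base D nn by linarith+
qed

lemma power_base_le: "a \<le> 5 * ((k + 1) * (d + 1)) \<Longrightarrow> int base ^ a \<le> value_bound k d"
  unfolding value_bound_def using base_ge(1) by (intro power_increasing) auto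

lemma value_bound:
  "int (r ^ d) \<le> value_bound k d" "int r \<le> value_bound k d" "int k ^ 5 \<le> value_bound k d" "D ^ d \<le> value_bound k d"
  "\<mu> \<le> value_bound k d" "int (k * k * P ^ d) \<le> value_bound k d" "2 \<le> value_bound k d"
  "(int r * \<mu>) ^ d * ((int P * \<mu>) ^ d * int (b ^ d) ^ k) ^ 2 \<le> value_bound k d"
  "int (P ^ d) * int (b ^ d) ^ k \<le> value_bound k d" "int word \<le> value_bound k d"
proof -
  let ?B = "int base" and ?V = "value_bound k d"
  have pw: "x ^ a \<le> ?B ^ a" if "0 \<le> x" "x \<le> ?B" for x a using that by (intro power_mono)
  have one: "?B \<le> ?V" using power_base_le[of 1 k d] by simp
  show "int r \<le> ?V" "\<mu> \<le> ?V" "2 \<le> ?V" "int word \<le> ?V" using one base_ge by linarith+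
  have d5: "d \<le> 5 * ((k + 1) * (d + 1))" by simp
  show "int (r ^ d) \<le> ?V" using pw[of "int r" d] base_ge power_base_le[OF d5] by simp
  show "D ^ d \<le> ?V" using pw[of D d] base_ge D power_base_le[OF d5] by linarith
  have kB: "int k \<le> ?B ^ k"
  proof -
    have "k < 2 ^ k" by (rule less_exp)
    then have "int k \<le> int (2 ^ k)" by linarith
    also have "\<dots> = 2 ^ k" by simp
    also have "\<dots> \<le> ?B ^ k" using base_ge(1) by (intro power_mono) auto
    finally show ?thesis .
  qed
  have "int k ^ 5 \<le> (?B ^ k) ^ 5" using kB by (intro power_mono) auto
  also have "\<dots> = ?B ^ (k * 5)" by (rule power_mult[symmetric])
  also have "\<dots> \<le> ?V" by (intro power_base_le) simp
  finally show "int k ^ 5 \<le> ?V" .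
  have Pd: "int (P ^ d) \<le> ?B ^ d" using pw[of "int P" d] base_ge by simp
  have "int (k * k * P ^ d) = int k * int k * int (P ^ d)" by simp
  also have "\<dots> \<le> ?B ^ k * ?B ^ k * ?B ^ d" using kB Pd by (intro mult_mono) auto
  also have "\<dots> = ?B ^ (k + k + d)" by (simp add: power_add)
  also have "\<dots> \<le> ?V" by (intro power_base_le) simp
  finally show "int (k * k * P ^ d) \<le> ?V" .
  have Y: "int (b ^ d) ^ k \<le> ?B ^ (d * k)"
  proof -
    have "int (b ^ d) \<le> ?B ^ d" using pw[of "int b" d] base_ge by simp
    then have "int (b ^ d) ^ k \<le> (?B ^ d) ^ k" by (intro power_mono) auto
    then show ?thesis by (simp add: power_mult)
  qed
  have "int (P ^ d) * int (b ^ d) ^ k \<le> ?B ^ d * ?B ^ (d * k)" using Pd Y by (intro mult_mono) auto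
  also have "\<dots> = ?B ^ (d + d * k)" by (simp add: power_add)
  also have "\<dots> \<le> ?V" by (intro power_base_le) (simp add: algebra_simps)
  finally show "int (P ^ d) * int (b ^ d) ^ k \<le> ?V" .
  have m0: "0 \<le> int r * \<mu>" "0 \<le> int P * \<mu>" using \<mu> by simp_all
  have "(int P * \<mu>) ^ d * int (b ^ d) ^ k \<le> ?B ^ d * ?B ^ (d * k)"
    using Y by (intro mult_mono pw base_ge m0 zero_le_power) auto
  also have "\<dots> = ?B ^ (d + d * k)" by (simp add: power_add)
  finally have "((int P * \<mu>) ^ d * int (b ^ d) ^ k) ^ 2 \<le> (?B ^ (d + d * k)) ^ 2"
    using m0 by (intro power_mono) auto
  then have "(int r * \<mu>) ^ d * ((int P * \<mu>) ^ d * int (b ^ d) ^ k) ^ 2 \<le> ?B ^ d * (?B ^ (d + d * k)) ^ 2"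
    by (intro mult_mono pw base_ge m0) auto
  also have "\<dots> = ?B ^ (d + (d + d * k) * 2)" by (simp only: power_add power_mult)
  also have "\<dots> \<le> ?V" by (intro power_base_le) (simp add: algebra_simps)
  finally show "(int r * \<mu>) ^ d * ((int P * \<mu>) ^ d * int (b ^ d) ^ k) ^ 2 \<le> ?V" .
qed

definition len_const :: nat where
  "len_const = 5 * base * word + 6"

text \<open>From base < 2^base a power base^e has at most base * e bits, which is linear in (k + 1)
  (d + 1).\<close>

lemma len_lowbound: "len (lowbound (value_bound k d) word) \<le> len_const * ((k + 1) * (d + 1))"
proof -
  let ?e = "(k + 1) * (d + 1)"
  define m where "m = 5 * base * word * ?e"
  have "base < 2 ^ base" by (rule less_exp)
  then have "base ^ (5 * ?e * word) \<le> (2 ^ base) ^ (5 * ?e * word)" by (intro power_mono) auto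
  also have "\<dots> = 2 ^ m" unfolding m_def power_mult[symmetric] by (simp only: mult_ac)
  finally have b: "base ^ (5 * ?e * word) \<le> 2 ^ m" .
  have "value_bound k d ^ word = int (base ^ (5 * ?e * word))"
    unfolding value_bound_def by (simp add: power_mult)
  also have "\<dots> \<le> int (2 ^ m)" using b by (simp only: of_nat_le_iff)
  finally have "value_bound k d ^ word \<le> 2 ^ m" by simp
  moreover have "(1::int) \<le> 2 ^ m" by simp
  \<comment> \<open>The inequality 16 x + 32 < 64 x for x \<ge> 1 accounts for six extra
    bits.\<close>
  ultimately have "lowbound (value_bound k d) word < 64 * 2 ^ m" unfolding lowbound_def by linarith
  also have "(64::int) * 2 ^ m = 2 ^ (m + 6)" by (simp add: power_add)
  finally have "len (lowbound (value_bound k d) word) \<le> max 1 (m + 6)"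
    using value_bound(7)[of k d] by (intro len_less_power) (simp_all add: lowbound_def)
  also have "\<dots> \<le> m + 6 * ?e" by simp
  also have "\<dots> = len_const * ?e" unfolding m_def len_const_def by (simp add: add_mult_distrib)
  finally show ?thesis .
qed

definition total_const :: nat where
  "total_const = (201 + 20 * r + 3 * (r * P)) * ((4 * word + 8) * (9 * len_const))"

text \<open>The bit length contributes one more factor k + 1 and one more factor d + 1 to the count
  of steps.\<close>

lemma exec_main:
  assumes H: "simple_graph H" "verts H = {..<k}" "treewidth H \<le> 2" and G: "verts G = {..<n}"
  shows "\<exists>t M. exec (program main 0) (input_mem H G) t M \<and> M 0 = int (card (Hom H G)) \<and>
    t \<le> total_const * ((k + 1) ^ 6 * ((depth n + 1) ^ 2 * r ^ depth n))"
proof -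
  define d where "d = depth n"
  let ?V = "value_bound k d" and ?s = "init_state (input_mem H G)"
  note vb = value_bound[where k = k and d = d]
  have m: "does ?V main ?s (main_time k n d) (\<lambda>s'. s' (S 0) = int (card (Hom H G)))"
    by (rule does_main[OF H G d_def vb(1-9)])
  then have ok: "ok ?V main ?s" and cost: "cost main ?s \<le> main_time k n d" and res: "run main ?s (S 0) = int (card (Hom H G))"
    unfolding does_def by blast+
  have n: "n \<le> b ^ d" using depth(1) unfolding d_def by blast
  have "b ^ d \<le> r ^ d" using P r by (intro power_mono order_trans[OF _ r]) auto
  then have nV: "int n \<le> ?V" using n vb(1) by linarith
  have kV: "int k \<le> ?V"
  proof (cases "k = 0")
    case False
    then have "int k ^ 1 \<le> int k ^ 5" by (intro power_increasing) auto
    then have "int k \<le> int k ^ 5" by (simp only: power_one_right)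
    then show ?thesis using vb(3) by linarith
  qed (use vb(7) in simp)
  have bn: "bnd ?V (input_mem H G)"
    unfolding bnd_def using input_mem_bound[OF H(2) G _ kV nV] vb(7) by simp
  obtain t M where t: "exec (program main 0) (input_mem H G) t M" "M 0 = run main ?s (S 0)"
    "t \<le> (cost main ?s + 1) * ((4 * word + 8) * (9 * len (lowbound ?V word)))"
    using exec_program[OF vb(7,10) _ bn input_mem_neg[OF H(2) G] ok, of 0] unfolding word_def by auto
  let ?X = "(k + 1) ^ 5 * ((d + 1) * r ^ d)"
  have "1 * (1 * 1) \<le> ?X" by (intro mult_le_mono power_P_le(3)) simp_all
  then have X: "1 \<le> ?X" by (simp only: mult_1)
  have "cost main ?s + 1 \<le> (200 + 20 * r + 3 * (r * P)) * ?X + ?X"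
    using cost main_time_bound[OF n, of k] X by linarith
  also have "\<dots> = (201 + 20 * r + 3 * (r * P)) * ?X" by (simp add: add_mult_distrib)
  finally have c: "cost main ?s + 1 \<le> (201 + 20 * r + 3 * (r * P)) * ?X" .
  have "t \<le> ((201 + 20 * r + 3 * (r * P)) * ?X) * ((4 * word + 8) * (9 * (len_const * ((k + 1) * (d + 1)))))"
    using t(3) by (rule order_trans) (intro mult_le_mono c len_lowbound order_refl)
  also have "\<dots> = total_const * ((k + 1) ^ 6 * ((d + 1) ^ 2 * r ^ d))"
  proof -
    have "(A * (K ^ 5 * (L * Q))) * (B * (9 * (C * (K * L)))) = (A * (B * (9 * C))) * (K ^ 6 * (L ^ 2 * Q))" for A B C K L Q :: nat
    proof -
      have "K ^ 6 = K * K ^ 5" by (simp flip: power_Suc)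
      then show ?thesis by (simp only: power2_eq_square mult_ac)
    qed
    then show ?thesis unfolding total_const_def .
  qed
  finally show ?thesis using t res unfolding d_def by auto
qed

text \<open>Padding costs at most a factor b, a constant. For n = 0 the padded size is 1, hence
  \<open>max 1 n\<close>.\<close>

lemma power_depth_le: "b ^ depth n \<le> b * max 1 n"
proof (cases "depth n")
  case 0
  then show ?thesis using P by simp
next
  case (Suc l)
  then have "b ^ l < n" using depth(3) by simp
  then have "b * b ^ l \<le> b * max 1 n" by (intro mult_le_mono2) simp
  then show ?thesis unfolding Suc by simp
qed

lemma exec_main_real:
  assumes \<sigma>: "real r \<le> real b powr \<sigma>" and \<delta>: "0 < \<delta>"
  shows "\<exists>K. \<forall>H G k n. simple_graph H \<and> verts H = {..<k} \<and> treewidth H \<le> 2 \<and> simple_graph G \<and> verts G = {..<n} \<longrightarrow>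
    (\<exists>t M. exec (program main 0) (input_mem H G) t M \<and> M 0 = int (card (Hom H G)) \<and>
      real t \<le> K * (real k + 1) ^ 6 * real (max 1 n) powr (\<sigma> + \<delta>))"
proof -
  have b1: "1 < real b" using b by simp
  have "1 < real r" using P r by (metis (no_types, lifting) numeral_le_one_iff of_nat_1 of_nat_le_iff order_trans semiring_norm(69) linorder_not_le)
  then have "1 < real b powr \<sigma>" using \<sigma> by linarith
  \<comment> \<open>Monotonicity of \<open>powr\<close> in its base needs a nonnegative exponent;
    here it is positive because 1 < r \<le> b^\<sigma>.\<close>
  then have \<sigma>0: "0 < \<sigma>" using b1 by (metis less_le_trans linorder_not_le powr_mono powr_zero_eq_one less_irrefl order_less_imp_le of_nat_0 not_one_less_zero)
  have "1 < real b powr \<delta>" using b1 \<delta> by simp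
  then obtain C where C: "0 < C" "\<And>d. (real d + 1) ^ 2 \<le> C * (real b powr \<delta>) ^ d"
    using square_le_exponential by blast
  define K where "K = real total_const * (C * real b powr (\<sigma> + \<delta>))"
  have "real (total_const * ((k + 1) ^ 6 * ((depth n + 1) ^ 2 * r ^ depth n))) \<le> K * (real k + 1) ^ 6 * real (max 1 n) powr (\<sigma> + \<delta>)" for k n
  proof -
    define d where "d = depth n"
    have pow: "(real b powr x) ^ d = real (b ^ d) powr x" for x
    proof -
      have "(real b powr x) ^ d = real b powr (x * real d)" using b1 by (simp add: powr_powr flip: powr_realpow)
      also have "\<dots> = (real b powr real d) powr x" by (simp add: powr_powr mult.commute)
      also have "real b powr real d = real (b ^ d)" using b1 by (simp add: powr_realpow)
      finally show ?thesis .
    qed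
    have "real r ^ d \<le> (real b powr \<sigma>) ^ d" using \<sigma> by (intro power_mono) auto
    then have "(real d + 1) ^ 2 * real r ^ d \<le> (C * real (b ^ d) powr \<delta>) * real (b ^ d) powr \<sigma>"
      using C(2)[of d] C(1) unfolding pow by (intro mult_mono) auto
    also have "\<dots> = C * real (b ^ d) powr (\<sigma> + \<delta>)" by (simp add: powr_add mult_ac)
    also have "\<dots> \<le> C * real (b * max 1 n) powr (\<sigma> + \<delta>)"
    proof -
      have "real (b ^ d) \<le> real (b * max 1 n)" unfolding of_nat_le_iff d_def by (rule power_depth_le)
      then show ?thesis using C(1) \<sigma>0 \<delta> by (intro mult_left_mono powr_mono2) auto
    qed
    also have "\<dots> = C * (real b powr (\<sigma> + \<delta>) * real (max 1 n) powr (\<sigma> + \<delta>))" by (simp add: powr_mult)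
    finally have *: "(real d + 1) ^ 2 * real r ^ d \<le> C * (real b powr (\<sigma> + \<delta>) * real (max 1 n) powr (\<sigma> + \<delta>))" .
    have "real (total_const * ((k + 1) ^ 6 * ((depth n + 1) ^ 2 * r ^ depth n))) =
        real total_const * ((real k + 1) ^ 6 * ((real d + 1) ^ 2 * real r ^ d))"
      unfolding d_def by (simp add: add.commute)
    also have "\<dots> \<le> real total_const * ((real k + 1) ^ 6 * (C * (real b powr (\<sigma> + \<delta>) * real (max 1 n) powr (\<sigma> + \<delta>))))"
      using * by (intro mult_left_mono) auto
    also have "\<dots> = K * (real k + 1) ^ 6 * real (max 1 n) powr (\<sigma> + \<delta>)" unfolding K_def by (simp add: mult_ac)
    finally show ?thesis .
  qed
  note bound = this
  show ?thesis
  proof (intro exI[of _ K] allI impI)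
    fix H G :: "nat sgraph" and k n
    assume HG: "simple_graph H \<and> verts H = {..<k} \<and> treewidth H \<le> 2 \<and> simple_graph G \<and> verts G = {..<n}"
    then obtain t M where t: "exec (program main 0) (input_mem H G) t M" "M 0 = int (card (Hom H G))"
      "t \<le> total_const * ((k + 1) ^ 6 * ((depth n + 1) ^ 2 * r ^ depth n))"
      using exec_main[of H k G n] by blast
    have "real t \<le> real (total_const * ((k + 1) ^ 6 * ((depth n + 1) ^ 2 * r ^ depth n)))" using t(3) by (simp only: of_nat_le_iff)
    then show "\<exists>t M. exec (program main 0) (input_mem H G) t M \<and> M 0 = int (card (Hom H G)) \<and>
      real t \<le> K * (real k + 1) ^ 6 * real (max 1 n) powr (\<sigma> + \<delta>)"
      using t bound[of k n] by (meson order_trans)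
  qed
qed

end

text \<open>The rank r is twice the length of an optimal program, which is the quantity that
  \<open>mm_exponent_approx\<close> bounds.\<close>

lemma tensor_algorithm_exists:
  assumes "mm_exponent < \<sigma>"
  shows "\<exists>b r U V W D \<mu>. tensor_algorithm b r U V W D \<mu> \<and> real r \<le> real b powr \<sigma>"
proof -
  obtain b where b: "2 \<le> b" "real (2 * mm_ops b) \<le> real b powr \<sigma>" using mm_exponent_approx[OF assms] by blast
  obtain p where p: "slp_multiplies b p" "length p = mm_ops b" using mm_ops by blast
  obtain D :: int and U V W where D: "0 < D" and UVW: "\<And>q g h. q < b * b \<Longrightarrow> g < b * b \<Longrightarrow> h < b * b \<Longrightarrow>
    (\<Sum>s < 2 * length p. W q s * U s g * V s h) = D * of_bool (mm_tensor b q g h)"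
    using slp_multiplies_int_tensor[OF p(1)] by blast
  define r where "r = 2 * length p"
  define f where "f s g = \<bar>U s g\<bar> + \<bar>V s g\<bar> + \<bar>W g s\<bar>" for s g
  \<comment> \<open>A crude common bound for all coefficients; the summand 1 secures
    \<open>1 \<le> \<mu>\<close>.\<close>
  define \<mu> where "\<mu> = 1 + (\<Sum>s<r. \<Sum>g<b * b. f s g)"
  have f0: "0 \<le> f s g" for s g unfolding f_def by simp
  have f: "f s g \<le> \<mu>" if "s < r" "g < b * b" for s g
  proof -
    have "f s g \<le> (\<Sum>g<b * b. f s g)" using that f0 by (intro member_le_sum) auto
    also have "\<dots> \<le> (\<Sum>s<r. \<Sum>g<b * b. f s g)" using that f0 by (intro member_le_sum[of s "{..<r}" "\<lambda>s. \<Sum>g<b * b. f s g"]) (auto intro: sum_nonneg)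
    finally show ?thesis unfolding \<mu>_def by simp
  qed
  have "tensor_algorithm b r U V W D \<mu>"
  proof
    show "b * b \<le> r" using mm_ops_ge[of b] p(2) unfolding r_def by simp
    show "1 \<le> \<mu>" unfolding \<mu>_def using f0 by (simp add: sum_nonneg)
    show "(\<Sum>s<r. W q s * U s g * V s h) = D * of_bool (mm_tensor b q g h)" if "q < b * b" "g < b * b" "h < b * b" for q g h
      unfolding r_def using UVW that by blast
    show "\<bar>U s g\<bar> \<le> \<mu>" "\<bar>V s g\<bar> \<le> \<mu>" if "s < r" "g < b * b" for s g using f[OF that] unfolding f_def by linarith+
    show "\<bar>W g s\<bar> \<le> \<mu>" if "g < b * b" "s < r" for s g using f[OF that(2,1)] unfolding f_def by linarith
  qed (use b D in auto)
  then show ?thesis using b(2) p(2) unfolding r_def by metis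
qed

theorem theorem1p7:
  shows "\<exists>p :: nat poly. \<forall>\<epsilon>::real. \<epsilon> > 0 \<longrightarrow>
    (\<exists>(c :: com) (K :: real).
      \<forall>(H :: nat sgraph) (G :: nat sgraph) k n.
        simple_graph H \<and> verts H = {..<k} \<and> treewidth H \<le> 2 \<and>
        simple_graph G \<and> verts G = {..<n} \<longrightarrow>
        (\<exists>t M. exec c (input_mem H G) t M \<and> M 0 = int (card (Hom H G)) \<and>
          real t \<le> K * real (poly p k) * real (max 1 n) powr (mm_exponent + \<epsilon>)))"
proof (intro exI[of _ "[:1, 1:] ^ 6"] allI impI)
  \<comment> \<open>The polynomial (k + 1)^6 is the same for every \<epsilon>; the program and the
    constant depend on \<epsilon> through the size b.\<close>
  fix \<epsilon> :: real assume \<epsilon>: "0 < \<epsilon>"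
  then obtain b r U V W D \<mu> where alg: "tensor_algorithm b r U V W D \<mu>" and rank: "real r \<le> real b powr (mm_exponent + \<epsilon> / 2)"
    using tensor_algorithm_exists[of "mm_exponent + \<epsilon> / 2"] by auto
  interpret tensor_algorithm b r U V W D \<mu> by (rule alg)
  have p: "real (poly ([:1, 1:] ^ 6) k) = (real k + 1) ^ 6" for k :: nat
    by (simp add: poly_power add.commute)
  \<comment> \<open>One half of \<epsilon> went into the rank, the other is the \<delta> that
    absorbs the squared depth.\<close>
  have e: "mm_exponent + \<epsilon> / 2 + \<epsilon> / 2 = mm_exponent + \<epsilon>" by simp
  have "0 < \<epsilon> / 2" using \<epsilon> by simp
  from exec_main_real[OF rank this] show "\<exists>(c :: com) (K :: real).
      \<forall>(H :: nat sgraph) (G :: nat sgraph) k n.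
        simple_graph H \<and> verts H = {..<k} \<and> treewidth H \<le> 2 \<and>
        simple_graph G \<and> verts G = {..<n} \<longrightarrow>
        (\<exists>t M. exec c (input_mem H G) t M \<and> M 0 = int (card (Hom H G)) \<and>
          real t \<le> K * real (poly ([:1, 1:] ^ 6) k) * real (max 1 n) powr (mm_exponent + \<epsilon>))"
    unfolding p e by blast
qed

end
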